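(* Let $\Lambda$ be a selfinjective Artin algebra. Then $$\mathrm{rep.dim}\begin{pmatrix}\Lambda&\Lambda\\ \Lambda&\Lambda\end{pmatrix}_{(0,0)}\ \le\ 2\,\mathrm{LL}(\Lambda).$$
   Context: $\begin{pmatrix}\Lambda&\Lambda\\ \Lambda&\Lambda\end{pmatrix}_{(0,0)}$ is the Artin algebra of $2\times2$ matrices over $\Lambda$ with componentwise addition and multiplication $\begin{pmatrix} a & n\\ m & b\end{pmatrix}\begin{pmatrix} a' & n'\\ m' & b'\end{pmatrix}=\begin{pmatrix} aa' & an'+nb'\\ ma'+bm' & bb'\end{pmatrix}$ (the Morita ring with all entries $\Lambda$ and zero bimodule homomorphisms). $\mathrm{LL}(\Lambda)$ is the Loewy length of $\Lambda$. $\mathrm{rep.dim}$ is Auslander's representation dimension: $\mathrm{rep.dim}\,\Gamma$ is the infimum of $\mathrm{gl.dim}\,\mathrm{End}_\Gamma(V)$ over all finitely generated $\Gamma$-modules $V$ that are both a generator and a cogenerator of the category of finitely generated $\Gamma$-modules. An Artin algebra is selfinjective if it is injective as a module over itself. *)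

theory Defs
  imports "HOL-Algebra.Module" "HOL-Algebra.Ideal" "HOL-Library.Extended_Nat" "HOL-Library.FuncSet"
begin

text \<open>The library locale \<^locale>\<open>Module.module\<close> demands a commutative ring of scalars. The records
  and the locale \<^locale>\<open>submodule\<close> do not, and are reused for left modules over arbitrary rings.\<close>

locale left_module = R?: ring R + M?: abelian_group M
  for R :: "('a, 'r) ring_scheme" (structure) and M :: "('a, 'm, 'x) module_scheme" (structure) +
  assumes smult_closed [simp, intro]:
      "\<lbrakk>a \<in> carrier R; x \<in> carrier M\<rbrakk> \<Longrightarrow> a \<odot>\<^bsub>M\<^esub> x \<in> carrier M"
    and smult_l_distr:
      "\<lbrakk>a \<in> carrier R; b \<in> carrier R; x \<in> carrier M\<rbrakk>
        \<Longrightarrow> (a \<oplus> b) \<odot>\<^bsub>M\<^esub> x = a \<odot>\<^bsub>M\<^esub> x \<oplus>\<^bsub>M\<^esub> b \<odot>\<^bsub>M\<^esub> x"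
    and smult_r_distr:
      "\<lbrakk>a \<in> carrier R; x \<in> carrier M; y \<in> carrier M\<rbrakk>
        \<Longrightarrow> a \<odot>\<^bsub>M\<^esub> (x \<oplus>\<^bsub>M\<^esub> y) = a \<odot>\<^bsub>M\<^esub> x \<oplus>\<^bsub>M\<^esub> a \<odot>\<^bsub>M\<^esub> y"
    and smult_assoc:
      "\<lbrakk>a \<in> carrier R; b \<in> carrier R; x \<in> carrier M\<rbrakk>
        \<Longrightarrow> (a \<otimes> b) \<odot>\<^bsub>M\<^esub> x = a \<odot>\<^bsub>M\<^esub> (b \<odot>\<^bsub>M\<^esub> x)"
    and smult_one [simp]: "x \<in> carrier M \<Longrightarrow> \<one> \<odot>\<^bsub>M\<^esub> x = x"

definition module_hom ::
    "('a, 'r) ring_scheme \<Rightarrow> ('a, 'm, 'x) module_scheme \<Rightarrow> ('a, 'n, 'y) module_scheme \<Rightarrow> ('m \<Rightarrow> 'n) set"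
  where "module_hom R M N =
    {f \<in> carrier M \<rightarrow> carrier N.
       (\<forall>x \<in> carrier M. \<forall>y \<in> carrier M. f (x \<oplus>\<^bsub>M\<^esub> y) = f x \<oplus>\<^bsub>N\<^esub> f y) \<and>
       (\<forall>a \<in> carrier R. \<forall>x \<in> carrier M. f (a \<odot>\<^bsub>M\<^esub> x) = a \<odot>\<^bsub>N\<^esub> f x)}"

definition module_ker ::
    "('a, 'm, 'x) module_scheme \<Rightarrow> ('a, 'n, 'y) module_scheme \<Rightarrow> ('m \<Rightarrow> 'n) \<Rightarrow> 'm set"
  where "module_ker M N f = {x \<in> carrier M. f x = \<zero>\<^bsub>N\<^esub>}"

definition finitely_generated :: "('a, 'r) ring_scheme \<Rightarrow> ('a, 'm, 'x) module_scheme \<Rightarrow> bool"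
  where "finitely_generated R M \<longleftrightarrow>
    (\<exists>S. finite S \<and> S \<subseteq> carrier M \<and> \<Inter>{N. submodule N R M \<and> S \<subseteq> N} = carrier M)"

text \<open>HOL cannot quantify over modules on all types at once, so modules over a ring with elements
  in \<^typ>\<open>'a\<close> are taken on the type \<^typ>\<open>(nat \<Rightarrow> 'a) set\<close>. It has room for every quotient of every
  free module of finite rank, i.e.\ for every finitely generated module up to isomorphism
  (lemma \<open>finitely_generated_representable\<close> below). The fields \<open>mult\<close> and \<open>one\<close> of
  a module record carry no meaning.\<close>

type_synonym 'a umodule = "('a, (nat \<Rightarrow> 'a) set) module"

definition regular_module :: "('a, 'r) ring_scheme \<Rightarrow> ('a, 'a) module"
  where "regular_module R =
    \<lparr>carrier = carrier R, mult = mult R, one = one R, zero = zero R, add = add R, smult = mult R\<rparr>"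

definition power_module :: "('a, 'm, 'x) module_scheme \<Rightarrow> nat \<Rightarrow> ('a, nat \<Rightarrow> 'm) module"
  where "power_module M n =
    \<lparr>carrier = {..<n} \<rightarrow>\<^sub>E carrier M,
     mult = undefined,
     one = undefined,
     zero = (\<lambda>i\<in>{..<n}. \<zero>\<^bsub>M\<^esub>),
     add = (\<lambda>x y. \<lambda>i\<in>{..<n}. x i \<oplus>\<^bsub>M\<^esub> y i),
     smult = (\<lambda>a x. \<lambda>i\<in>{..<n}. a \<odot>\<^bsub>M\<^esub> x i)\<rparr>"

text \<open>Testing projectivity and injectivity on the modules of type \<^typ>\<open>'a umodule\<close> loses nothing:
  for injectivity Baer's criterion only needs left ideals and the regular module, and for the
  projectivity of a module that is finitely generated or itself of type \<^typ>\<open>'a umodule\<close> an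
  epimorphism from a free module onto it suffices, which exists on that type.\<close>

definition projective :: "('a, 'r) ring_scheme \<Rightarrow> ('a, 'm, 'x) module_scheme \<Rightarrow> bool"
  where "projective R P \<longleftrightarrow> left_module R P \<and>
    (\<forall>(M :: 'a umodule) (N :: 'a umodule) p f.
       left_module R M \<and> left_module R N \<and>
       p \<in> module_hom R M N \<and> p ` carrier M = carrier N \<and> f \<in> module_hom R P N \<longrightarrow>
       (\<exists>g \<in> module_hom R P M. \<forall>x \<in> carrier P. p (g x) = f x))"

definition injective :: "('a, 'r) ring_scheme \<Rightarrow> ('a, 'm, 'x) module_scheme \<Rightarrow> bool"
  where "injective R I \<longleftrightarrow> left_module R I \<and>
    (\<forall>(M :: 'a umodule) (N :: 'a umodule) i f.
       left_module R M \<and> left_module R N \<and>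
       i \<in> module_hom R M N \<and> inj_on i (carrier M) \<and> f \<in> module_hom R M I \<longrightarrow>
       (\<exists>g \<in> module_hom R N I. \<forall>x \<in> carrier M. g (i x) = f x))"

definition selfinjective :: "('a, 'r) ring_scheme \<Rightarrow> bool"
  where "selfinjective R \<longleftrightarrow> injective R (regular_module R)"

text \<open>\<open>0 \<rightarrow> P n \<rightarrow> \<dots> \<rightarrow> P 1 \<rightarrow> P 0 \<rightarrow> M \<rightarrow> 0\<close> is exact, where \<open>d i\<close> maps \<open>P (i + 1)\<close> to \<open>P i\<close> and
  \<open>e\<close> is the augmentation.\<close>

definition projective_resolution ::
    "('a, 'r) ring_scheme \<Rightarrow> ('a, 'm, 'x) module_scheme \<Rightarrow> nat \<Rightarrow> (nat \<Rightarrow> 'a umodule)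
      \<Rightarrow> (nat \<Rightarrow> (nat \<Rightarrow> 'a) set \<Rightarrow> (nat \<Rightarrow> 'a) set) \<Rightarrow> ((nat \<Rightarrow> 'a) set \<Rightarrow> 'm) \<Rightarrow> bool"
  where "projective_resolution R M n P d e \<longleftrightarrow>
    (\<forall>i. projective R (P i)) \<and>
    (\<forall>i>n. carrier (P i) = {\<zero>\<^bsub>P i\<^esub>}) \<and>
    (\<forall>i. d i \<in> module_hom R (P (Suc i)) (P i)) \<and>
    e \<in> module_hom R (P 0) M \<and>
    e ` carrier (P 0) = carrier M \<and>
    d 0 ` carrier (P 1) = module_ker (P 0) M e \<and>
    (\<forall>i. d (Suc i) ` carrier (P (Suc (Suc i))) = module_ker (P (Suc i)) (P i) (d i))"

text \<open>The infimum of the empty set is \<open>\<infinity>\<close>; the zero module has projective dimension \<open>0\<close>.\<close>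

definition projective_dim :: "('a, 'r) ring_scheme \<Rightarrow> ('a, 'm, 'x) module_scheme \<Rightarrow> enat"
  where "projective_dim R M = Inf {enat n | n. \<exists>P d e. projective_resolution R M n P d e}"

text \<open>As usual for Artin algebras, the supremum runs over the finitely generated left modules. By
  Auslander's theorem (cyclic modules suffice) this is the left global dimension of any ring.\<close>

definition global_dim :: "('a, 'r) ring_scheme \<Rightarrow> enat"
  where "global_dim R =
    Sup {projective_dim R M | M :: 'a umodule. left_module R M \<and> finitely_generated R M}"

text \<open>Endomorphisms are made extensional, so that equal maps on the carrier are equal as
  elements of the ring. The product \<open>f g\<close> is \<open>f\<close> after \<open>g\<close>.\<close>

definition End_ring :: "('a, 'r) ring_scheme \<Rightarrow> ('a, 'm, 'x) module_scheme \<Rightarrow> ('m \<Rightarrow> 'm) ring"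
  where "End_ring R M =
    \<lparr>carrier = module_hom R M M \<inter> extensional (carrier M),
     mult = (\<lambda>f g. compose (carrier M) f g),
     one = (\<lambda>x\<in>carrier M. x),
     zero = (\<lambda>x\<in>carrier M. \<zero>\<^bsub>M\<^esub>),
     add = (\<lambda>f g. \<lambda>x\<in>carrier M. f x \<oplus>\<^bsub>M\<^esub> g x)\<rparr>"

definition generator :: "('a, 'r) ring_scheme \<Rightarrow> ('a, 'm, 'x) module_scheme \<Rightarrow> bool"
  where "generator R V \<longleftrightarrow>
    (\<forall>X :: 'a umodule. left_module R X \<and> finitely_generated R X \<longrightarrow>
       (\<exists>n. \<exists>p \<in> module_hom R (power_module V n) X. p ` carrier (power_module V n) = carrier X))"

definition cogenerator :: "('a, 'r) ring_scheme \<Rightarrow> ('a, 'm, 'x) module_scheme \<Rightarrow> bool"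
  where "cogenerator R V \<longleftrightarrow>
    (\<forall>X :: 'a umodule. left_module R X \<and> finitely_generated R X \<longrightarrow>
       (\<exists>n. \<exists>i \<in> module_hom R X (power_module V n). inj_on i (carrier X)))"

definition rep_dim :: "('a, 'r) ring_scheme \<Rightarrow> enat"
  where "rep_dim R =
    Inf {global_dim (End_ring R V) | V :: 'a umodule.
           left_module R V \<and> finitely_generated R V \<and> generator R V \<and> cogenerator R V}"

definition maximal_submodule ::
    "('a, 'r) ring_scheme \<Rightarrow> ('a, 'm, 'x) module_scheme \<Rightarrow> 'm set \<Rightarrow> 'm set \<Rightarrow> bool"
  where "maximal_submodule R M K N \<longleftrightarrow>
    submodule K R M \<and> K \<subset> N \<and> \<not> (\<exists>L. submodule L R M \<and> K \<subset> L \<and> L \<subset> N)"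

text \<open>The radical of a submodule \<open>N\<close> of \<open>M\<close>, as a submodule of \<open>M\<close>; it is \<open>N\<close> if \<open>N\<close> has
  no maximal submodules.\<close>

definition radical ::
    "('a, 'r) ring_scheme \<Rightarrow> ('a, 'm, 'x) module_scheme \<Rightarrow> 'm set \<Rightarrow> 'm set"
  where "radical R M N = N \<inter> \<Inter>{K. maximal_submodule R M K N}"

definition module_loewy_length :: "('a, 'r) ring_scheme \<Rightarrow> ('a, 'm, 'x) module_scheme \<Rightarrow> enat"
  where "module_loewy_length R M =
    Inf {enat n | n. (radical R M ^^ n) (carrier M) = {\<zero>\<^bsub>M\<^esub>}}"

definition loewy_length :: "('a, 'r) ring_scheme \<Rightarrow> enat"
  where "loewy_length R = module_loewy_length R (regular_module R)"

locale artinian_cring = cring R for R (structure) +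
  assumes descending_chain:
    "\<And>I :: nat \<Rightarrow> 'a set. \<lbrakk>\<And>n. ideal (I n) R; \<And>n. I (Suc n) \<subseteq> I n\<rbrakk> \<Longrightarrow> \<exists>N. \<forall>n\<ge>N. I n = I N"

text \<open>Unlike in the library locale \<^locale>\<open>algebra\<close>, the algebra \<open>A\<close> need not be commutative;
  the scalars act centrally.\<close>

locale artin_algebra = Module.module R A + ring A + artinian_cring R
  for R :: "('k, 'r) ring_scheme" and A :: "('k, 'a, 'x) module_scheme" +
  assumes smult_mult_left:
      "\<lbrakk>a \<in> carrier R; x \<in> carrier A; y \<in> carrier A\<rbrakk>
        \<Longrightarrow> (a \<odot>\<^bsub>A\<^esub> x) \<otimes>\<^bsub>A\<^esub> y = a \<odot>\<^bsub>A\<^esub> (x \<otimes>\<^bsub>A\<^esub> y)"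
    and smult_mult_right:
      "\<lbrakk>a \<in> carrier R; x \<in> carrier A; y \<in> carrier A\<rbrakk>
        \<Longrightarrow> x \<otimes>\<^bsub>A\<^esub> (a \<odot>\<^bsub>A\<^esub> y) = a \<odot>\<^bsub>A\<^esub> (x \<otimes>\<^bsub>A\<^esub> y)"
    and finitely_generated: "finitely_generated R A"

text \<open>The quadruple \<open>(a, n, m, b)\<close> is the matrix with rows \<open>a n\<close> and \<open>m b\<close>. The two bimodule
  homomorphisms being zero, the terms \<open>n m'\<close> and \<open>m n'\<close> do not occur in the diagonal
  entries of a product.\<close>

definition morita_ring :: "('a, 'r) ring_scheme \<Rightarrow> ('a \<times> 'a \<times> 'a \<times> 'a) ring"
  where "morita_ring L =
    \<lparr>carrier = carrier L \<times> carrier L \<times> carrier L \<times> carrier L,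
     mult = (\<lambda>(a, n, m, b) (a', n', m', b').
       (a \<otimes>\<^bsub>L\<^esub> a', a \<otimes>\<^bsub>L\<^esub> n' \<oplus>\<^bsub>L\<^esub> n \<otimes>\<^bsub>L\<^esub> b', m \<otimes>\<^bsub>L\<^esub> a' \<oplus>\<^bsub>L\<^esub> b \<otimes>\<^bsub>L\<^esub> m', b \<otimes>\<^bsub>L\<^esub> b')),
     one = (\<one>\<^bsub>L\<^esub>, \<zero>\<^bsub>L\<^esub>, \<zero>\<^bsub>L\<^esub>, \<one>\<^bsub>L\<^esub>),
     zero = (\<zero>\<^bsub>L\<^esub>, \<zero>\<^bsub>L\<^esub>, \<zero>\<^bsub>L\<^esub>, \<zero>\<^bsub>L\<^esub>),
     add = (\<lambda>(a, n, m, b) (a', n', m', b').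
       (a \<oplus>\<^bsub>L\<^esub> a', n \<oplus>\<^bsub>L\<^esub> n', m \<oplus>\<^bsub>L\<^esub> m', b \<oplus>\<^bsub>L\<^esub> b'))\<rparr>"

lemma left_module_regular:
  assumes "ring R"
  shows "left_module R (regular_module R)"
proof -
  interpret ring R by fact
  have "abelian_group (regular_module R)"
    by (rule abelian_groupI) (auto simp: regular_module_def a_ac intro: l_neg bexI[of _ "\<ominus>\<^bsub>R\<^esub> _"])
  then show ?thesis
    by (intro left_module.intro left_module_axioms.intro)
       (auto simp: regular_module_def l_distr r_distr m_assoc assms)
qed

lemma left_module_power:
  assumes "left_module R M"
  shows "left_module R (power_module M n)"
proof -
  interpret left_module R M by fact
  have "abelian_group (power_module M n)"
  proof (rule abelian_groupI)
    fix x assume "x \<in> carrier (power_module M n)"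
    then show "\<exists>y\<in>carrier (power_module M n). y \<oplus>\<^bsub>power_module M n\<^esub> x = \<zero>\<^bsub>power_module M n\<^esub>"
      by (intro bexI[of _ "\<lambda>i\<in>{..<n}. \<ominus>\<^bsub>M\<^esub> x i"])
         (auto simp: power_module_def fun_eq_iff PiE_iff M.l_neg)
  qed (auto simp: power_module_def fun_eq_iff PiE_iff extensional_def M.a_ac)
  then show ?thesis
    by (intro left_module.intro left_module_axioms.intro R.ring_axioms)
       (auto simp: power_module_def fun_eq_iff PiE_iff extensional_def
         smult_l_distr smult_r_distr smult_assoc)
qed

lemma ring_morita_ring:
  assumes "ring L"
  shows "ring (morita_ring L)"
proof -
  interpret ring L by fact
  show ?thesis
  proof (rule ringI)
    show "abelian_group (morita_ring L)"
    proof (rule abelian_groupI)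
      fix x assume x: "x \<in> carrier (morita_ring L)"
      then obtain a n m b where "x = (a, n, m, b)" "{a, n, m, b} \<subseteq> carrier L"
        by (auto simp: morita_ring_def)
      then show "\<exists>y\<in>carrier (morita_ring L). y \<oplus>\<^bsub>morita_ring L\<^esub> x = \<zero>\<^bsub>morita_ring L\<^esub>"
        by (intro bexI[of _ "(\<ominus>\<^bsub>L\<^esub> a, \<ominus>\<^bsub>L\<^esub> n, \<ominus>\<^bsub>L\<^esub> m, \<ominus>\<^bsub>L\<^esub> b)"]) (auto simp: morita_ring_def l_neg)
    qed (auto simp: morita_ring_def a_ac)
    show "monoid (morita_ring L)"
      by (rule monoidI) (auto simp: morita_ring_def l_distr r_distr m_assoc a_ac)
  qed (auto simp: morita_ring_def l_distr r_distr a_ac)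
qed

lemma ring_End_ring:
  assumes "left_module R M"
  shows "ring (End_ring R M)"
proof -
  interpret left_module R M by fact
  have z: "a \<odot>\<^bsub>M\<^esub> \<zero>\<^bsub>M\<^esub> = \<zero>\<^bsub>M\<^esub>" if "a \<in> carrier R" for a
    using smult_r_distr[of a "\<zero>\<^bsub>M\<^esub>" "\<zero>\<^bsub>M\<^esub>"] that
    by (metis M.add.l_cancel_one M.l_zero M.zero_closed smult_closed)
  have neg: "a \<odot>\<^bsub>M\<^esub> (\<ominus>\<^bsub>M\<^esub> x) = \<ominus>\<^bsub>M\<^esub> (a \<odot>\<^bsub>M\<^esub> x)" if "a \<in> carrier R" "x \<in> carrier M" for a x
    using smult_r_distr[of a "\<ominus>\<^bsub>M\<^esub> x" x] that z
    by (metis M.add.inv_closed M.l_neg M.minus_equality smult_closed)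
  note defs = End_ring_def module_hom_def compose_def
  show ?thesis
  proof (rule ringI)
    show "abelian_group (End_ring R M)"
    proof (rule abelian_groupI)
      fix f assume f: "f \<in> carrier (End_ring R M)"
      then show "\<exists>g\<in>carrier (End_ring R M). g \<oplus>\<^bsub>End_ring R M\<^esub> f = \<zero>\<^bsub>End_ring R M\<^esub>"
        by (intro bexI[of _ "\<lambda>x\<in>carrier M. \<ominus>\<^bsub>M\<^esub> f x"])
           (auto simp: defs M.minus_add M.l_neg neg Pi_iff fun_eq_iff)
    qed (auto simp: defs Pi_iff fun_eq_iff extensional_def M.a_ac smult_r_distr z)
    show "monoid (End_ring R M)"
      by (rule monoidI) (auto simp: defs Pi_iff fun_eq_iff extensional_def)
  qed (auto simp: defs Pi_iff fun_eq_iff extensional_def)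
qed

text \<open>An element \<open>x\<close> of a module generated by \<open>s 0, \<dots>, s (n - 1)\<close> is encoded as the set of its
  coefficient vectors.\<close>

lemma finitely_generated_representable:
  fixes R :: "('a, 'r) ring_scheme" and M :: "('a, 'm, 'x) module_scheme"
  assumes "left_module R M" and "finitely_generated R M"
  shows "\<exists>(N :: 'a umodule) f. left_module R N \<and> finitely_generated R N \<and>
    f \<in> module_hom R M N \<and> bij_betw f (carrier M) (carrier N)"
proof -
  interpret left_module R M by fact
  have z: "a \<odot>\<^bsub>M\<^esub> \<zero>\<^bsub>M\<^esub> = \<zero>\<^bsub>M\<^esub>" if "a \<in> carrier R" for a
    using smult_r_distr[of a "\<zero>\<^bsub>M\<^esub>" "\<zero>\<^bsub>M\<^esub>"] that
    by (metis M.add.l_cancel_one M.l_zero M.zero_closed smult_closed)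
  have z': "\<zero>\<^bsub>R\<^esub> \<odot>\<^bsub>M\<^esub> x = \<zero>\<^bsub>M\<^esub>" if "x \<in> carrier M" for x
    using smult_l_distr[of "\<zero>\<^bsub>R\<^esub>" "\<zero>\<^bsub>R\<^esub>" x] that
    by (metis M.add.l_cancel_one R.l_zero R.zero_closed smult_closed)
  have neg: "\<ominus>\<^bsub>M\<^esub> x = (\<ominus>\<^bsub>R\<^esub> \<one>\<^bsub>R\<^esub>) \<odot>\<^bsub>M\<^esub> x" if "x \<in> carrier M" for x
    using smult_l_distr[of "\<ominus>\<^bsub>R\<^esub> \<one>\<^bsub>R\<^esub>" "\<one>\<^bsub>R\<^esub>" x] that z'
    by (metis M.minus_equality R.add.inv_closed R.l_neg R.one_closed smult_closed smult_one)
  obtain S where S: "finite S" "S \<subseteq> carrier M" "\<Inter>{N. submodule N R M \<and> S \<subseteq> N} = carrier M"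
    using assms(2) by (auto simp: finitely_generated_def)
  obtain s and n :: nat where s: "S = s ` {..<n}"
    using S(1) by (metis finite_imp_nat_seg_image_inj_on lessThan_def)
  have s_closed [simp]: "s i \<in> carrier M" if "i < n" for i
    using S(2) s that by auto
  define comb where "comb c = (\<Oplus>\<^bsub>M\<^esub>i\<in>{..<n}. c i \<odot>\<^bsub>M\<^esub> s i)" for c
  have comb_closed: "comb c \<in> carrier M" if "c \<in> {..<n} \<rightarrow> carrier R" for c
    unfolding comb_def using that by (auto intro!: M.finsum_closed)
  have comb_add: "comb (\<lambda>i. c i \<oplus>\<^bsub>R\<^esub> d i) = comb c \<oplus>\<^bsub>M\<^esub> comb d"
    if "c \<in> {..<n} \<rightarrow> carrier R" "d \<in> {..<n} \<rightarrow> carrier R" for c d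
  proof -
    have "comb (\<lambda>i. c i \<oplus>\<^bsub>R\<^esub> d i) = (\<Oplus>\<^bsub>M\<^esub>i\<in>{..<n}. c i \<odot>\<^bsub>M\<^esub> s i \<oplus>\<^bsub>M\<^esub> d i \<odot>\<^bsub>M\<^esub> s i)"
      unfolding comb_def using that
      by (intro M.finsum_cong') (auto simp: smult_l_distr Pi_iff)
    also have "\<dots> = comb c \<oplus>\<^bsub>M\<^esub> comb d"
      unfolding comb_def using that by (intro M.finsum_addf) (auto simp: Pi_iff)
    finally show ?thesis .
  qed
  have comb_smult: "comb (\<lambda>i. a \<otimes>\<^bsub>R\<^esub> c i) = a \<odot>\<^bsub>M\<^esub> comb c"
    if a: "a \<in> carrier R" and c: "c \<in> {..<n} \<rightarrow> carrier R" for a c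
  proof -
    have "k \<le> n \<Longrightarrow> (\<Oplus>\<^bsub>M\<^esub>i\<in>{..<k}. (a \<otimes>\<^bsub>R\<^esub> c i) \<odot>\<^bsub>M\<^esub> s i) = a \<odot>\<^bsub>M\<^esub> (\<Oplus>\<^bsub>M\<^esub>i\<in>{..<k}. c i \<odot>\<^bsub>M\<^esub> s i)" for k
    proof (induction k)
      case (Suc k)
      then have cl: "c i \<in> carrier R" "s i \<in> carrier M" if "i \<le> k" for i
        using c that by auto
      then have "(\<Oplus>\<^bsub>M\<^esub>i\<in>{..<k}. c i \<odot>\<^bsub>M\<^esub> s i) \<in> carrier M"
        by (intro M.finsum_closed) auto
      then show ?case
        using Suc a cl by (auto simp: lessThan_Suc M.finsum_insert smult_assoc smult_r_distr Pi_iff)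
    qed (simp add: z a)
    then show ?thesis by (simp add: comb_def)
  qed
  define C where "C = comb ` ({..<n} \<rightarrow> carrier R)"
  have "submodule C R M"
  proof (intro submodule.intro subgroup.intro submodule_axioms.intro)
    have "comb (\<lambda>i. \<zero>\<^bsub>R\<^esub>) = \<zero>\<^bsub>M\<^esub>"
      unfolding comb_def by (subst M.finsum_cong'[where g = "\<lambda>_. \<zero>\<^bsub>M\<^esub>"]) (auto simp: z')
    then show "\<one>\<^bsub>add_monoid M\<^esub> \<in> C"
      unfolding C_def by (auto intro!: image_eqI[where x = "\<lambda>i. \<zero>\<^bsub>R\<^esub>"])
    show smult: "a \<odot>\<^bsub>M\<^esub> x \<in> C" if "a \<in> carrier R" "x \<in> C" for a x
      using that unfolding C_def
      by (auto simp: Pi_iff simp flip: comb_smult intro!: imageI)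
    show "inv\<^bsub>add_monoid M\<^esub> x \<in> C" if "x \<in> C" for x
      using smult[of "\<ominus>\<^bsub>R\<^esub> \<one>\<^bsub>R\<^esub>" x] that neg[of x] comb_closed by (auto simp: C_def a_inv_def)
    show "x \<otimes>\<^bsub>add_monoid M\<^esub> y \<in> C" if "x \<in> C" "y \<in> C" for x y
      using that unfolding C_def by (auto simp: Pi_iff simp flip: comb_add intro!: imageI)
  qed (auto simp: C_def comb_closed)
  moreover have "S \<subseteq> C"
  proof
    fix x assume "x \<in> S"
    then obtain j where j: "j < n" "x = s j" using s by auto
    have "comb (\<lambda>i. if i = j then \<one>\<^bsub>R\<^esub> else \<zero>\<^bsub>R\<^esub>) = (\<Oplus>\<^bsub>M\<^esub>i\<in>{..<n}. if j = i then s i else \<zero>\<^bsub>M\<^esub>)"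
      unfolding comb_def by (intro M.finsum_cong') (auto simp: z')
    also have "\<dots> = x"
      using j by (subst M.finsum_singleton) auto
    finally show "x \<in> C"
      unfolding C_def by (auto intro!: image_eqI[where x = "\<lambda>i. if i = j then \<one>\<^bsub>R\<^esub> else \<zero>\<^bsub>R\<^esub>"])
  qed
  ultimately have C: "carrier M \<subseteq> C" using S(3) by blast
  define f where "f x = {c \<in> {..<n} \<rightarrow> carrier R. comb c = x}" for x
  have inj: "inj_on f (carrier M)"
  proof (rule inj_onI)
    fix x y assume xy: "x \<in> carrier M" "y \<in> carrier M" "f x = f y"
    then obtain c where "c \<in> f x" using C by (auto simp: f_def C_def)
    then show "x = y" using xy(3) by (auto simp: f_def)
  qed
  define h where "h = inv_into (carrier M) f"
  have h: "h (f x) = x" if "x \<in> carrier M" for x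
    using inj that by (simp add: h_def)
  define N :: "'a umodule" where "N =
    \<lparr>carrier = f ` carrier M, mult = undefined, one = undefined, zero = f \<zero>\<^bsub>M\<^esub>,
     add = (\<lambda>x y. f (h x \<oplus>\<^bsub>M\<^esub> h y)), smult = (\<lambda>a x. f (a \<odot>\<^bsub>M\<^esub> h x))\<rparr>"
  have hom: "f \<in> module_hom R M N"
    by (auto simp: module_hom_def N_def h)
  have "abelian_group N"
    by (rule abelian_groupI) (auto simp: N_def h M.a_ac intro!: bexI[of _ "\<ominus>\<^bsub>M\<^esub> _"] M.l_neg arg_cong[of _ _ f])
  then have N: "left_module R N"
    by (intro left_module.intro left_module_axioms.intro R.ring_axioms)
       (auto simp: N_def h smult_l_distr smult_r_distr smult_assoc)
  interpret N: left_module R N by fact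
  have "finitely_generated R N"
    unfolding finitely_generated_def
  proof (intro exI[of _ "f ` S"] conjI equalityI)
    show "\<Inter>{K. submodule K R N \<and> f ` S \<subseteq> K} \<subseteq> carrier N"
    proof -
      have "submodule (carrier N) R N"
        by (intro submodule.intro submodule_axioms.intro N.add.subgroup_self) auto
      moreover have "f ` S \<subseteq> carrier N" using S(2) by (auto simp: N_def)
      ultimately show ?thesis by (intro Inter_lower) auto
    qed
    show "carrier N \<subseteq> \<Inter>{K. submodule K R N \<and> f ` S \<subseteq> K}"
    proof (intro Inter_greatest subsetI)
      fix K y assume "K \<in> {K. submodule K R N \<and> f ` S \<subseteq> K}" and y: "y \<in> carrier N"
      then have K: "submodule K R N" "f ` S \<subseteq> K" by auto
      interpret K: submodule K R N by fact
      define L where "L = {x \<in> carrier M. f x \<in> K}"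
      have smult_L: "a \<odot>\<^bsub>M\<^esub> x \<in> L" if "a \<in> carrier R" "x \<in> L" for a x
        using that K.smult_closed[of a "f x"] by (auto simp: L_def N_def h)
      have "submodule L R M"
      proof (intro submodule.intro subgroup.intro submodule_axioms.intro)
        show "x \<otimes>\<^bsub>add_monoid M\<^esub> y \<in> L" if "x \<in> L" "y \<in> L" for x y
          using that K.m_closed[of "f x" "f y"] by (auto simp: L_def N_def h)
        show "\<one>\<^bsub>add_monoid M\<^esub> \<in> L"
          using K.one_closed by (auto simp: L_def N_def)
        show "inv\<^bsub>add_monoid M\<^esub> x \<in> L" if "x \<in> L" for x
          using smult_L[of "\<ominus>\<^bsub>R\<^esub> \<one>\<^bsub>R\<^esub>" x] that neg[of x] by (auto simp: L_def a_inv_def)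
      qed (use smult_L in \<open>auto simp: L_def\<close>)
      moreover have "S \<subseteq> L" using S(2) K(2) by (auto simp: L_def)
      ultimately have "carrier M \<subseteq> L" using S(3) by blast
      then show "y \<in> K" using y by (auto simp: N_def L_def)
    qed
  qed (use S in \<open>auto simp: N_def\<close>)
  with N hom inj show ?thesis
    by (intro exI[of _ N] exI[of _ f]) (auto simp: bij_betw_def N_def)
qed

end

theory Submission
  imports Defs
begin

text \<open>Let \<open>G\<close> be the Morita ring, \<open>r\<close> the radical of \<open>\<Lambda>\<close> and \<open>l\<close> its Loewy length, which may be assumed
  finite. The ideal \<open>J\<close> of \<open>G\<close> with entries from \<open>r\<close> on the diagonal and from \<open>\<Lambda>\<close> off the diagonal satisfies
  \<open>J\<^sup>l\<^sup>+\<^sup>1 = 0\<close>, as the off-diagonal part has square zero, and \<open>G/J\<close> is the semisimple ring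
  \<open>\<Lambda>/r \<times> \<Lambda>/r\<close>. The representation dimension is at most \<open>l + 1\<close>, and \<open>l + 1 \<le> 2 l\<close> unless \<open>\<Lambda> = 0\<close>.

  The bound \<open>l + 1\<close> comes from a version of Auslander's generator-cogenerator: the direct sum \<open>V\<close> of the
  left modules \<open>A i = {x. x J\<^sup>i\<^sup>+\<^sup>1 = 0}\<close> for \<open>i \<le> l\<close>. It is a generator since \<open>A l = G\<close>. For \<open>V\<close> to be a
  cogenerator it is enough that homomorphisms to \<open>G\<close> separate the points of every finitely
  generated module (\<open>embedding_if_separating\<close>). Over \<open>\<Lambda>\<close> this holds because every simple module embeds
  into the selfinjective ring \<open>\<Lambda>\<close> (\<open>simple_left_ideal_exists\<close>), and it passes to \<open>G\<close>
  (\<open>morita_separating_hom\<close>). Selfinjectivity of \<open>\<Lambda>\<close> also shows that all homomorphisms between left ideals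
  of \<open>G\<close> are right multiplications (\<open>morita_right_multiplication\<close>), so that \<open>E = End V\<close> is a ring of matrices
  of such multiplications, with the following two properties. For \<open>i \<le> j\<close> every homomorphism from \<open>A i\<close> to
  \<open>A j\<close> has its image in \<open>A i\<close>; and right multiplication by an element of \<open>J\<close> maps \<open>A (i + 1)\<close> to \<open>A i\<close>.

  Call the part of an \<open>E\<close>-module cut out by the projection of \<open>V\<close> to \<open>A k\<close> its level \<open>k\<close>. The main point
  (\<open>res_len_gen\<close>) is that a submodule \<open>U\<close> of a free \<open>E\<close>-module that is generated by its levels below \<open>k\<close>
  has a projective resolution with at most \<open>k\<close> terms. In the induction step one starts from the submodule generated by
  the levels below \<open>k\<close> of \<open>U\<close> and adjoins elements \<open>z\<close> of level \<open>k\<close>, one simple module over \<open>G/J\<close> at a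
  time. By the two properties above, the relations that a new \<open>z\<close> satisfies are generated in levels
  below \<open>k\<close> (\<open>adjoin_generator\<close>), so that the induction hypothesis applies to them, and the horseshoe
  lemma (\<open>res_len_extension\<close>) bounds the length of the new module. As \<open>G\<close> is noetherian, the process
  ends. For the kernel of a free cover and \<open>k = l + 1\<close> the result is that \<open>E\<close> has
  global dimension at most \<open>l + 1\<close> (\<open>global_dim_le\<close>).

  What has to be known about \<open>\<Lambda>\<close> besides selfinjectivity is collected in the notion of a semiprimary ring
  with a set of primitive idempotents: artinian rings with nilpotent radical are of this kind
  (\<open>semiprimary_if_artinian\<close>), the notion is left-right symmetric, it passes to the Morita ring
  (\<open>semiprimary_morita\<close>), and it allows one to deduce the ascending chain condition from the descending one
  (\<open>artinian_imp_noetherian\<close>).\<close>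

section \<open>Submodules and homomorphisms\<close>

lemma (in abelian_group) diff_eq_zero:
  assumes "x \<in> carrier G" "y \<in> carrier G" "x \<ominus> y = \<zero>"
  shows "x = y"
proof -
  have "x = (x \<ominus> y) \<oplus> y" using assms(1,2) by (simp add: a_minus_def a_assoc l_neg)
  then show ?thesis using assms by simp
qed

context left_module
begin

lemma smult_zero_right [simp]: "a \<in> carrier R \<Longrightarrow> a \<odot>\<^bsub>M\<^esub> \<zero>\<^bsub>M\<^esub> = \<zero>\<^bsub>M\<^esub>"
  using smult_r_distr[of a "\<zero>\<^bsub>M\<^esub>" "\<zero>\<^bsub>M\<^esub>"]
  by (metis M.add.l_cancel_one M.l_zero M.zero_closed smult_closed)

lemma smult_zero_left [simp]: "x \<in> carrier M \<Longrightarrow> \<zero> \<odot>\<^bsub>M\<^esub> x = \<zero>\<^bsub>M\<^esub>"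
  using smult_l_distr[of \<zero> \<zero> x]
  by (metis M.add.l_cancel_one M.l_zero M.zero_closed R.l_zero R.zero_closed smult_closed)

lemma smult_minus_one: "x \<in> carrier M \<Longrightarrow> (\<ominus> \<one>) \<odot>\<^bsub>M\<^esub> x = \<ominus>\<^bsub>M\<^esub> x"
  using smult_l_distr[of "\<ominus> \<one>" \<one> x]
  by (metis M.minus_equality R.add.inv_closed R.l_neg R.one_closed smult_closed smult_one smult_zero_left)

lemma submodule_iff:
  "submodule N R M \<longleftrightarrow> N \<subseteq> carrier M \<and> \<zero>\<^bsub>M\<^esub> \<in> N \<and> (\<forall>x\<in>N. \<forall>y\<in>N. x \<oplus>\<^bsub>M\<^esub> y \<in> N) \<and>
     (\<forall>a\<in>carrier R. \<forall>x\<in>N. a \<odot>\<^bsub>M\<^esub> x \<in> N)" (is "_ \<longleftrightarrow> ?r")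
proof
  assume "submodule N R M"
  then interpret submodule N R M .
  show ?r using subset one_closed m_closed smult_closed by auto
next
  assume r: ?r
  then have "inv\<^bsub>add_monoid M\<^esub> x \<in> N" if "x \<in> N" for x
    using smult_minus_one[of x, symmetric] that unfolding a_inv_def by auto
  with r show "submodule N R M"
    by (intro submodule.intro subgroup.intro submodule_axioms.intro) auto
qed

lemma submoduleI:
  assumes "N \<subseteq> carrier M" "\<zero>\<^bsub>M\<^esub> \<in> N" "\<And>x y. x \<in> N \<Longrightarrow> y \<in> N \<Longrightarrow> x \<oplus>\<^bsub>M\<^esub> y \<in> N"
    "\<And>a x. a \<in> carrier R \<Longrightarrow> x \<in> N \<Longrightarrow> a \<odot>\<^bsub>M\<^esub> x \<in> N"
  shows "submodule N R M"
  using assms by (auto simp: submodule_iff)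

lemma submoduleD:
  assumes "submodule N R M"
  shows "x \<in> N \<Longrightarrow> x \<in> carrier M" "N \<subseteq> carrier M" "\<zero>\<^bsub>M\<^esub> \<in> N"
    "\<And>x y. x \<in> N \<Longrightarrow> y \<in> N \<Longrightarrow> x \<oplus>\<^bsub>M\<^esub> y \<in> N"
    "\<And>a x. a \<in> carrier R \<Longrightarrow> x \<in> N \<Longrightarrow> a \<odot>\<^bsub>M\<^esub> x \<in> N"
    "\<And>x. x \<in> N \<Longrightarrow> \<ominus>\<^bsub>M\<^esub> x \<in> N"
    "\<And>x y. x \<in> N \<Longrightarrow> y \<in> N \<Longrightarrow> x \<ominus>\<^bsub>M\<^esub> y \<in> N"
proof -
  show mem: "x \<in> carrier M" if "x \<in> N" for x using assms that by (auto simp: submodule_iff)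
  show add: "x \<oplus>\<^bsub>M\<^esub> y \<in> N" if "x \<in> N" "y \<in> N" for x y
    using assms that by (auto simp: submodule_iff)
  show neg: "\<ominus>\<^bsub>M\<^esub> x \<in> N" if "x \<in> N" for x
    using assms that smult_minus_one[OF mem[OF that], symmetric] by (simp add: submodule_iff)
  show "x \<ominus>\<^bsub>M\<^esub> y \<in> N" if "x \<in> N" "y \<in> N" for x y
    using that add neg by (auto simp: a_minus_def)
qed (use assms in \<open>auto simp: submodule_iff\<close>)

lemma submodule_diffD:
  assumes N: "submodule N R M" and y: "y \<in> N" and x: "x \<in> carrier M"
  shows "x \<oplus>\<^bsub>M\<^esub> y \<in> N \<Longrightarrow> x \<in> N" "y \<oplus>\<^bsub>M\<^esub> x \<in> N \<Longrightarrow> x \<in> N"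
proof -
  have yc: "y \<in> carrier M" using submoduleD(1)[OF N y] .
  have *: "x = (x \<oplus>\<^bsub>M\<^esub> y) \<ominus>\<^bsub>M\<^esub> y"
    using x yc by (simp add: a_minus_def M.a_assoc M.r_neg)
  show 1: "x \<oplus>\<^bsub>M\<^esub> y \<in> N \<Longrightarrow> x \<in> N" using submoduleD(7)[OF N _ y, of "x \<oplus>\<^bsub>M\<^esub> y"] * by simp
  then show "y \<oplus>\<^bsub>M\<^esub> x \<in> N \<Longrightarrow> x \<in> N" using x yc by (simp add: M.a_comm)
qed

lemma submodule_self: "submodule (carrier M) R M"
  by (rule submoduleI) auto

lemma submodule_zero: "submodule {\<zero>\<^bsub>M\<^esub>} R M"
  by (rule submoduleI) auto

lemma submodule_Int: "submodule A R M \<Longrightarrow> submodule B R M \<Longrightarrow> submodule (A \<inter> B) R M"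
  by (auto simp: submodule_iff)

lemma submodule_Inter:
  assumes "\<And>N. N \<in> \<N> \<Longrightarrow> submodule N R M" "\<N> \<noteq> {}"
  shows "submodule (\<Inter>\<N>) R M"
  using assms by (fastforce simp: submodule_iff)

lemma submodule_adjoin:
  assumes K: "submodule K R M" and x: "x \<in> carrier M"
  shows "submodule {k \<oplus>\<^bsub>M\<^esub> a \<odot>\<^bsub>M\<^esub> x | k a. k \<in> K \<and> a \<in> carrier R} R M" (is "submodule ?N _ _")
    and "K \<subseteq> {k \<oplus>\<^bsub>M\<^esub> a \<odot>\<^bsub>M\<^esub> x | k a. k \<in> K \<and> a \<in> carrier R}"
    and "x \<in> {k \<oplus>\<^bsub>M\<^esub> a \<odot>\<^bsub>M\<^esub> x | k a. k \<in> K \<and> a \<in> carrier R}"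
proof -
  note K' = submoduleD[OF K]
  show "submodule ?N R M"
  proof (rule submoduleI)
    show "?N \<subseteq> carrier M" using K' x by auto
    show "\<zero>\<^bsub>M\<^esub> \<in> ?N" using K'(3) x by (auto intro!: exI[of _ "\<zero>\<^bsub>M\<^esub>"] exI[of _ "\<zero>"])
    fix u v assume "u \<in> ?N" "v \<in> ?N"
    then obtain k a l b where "u = k \<oplus>\<^bsub>M\<^esub> a \<odot>\<^bsub>M\<^esub> x" "v = l \<oplus>\<^bsub>M\<^esub> b \<odot>\<^bsub>M\<^esub> x" and
      kl: "k \<in> K" "l \<in> K" "a \<in> carrier R" "b \<in> carrier R" by auto
    then have "u \<oplus>\<^bsub>M\<^esub> v = (k \<oplus>\<^bsub>M\<^esub> l) \<oplus>\<^bsub>M\<^esub> (a \<oplus> b) \<odot>\<^bsub>M\<^esub> x"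
      using x K'(1) by (simp add: smult_l_distr M.a_ac)
    then show "u \<oplus>\<^bsub>M\<^esub> v \<in> ?N" using kl K'(4) by blast
  next
    fix c u assume c: "c \<in> carrier R" and "u \<in> ?N"
    then obtain k a where u: "u = k \<oplus>\<^bsub>M\<^esub> a \<odot>\<^bsub>M\<^esub> x" "k \<in> K" "a \<in> carrier R" by auto
    then have "c \<odot>\<^bsub>M\<^esub> u = c \<odot>\<^bsub>M\<^esub> k \<oplus>\<^bsub>M\<^esub> (c \<otimes> a) \<odot>\<^bsub>M\<^esub> x"
      using x c K'(1) by (simp add: smult_r_distr smult_assoc)
    then show "c \<odot>\<^bsub>M\<^esub> u \<in> ?N" using u c K'(5) by blast
  qed
  show "K \<subseteq> ?N"
  proof
    fix k assume "k \<in> K"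
    then show "k \<in> ?N" using K'(1) x by (auto intro!: exI[of _ k] exI[of _ "\<zero>"])
  qed
  show "x \<in> ?N" using K'(3) x by (auto intro!: exI[of _ "\<zero>\<^bsub>M\<^esub>"] exI[of _ "\<one>"])
qed

lemma left_module_sub:
  assumes "submodule N R M"
  shows "left_module R (M\<lparr>carrier := N\<rparr>)"
proof -
  note N = submoduleD[OF assms]
  have "abelian_group (M\<lparr>carrier := N\<rparr>)"
  proof (rule abelian_groupI)
    fix x assume "x \<in> carrier (M\<lparr>carrier := N\<rparr>)"
    then show "\<exists>y\<in>carrier (M\<lparr>carrier := N\<rparr>). y \<oplus>\<^bsub>M\<lparr>carrier := N\<rparr>\<^esub> x = \<zero>\<^bsub>M\<lparr>carrier := N\<rparr>\<^esub>"
      by (intro bexI[of _ "\<ominus>\<^bsub>M\<^esub> x"]) (auto simp: N M.l_neg)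
  qed (auto simp: N M.a_ac)
  then show ?thesis
    by (intro left_module.intro left_module_axioms.intro R.ring_axioms)
       (auto simp: N smult_l_distr smult_r_distr smult_assoc)
qed

end

definition lin_span :: "('a, 'r) ring_scheme \<Rightarrow> ('a, 'm, 'x) module_scheme \<Rightarrow> 'm set \<Rightarrow> 'm set"
  where "lin_span R M S = \<Inter>{N. submodule N R M \<and> S \<subseteq> N}"

lemma span_superset: "S \<subseteq> lin_span R M S"
  by (auto simp: lin_span_def)

lemma span_minimal: "submodule N R M \<Longrightarrow> S \<subseteq> N \<Longrightarrow> lin_span R M S \<subseteq> N"
  by (auto simp: lin_span_def)

lemma span_mono: "S \<subseteq> T \<Longrightarrow> lin_span R M S \<subseteq> lin_span R M T"
  by (auto simp: lin_span_def)

lemma (in left_module) span_submodule: "S \<subseteq> carrier M \<Longrightarrow> submodule (lin_span R M S) R M"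
  unfolding lin_span_def using submodule_self by (intro submodule_Inter) auto

lemma (in left_module) span_insert:
  assumes "S \<subseteq> carrier M" "x \<in> carrier M"
  shows "lin_span R M (insert x S) = {k \<oplus>\<^bsub>M\<^esub> a \<odot>\<^bsub>M\<^esub> x | k a. k \<in> lin_span R M S \<and> a \<in> carrier R}" (is "_ = ?N")
proof
  note K = span_submodule[OF assms(1)]
  note N = submodule_adjoin[OF K assms(2)]
  show "lin_span R M (insert x S) \<subseteq> ?N"
    using N(2,3) span_superset[of S R M] by (intro span_minimal[OF N(1)]) blast
  have I: "submodule (lin_span R M (insert x S)) R M" using assms by (intro span_submodule) auto
  have "lin_span R M S \<subseteq> lin_span R M (insert x S)" by (rule span_mono) auto
  moreover have "x \<in> lin_span R M (insert x S)" using span_superset[of "insert x S"] by blast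
  ultimately show "?N \<subseteq> lin_span R M (insert x S)" using submoduleD(4,5)[OF I] by blast
qed

lemma (in left_module) span_empty: "lin_span R M {} = {\<zero>\<^bsub>M\<^esub>}"
  using span_minimal[OF submodule_zero, of "{}"] submoduleD(3)[OF span_submodule[of "{}"]] by auto

lemma finitely_generated_span:
  "finitely_generated R M \<longleftrightarrow> (\<exists>S. finite S \<and> S \<subseteq> carrier M \<and> lin_span R M S = carrier M)"
  by (simp add: finitely_generated_def lin_span_def)

text \<open>Finite generation of a submodule can be tested inside the ambient module.\<close>

lemma (in left_module) finitely_generated_sub:
  assumes N: "submodule N R M" and S: "finite S" "N = lin_span R M S"
  shows "finitely_generated R (M\<lparr>carrier := N\<rparr>)"
proof -
  interpret N: left_module R "M\<lparr>carrier := N\<rparr>" by (rule left_module_sub[OF N])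
  have SN: "S \<subseteq> N" using S span_superset[of S] by blast
  have "lin_span R (M\<lparr>carrier := N\<rparr>) S = N"
  proof
    show "lin_span R (M\<lparr>carrier := N\<rparr>) S \<subseteq> N"
      using N.submodule_self SN by (intro span_minimal) auto
    have "N \<subseteq> K" if "submodule K R (M\<lparr>carrier := N\<rparr>)" "S \<subseteq> K" for K
    proof -
      have "submodule K R M"
        using N.submoduleD[OF that(1)] submoduleD[OF N] by (intro submoduleI) auto
      then show ?thesis using S that span_minimal[of K R M S] by auto
    qed
    then show "N \<subseteq> lin_span R (M\<lparr>carrier := N\<rparr>) S" by (auto simp: lin_span_def)
  qed
  then show ?thesis unfolding finitely_generated_span using S SN by auto
qed

lemma module_homI:
  assumes "\<And>x. x \<in> carrier M \<Longrightarrow> f x \<in> carrier N"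
    "\<And>x y. x \<in> carrier M \<Longrightarrow> y \<in> carrier M \<Longrightarrow> f (x \<oplus>\<^bsub>M\<^esub> y) = f x \<oplus>\<^bsub>N\<^esub> f y"
    "\<And>a x. a \<in> carrier R \<Longrightarrow> x \<in> carrier M \<Longrightarrow> f (a \<odot>\<^bsub>M\<^esub> x) = a \<odot>\<^bsub>N\<^esub> f x"
  shows "f \<in> module_hom R M N"
  using assms by (auto simp: module_hom_def)

lemma module_homD:
  assumes "f \<in> module_hom R M N"
  shows "\<And>x. x \<in> carrier M \<Longrightarrow> f x \<in> carrier N"
    "\<And>x y. x \<in> carrier M \<Longrightarrow> y \<in> carrier M \<Longrightarrow> f (x \<oplus>\<^bsub>M\<^esub> y) = f x \<oplus>\<^bsub>N\<^esub> f y"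
    "\<And>a x. a \<in> carrier R \<Longrightarrow> x \<in> carrier M \<Longrightarrow> f (a \<odot>\<^bsub>M\<^esub> x) = a \<odot>\<^bsub>N\<^esub> f x"
  using assms by (auto simp: module_hom_def)

lemma module_hom_zero:
  assumes "left_module R M" "left_module R N" "f \<in> module_hom R M N"
  shows "f \<zero>\<^bsub>M\<^esub> = \<zero>\<^bsub>N\<^esub>"
proof -
  interpret M: left_module R M by fact
  interpret N: left_module R N by fact
  show ?thesis using module_homD(3)[OF assms(3), of "\<zero>\<^bsub>R\<^esub>" "\<zero>\<^bsub>M\<^esub>"] module_homD(1)[OF assms(3)] by simp
qed

lemma module_hom_minus:
  assumes "left_module R M" "left_module R N" "f \<in> module_hom R M N" "x \<in> carrier M"
  shows "f (\<ominus>\<^bsub>M\<^esub> x) = \<ominus>\<^bsub>N\<^esub> f x"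
proof -
  interpret M: left_module R M by fact
  interpret N: left_module R N by fact
  show ?thesis using module_homD(3)[OF assms(3), of "\<ominus>\<^bsub>R\<^esub> \<one>\<^bsub>R\<^esub>" x] module_homD(1)[OF assms(3)] assms(4)
    by (simp add: M.smult_minus_one N.smult_minus_one)
qed

lemma module_hom_finsum:
  assumes "left_module R M" "left_module R N" "f \<in> module_hom R M N" "finite A" "g \<in> A \<rightarrow> carrier M"
  shows "f (finsum M g A) = finsum N (\<lambda>i. f (g i)) A"
proof -
  interpret M: left_module R M by fact
  interpret N: left_module R N by fact
  note f = module_homD[OF assms(3)]
  show ?thesis using assms(4,5)
  proof (induction A)
    case empty then show ?case using module_hom_zero[OF assms(1-3)] by simp
  next
    case (insert a A)
    then have "finsum M g A \<in> carrier M" by (intro M.finsum_closed) auto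
    with insert f show ?case by (auto simp: Pi_iff M.finsum_insert N.finsum_insert)
  qed
qed

lemma module_hom_comp:
  "f \<in> module_hom R L M \<Longrightarrow> g \<in> module_hom R M N \<Longrightarrow> (\<lambda>x. g (f x)) \<in> module_hom R L N"
  by (auto simp: module_hom_def Pi_iff)

lemma submodule_vimage:
  assumes "left_module R M" "left_module R N" "f \<in> module_hom R M N" "submodule K R N"
  shows "submodule {x \<in> carrier M. f x \<in> K} R M"
proof -
  interpret M: left_module R M by fact
  interpret N: left_module R N by fact
  show ?thesis
    using N.submoduleD[OF assms(4)] module_homD[OF assms(3)] module_hom_zero[OF assms(1-3)]
    by (intro M.submoduleI) auto
qed

lemma submodule_image:
  assumes "left_module R M" "left_module R N" "f \<in> module_hom R M N" "submodule K R M"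
  shows "submodule (f ` K) R N"
proof -
  interpret M: left_module R M by fact
  interpret N: left_module R N by fact
  note K = M.submoduleD[OF assms(4)] and f = module_homD[OF assms(3)]
  show ?thesis
  proof (rule N.submoduleI)
    show "f ` K \<subseteq> carrier N" using K(2) f(1) by blast
    show "\<zero>\<^bsub>N\<^esub> \<in> f ` K" using K(3) module_hom_zero[OF assms(1-3)] by (intro image_eqI[of _ _ "\<zero>\<^bsub>M\<^esub>"]) auto
    fix x y assume "x \<in> f ` K" "y \<in> f ` K"
    then obtain u v where "u \<in> K" "v \<in> K" "x = f u" "y = f v" by blast
    then show "x \<oplus>\<^bsub>N\<^esub> y \<in> f ` K"
      using f(2)[of u v] K(1,4) by (intro image_eqI[of _ _ "u \<oplus>\<^bsub>M\<^esub> v"]) auto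
  next
    fix a x assume a: "a \<in> carrier R" and "x \<in> f ` K"
    then obtain u where "u \<in> K" "x = f u" by blast
    then show "a \<odot>\<^bsub>N\<^esub> x \<in> f ` K"
      using f(3)[of a u] K(1,5) a by (intro image_eqI[of _ _ "a \<odot>\<^bsub>M\<^esub> u"]) auto
  qed
qed

lemma submodule_ker:
  assumes "left_module R M" "left_module R N" "f \<in> module_hom R M N"
  shows "submodule (module_ker M N f) R M"
  using submodule_vimage[OF assms left_module.submodule_zero[OF assms(2)]]
  by (simp add: module_ker_def)

lemma module_hom_inj_iff:
  assumes "left_module R M" "left_module R N" "f \<in> module_hom R M N"
  shows "inj_on f (carrier M) \<longleftrightarrow> (\<forall>x\<in>carrier M. f x = \<zero>\<^bsub>N\<^esub> \<longrightarrow> x = \<zero>\<^bsub>M\<^esub>)"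
proof -
  interpret M: left_module R M by fact
  interpret N: left_module R N by fact
  note f = module_homD[OF assms(3)] and z = module_hom_zero[OF assms] and m = module_hom_minus[OF assms]
  have eq: "x = y" if "\<forall>x\<in>carrier M. f x = \<zero>\<^bsub>N\<^esub> \<longrightarrow> x = \<zero>\<^bsub>M\<^esub>" "x \<in> carrier M" "y \<in> carrier M" "f x = f y" for x y
  proof -
    have "f (x \<ominus>\<^bsub>M\<^esub> y) = \<zero>\<^bsub>N\<^esub>" using that f m by (simp add: a_minus_def N.r_neg)
    then have "x \<ominus>\<^bsub>M\<^esub> y = \<zero>\<^bsub>M\<^esub>" using that by simp
    then show ?thesis using that by (simp add: M.diff_eq_zero)
  qed
  then show ?thesis using z M.zero_closed unfolding inj_on_def by metis
qed

section \<open>The regular module and finite powers\<close>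

lemma regular_module_simps [simp]:
  "carrier (regular_module R) = carrier R" "zero (regular_module R) = zero R"
  "add (regular_module R) = add R" "smult (regular_module R) = mult R"
  by (simp_all add: regular_module_def)

lemma a_inv_regular [simp]: "a_inv (regular_module R) = a_inv R"
  by (simp add: fun_eq_iff a_inv_def m_inv_def)

lemma power_module_simps:
  "carrier (power_module M n) = {..<n} \<rightarrow>\<^sub>E carrier M" "zero (power_module M n) = (\<lambda>i\<in>{..<n}. \<zero>\<^bsub>M\<^esub>)"
  "add (power_module M n) = (\<lambda>x y. \<lambda>i\<in>{..<n}. x i \<oplus>\<^bsub>M\<^esub> y i)"
  "smult (power_module M n) = (\<lambda>a x. \<lambda>i\<in>{..<n}. a \<odot>\<^bsub>M\<^esub> x i)"
  by (simp_all add: power_module_def)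

lemma power_module_proj: "i < n \<Longrightarrow> (\<lambda>x. x i) \<in> module_hom R (power_module M n) M"
  by (rule module_homI) (auto simp: power_module_simps)

lemma power_module_tuple:
  assumes "\<And>i. i < n \<Longrightarrow> f i \<in> module_hom R L M" "left_module R L"
  shows "(\<lambda>x. \<lambda>i\<in>{..<n}. f i x) \<in> module_hom R L (power_module M n)"
proof -
  interpret L: left_module R L by fact
  show ?thesis using module_homD[OF assms(1)]
    by (intro module_homI) (auto simp: power_module_simps fun_eq_iff)
qed

text \<open>The map from a free module determined by the images \<open>m\<close> of the basis vectors.\<close>

lemma (in left_module) free_hom:
  assumes "\<And>i. i < n \<Longrightarrow> m i \<in> carrier M"
  shows "(\<lambda>x. \<Oplus>\<^bsub>M\<^esub>i\<in>{..<n}. x i \<odot>\<^bsub>M\<^esub> m i) \<in> module_hom R (power_module (regular_module R) n) M"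
proof (rule module_homI)
  fix x y assume xy: "x \<in> carrier (power_module (regular_module R) n)" "y \<in> carrier (power_module (regular_module R) n)"
  then have c: "x i \<in> carrier R" "y i \<in> carrier R" if "i < n" for i
    using that by (auto simp: power_module_simps)
  show "(\<Oplus>\<^bsub>M\<^esub>i\<in>{..<n}. x i \<odot>\<^bsub>M\<^esub> m i) \<in> carrier M"
    using c assms by (intro M.finsum_closed) auto
  have "(\<Oplus>\<^bsub>M\<^esub>i\<in>{..<n}. (x \<oplus>\<^bsub>power_module (regular_module R) n\<^esub> y) i \<odot>\<^bsub>M\<^esub> m i)
      = (\<Oplus>\<^bsub>M\<^esub>i\<in>{..<n}. x i \<odot>\<^bsub>M\<^esub> m i \<oplus>\<^bsub>M\<^esub> y i \<odot>\<^bsub>M\<^esub> m i)"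
    using c assms by (intro M.finsum_cong') (auto simp: power_module_simps smult_l_distr)
  also have "\<dots> = (\<Oplus>\<^bsub>M\<^esub>i\<in>{..<n}. x i \<odot>\<^bsub>M\<^esub> m i) \<oplus>\<^bsub>M\<^esub> (\<Oplus>\<^bsub>M\<^esub>i\<in>{..<n}. y i \<odot>\<^bsub>M\<^esub> m i)"
    using c assms by (intro M.finsum_addf) auto
  finally show "(\<Oplus>\<^bsub>M\<^esub>i\<in>{..<n}. (x \<oplus>\<^bsub>power_module (regular_module R) n\<^esub> y) i \<odot>\<^bsub>M\<^esub> m i) = \<dots>" .
next
  fix a x assume a: "a \<in> carrier R" and "x \<in> carrier (power_module (regular_module R) n)"
  then have c: "x i \<in> carrier R" if "i < n" for i
    using that by (auto simp: power_module_simps)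
  have "k \<le> n \<Longrightarrow> (\<Oplus>\<^bsub>M\<^esub>i\<in>{..<k}. (a \<otimes> x i) \<odot>\<^bsub>M\<^esub> m i) = a \<odot>\<^bsub>M\<^esub> (\<Oplus>\<^bsub>M\<^esub>i\<in>{..<k}. x i \<odot>\<^bsub>M\<^esub> m i)" for k
  proof (induction k)
    case (Suc k)
    then have "(\<Oplus>\<^bsub>M\<^esub>i\<in>{..<k}. x i \<odot>\<^bsub>M\<^esub> m i) \<in> carrier M"
      using c assms by (intro M.finsum_closed) auto
    with Suc a c assms show ?case
      by (auto simp: lessThan_Suc M.finsum_insert smult_assoc smult_r_distr Pi_iff)
  qed (simp add: a)
  from this[of n] show "(\<Oplus>\<^bsub>M\<^esub>i\<in>{..<n}. (a \<odot>\<^bsub>power_module (regular_module R) n\<^esub> x) i \<odot>\<^bsub>M\<^esub> m i)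
    = a \<odot>\<^bsub>M\<^esub> (\<Oplus>\<^bsub>M\<^esub>i\<in>{..<n}. x i \<odot>\<^bsub>M\<^esub> m i)"
    using c assms a by (subst M.finsum_cong'[where g = "\<lambda>i. (a \<otimes> x i) \<odot>\<^bsub>M\<^esub> m i"]) (auto simp: power_module_simps)
qed

definition unit_vector :: "('a, 'r) ring_scheme \<Rightarrow> nat \<Rightarrow> nat \<Rightarrow> nat \<Rightarrow> 'a"
  where "unit_vector R n j = (\<lambda>i\<in>{..<n}. if i = j then \<one>\<^bsub>R\<^esub> else \<zero>\<^bsub>R\<^esub>)"

lemma (in ring) unit_vector_carrier: "unit_vector R n j \<in> carrier (power_module (regular_module R) n)"
  by (auto simp: unit_vector_def power_module_simps)

lemma (in left_module) free_hom_unit_vector: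
  assumes "\<And>i. i < n \<Longrightarrow> m i \<in> carrier M" "j < n"
  shows "(\<Oplus>\<^bsub>M\<^esub>i\<in>{..<n}. unit_vector R n j i \<odot>\<^bsub>M\<^esub> m i) = m j"
proof -
  have "(\<Oplus>\<^bsub>M\<^esub>i\<in>{..<n}. unit_vector R n j i \<odot>\<^bsub>M\<^esub> m i) = (\<Oplus>\<^bsub>M\<^esub>i\<in>{..<n}. if j = i then m i else \<zero>\<^bsub>M\<^esub>)"
    using assms by (intro M.finsum_cong') (auto simp: unit_vector_def)
  also have "\<dots> = m j" using assms by (subst M.finsum_singleton) auto
  finally show ?thesis .
qed

lemma free_hom_unique:
  assumes M: "left_module R M" and f: "f \<in> module_hom R (power_module (regular_module R) n) M"
    and x: "x \<in> carrier (power_module (regular_module R) n)"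
  shows "f x = (\<Oplus>\<^bsub>M\<^esub>i\<in>{..<n}. x i \<odot>\<^bsub>M\<^esub> f (unit_vector R n i))"
proof -
  interpret left_module R M by fact
  let ?F = "power_module (regular_module R) n"
  interpret F: left_module R ?F by (intro left_module_power left_module_regular R.ring_axioms)
  note f' = module_homD[OF f]
  have c: "x i \<in> carrier R" if "i < n" for i using x that by (auto simp: power_module_simps)
  have u: "unit_vector R n i \<in> carrier ?F" for i by (rule unit_vector_carrier)
  have "k \<le> n \<Longrightarrow> f (\<lambda>i\<in>{..<n}. if i < k then x i else \<zero>\<^bsub>R\<^esub>) = (\<Oplus>\<^bsub>M\<^esub>i\<in>{..<k}. x i \<odot>\<^bsub>M\<^esub> f (unit_vector R n i))" for k
  proof (induction k)
    case 0
    have "(\<lambda>i\<in>{..<n}. if i < (0::nat) then x i else \<zero>\<^bsub>R\<^esub>) = \<zero>\<^bsub>?F\<^esub>"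
      by (auto simp: power_module_simps)
    then show ?case using module_hom_zero[OF F.left_module_axioms M f] by simp
  next
    case (Suc k)
    have eq: "(\<lambda>i\<in>{..<n}. if i < Suc k then x i else \<zero>\<^bsub>R\<^esub>)
      = (\<lambda>i\<in>{..<n}. if i < k then x i else \<zero>\<^bsub>R\<^esub>) \<oplus>\<^bsub>?F\<^esub> x k \<odot>\<^bsub>?F\<^esub> unit_vector R n k"
      using Suc c by (auto simp: power_module_simps unit_vector_def fun_eq_iff less_Suc_eq)
    have ck: "x k \<in> carrier R" using Suc c by simp
    have in1: "(\<lambda>i\<in>{..<n}. if i < k then x i else \<zero>\<^bsub>R\<^esub>) \<in> carrier ?F"
      using c by (auto simp: power_module_simps)
    have "f (\<lambda>i\<in>{..<n}. if i < Suc k then x i else \<zero>\<^bsub>R\<^esub>)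
      = (\<Oplus>\<^bsub>M\<^esub>i\<in>{..<k}. x i \<odot>\<^bsub>M\<^esub> f (unit_vector R n i)) \<oplus>\<^bsub>M\<^esub> x k \<odot>\<^bsub>M\<^esub> f (unit_vector R n k)"
      unfolding eq f'(2)[OF in1 F.smult_closed[OF ck u]] f'(3)[OF ck u] Suc.IH[OF Suc_leD[OF Suc.prems]] ..
    moreover have "(\<Oplus>\<^bsub>M\<^esub>i\<in>{..<k}. x i \<odot>\<^bsub>M\<^esub> f (unit_vector R n i)) \<in> carrier M"
      using Suc c f' u by (intro M.finsum_closed) auto
    ultimately show ?case
      using Suc c f' u by (subst lessThan_Suc, subst M.finsum_insert) (auto simp: Pi_iff M.a_comm)
  qed
  from this[OF order_refl] have "f (\<lambda>i\<in>{..<n}. if i < n then x i else \<zero>\<^bsub>R\<^esub>)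
    = (\<Oplus>\<^bsub>M\<^esub>i\<in>{..<n}. x i \<odot>\<^bsub>M\<^esub> f (unit_vector R n i))" .
  moreover have "(\<lambda>i\<in>{..<n}. if i < n then x i else \<zero>\<^bsub>R\<^esub>) = x"
    using x by (auto simp: power_module_simps PiE_iff extensional_def)
  ultimately show ?thesis by argo
qed

text \<open>A finitely generated module is an image of a free module of finite rank.\<close>

lemma finitely_generated_free_cover:
  assumes "left_module R M" "finitely_generated R M"
  shows "\<exists>n. \<exists>p \<in> module_hom R (power_module (regular_module R) n) M.
    p ` carrier (power_module (regular_module R) n) = carrier M"
proof -
  interpret left_module R M by fact
  obtain S where S: "finite S" "S \<subseteq> carrier M" "lin_span R M S = carrier M"
    using assms(2) by (auto simp: finitely_generated_span)
  obtain s and n :: nat where s: "S = s ` {..<n}"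
    using S(1) by (metis finite_imp_nat_seg_image_inj_on lessThan_def)
  have sc: "s i \<in> carrier M" if "i < n" for i using S(2) s that by auto
  let ?F = "power_module (regular_module R) n"
  interpret F: left_module R ?F by (intro left_module_power left_module_regular R.ring_axioms)
  define p where "p x = (\<Oplus>\<^bsub>M\<^esub>i\<in>{..<n}. x i \<odot>\<^bsub>M\<^esub> s i)" for x
  have p: "p \<in> module_hom R ?F M" unfolding p_def using sc by (rule free_hom)
  have "S \<subseteq> p ` carrier ?F"
  proof
    fix y assume "y \<in> S"
    then obtain j where "j < n" "y = s j" using s by auto
    then show "y \<in> p ` carrier ?F"
      using free_hom_unit_vector[of n s j] sc unit_vector_carrier[of n j] by (auto simp: p_def intro!: image_eqI)
  qed
  then have "carrier M \<subseteq> p ` carrier ?F"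
    using S(3) span_minimal[OF submodule_image[OF F.left_module_axioms assms(1) p F.submodule_self]] by blast
  then show ?thesis using p module_homD(1)[OF p] by blast
qed

section \<open>Chain conditions\<close>

text \<open>Both chain conditions are treated at once: \<open>up\<close> selects ascending chains.\<close>

definition chain_stable :: "bool \<Rightarrow> 'a set set \<Rightarrow> bool"
  where "chain_stable up \<L> \<longleftrightarrow> (\<forall>f :: nat \<Rightarrow> 'a set. (\<forall>t. f t \<in> \<L>) \<and>
    (\<forall>t. if up then f t \<subseteq> f (Suc t) else f (Suc t) \<subseteq> f t) \<longrightarrow> (\<exists>T. \<forall>t\<ge>T. f t = f T))"

abbreviation submodules :: "('a, 'r) ring_scheme \<Rightarrow> ('a, 'm, 'x) module_scheme \<Rightarrow> 'm set set"
  where "submodules R M \<equiv> {N. submodule N R M}"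

lemma chain_stable_subset: "chain_stable up \<L> \<Longrightarrow> \<K> \<subseteq> \<L> \<Longrightarrow> chain_stable up \<K>"
  unfolding chain_stable_def by blast

text \<open>An extension has a chain condition if both ends have it: \<open>\<phi>\<close> and \<open>\<psi>\<close> play the roles of
  intersection with a submodule and image in the quotient.\<close>

lemma chain_stable_glue:
  assumes "chain_stable up \<A>" "chain_stable up \<B>"
    and \<phi>: "\<And>X. X \<in> \<L> \<Longrightarrow> \<phi> X \<in> \<A>" "\<And>X Y. X \<in> \<L> \<Longrightarrow> Y \<in> \<L> \<Longrightarrow> X \<subseteq> Y \<Longrightarrow> \<phi> X \<subseteq> \<phi> Y"
    and \<psi>: "\<And>X. X \<in> \<L> \<Longrightarrow> \<psi> X \<in> \<B>" "\<And>X Y. X \<in> \<L> \<Longrightarrow> Y \<in> \<L> \<Longrightarrow> X \<subseteq> Y \<Longrightarrow> \<psi> X \<subseteq> \<psi> Y"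
    and sep: "\<And>X Y. X \<in> \<L> \<Longrightarrow> Y \<in> \<L> \<Longrightarrow> X \<subseteq> Y \<Longrightarrow> \<phi> X = \<phi> Y \<Longrightarrow> \<psi> X = \<psi> Y \<Longrightarrow> X = Y"
  shows "chain_stable up \<L>"
  unfolding chain_stable_def
proof (intro allI impI)
  fix f assume f: "(\<forall>t. f t \<in> \<L>) \<and> (\<forall>t. if up then f t \<subseteq> f (Suc t) else f (Suc t) \<subseteq> f t)"
  have "\<exists>T. \<forall>t\<ge>T. \<phi> (f t) = \<phi> (f T)"
    using assms(1)[unfolded chain_stable_def, rule_format, of "\<lambda>t. \<phi> (f t)"] f \<phi> by (auto split: if_splits)
  moreover have "\<exists>T. \<forall>t\<ge>T. \<psi> (f t) = \<psi> (f T)"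
    using assms(2)[unfolded chain_stable_def, rule_format, of "\<lambda>t. \<psi> (f t)"] f \<psi> by (auto split: if_splits)
  ultimately obtain T1 T2 where
    T: "\<And>t. t \<ge> T1 \<Longrightarrow> \<phi> (f t) = \<phi> (f T1)" "\<And>t. t \<ge> T2 \<Longrightarrow> \<psi> (f t) = \<psi> (f T2)" by blast
  have step: "f (Suc t) = f t" if "t \<ge> max T1 T2" for t
  proof -
    have "\<phi> (f (Suc t)) = \<phi> (f t)" "\<psi> (f (Suc t)) = \<psi> (f t)"
      using T(1)[of t] T(1)[of "Suc t"] T(2)[of t] T(2)[of "Suc t"] that
      by (simp_all only: max.bounded_iff le_SucI simp_thms)
    then show ?thesis
      using f sep[of "f t" "f (Suc t)"] sep[of "f (Suc t)" "f t"] by (cases up) metis+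
  qed
  have "f t = f (max T1 T2)" if "t \<ge> max T1 T2" for t
    using that by (induction t rule: dec_induct) (use step in auto)
  then show "\<exists>T. \<forall>t\<ge>T. f t = f T" by blast
qed

lemma chain_stable_transfer:
  assumes "chain_stable up \<A>"
    and "\<And>X. X \<in> \<L> \<Longrightarrow> \<phi> X \<in> \<A>" "\<And>X Y. X \<in> \<L> \<Longrightarrow> Y \<in> \<L> \<Longrightarrow> X \<subseteq> Y \<Longrightarrow> \<phi> X \<subseteq> \<phi> Y"
    and "\<And>X Y. X \<in> \<L> \<Longrightarrow> Y \<in> \<L> \<Longrightarrow> X \<subseteq> Y \<Longrightarrow> \<phi> X = \<phi> Y \<Longrightarrow> X = Y"
  shows "chain_stable up \<L>"
  by (rule chain_stable_glue[OF assms(1,1), of \<L> \<phi> \<phi>]) (use assms in auto)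

lemma chain_stable_extremal:
  assumes "chain_stable up \<L>" "\<L> \<noteq> {}"
  shows "\<exists>X\<in>\<L>. \<forall>Y\<in>\<L>. (if up then X \<subseteq> Y else Y \<subseteq> X) \<longrightarrow> Y = X"
proof (rule ccontr)
  assume "\<not> ?thesis"
  then have ex: "\<exists>Y\<in>\<L>. (if up then X \<subseteq> Y else Y \<subseteq> X) \<and> Y \<noteq> X" if "X \<in> \<L>" for X using that by blast
  have "\<exists>f. \<forall>t. f t \<in> \<L> \<and> (if up then f t \<subseteq> f (Suc t) else f (Suc t) \<subseteq> f t) \<and> f (Suc t) \<noteq> f t"
    using dependent_nat_choice[of "\<lambda>_ X. X \<in> \<L>" "\<lambda>_ X Y. (if up then X \<subseteq> Y else Y \<subseteq> X) \<and> Y \<noteq> X"] ex assms(2)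
    by (metis all_not_in_conv)
  then obtain f where f: "\<forall>t. f t \<in> \<L>" "\<forall>t. if up then f t \<subseteq> f (Suc t) else f (Suc t) \<subseteq> f t" "\<forall>t. f (Suc t) \<noteq> f t"
    by blast
  then obtain T where "\<forall>t\<ge>T. f t = f T" using assms(1) unfolding chain_stable_def by meson
  then show False using f(3) by (metis le_SucI order_refl)
qed

lemma chain_stable_minimal:
  assumes "chain_stable False \<L>" "X0 \<in> \<L>"
  shows "\<exists>X\<in>\<L>. \<forall>Y\<in>\<L>. Y \<subseteq> X \<longrightarrow> Y = X"
  using chain_stable_extremal[OF assms(1)] assms(2) by auto

lemma chain_stable_maximal:
  assumes "chain_stable True \<L>" "X0 \<in> \<L>"
  shows "\<exists>X\<in>\<L>. \<forall>Y\<in>\<L>. X \<subseteq> Y \<longrightarrow> Y = X"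
  using chain_stable_extremal[OF assms(1)] assms(2) by auto

text \<open>Adjoin one generator \<open>x\<close> at a time: below \<open>span (insert x S)\<close> a submodule \<open>N\<close> is
  controlled by \<open>N \<inter> span S\<close> and by the left ideal of the coefficients of \<open>x\<close>.\<close>

lemma chain_stable_span:
  assumes M: "left_module R M" and R: "chain_stable up (submodules R (regular_module R))"
    and S: "finite S" "S \<subseteq> carrier M"
  shows "chain_stable up {N. submodule N R M \<and> N \<subseteq> lin_span R M S}"
  using S
proof (induction S)
  interpret left_module R M by fact
  case empty
  have "{N. submodule N R M \<and> N \<subseteq> lin_span R M {}} = {{\<zero>\<^bsub>M\<^esub>}}"
    using submodule_zero submoduleD(3) by (auto simp: span_empty)
  then show ?case by (simp add: chain_stable_def)
next
  interpret left_module R M by fact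
  case (insert x S)
  have S: "S \<subseteq> carrier M" and x: "x \<in> carrier M" using insert.prems by auto
  let ?K = "lin_span R M S"
  note K = span_submodule[OF S] and K' = submoduleD[OF span_submodule[OF S]]
  define c where "c N = {a \<in> carrier R. \<exists>k\<in>?K. k \<oplus>\<^bsub>M\<^esub> a \<odot>\<^bsub>M\<^esub> x \<in> N}" for N
  have c: "submodule (c N) R (regular_module R)" if N: "submodule N R M" for N
  proof -
    interpret reg: left_module R "regular_module R" by (rule left_module_regular) (rule R.ring_axioms)
    note N' = submoduleD[OF N]
    show ?thesis
    proof (rule reg.submoduleI)
      show "c N \<subseteq> carrier (regular_module R)" by (auto simp: c_def)
      show "\<zero>\<^bsub>regular_module R\<^esub> \<in> c N" using N'(3) K'(3) x by (auto simp: c_def intro!: bexI[of _ "\<zero>\<^bsub>M\<^esub>"])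
      fix a b assume "a \<in> c N" "b \<in> c N"
      then obtain k l where kl: "a \<in> carrier R" "b \<in> carrier R" "k \<in> ?K" "l \<in> ?K" "k \<oplus>\<^bsub>M\<^esub> a \<odot>\<^bsub>M\<^esub> x \<in> N" "l \<oplus>\<^bsub>M\<^esub> b \<odot>\<^bsub>M\<^esub> x \<in> N"
        by (auto simp: c_def)
      then have "(k \<oplus>\<^bsub>M\<^esub> l) \<oplus>\<^bsub>M\<^esub> (a \<oplus>\<^bsub>R\<^esub> b) \<odot>\<^bsub>M\<^esub> x = (k \<oplus>\<^bsub>M\<^esub> a \<odot>\<^bsub>M\<^esub> x) \<oplus>\<^bsub>M\<^esub> (l \<oplus>\<^bsub>M\<^esub> b \<odot>\<^bsub>M\<^esub> x)"
        using x K'(1) by (simp add: smult_l_distr M.a_ac)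
      then show "a \<oplus>\<^bsub>regular_module R\<^esub> b \<in> c N"
        using kl N'(4) K'(4)[OF kl(3,4)] by (auto simp: c_def intro!: bexI[of _ "k \<oplus>\<^bsub>M\<^esub> l"])
    next
      fix a b assume a: "a \<in> carrier R" and "b \<in> c N"
      then obtain l where l: "b \<in> carrier R" "l \<in> ?K" "l \<oplus>\<^bsub>M\<^esub> b \<odot>\<^bsub>M\<^esub> x \<in> N"
        by (auto simp: c_def)
      then have "a \<odot>\<^bsub>M\<^esub> l \<oplus>\<^bsub>M\<^esub> (a \<otimes>\<^bsub>R\<^esub> b) \<odot>\<^bsub>M\<^esub> x = a \<odot>\<^bsub>M\<^esub> (l \<oplus>\<^bsub>M\<^esub> b \<odot>\<^bsub>M\<^esub> x)"
        using x a K'(1) by (simp add: smult_r_distr smult_assoc)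
      then show "a \<odot>\<^bsub>regular_module R\<^esub> b \<in> c N"
        using l a N'(5)[OF a l(3)] K'(5)[OF a l(2)] by (auto simp: c_def intro!: bexI[of _ "a \<odot>\<^bsub>M\<^esub> l"])
    qed
  qed
  have c_mono: "c X \<subseteq> c Y" if "X \<subseteq> Y" for X Y using that by (auto simp: c_def)
  show ?case
  proof (rule chain_stable_glue[OF insert.IH[OF S] R, where \<phi> = "\<lambda>N. N \<inter> ?K" and \<psi> = c])
    fix X Y assume XY: "X \<in> {N. submodule N R M \<and> N \<subseteq> lin_span R M (insert x S)}"
      "Y \<in> {N. submodule N R M \<and> N \<subseteq> lin_span R M (insert x S)}" "X \<subseteq> Y" "X \<inter> ?K = Y \<inter> ?K" "c X = c Y"
    note X = submoduleD[of X] and Y = submoduleD[of Y]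
    have "y \<in> X" if y: "y \<in> Y" for y
    proof -
      obtain k a where ka: "y = k \<oplus>\<^bsub>M\<^esub> a \<odot>\<^bsub>M\<^esub> x" "k \<in> ?K" "a \<in> carrier R"
        using XY(2) y unfolding span_insert[OF S x] by blast
      then have "a \<in> c Y" using y by (auto simp: c_def)
      then have "a \<in> c X" using XY(5) by simp
      then obtain l where l: "l \<in> ?K" "l \<oplus>\<^bsub>M\<^esub> a \<odot>\<^bsub>M\<^esub> x \<in> X" by (auto simp: c_def)
      have "(k \<ominus>\<^bsub>M\<^esub> l) \<oplus>\<^bsub>M\<^esub> (l \<oplus>\<^bsub>M\<^esub> a \<odot>\<^bsub>M\<^esub> x) = k \<oplus>\<^bsub>M\<^esub> (\<ominus>\<^bsub>M\<^esub> l \<oplus>\<^bsub>M\<^esub> l) \<oplus>\<^bsub>M\<^esub> a \<odot>\<^bsub>M\<^esub> x"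
        using x ka(3) K'(1)[OF ka(2)] K'(1)[OF l(1)] unfolding a_minus_def by (simp add: M.a_assoc)
      also have "\<dots> = y" using x ka K'(1)[OF ka(2)] K'(1)[OF l(1)] by (simp add: M.l_neg)
      finally have y': "y = (k \<ominus>\<^bsub>M\<^esub> l) \<oplus>\<^bsub>M\<^esub> (l \<oplus>\<^bsub>M\<^esub> a \<odot>\<^bsub>M\<^esub> x)" ..
      moreover have kl: "k \<ominus>\<^bsub>M\<^esub> l \<in> ?K" using K'(7)[OF ka(2) l(1)] .
      moreover have "k \<ominus>\<^bsub>M\<^esub> l \<in> Y"
        using submodule_diffD(1)[of Y "l \<oplus>\<^bsub>M\<^esub> a \<odot>\<^bsub>M\<^esub> x" "k \<ominus>\<^bsub>M\<^esub> l"] XY y y' l kl K'(1) by auto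
      ultimately have "k \<ominus>\<^bsub>M\<^esub> l \<in> X" using XY(4) by blast
      then show ?thesis using y' l(2) XY(1) X(4) by auto
    qed
    then show "X = Y" using XY(3) by blast
  qed (auto simp: c intro: submodule_Int K dest: c_mono)
qed

lemma chain_stable_finitely_generated:
  assumes M: "left_module R M" and R: "chain_stable up (submodules R (regular_module R))"
    and fg: "finitely_generated R M"
  shows "chain_stable up (submodules R M)"
proof -
  interpret left_module R M by fact
  obtain S where S: "finite S" "S \<subseteq> carrier M" "lin_span R M S = carrier M"
    using fg unfolding finitely_generated_span by blast
  show ?thesis
    using chain_stable_span[OF M R S(1,2)]
    by (rule chain_stable_subset) (use S(3) submoduleD(1) in auto)
qed

lemma chain_stable_power:
  assumes M: "left_module R M" and c: "chain_stable up (submodules R M)"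
  shows "chain_stable up (submodules R (power_module M n))"
proof -
  interpret left_module R M by fact
  let ?P = "power_module M n"
  interpret P: left_module R ?P by (rule left_module_power[OF M])
  let ?U = "\<lambda>k. {x \<in> carrier ?P. \<forall>i<n. k \<le> i \<longrightarrow> x i = \<zero>\<^bsub>M\<^esub>}"
  have U: "submodule (?U k) R ?P" for k
    by (rule P.submoduleI) (auto simp: power_module_simps)
  have "k \<le> n \<Longrightarrow> chain_stable up {N. submodule N R ?P \<and> N \<subseteq> ?U k}" for k
  proof (induction k)
    case 0
    have "?U 0 = {\<zero>\<^bsub>?P\<^esub>}"
      by (auto simp: power_module_simps fun_eq_iff PiE_iff extensional_def)
    then have "{N. submodule N R ?P \<and> N \<subseteq> ?U 0} = {{\<zero>\<^bsub>?P\<^esub>}}"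
      using P.submodule_zero P.submoduleD(3) by auto
    then show ?case by (simp add: chain_stable_def)
  next
    case (Suc k)
    then have k: "k < n" by simp
    have pr: "(\<lambda>x. x k) \<in> module_hom R ?P M" by (rule power_module_proj[OF k])
    show ?case
    proof (rule chain_stable_glue[OF Suc.IH c, where \<phi> = "\<lambda>N. N \<inter> ?U k" and \<psi> = "\<lambda>N. (\<lambda>x. x k) ` N"])
      fix X Y assume XY: "X \<in> {N. submodule N R ?P \<and> N \<subseteq> ?U (Suc k)}" "Y \<in> {N. submodule N R ?P \<and> N \<subseteq> ?U (Suc k)}"
        "X \<subseteq> Y" "X \<inter> ?U k = Y \<inter> ?U k" "(\<lambda>x. x k) ` X = (\<lambda>x. x k) ` Y"
      have X: "submodule X R ?P" and Y: "submodule Y R ?P" using XY by auto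
      have "y \<in> X" if y: "y \<in> Y" for y
      proof -
        obtain x where x: "x \<in> X" "x k = y k" using XY(5) y by (metis (no_types, lifting) imageE imageI)
        have xc: "x \<in> carrier ?P" and yc: "y \<in> carrier ?P" using P.submoduleD(1)[OF X] P.submoduleD(1)[OF Y] x y by auto
        have d: "y \<ominus>\<^bsub>?P\<^esub> x \<in> Y" using P.submoduleD(7)[OF Y y] x XY(3) by blast
        have "(y \<ominus>\<^bsub>?P\<^esub> x) k \<oplus>\<^bsub>M\<^esub> x k = y k"
        proof -
          have "(y \<ominus>\<^bsub>?P\<^esub> x) \<oplus>\<^bsub>?P\<^esub> x = y" using xc yc by (simp add: a_minus_def P.M.a_assoc P.M.l_neg)
          moreover have "((y \<ominus>\<^bsub>?P\<^esub> x) \<oplus>\<^bsub>?P\<^esub> x) k = (y \<ominus>\<^bsub>?P\<^esub> x) k \<oplus>\<^bsub>M\<^esub> x k" using k by (simp add: power_module_simps)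
          ultimately show ?thesis by simp
        qed
        moreover have "(y \<ominus>\<^bsub>?P\<^esub> x) k \<in> carrier M" "x k \<in> carrier M"
          using P.M.minus_closed[OF yc xc] xc k by (auto simp: power_module_simps)
        ultimately have "(y \<ominus>\<^bsub>?P\<^esub> x) k = \<zero>\<^bsub>M\<^esub>"
          unfolding x(2) by simp
        moreover have "y \<ominus>\<^bsub>?P\<^esub> x \<in> ?U (Suc k)" using d XY(2) by blast
        ultimately have "y \<ominus>\<^bsub>?P\<^esub> x \<in> ?U k" using k by (auto simp: le_less Suc_le_eq)
        then have "y \<ominus>\<^bsub>?P\<^esub> x \<in> X" using d XY(4) by blast
        then have "(y \<ominus>\<^bsub>?P\<^esub> x) \<oplus>\<^bsub>?P\<^esub> x \<in> X" using P.submoduleD(4)[OF X] x by blast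
        then show ?thesis using xc yc by (simp add: a_minus_def P.M.a_assoc P.M.l_neg)
      qed
      then show "X = Y" using XY(3) by blast
    next
      fix X assume "X \<in> {N. submodule N R ?P \<and> N \<subseteq> ?U (Suc k)}"
      then show "X \<inter> ?U k \<in> {N. submodule N R ?P \<and> N \<subseteq> ?U k}" "(\<lambda>x. x k) ` X \<in> submodules R M"
        using P.submodule_Int[OF _ U, of X k] submodule_image[OF P.left_module_axioms M pr, of X] by auto
    qed (use Suc k in auto)
  qed
  from this[OF order_refl] show ?thesis
    by (rule chain_stable_subset) (use P.submoduleD(1) in auto)
qed

lemma noetherian_finite_span:
  assumes M: "left_module R M" and c: "chain_stable True (submodules R M)" and N: "submodule N R M"
  shows "\<exists>S. finite S \<and> S \<subseteq> N \<and> N = lin_span R M S"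
proof -
  interpret left_module R M by fact
  let ?\<L> = "{lin_span R M S | S. finite S \<and> S \<subseteq> N}"
  have "?\<L> \<subseteq> submodules R M" using span_submodule submoduleD(2)[OF N] by blast
  then have cs: "chain_stable True ?\<L>" by (rule chain_stable_subset[OF c])
  have "lin_span R M {} \<in> ?\<L>" by blast
  then obtain X where X: "X \<in> ?\<L>" "\<forall>Y\<in>?\<L>. X \<subseteq> Y \<longrightarrow> Y = X"
    by (rule chain_stable_maximal[OF cs, THEN bexE])
  then obtain S where S: "finite S" "S \<subseteq> N" "X = lin_span R M S" by blast
  have "N \<subseteq> X"
  proof
    fix x assume "x \<in> N"
    then have "lin_span R M (insert x S) \<in> ?\<L>" using S by blast
    then have "lin_span R M (insert x S) = X" using X(2) S(3) span_mono[of S "insert x S" R M] by blast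
    then show "x \<in> X" using span_superset[of "insert x S" R M] by blast
  qed
  then show ?thesis using S span_minimal[OF N S(2)] by blast
qed

lemma noetherian_if_finite_span:
  assumes M: "left_module R M"
    and fg: "\<And>N. submodule N R M \<Longrightarrow> \<exists>S. finite S \<and> S \<subseteq> N \<and> N = lin_span R M S"
  shows "chain_stable True (submodules R M)"
  unfolding chain_stable_def
proof (intro allI impI)
  interpret left_module R M by fact
  fix f :: "nat \<Rightarrow> _"
  assume f: "(\<forall>t. f t \<in> submodules R M) \<and> (\<forall>t. if True then f t \<subseteq> f (Suc t) else f (Suc t) \<subseteq> f t)"
  then have mono: "f s \<subseteq> f t" if "s \<le> t" for s t using lift_Suc_mono_le[of f] that by auto
  have sub: "submodule (f t) R M" for t using f by blast
  have "submodule (\<Union>t. f t) R M"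
  proof (rule submoduleI)
    fix x y assume "x \<in> (\<Union>t. f t)" "y \<in> (\<Union>t. f t)"
    then obtain s t where "x \<in> f s" "y \<in> f t" by blast
    then have "x \<in> f (max s t)" "y \<in> f (max s t)" using mono[of s "max s t"] mono[of t "max s t"] by auto
    then show "x \<oplus>\<^bsub>M\<^esub> y \<in> (\<Union>t. f t)" using submoduleD(4)[OF sub] by blast
  next
    fix a x assume "a \<in> carrier R" "x \<in> (\<Union>t. f t)"
    then show "a \<odot>\<^bsub>M\<^esub> x \<in> (\<Union>t. f t)" using submoduleD(5)[OF sub] by blast
  next
    show "(\<Union>t. f t) \<subseteq> carrier M" using submoduleD(2)[OF sub] by blast
    show "\<zero>\<^bsub>M\<^esub> \<in> (\<Union>t. f t)" using submoduleD(3)[OF sub] by blast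
  qed
  from fg[OF this] obtain S where S: "finite S" "S \<subseteq> (\<Union>t. f t)" "(\<Union>t. f t) = lin_span R M S" by blast
  have "\<exists>T. S \<subseteq> f T" using S(1,2)
  proof (induction S)
    case (insert x S)
    then obtain s t where "x \<in> f s" "S \<subseteq> f t" by blast
    then have "insert x S \<subseteq> f (max s t)" using mono[of s "max s t"] mono[of t "max s t"] by auto
    then show ?case by blast
  qed auto
  then obtain T where "S \<subseteq> f T" by blast
  then have "(\<Union>t. f t) \<subseteq> f T" unfolding S(3) by (rule span_minimal[OF sub])
  then have "f t = f T" if "t \<ge> T" for t using mono[OF that] by blast
  then show "\<exists>T. \<forall>t\<ge>T. f t = f T" by blast
qed

section \<open>Restriction of scalars and the opposite ring\<close>

definition restrict_scalars :: "('b \<Rightarrow> 'a) \<Rightarrow> ('a, 'm, 'x) module_scheme \<Rightarrow> ('b, 'm) module"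
  where "restrict_scalars \<phi> M =
    \<lparr>carrier = carrier M, mult = undefined, one = undefined, zero = zero M, add = add M,
     smult = (\<lambda>a x. \<phi> a \<odot>\<^bsub>M\<^esub> x)\<rparr>"

lemma restrict_scalars_simps [simp]:
  "carrier (restrict_scalars \<phi> M) = carrier M" "zero (restrict_scalars \<phi> M) = zero M"
  "add (restrict_scalars \<phi> M) = add M" "smult (restrict_scalars \<phi> M) = (\<lambda>a x. \<phi> a \<odot>\<^bsub>M\<^esub> x)"
  by (simp_all add: restrict_scalars_def)

lemma left_module_restrict:
  assumes "left_module T M" "ring S" "\<phi> \<in> ring_hom S T"
  shows "left_module S (restrict_scalars \<phi> M)"
proof -
  interpret left_module T M by fact
  interpret S: ring S by fact
  note h = ring_hom_memE[OF assms(3)]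
  have "abelian_group (restrict_scalars \<phi> M)"
  proof (rule abelian_groupI)
    fix x assume "x \<in> carrier (restrict_scalars \<phi> M)"
    then show "\<exists>y\<in>carrier (restrict_scalars \<phi> M). y \<oplus>\<^bsub>restrict_scalars \<phi> M\<^esub> x = \<zero>\<^bsub>restrict_scalars \<phi> M\<^esub>"
      by (intro bexI[of _ "\<ominus>\<^bsub>M\<^esub> x"]) (auto simp: M.l_neg)
  qed (auto simp: M.a_ac)
  then show ?thesis
    by (intro left_module.intro left_module_axioms.intro assms)
       (auto simp: h smult_l_distr smult_r_distr smult_assoc)
qed

lemma submodule_restrict:
  assumes "left_module T M" "ring S" "\<phi> \<in> ring_hom S T" "submodule N T M"
  shows "submodule N S (restrict_scalars \<phi> M)"
proof -
  interpret left_module T M by fact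
  interpret r: left_module S "restrict_scalars \<phi> M" by (rule left_module_restrict) fact+
  show ?thesis
    using submoduleD[OF assms(4)] ring_hom_memE(1)[OF assms(3)] by (intro r.submoduleI) auto
qed

text \<open>A ring that is a finitely generated module over another one inherits its chain conditions.\<close>

lemma chain_stable_finite_extension:
  assumes "ring S" "ring T" "\<phi> \<in> ring_hom S T"
    and "finitely_generated S (restrict_scalars \<phi> (regular_module T))"
    and "chain_stable up (submodules S (regular_module S))"
  shows "chain_stable up (submodules T (regular_module T))"
proof -
  have T: "left_module T (regular_module T)" by (rule left_module_regular) fact
  have r: "left_module S (restrict_scalars \<phi> (regular_module T))"
    by (rule left_module_restrict) fact+
  show ?thesis
    using chain_stable_finitely_generated[OF r assms(5,4)]
    by (rule chain_stable_subset) (use submodule_restrict[OF T assms(1,3)] in auto)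
qed

definition opposite :: "('a, 'r) ring_scheme \<Rightarrow> 'a ring"
  where "opposite R =
    \<lparr>carrier = carrier R, mult = (\<lambda>x y. y \<otimes>\<^bsub>R\<^esub> x), one = one R, zero = zero R, add = add R\<rparr>"

lemma opposite_simps [simp]:
  "carrier (opposite R) = carrier R" "one (opposite R) = one R" "zero (opposite R) = zero R"
  "add (opposite R) = add R" "mult (opposite R) = (\<lambda>x y. y \<otimes>\<^bsub>R\<^esub> x)"
  by (simp_all add: opposite_def)

lemma ring_opposite:
  assumes "ring R"
  shows "ring (opposite R)"
proof -
  interpret ring R by fact
  show ?thesis
  proof (rule ringI)
    show "abelian_group (opposite R)"
    proof (rule abelian_groupI)
      fix x assume "x \<in> carrier (opposite R)"
      then show "\<exists>y\<in>carrier (opposite R). y \<oplus>\<^bsub>opposite R\<^esub> x = \<zero>\<^bsub>opposite R\<^esub>"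
        by (intro bexI[of _ "\<ominus>\<^bsub>R\<^esub> x"]) (auto simp: l_neg)
    qed (auto simp: a_ac)
    show "monoid (opposite R)" by (rule monoidI) (auto simp: m_assoc)
  qed (auto simp: l_distr r_distr)
qed

section \<open>Projective modules\<close>

text \<open>Modules on the type \<open>nat \<Rightarrow> 'a\<close>, such as submodules of free modules, are moved to the type of
  the test modules by passing to singletons.\<close>

definition singleton_module :: "('a, 'm, 'x) module_scheme \<Rightarrow> ('a, 'm set) module"
  where "singleton_module M =
    \<lparr>carrier = (\<lambda>x. {x}) ` carrier M, mult = undefined, one = undefined, zero = {\<zero>\<^bsub>M\<^esub>},
     add = (\<lambda>X Y. {the_elem X \<oplus>\<^bsub>M\<^esub> the_elem Y}), smult = (\<lambda>a X. {a \<odot>\<^bsub>M\<^esub> the_elem X})\<rparr>"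

lemma singleton_module_simps [simp]:
  "carrier (singleton_module M) = (\<lambda>x. {x}) ` carrier M" "zero (singleton_module M) = {\<zero>\<^bsub>M\<^esub>}"
  "add (singleton_module M) = (\<lambda>X Y. {the_elem X \<oplus>\<^bsub>M\<^esub> the_elem Y})"
  "smult (singleton_module M) = (\<lambda>a X. {a \<odot>\<^bsub>M\<^esub> the_elem X})"
  by (simp_all add: singleton_module_def)

lemma left_module_singleton:
  assumes "left_module R M"
  shows "left_module R (singleton_module M)"
proof -
  interpret left_module R M by fact
  have "abelian_group (singleton_module M)"
  proof (rule abelian_groupI)
    fix x assume "x \<in> carrier (singleton_module M)"
    then show "\<exists>y\<in>carrier (singleton_module M). y \<oplus>\<^bsub>singleton_module M\<^esub> x = \<zero>\<^bsub>singleton_module M\<^esub>"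
      by (auto simp: M.l_neg intro!: bexI[of _ "\<ominus>\<^bsub>M\<^esub> _"])
  qed (auto simp: M.a_ac)
  then show ?thesis
    by (intro left_module.intro left_module_axioms.intro R.ring_axioms)
       (auto simp: smult_l_distr smult_r_distr smult_assoc)
qed

lemma singleton_hom: "(\<lambda>x. {x}) \<in> module_hom R M (singleton_module M)"
  by (rule module_homI) auto

lemma the_elem_hom: "left_module R M \<Longrightarrow> the_elem \<in> module_hom R (singleton_module M) M"
  by (rule module_homI) auto

lemma projectiveD:
  fixes M N :: "'a umodule"
  assumes "projective R P" "left_module R M \<and> left_module R N \<and> p \<in> module_hom R M N \<and> p ` carrier M = carrier N \<and> f \<in> module_hom R P N"
  shows "\<exists>g\<in>module_hom R P M. \<forall>x\<in>carrier P. p (g x) = f x"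
  using assms(1) unfolding projective_def by (elim conjE allE impE) (rule assms(2))

lemma projective_lift:
  fixes M N :: "('a, nat \<Rightarrow> 'a) module"
  assumes P: "projective R P" and M: "left_module R M" and N: "left_module R N"
    and p: "p \<in> module_hom R M N" "p ` carrier M = carrier N" and f: "f \<in> module_hom R P N"
  shows "\<exists>g \<in> module_hom R P M. \<forall>x \<in> carrier P. p (g x) = f x"
proof -
  let ?p = "\<lambda>X. {p (the_elem X)}" and ?f = "\<lambda>x. {f x}"
  have p': "?p \<in> module_hom R (singleton_module M) (singleton_module N)"
    by (rule module_hom_comp[OF module_hom_comp[OF the_elem_hom[OF M] p(1)] singleton_hom])
  have onto: "?p ` carrier (singleton_module M) = carrier (singleton_module N)"
    by (simp add: image_image flip: p(2))
  have f': "?f \<in> module_hom R P (singleton_module N)"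
    by (rule module_hom_comp[OF f singleton_hom])
  obtain g where g: "g \<in> module_hom R P (singleton_module M)" "\<forall>x\<in>carrier P. ?p (g x) = ?f x"
    using projectiveD[OF P, of "singleton_module M" "singleton_module N" ?p ?f]
      left_module_singleton[OF M] left_module_singleton[OF N] p' onto f' by blast
  show ?thesis
    using g(2) by (intro bexI[of _ "\<lambda>x. the_elem (g x)"] module_hom_comp[OF g(1) the_elem_hom[OF M]]) auto
qed

lemma projective_retract:
  assumes P: "projective R P" and Q: "left_module R Q" and i: "i \<in> module_hom R Q P"
    and r: "r \<in> module_hom R P Q" and ri: "\<And>x. x \<in> carrier Q \<Longrightarrow> r (i x) = x"
  shows "projective R Q"
  unfolding projective_def
proof (intro conjI allI impI, fact)
  fix M N :: "'a umodule" and p f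
  assume A: "left_module R M \<and> left_module R N \<and> p \<in> module_hom R M N \<and> p ` carrier M = carrier N \<and> f \<in> module_hom R Q N"
  then have "(\<lambda>x. f (r x)) \<in> module_hom R P N" by (intro module_hom_comp[OF r]) blast
  then obtain g where g: "g \<in> module_hom R P M" "\<forall>x\<in>carrier P. p (g x) = f (r x)"
    using projectiveD[OF P, of M N p "\<lambda>x. f (r x)"] A by blast
  show "\<exists>g\<in>module_hom R Q M. \<forall>x\<in>carrier Q. p (g x) = f x"
    using g(2) ri module_homD(1)[OF i] by (intro bexI[of _ "\<lambda>x. g (i x)"] module_hom_comp[OF i g(1)]) auto
qed

lemma projective_singleton: "projective R P \<Longrightarrow> projective R (singleton_module P)"
  by (rule projective_retract[where i = the_elem and r = "\<lambda>x. {x}"])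
     (auto simp: left_module_singleton the_elem_hom singleton_hom projective_def)

lemma projective_zero:
  assumes "left_module R P" "carrier P = {\<zero>\<^bsub>P\<^esub>}"
  shows "projective R P"
  unfolding projective_def
proof (intro conjI allI impI, fact)
  fix M N :: "'a umodule" and p f
  assume A: "left_module R M \<and> left_module R N \<and> p \<in> module_hom R M N \<and> p ` carrier M = carrier N \<and> f \<in> module_hom R P N"
  then interpret M: left_module R M by blast
  interpret P: left_module R P by fact
  have "(\<lambda>_. \<zero>\<^bsub>M\<^esub>) \<in> module_hom R P M" by (rule module_homI) auto
  moreover have "p \<zero>\<^bsub>M\<^esub> = f x" if "x \<in> carrier P" for x
    using module_hom_zero[of R M N p] module_hom_zero[of R P N f] A assms that by simp
  ultimately show "\<exists>g\<in>module_hom R P M. \<forall>x\<in>carrier P. p (g x) = f x"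
    by (intro bexI[of _ "\<lambda>_. \<zero>\<^bsub>M\<^esub>"]) auto
qed

lemma projective_free:
  assumes "ring R"
  shows "projective R (power_module (regular_module R) n)"
  unfolding projective_def
proof (intro conjI allI impI)
  let ?F = "power_module (regular_module R) n"
  show F: "left_module R ?F" by (intro left_module_power left_module_regular assms)
  interpret ring R by fact
  fix M N :: "'a umodule" and p f
  assume A: "left_module R M \<and> left_module R N \<and> p \<in> module_hom R M N \<and> p ` carrier M = carrier N \<and> f \<in> module_hom R ?F N"
  interpret M: left_module R M using A by blast
  interpret N: left_module R N using A by blast
  have p: "p \<in> module_hom R M N" "p ` carrier M = carrier N" and f: "f \<in> module_hom R ?F N" using A by auto
  have u: "f (unit_vector R n i) \<in> carrier N" for i
    using module_homD(1)[OF f unit_vector_carrier] .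
  define m where "m i = (SOME y. y \<in> carrier M \<and> p y = f (unit_vector R n i))" for i
  have "\<exists>y. y \<in> carrier M \<and> p y = f (unit_vector R n i)" for i
  proof -
    have "f (unit_vector R n i) \<in> p ` carrier M" using u p(2) by simp
    then show ?thesis by (rule imageE) blast
  qed
  then have m: "m i \<in> carrier M \<and> p (m i) = f (unit_vector R n i)" for i
    unfolding m_def by (rule someI_ex)
  let ?g = "\<lambda>x. \<Oplus>\<^bsub>M\<^esub>i\<in>{..<n}. x i \<odot>\<^bsub>M\<^esub> m i"
  have g: "?g \<in> module_hom R ?F M" by (rule M.free_hom) (use m in auto)
  have "p (?g x) = f x" if x: "x \<in> carrier ?F" for x
  proof -
    have c: "x i \<in> carrier R" if "i < n" for i using x that by (auto simp: power_module_simps)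
    have "p (?g x) = (\<Oplus>\<^bsub>N\<^esub>i\<in>{..<n}. p (x i \<odot>\<^bsub>M\<^esub> m i))"
      by (rule module_hom_finsum[OF M.left_module_axioms N.left_module_axioms p(1)]) (use c m in auto)
    also have "\<dots> = (\<Oplus>\<^bsub>N\<^esub>i\<in>{..<n}. x i \<odot>\<^bsub>N\<^esub> f (unit_vector R n i))"
      by (rule N.finsum_cong') (use c m u module_homD(3)[OF p(1)] in auto)
    also have "\<dots> = f x" using free_hom_unique[OF N.left_module_axioms f x] by simp
    finally show ?thesis .
  qed
  then show "\<exists>g\<in>module_hom R ?F M. \<forall>x\<in>carrier ?F. p (g x) = f x"
    by (intro bexI[OF _ g] ballI)
qed

text \<open>The direct sum of two modules on the type \<open>nat \<Rightarrow> 'a\<close>, on the same type: pairs of sequences are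
  interleaved.\<close>

definition join :: "(nat \<Rightarrow> 'a) \<Rightarrow> (nat \<Rightarrow> 'a) \<Rightarrow> nat \<Rightarrow> 'a"
  where "join x y = (\<lambda>n. if even n then x (n div 2) else y (n div 2))"

definition evens :: "(nat \<Rightarrow> 'a) \<Rightarrow> nat \<Rightarrow> 'a" where "evens x = (\<lambda>n. x (2 * n))"

definition odds :: "(nat \<Rightarrow> 'a) \<Rightarrow> nat \<Rightarrow> 'a" where "odds x = (\<lambda>n. x (Suc (2 * n)))"

lemma join_simps [simp]: "evens (join x y) = x" "odds (join x y) = y" "join (evens z) (odds z) = z"
  by (auto simp: join_def evens_def odds_def fun_eq_iff)

lemma join_eq_iff [simp]: "join x y = join x' y' \<longleftrightarrow> x = x' \<and> y = y'"
  by (metis join_simps(1,2))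

definition direct_sum :: "('a, nat \<Rightarrow> 'a) module \<Rightarrow> ('a, nat \<Rightarrow> 'a) module \<Rightarrow> ('a, nat \<Rightarrow> 'a) module"
  where "direct_sum M N =
    \<lparr>carrier = {x. evens x \<in> carrier M \<and> odds x \<in> carrier N}, mult = undefined, one = undefined,
     zero = join \<zero>\<^bsub>M\<^esub> \<zero>\<^bsub>N\<^esub>,
     add = (\<lambda>x y. join (evens x \<oplus>\<^bsub>M\<^esub> evens y) (odds x \<oplus>\<^bsub>N\<^esub> odds y)),
     smult = (\<lambda>a x. join (a \<odot>\<^bsub>M\<^esub> evens x) (a \<odot>\<^bsub>N\<^esub> odds x))\<rparr>"

lemma direct_sum_simps [simp]:
  "x \<in> carrier (direct_sum M N) \<longleftrightarrow> evens x \<in> carrier M \<and> odds x \<in> carrier N"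
  "zero (direct_sum M N) = join \<zero>\<^bsub>M\<^esub> \<zero>\<^bsub>N\<^esub>"
  "add (direct_sum M N) = (\<lambda>x y. join (evens x \<oplus>\<^bsub>M\<^esub> evens y) (odds x \<oplus>\<^bsub>N\<^esub> odds y))"
  "smult (direct_sum M N) = (\<lambda>a x. join (a \<odot>\<^bsub>M\<^esub> evens x) (a \<odot>\<^bsub>N\<^esub> odds x))"
  by (simp_all add: direct_sum_def)

lemma left_module_direct_sum:
  assumes "left_module R M" "left_module R N"
  shows "left_module R (direct_sum M N)"
proof -
  interpret M: left_module R M by fact
  interpret N: left_module R N by fact
  have "abelian_group (direct_sum M N)"
  proof (rule abelian_groupI)
    fix x assume x: "x \<in> carrier (direct_sum M N)"
    then show "\<exists>y\<in>carrier (direct_sum M N). y \<oplus>\<^bsub>direct_sum M N\<^esub> x = \<zero>\<^bsub>direct_sum M N\<^esub>"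
      by (intro bexI[of _ "join (\<ominus>\<^bsub>M\<^esub> evens x) (\<ominus>\<^bsub>N\<^esub> odds x)"]) (auto simp: M.M.l_neg N.M.l_neg)
  qed (auto simp: M.M.a_ac N.M.a_ac)
  then show ?thesis
    by (intro left_module.intro left_module_axioms.intro M.R.ring_axioms)
       (auto simp: M.smult_l_distr M.smult_r_distr M.smult_assoc N.smult_l_distr N.smult_r_distr N.smult_assoc)
qed

lemma direct_sum_homs:
  assumes "left_module R M" "left_module R N"
  shows "evens \<in> module_hom R (direct_sum M N) M" "odds \<in> module_hom R (direct_sum M N) N"
    "(\<lambda>x. join x \<zero>\<^bsub>N\<^esub>) \<in> module_hom R M (direct_sum M N)"
    "(\<lambda>y. join \<zero>\<^bsub>M\<^esub> y) \<in> module_hom R N (direct_sum M N)"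
proof -
  interpret M: left_module R M by fact
  interpret N: left_module R N by fact
  show "evens \<in> module_hom R (direct_sum M N) M" "odds \<in> module_hom R (direct_sum M N) N"
    "(\<lambda>x. join x \<zero>\<^bsub>N\<^esub>) \<in> module_hom R M (direct_sum M N)"
    "(\<lambda>y. join \<zero>\<^bsub>M\<^esub> y) \<in> module_hom R N (direct_sum M N)"
    by (intro module_homI; simp)+
qed

lemma module_hom_add:
  assumes "left_module R M" "left_module R N" "f \<in> module_hom R M N" "g \<in> module_hom R M N"
  shows "(\<lambda>x. f x \<oplus>\<^bsub>N\<^esub> g x) \<in> module_hom R M N"
proof -
  interpret N: left_module R N by fact
  note f = module_homD[OF assms(3)] and g = module_homD[OF assms(4)]
  show ?thesis by (rule module_homI) (simp_all add: f g N.M.a_ac N.smult_r_distr)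
qed

lemma projective_direct_sum:
  assumes P: "projective R P" and Q: "projective R Q"
  shows "projective R (direct_sum P Q)"
  unfolding projective_def
proof (intro conjI allI impI)
  have Pm: "left_module R P" and Qm: "left_module R Q" using P Q by (auto simp: projective_def)
  interpret P: left_module R P by fact
  interpret Q: left_module R Q by fact
  show S: "left_module R (direct_sum P Q)" by (rule left_module_direct_sum[OF Pm Qm])
  note h = direct_sum_homs[OF Pm Qm]
  fix M N :: "'a umodule" and p f
  assume A: "left_module R M \<and> left_module R N \<and> p \<in> module_hom R M N \<and> p ` carrier M = carrier N \<and> f \<in> module_hom R (direct_sum P Q) N"
  have f: "f \<in> module_hom R (direct_sum P Q) N" and p: "p \<in> module_hom R M N" using A by auto
  obtain \<alpha> where \<alpha>: "\<alpha> \<in> module_hom R P M" "\<forall>x\<in>carrier P. p (\<alpha> x) = f (join x \<zero>\<^bsub>Q\<^esub>)"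
    using projectiveD[OF P, of M N p "\<lambda>x. f (join x \<zero>\<^bsub>Q\<^esub>)"] A module_hom_comp[OF h(3) f] by blast
  obtain \<beta> where \<beta>: "\<beta> \<in> module_hom R Q M" "\<forall>x\<in>carrier Q. p (\<beta> x) = f (join \<zero>\<^bsub>P\<^esub> x)"
    using projectiveD[OF Q, of M N p "\<lambda>x. f (join \<zero>\<^bsub>P\<^esub> x)"] A module_hom_comp[OF h(4) f] by blast
  let ?g = "\<lambda>x. \<alpha> (evens x) \<oplus>\<^bsub>M\<^esub> \<beta> (odds x)"
  have "?g \<in> module_hom R (direct_sum P Q) M"
    by (rule module_hom_add[OF S _ module_hom_comp[OF h(1) \<alpha>(1)] module_hom_comp[OF h(2) \<beta>(1)]]) (use A in blast)
  moreover have "p (?g x) = f x" if x: "x \<in> carrier (direct_sum P Q)" for x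
  proof -
    have e: "evens x \<in> carrier P" "odds x \<in> carrier Q" using x by auto
    have "p (?g x) = f (join (evens x) \<zero>\<^bsub>Q\<^esub>) \<oplus>\<^bsub>N\<^esub> f (join \<zero>\<^bsub>P\<^esub> (odds x))"
      using module_homD(2)[OF p] module_homD(1)[OF \<alpha>(1)] module_homD(1)[OF \<beta>(1)] \<alpha>(2) \<beta>(2) e by simp
    also have "\<dots> = f (join (evens x) \<zero>\<^bsub>Q\<^esub> \<oplus>\<^bsub>direct_sum P Q\<^esub> join \<zero>\<^bsub>P\<^esub> (odds x))"
      using module_homD(2)[OF f, of "join (evens x) \<zero>\<^bsub>Q\<^esub>" "join \<zero>\<^bsub>P\<^esub> (odds x)"] e by simp
    also have "\<dots> = f x" using e by simp
    finally show ?thesis .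
  qed
  ultimately show "\<exists>g\<in>module_hom R (direct_sum P Q) M. \<forall>x\<in>carrier (direct_sum P Q). p (g x) = f x"
    by (intro bexI[of _ ?g] ballI)
qed

section \<open>Lengths of projective resolutions\<close>

text \<open>\<open>res_len R n M\<close> says that \<open>M\<close> has a projective resolution with at most \<open>n\<close> nonzero
  terms, i.e.\ that \<open>M\<close> is zero or has projective dimension less than \<open>n\<close>. All syzygies are kept
  on one type, which makes the recursion possible.\<close>

primrec res_len :: "('a, 'r) ring_scheme \<Rightarrow> nat \<Rightarrow> ('a, nat \<Rightarrow> 'a) module \<Rightarrow> bool"
  where
    "res_len R 0 M \<longleftrightarrow> left_module R M \<and> carrier M = {\<zero>\<^bsub>M\<^esub>}"
  | "res_len R (Suc n) M \<longleftrightarrow> left_module R M \<and>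
      (\<exists>(P :: ('a, nat \<Rightarrow> 'a) module) p. projective R P \<and> p \<in> module_hom R P M \<and>
         p ` carrier P = carrier M \<and> res_len R n (P\<lparr>carrier := module_ker P M p\<rparr>))"

lemma res_len_Suc: "res_len R n M \<Longrightarrow> res_len R (Suc n) M"
proof (induction n arbitrary: M)
  case 0
  then interpret left_module R M by simp
  have "module_ker M M (\<lambda>x. x) = {\<zero>\<^bsub>M\<^esub>}" by (auto simp: module_ker_def)
  moreover have "left_module R (M\<lparr>carrier := {\<zero>\<^bsub>M\<^esub>}\<rparr>)" by (rule left_module_sub[OF submodule_zero])
  moreover have "projective R M" using 0 by (intro projective_zero) auto
  ultimately show ?case using 0
    by (auto intro!: exI[of _ M] exI[of _ "\<lambda>x. x"] module_homI)
next
  case (Suc n)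
  then show ?case using res_len.simps(2)[of R n M] res_len.simps(2)[of R "Suc n" M] by blast
qed

text \<open>One half of a mutual induction: given the horseshoe lemma for length \<open>n\<close>, the
  module \<open>Y = A + q P\<close> is covered by the direct sum of \<open>P\<close> and a projective cover of \<open>A\<close>; the kernel is an
  extension of \<open>{x \<in> P. q x \<in> A}\<close> by a syzygy of \<open>A\<close>.\<close>

lemma res_len_attach_step:
  fixes A Y P :: "('a, nat \<Rightarrow> 'a) module"
  assumes ext: "\<And>(A :: ('a, nat \<Rightarrow> 'a) module) (B :: ('a, nat \<Rightarrow> 'a) module) (C :: ('a, nat \<Rightarrow> 'a) module) f g.
      \<lbrakk>res_len R n A; res_len R n C; left_module R B; f \<in> module_hom R A B; inj_on f (carrier A);
       g \<in> module_hom R B C; g ` carrier B = carrier C; f ` carrier A = module_ker B C g\<rbrakk> \<Longrightarrow> res_len R n B"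
    and A: "res_len R (Suc n) A" and Y: "left_module R Y"
    and f: "f \<in> module_hom R A Y" "inj_on f (carrier A)"
    and P: "projective R P" and q: "q \<in> module_hom R P Y"
    and gen: "\<And>y. y \<in> carrier Y \<Longrightarrow> \<exists>a\<in>carrier A. \<exists>x\<in>carrier P. y = f a \<oplus>\<^bsub>Y\<^esub> q x"
    and K: "res_len R n (P\<lparr>carrier := {x \<in> carrier P. q x \<in> f ` carrier A}\<rparr>)"
  shows "res_len R (Suc n) Y"
proof -
  have Am: "left_module R A" using A by simp
  obtain Q p where Q: "projective R Q" and p: "p \<in> module_hom R Q A" "p ` carrier Q = carrier A"
    and kp: "res_len R n (Q\<lparr>carrier := module_ker Q A p\<rparr>)"
    using A unfolding res_len.simps by blast
  have Qm: "left_module R Q" and Pm: "left_module R P" using P Q by (auto simp: projective_def)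
  interpret A: left_module R A by fact
  interpret Y: left_module R Y by fact
  interpret Q: left_module R Q by fact
  interpret P: left_module R P by fact
  let ?S = "direct_sum Q P"
  have Sm: "left_module R ?S" by (rule left_module_direct_sum[OF Qm Pm])
  interpret S: left_module R ?S by fact
  note sh = direct_sum_homs[OF Qm Pm]
  note fD = module_homD[OF f(1)] and pD = module_homD[OF p(1)] and qD = module_homD[OF q]
  let ?h = "\<lambda>x. f (p (evens x)) \<oplus>\<^bsub>Y\<^esub> q (odds x)"
  have h: "?h \<in> module_hom R ?S Y"
    by (intro module_hom_add[OF Sm Y] module_hom_comp[OF module_hom_comp[OF sh(1) p(1)] f(1)] module_hom_comp[OF sh(2) q])
  have onto: "?h ` carrier ?S = carrier Y"
  proof
    show "?h ` carrier ?S \<subseteq> carrier Y" using module_homD(1)[OF h] by blast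
    show "carrier Y \<subseteq> ?h ` carrier ?S"
    proof
      fix y assume "y \<in> carrier Y"
      then obtain a x where ax: "a \<in> carrier A" "x \<in> carrier P" "y = f a \<oplus>\<^bsub>Y\<^esub> q x" using gen by blast
      then obtain u where "u \<in> carrier Q" "a = p u" using p(2) by blast
      then show "y \<in> ?h ` carrier ?S" using ax by (intro image_eqI[of _ _ "join u x"]) auto
    qed
  qed
  let ?H = "?S\<lparr>carrier := module_ker ?S Y ?h\<rparr>" and ?K = "P\<lparr>carrier := {x \<in> carrier P. q x \<in> f ` carrier A}\<rparr>"
    and ?N = "Q\<lparr>carrier := module_ker Q A p\<rparr>"
  have f0: "f a = \<zero>\<^bsub>Y\<^esub> \<Longrightarrow> a = \<zero>\<^bsub>A\<^esub>" if "a \<in> carrier A" for a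
    using f(2) that module_hom_inj_iff[OF Am Y f(1)] by blast
  have q0: "q \<zero>\<^bsub>P\<^esub> = \<zero>\<^bsub>Y\<^esub>" by (rule module_hom_zero[OF Pm Y q])
  have fz: "f \<zero>\<^bsub>A\<^esub> = \<zero>\<^bsub>Y\<^esub>" by (rule module_hom_zero[OF Am Y f(1)])
  have H: "left_module R ?H" by (rule S.left_module_sub[OF submodule_ker[OF Sm Y h]])
  have neg: "f (p (\<ominus>\<^bsub>Q\<^esub> u)) = \<ominus>\<^bsub>Y\<^esub> f (p u)" if "u \<in> carrier Q" for u
    using that module_hom_minus[OF Qm Am p(1)] module_hom_minus[OF Am Y f(1)] pD(1) by simp
  have "res_len R n ?H"
  proof (rule ext[OF kp K H, where f = "\<lambda>x. join x \<zero>\<^bsub>P\<^esub>" and g = odds])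
    show "(\<lambda>x. join x \<zero>\<^bsub>P\<^esub>) \<in> module_hom R ?N ?H"
      by (rule module_homI) (auto simp: module_ker_def q0 fz)
    show "inj_on (\<lambda>x. join x \<zero>\<^bsub>P\<^esub>) (carrier ?N)" by (auto simp: inj_on_def)
    show odds: "odds \<in> module_hom R ?H ?K"
    proof (rule module_homI)
      fix x assume "x \<in> carrier ?H"
      then have x: "evens x \<in> carrier Q" "odds x \<in> carrier P" "f (p (evens x)) \<oplus>\<^bsub>Y\<^esub> q (odds x) = \<zero>\<^bsub>Y\<^esub>"
        by (auto simp: module_ker_def)
      then have "q (odds x) = f (p (\<ominus>\<^bsub>Q\<^esub> evens x))"
        using neg[OF x(1)] fD(1) pD(1) qD(1) by (simp add: Y.M.minus_equality Y.M.a_comm Y.M.minus_minus)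
      then show "odds x \<in> carrier ?K" using x pD(1)[of "\<ominus>\<^bsub>Q\<^esub> evens x"] by auto
    qed auto
    show "odds ` carrier ?H = carrier ?K"
    proof
      show "odds ` carrier ?H \<subseteq> carrier ?K" using module_homD(1)[OF odds] by blast
      show "carrier ?K \<subseteq> odds ` carrier ?H"
      proof
        fix y assume "y \<in> carrier ?K"
        then obtain a where a: "y \<in> carrier P" "a \<in> carrier A" "q y = f a" by auto
        then obtain u where u: "u \<in> carrier Q" "a = p u" using p(2) by blast
        have "join (\<ominus>\<^bsub>Q\<^esub> u) y \<in> carrier ?H"
          using a u neg[OF u(1)] fD(1) by (auto simp: module_ker_def Y.M.l_neg)
        then show "y \<in> odds ` carrier ?H" by (rule image_eqI[rotated]) simp
      qed
    qed
    show "(\<lambda>x. join x \<zero>\<^bsub>P\<^esub>) ` carrier ?N = module_ker ?H ?K odds"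
    proof
      show "(\<lambda>x. join x \<zero>\<^bsub>P\<^esub>) ` carrier ?N \<subseteq> module_ker ?H ?K odds"
        by (auto simp: module_ker_def q0 fz)
      show "module_ker ?H ?K odds \<subseteq> (\<lambda>x. join x \<zero>\<^bsub>P\<^esub>) ` carrier ?N"
      proof
        fix x assume "x \<in> module_ker ?H ?K odds"
        then have x: "evens x \<in> carrier Q" "odds x = \<zero>\<^bsub>P\<^esub>" "f (p (evens x)) = \<zero>\<^bsub>Y\<^esub>"
          using fD(1) pD(1) by (auto simp: module_ker_def q0)
        then have "evens x \<in> carrier ?N" using f0 pD(1) by (auto simp: module_ker_def)
        then show "x \<in> (\<lambda>x. join x \<zero>\<^bsub>P\<^esub>) ` carrier ?N"
          using x(2) by (metis image_eqI join_simps(3))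
      qed
    qed
  qed
  then show ?thesis
    unfolding res_len.simps
    by (intro conjI exI[of _ ?S] exI[of _ ?h] Y projective_direct_sum[OF Q P] h onto)
qed

text \<open>The horseshoe lemma.\<close>

lemma res_len_extension:
  fixes A B C :: "('a, nat \<Rightarrow> 'a) module"
  assumes "res_len R n A" "res_len R n C" "left_module R B" "f \<in> module_hom R A B" "inj_on f (carrier A)"
    "g \<in> module_hom R B C" "g ` carrier B = carrier C" "f ` carrier A = module_ker B C g"
  shows "res_len R n B"
  using assms
proof (induction n arbitrary: A B C f g)
  case 0
  have Am: "left_module R A" and Cm: "left_module R C" using 0 by auto
  interpret B: left_module R B by fact
  have "x = \<zero>\<^bsub>B\<^esub>" if "x \<in> carrier B" for x
  proof -
    have "g x = \<zero>\<^bsub>C\<^esub>" using module_homD(1)[OF \<open>g \<in> _\<close> that] 0 by auto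
    then have "x \<in> f ` carrier A" using that unfolding \<open>f ` carrier A = _\<close> by (simp add: module_ker_def)
    then show ?thesis using 0 module_hom_zero[OF Am \<open>left_module R B\<close> \<open>f \<in> _\<close>] by auto
  qed
  then show ?case using \<open>left_module R B\<close> by auto
next
  case (Suc n)
  have Cm: "left_module R C" using Suc by simp
  interpret B: left_module R B by fact
  interpret C: left_module R C by fact
  obtain P p where P: "projective R P" and p: "p \<in> module_hom R P C" "p ` carrier P = carrier C"
    and K: "res_len R n (P\<lparr>carrier := module_ker P C p\<rparr>)"
    using Suc.prems(2) unfolding res_len.simps by blast
  obtain q where q: "q \<in> module_hom R P B" "\<forall>x\<in>carrier P. g (q x) = p x"
    using projective_lift[OF P \<open>left_module R B\<close> Cm \<open>g \<in> _\<close> \<open>g ` _ = _\<close> p(1)] by blast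
  note gD = module_homD[OF \<open>g \<in> _\<close>] and qD = module_homD[OF q(1)]
  show ?case
  proof (rule res_len_attach_step[OF _ Suc.prems(1,3,4,5) P q(1)])
    fix A' B' C' :: "('a, nat \<Rightarrow> 'a) module" and f' g'
    assume "res_len R n A'" "res_len R n C'" "left_module R B'" "f' \<in> module_hom R A' B'"
      "inj_on f' (carrier A')" "g' \<in> module_hom R B' C'" "g' ` carrier B' = carrier C'"
      "f' ` carrier A' = module_ker B' C' g'"
    then show "res_len R n B'" by (rule Suc.IH)
  next
    fix y assume y: "y \<in> carrier B"
    then obtain x where x: "x \<in> carrier P" "p x = g y" using p(2) gD(1) by (metis imageE)
    have "g (y \<ominus>\<^bsub>B\<^esub> q x) = \<zero>\<^bsub>C\<^esub>"
      using x y q(2) qD(1)[OF x(1)] gD(1)[OF y] module_hom_minus[OF \<open>left_module R B\<close> Cm \<open>g \<in> _\<close>]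
      by (simp add: a_minus_def gD C.M.r_neg)
    then have "y \<ominus>\<^bsub>B\<^esub> q x \<in> f ` carrier A"
      unfolding Suc.prems(8) using y qD(1)[OF x(1)] by (simp add: module_ker_def)
    then obtain a where a: "a \<in> carrier A" "f a = y \<ominus>\<^bsub>B\<^esub> q x" by (metis imageE)
    have "y = (y \<ominus>\<^bsub>B\<^esub> q x) \<oplus>\<^bsub>B\<^esub> q x"
      using y qD(1)[OF x(1)] by (simp add: a_minus_def B.M.a_assoc B.M.l_neg)
    then show "\<exists>a\<in>carrier A. \<exists>x\<in>carrier P. y = f a \<oplus>\<^bsub>B\<^esub> q x" using a x by metis
  next
    have "{x \<in> carrier P. q x \<in> f ` carrier A} = module_ker P C p"
      unfolding Suc.prems(8) using q(2) qD(1) by (auto simp: module_ker_def)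
    then show "res_len R n (P\<lparr>carrier := {x \<in> carrier P. q x \<in> f ` carrier A}\<rparr>)" using K by simp
  qed
qed

text \<open>The quotient of \<open>Y\<close> by \<open>A\<close> is the quotient of \<open>P\<close> by the relations, which has a resolution of the same
  length as \<open>A\<close>.\<close>

lemma res_len_attach:
  fixes A Y P :: "('a, nat \<Rightarrow> 'a) module"
  assumes "res_len R (Suc n) A" "left_module R Y" "f \<in> module_hom R A Y" "inj_on f (carrier A)"
    and "projective R P" "q \<in> module_hom R P Y"
    and "\<And>y. y \<in> carrier Y \<Longrightarrow> \<exists>a\<in>carrier A. \<exists>x\<in>carrier P. y = f a \<oplus>\<^bsub>Y\<^esub> q x"
    and "res_len R n (P\<lparr>carrier := {x \<in> carrier P. q x \<in> f ` carrier A}\<rparr>)"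
  shows "res_len R (Suc n) Y"
proof (rule res_len_attach_step)
  fix A' B' C' :: "('a, nat \<Rightarrow> 'a) module" and f' g'
  assume "res_len R n A'" "res_len R n C'" "left_module R B'" "f' \<in> module_hom R A' B'"
    "inj_on f' (carrier A')" "g' \<in> module_hom R B' C'" "g' ` carrier B' = carrier C'"
    "f' ` carrier A' = module_ker B' C' g'"
  then show "res_len R n B'" by (rule res_len_extension)
qed fact+

section \<open>From lengths to projective dimension\<close>

lemma projective_resolution_base:
  fixes P :: "('a, nat \<Rightarrow> 'a) module"
  assumes P: "projective R P" and M: "left_module R M" and p: "p \<in> module_hom R P M" "p ` carrier P = carrier M"
    and ker: "module_ker P M p = {\<zero>\<^bsub>P\<^esub>}"
  shows "\<exists>P d e. projective_resolution R M 0 P d e"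
proof -
  have Pm: "left_module R P" using P by (simp add: projective_def)
  let ?S = "singleton_module P"
  let ?Z = "?S\<lparr>carrier := {\<zero>\<^bsub>?S\<^esub>}\<rparr>"
  interpret S: left_module R ?S by (rule left_module_singleton[OF Pm])
  have Z: "left_module R ?Z" by (rule S.left_module_sub[OF S.submodule_zero])
  interpret Z: left_module R ?Z by fact
  let ?P = "\<lambda>i. if i = 0 then ?S else ?Z" and ?d = "\<lambda>i::nat. \<lambda>x::(nat \<Rightarrow> 'a) set. \<zero>\<^bsub>?S\<^esub>"
  interpret P: left_module R P by fact
  have e: "(\<lambda>x. p (the_elem x)) \<in> module_hom R ?S M" by (rule module_hom_comp[OF the_elem_hom[OF Pm] p(1)])
  have "projective_resolution R M 0 ?P ?d (\<lambda>x. p (the_elem x))"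
    unfolding projective_resolution_def
  proof (intro conjI allI impI)
    fix i :: nat
    show "projective R (?P i)" using projective_singleton[OF P] projective_zero[OF Z] by auto
    have "\<zero>\<^bsub>?S\<^esub> \<in> carrier ?S" "\<zero>\<^bsub>?S\<^esub> \<oplus>\<^bsub>?S\<^esub> \<zero>\<^bsub>?S\<^esub> = \<zero>\<^bsub>?S\<^esub>" "a \<in> carrier R \<Longrightarrow> a \<odot>\<^bsub>?S\<^esub> \<zero>\<^bsub>?S\<^esub> = \<zero>\<^bsub>?S\<^esub>" for a
      using S.M.zero_closed S.M.l_zero S.smult_zero_right by blast+
    then show "?d i \<in> module_hom R (?P (Suc i)) (?P i)" by (auto intro!: module_homI)
    show "?d (Suc i) ` carrier (?P (Suc (Suc i))) = module_ker (?P (Suc i)) (?P i) (?d i)"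
      by (auto simp: module_ker_def)
    show "?d 0 ` carrier (?P 1) = module_ker (?P 0) M (\<lambda>x. p (the_elem x))"
    proof -
      have "module_ker (?P 0) M (\<lambda>x. p (the_elem x)) = (\<lambda>x. {x}) ` module_ker P M p"
        by (auto simp: module_ker_def)
      then show ?thesis unfolding ker by auto
    qed
    show "(\<lambda>x. p (the_elem x)) ` carrier (?P 0) = carrier M" using p(2) by (auto simp: image_image)
  qed (use e in auto)
  then show ?thesis by blast
qed

text \<open>A resolution of the kernel of \<open>p\<close> is spliced with \<open>p\<close>; the new term is moved to singletons, since the terms
  of a resolution share one type.\<close>

lemma projective_resolution_step:
  fixes P :: "('a, nat \<Rightarrow> 'a) module"
  assumes P: "projective R P" and M: "left_module R M" and p: "p \<in> module_hom R P M" "p ` carrier P = carrier M"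
    and res: "projective_resolution R (P\<lparr>carrier := module_ker P M p\<rparr>) n P' d' e'"
  shows "\<exists>P d e. projective_resolution R M (Suc n) P d e"
proof -
  have Pm: "left_module R P" using P by (simp add: projective_def)
  let ?S = "singleton_module P" and ?K = "P\<lparr>carrier := module_ker P M p\<rparr>"
  let ?P = "case_nat ?S P'" and ?d = "case_nat (\<lambda>x. {e' x}) d'" and ?e = "\<lambda>x. p (the_elem x)"
  have e: "?e \<in> module_hom R ?S M" by (rule module_hom_comp[OF the_elem_hom[OF Pm] p(1)])
  note res' = res[unfolded projective_resolution_def]
  have e': "e' \<in> module_hom R (P' 0) ?K" "e' ` carrier (P' 0) = module_ker P M p"
    "d' 0 ` carrier (P' 1) = module_ker (P' 0) ?K e'" using res' by auto
  have "projective_resolution R M (Suc n) ?P ?d ?e"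
    unfolding projective_resolution_def
  proof (intro conjI allI impI)
    fix i :: nat
    show "projective R (?P i)" using projective_singleton[OF P] res' by (cases i) auto
    show "carrier (?P i) = {\<zero>\<^bsub>?P i\<^esub>}" if "i > Suc n" using res' that by (cases i) auto
    have "(\<lambda>x. {e' x}) \<in> module_hom R (P' 0) ?S"
      using module_homD[OF e'(1)] by (intro module_homI) (auto simp: module_ker_def)
    then show "?d i \<in> module_hom R (?P (Suc i)) (?P i)" using res' by (cases i) auto
    show "?d 0 ` carrier (?P 1) = module_ker (?P 0) M ?e"
    proof -
      have "module_ker (?P 0) M ?e = (\<lambda>x. {x}) ` module_ker P M p" by (auto simp: module_ker_def)
      also have "\<dots> = (\<lambda>x. {e' x}) ` carrier (P' 0)" unfolding e'(2)[symmetric] by auto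
      finally show ?thesis by simp
    qed
    show "?d (Suc i) ` carrier (?P (Suc (Suc i))) = module_ker (?P (Suc i)) (?P i) (?d i)"
    proof (cases i)
      case 0
      have "module_ker (P' 0) ?S (\<lambda>x. {e' x}) = module_ker (P' 0) ?K e'" by (auto simp: module_ker_def)
      then show ?thesis using e'(3) 0 by simp
    qed (use res' in auto)
    show "?e ` carrier (?P 0) = carrier M" using p(2) by (auto simp: image_image)
  qed (use e in auto)
  then show ?thesis by blast
qed

lemma projective_resolution_exists:
  fixes P M :: "('a, nat \<Rightarrow> 'a) module"
  shows "\<lbrakk>projective R P; left_module R M; p \<in> module_hom R P M; p ` carrier P = carrier M;
    res_len R n (P\<lparr>carrier := module_ker P M p\<rparr>)\<rbrakk> \<Longrightarrow> \<exists>P d e. projective_resolution R M n P d e"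
proof (induction n arbitrary: P M p)
  case 0
  then show ?case by (intro projective_resolution_base[of R P M p]) auto
next
  case (Suc n)
  let ?K = "P\<lparr>carrier := module_ker P M p\<rparr>"
  from Suc.prems(5) obtain Q q where "left_module R ?K" "projective R Q" "q \<in> module_hom R Q ?K"
    "q ` carrier Q = carrier ?K" "res_len R n (Q\<lparr>carrier := module_ker Q ?K q\<rparr>)"
    unfolding res_len.simps by blast
  from Suc.IH[OF this(2,1,3,4,5)] show ?case using projective_resolution_step[OF Suc.prems(1-4)] by blast
qed

lemma projective_dim_le:
  fixes P :: "('a, nat \<Rightarrow> 'a) module"
  assumes P: "projective R P" and M: "left_module R M" and p: "p \<in> module_hom R P M" "p ` carrier P = carrier M"
    and K: "res_len R n (P\<lparr>carrier := module_ker P M p\<rparr>)"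
  shows "projective_dim R M \<le> enat n"
proof -
  have "\<exists>P d e. projective_resolution R M n P d e"
  proof (cases n)
    case 0
    with K have "module_ker P M p = {\<zero>\<^bsub>P\<^esub>}" by simp
    from projective_resolution_base[OF P M p this] show ?thesis by (simp add: 0)
  next
    case (Suc m)
    let ?K = "P\<lparr>carrier := module_ker P M p\<rparr>"
    from K[unfolded Suc] obtain Q q where "left_module R ?K" "projective R Q" "q \<in> module_hom R Q ?K"
      "q ` carrier Q = carrier ?K" "res_len R m (Q\<lparr>carrier := module_ker Q ?K q\<rparr>)"
      unfolding res_len.simps by blast
    from projective_resolution_exists[OF this(2,1,3,4,5)] show ?thesis
      unfolding Suc using projective_resolution_step[OF P M p] by blast
  qed
  then show ?thesis unfolding projective_dim_def by (intro Inf_lower) blast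
qed

section \<open>Semiprimary rings\<close>

subsection \<open>Congruence modulo an ideal\<close>

context ideal
begin

lemma plus_closed: "x \<in> I \<Longrightarrow> y \<in> I \<Longrightarrow> x \<oplus> y \<in> I"
  by (rule additive_subgroup.a_closed[OF is_additive_subgroup])

lemma cong_refl: "x \<in> carrier R \<Longrightarrow> x \<ominus> x \<in> I"
  by (simp add: a_minus_def r_neg)

lemma cong_sym: "x \<in> carrier R \<Longrightarrow> y \<in> carrier R \<Longrightarrow> x \<ominus> y \<in> I \<Longrightarrow> y \<ominus> x \<in> I"
  using I_l_closed[of "x \<ominus> y" "\<ominus> \<one>"] by (simp add: a_minus_def minus_add a_comm l_minus)

lemma cong_trans:
  assumes "x \<in> carrier R" "y \<in> carrier R" "z \<in> carrier R" "x \<ominus> y \<in> I" "y \<ominus> z \<in> I"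
  shows "x \<ominus> z \<in> I"
proof -
  have "(x \<ominus> y) \<oplus> (y \<ominus> z) = x \<oplus> ((\<ominus> y \<oplus> y) \<oplus> \<ominus> z)"
    using assms(1-3) unfolding a_minus_def by (simp only: a_assoc a_closed local.add.inv_closed)
  also have "\<dots> = x \<ominus> z" using assms(1-3) by (simp add: l_neg a_minus_def)
  finally show ?thesis using plus_closed[OF assms(4,5)] by simp
qed

lemma cong_mult_left:
  assumes "x \<in> carrier R" "y \<in> carrier R" "a \<in> carrier R" "x \<ominus> y \<in> I"
  shows "a \<otimes> x \<ominus> a \<otimes> y \<in> I"
  using I_l_closed[OF assms(4,3)] assms(1-3) by (simp add: a_minus_def r_distr r_minus)

lemma cong_mult_right:
  assumes "x \<in> carrier R" "y \<in> carrier R" "a \<in> carrier R" "x \<ominus> y \<in> I"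
  shows "x \<otimes> a \<ominus> y \<otimes> a \<in> I"
  using I_r_closed[OF assms(4,3)] assms(1-3) by (simp add: a_minus_def l_distr l_minus)

lemma cong_mem:
  assumes "x \<in> carrier R" "y \<in> I" "x \<ominus> y \<in> I"
  shows "x \<in> I"
proof -
  have "(x \<ominus> y) \<oplus> y = x" using assms(1) Icarr[OF assms(2)] by (simp add: a_minus_def a_assoc l_neg)
  then show ?thesis using plus_closed[OF assms(3,2)] by simp
qed

end

lemma (in ring) idealI2:
  assumes "I \<subseteq> carrier R" "\<zero> \<in> I" "\<And>x y. x \<in> I \<Longrightarrow> y \<in> I \<Longrightarrow> x \<oplus> y \<in> I"
    "\<And>a x. a \<in> carrier R \<Longrightarrow> x \<in> I \<Longrightarrow> a \<otimes> x \<in> I" "\<And>a x. a \<in> carrier R \<Longrightarrow> x \<in> I \<Longrightarrow> x \<otimes> a \<in> I"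
  shows "ideal I R"
proof (rule idealI[OF ring_axioms])
  show "subgroup I (add_monoid R)"
  proof (rule subgroup.intro)
    fix x assume x: "x \<in> I"
    then have "\<ominus> x = (\<ominus> \<one>) \<otimes> x" using assms(1) by (auto simp: l_minus)
    then show "inv\<^bsub>add_monoid R\<^esub> x \<in> I" using assms(4)[of "\<ominus> \<one>" x] x by (simp add: a_inv_def)
  qed (use assms in auto)
qed (use assms in auto)

lemma ideal_opposite:
  assumes "ring R"
  shows "ideal I (opposite R) \<longleftrightarrow> ideal I R"
proof -
  interpret ring R by fact
  interpret op: ring "opposite R" by (rule ring_opposite[OF assms])
  show ?thesis
  proof
    assume "ideal I (opposite R)"
    then interpret I: ideal I "opposite R" .
    show "ideal I R" by (rule idealI2) (use I.I_l_closed I.I_r_closed I.Icarr I.a_closed I.zero_closed in auto)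
  next
    assume "ideal I R"
    then interpret I: ideal I R .
    show "ideal I (opposite R)" by (rule op.idealI2) (use I.I_l_closed I.I_r_closed I.Icarr I.a_closed I.zero_closed in auto)
  qed
qed

lemma submodule_regular_ideal: "ideal I R \<Longrightarrow> submodule I R (regular_module R)"
proof -
  assume "ideal I R"
  then interpret I: ideal I R .
  interpret reg: left_module R "regular_module R" by (rule left_module_regular) (rule I.ring_axioms)
  show ?thesis
    by (rule reg.submoduleI) (use I.I_l_closed I.Icarr I.a_closed I.zero_closed in auto)
qed

subsection \<open>The annihilator chain of an ideal\<close>

text \<open>The elements killed from the left by every product of \<open>i\<close> elements of \<open>r\<close>. The use of this
  chain instead of powers of \<open>r\<close> avoids sums of products.\<close>

primrec ann_chain :: "('a, 's) ring_scheme \<Rightarrow> 'a set \<Rightarrow> nat \<Rightarrow> 'a set"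
  where
    "ann_chain S r 0 = {\<zero>\<^bsub>S\<^esub>}"
  | "ann_chain S r (Suc i) = {x \<in> carrier S. \<forall>a\<in>r. a \<otimes>\<^bsub>S\<^esub> x \<in> ann_chain S r i}"

lemma ann_chain_ideal:
  assumes "ideal r S"
  shows "ideal (ann_chain S r i) S"
proof -
  interpret ideal r S by fact
  show ?thesis
  proof (induction i)
    case 0
    show ?case by (rule idealI2) auto
  next
    case (Suc i)
    then interpret A: ideal "ann_chain S r i" S .
    show ?case
      by (rule idealI2)
         (use A.I_r_closed A.a_closed A.zero_closed Icarr I_r_closed in \<open>auto simp: r_distr m_assoc[symmetric]\<close>)
  qed
qed

lemma ann_chain_mono: "ideal r S \<Longrightarrow> ann_chain S r i \<subseteq> ann_chain S r (Suc i)"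
proof (induction i)
  case 0
  interpret ideal r S by (rule 0)
  show ?case using Icarr by auto
next
  case (Suc i)
  then show ?case using ideal.Icarr[OF ann_chain_ideal[OF Suc.prems]] by auto
qed

lemma ann_chain_opposite_opposite: "ann_chain (opposite (opposite S)) r i = ann_chain S r i"
  by (induction i) auto

lemma ann_chain_nilpotent:
  assumes "ideal r S" "x \<in> r" "y \<in> ann_chain S r i"
  shows "x [^]\<^bsub>S\<^esub> i \<otimes>\<^bsub>S\<^esub> y = \<zero>\<^bsub>S\<^esub>"
proof -
  interpret ideal r S by fact
  show ?thesis using assms(3)
  proof (induction i arbitrary: y)
    case (Suc i)
    then have "x [^]\<^bsub>S\<^esub> i \<otimes>\<^bsub>S\<^esub> (x \<otimes>\<^bsub>S\<^esub> y) = \<zero>\<^bsub>S\<^esub>" using assms(2) by simp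
    then show ?case using Suc.prems Icarr[OF assms(2)] by (simp add: m_assoc)
  qed auto
qed

subsection \<open>Rings with a complete set of primitive idempotents\<close>

text \<open>The ring \<open>S\<close> has a nilpotent ideal \<open>r\<close>, and idempotents \<open>e\<close> in \<open>\<E>\<close> that generate simple left
  and right modules over \<open>S/r\<close> and together generate the unit ideal. Thus \<open>S/r\<close> is
  semisimple. The conditions are symmetric, so that every statement about left modules applies to right
  modules.\<close>

locale semiprimary = ring S for S :: "('a, 's) ring_scheme" (structure) +
  fixes r :: "'a set" and \<E> :: "'a set"
  assumes r_ideal: "ideal r S"
    and \<E>_closed: "e \<in> \<E> \<Longrightarrow> e \<in> carrier S"
    and \<E>_idem: "e \<in> \<E> \<Longrightarrow> e \<otimes> e = e"
    and \<E>_proper: "e \<in> \<E> \<Longrightarrow> e \<notin> r"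
    and left_simple: "\<lbrakk>e \<in> \<E>; c \<in> carrier S; c \<otimes> e = c; c \<notin> r\<rbrakk> \<Longrightarrow> \<exists>a\<in>carrier S. e \<ominus> a \<otimes> c \<in> r"
    and right_simple: "\<lbrakk>e \<in> \<E>; c \<in> carrier S; e \<otimes> c = c; c \<notin> r\<rbrakk> \<Longrightarrow> \<exists>a\<in>carrier S. e \<ominus> c \<otimes> a \<in> r"
    and cover: "\<lbrakk>ideal I S; r \<subseteq> I; \<E> \<subseteq> I\<rbrakk> \<Longrightarrow> \<one> \<in> I"
    and left_nilpotent: "\<exists>n. \<one> \<in> ann_chain S r n"
    and right_nilpotent: "\<exists>n. \<one> \<in> ann_chain (opposite S) r n"

lemma a_minus_opposite [simp]: "a_minus (opposite S) = a_minus S"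
  by (simp add: fun_eq_iff a_minus_def a_inv_def m_inv_def)

lemma semiprimary_opposite:
  assumes "semiprimary S r \<E>"
  shows "semiprimary (opposite S) r \<E>"
proof -
  interpret semiprimary S r \<E> by fact
  show ?thesis
  proof (intro semiprimary.intro semiprimary_axioms.intro)
    show "ring (opposite S)" by (rule ring_opposite[OF ring_axioms])
    show "ideal r (opposite S)" using r_ideal by (simp add: ideal_opposite[OF ring_axioms])
    show "\<exists>n. \<one>\<^bsub>opposite S\<^esub> \<in> ann_chain (opposite (opposite S)) r n"
      using left_nilpotent by (simp add: ann_chain_opposite_opposite)
  qed (use \<E>_closed \<E>_idem \<E>_proper left_simple right_simple cover right_nilpotent ideal_opposite[OF ring_axioms] in auto)
qed

text \<open>If \<open>e b y \<in> K\<close> for all \<open>e\<close> in \<open>\<E>\<close> and all \<open>b\<close>, then the elements \<open>c\<close> with \<open>c S y \<subseteq> K\<close>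
  form an ideal that contains \<open>1\<close>.\<close>

lemma (in semiprimary) idempotent_multiple_outside:
  assumes M: "left_module S M" and K: "submodule K S M" and y: "y \<in> carrier M" "y \<notin> K"
    and ry: "\<And>a. a \<in> r \<Longrightarrow> a \<odot>\<^bsub>M\<^esub> y \<in> K"
  shows "\<exists>e\<in>\<E>. \<exists>b\<in>carrier S. (e \<otimes> b) \<odot>\<^bsub>M\<^esub> y \<notin> K"
proof (rule ccontr)
  interpret M: left_module S M by fact
  interpret r: ideal r S by (rule r_ideal)
  note K = M.submoduleD[OF K]
  assume *: "\<not> ?thesis"
  let ?I = "{c \<in> carrier S. \<forall>b\<in>carrier S. (c \<otimes> b) \<odot>\<^bsub>M\<^esub> y \<in> K}"
  have "ideal ?I S"
  proof (rule idealI2)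
    show "\<zero> \<in> ?I" using K(3) y by auto
    fix c d assume "c \<in> ?I" "d \<in> ?I"
    then show "c \<oplus> d \<in> ?I" using y K(4) by (auto simp: l_distr M.smult_l_distr)
  next
    fix a c assume "a \<in> carrier S" "c \<in> ?I"
    then show "a \<otimes> c \<in> ?I" using y K(5) by (auto simp: m_assoc M.smult_assoc)
    show "c \<otimes> a \<in> ?I" using \<open>a \<in> carrier S\<close> \<open>c \<in> ?I\<close> by (auto simp: m_assoc)
  qed auto
  moreover have "r \<subseteq> ?I" using ry r.I_r_closed r.Icarr by auto
  moreover have "\<E> \<subseteq> ?I" using * \<E>_closed by auto
  ultimately have "\<one> \<in> ?I" by (rule cover)
  then have "(\<one> \<otimes> \<one>) \<odot>\<^bsub>M\<^esub> y \<in> K" by blast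
  then show False using y by simp
qed

text \<open>Let \<open>D\<close> be maximal among the submodules between \<open>K\<close> and \<open>C\<close> that avoid \<open>z\<close>. If some \<open>y \<in> C\<close>
  were outside \<open>D + S z\<close>, so would be a multiple \<open>w\<close> that generates a simple module modulo \<open>D\<close>, and
  \<open>z \<in> D + S w\<close> would give \<open>w \<in> D + S z\<close>.\<close>

lemma (in semiprimary) complement_of_simple:
  assumes M: "left_module S M" and K: "submodule K S M" and C: "submodule C S M" "K \<subseteq> C"
    and rC: "\<And>a x. a \<in> r \<Longrightarrow> x \<in> C \<Longrightarrow> a \<odot>\<^bsub>M\<^esub> x \<in> K"
    and z: "z \<in> C" "z \<notin> K" and e: "e \<in> \<E>" "e \<odot>\<^bsub>M\<^esub> z = z"
  shows "\<exists>D. submodule D S M \<and> K \<subseteq> D \<and> D \<subseteq> C \<and> z \<notin> D \<and> C \<subseteq> lin_span S M (insert z D)"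
proof -
  interpret M: left_module S M by fact
  interpret r: ideal r S by (rule r_ideal)
  note CD = M.submoduleD[OF C(1)]
  let ?\<A> = "{D. submodule D S M \<and> K \<subseteq> D \<and> D \<subseteq> C \<and> z \<notin> D}"
  have "\<exists>D\<in>?\<A>. \<forall>X\<in>?\<A>. D \<subseteq> X \<longrightarrow> X = D"
  proof (rule subset_Zorn_nonempty)
    show "?\<A> \<noteq> {}" using K C z by blast
    fix \<C> assume ne: "\<C> \<noteq> {}" and ch: "subset.chain ?\<A> \<C>"
    then have sub: "\<And>D. D \<in> \<C> \<Longrightarrow> submodule D S M" "\<And>D. D \<in> \<C> \<Longrightarrow> K \<subseteq> D \<and> D \<subseteq> C \<and> z \<notin> D"
      and tot: "\<And>D E. D \<in> \<C> \<Longrightarrow> E \<in> \<C> \<Longrightarrow> D \<subseteq> E \<or> E \<subseteq> D"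
      by (auto simp: subset_chain_def)
    have "submodule (\<Union>\<C>) S M"
    proof (rule M.submoduleI)
      show "\<Union>\<C> \<subseteq> carrier M" using M.submoduleD(2)[OF sub(1)] by blast
      show "\<zero>\<^bsub>M\<^esub> \<in> \<Union>\<C>" using M.submoduleD(3)[OF sub(1)] ne by blast
      fix x y assume "x \<in> \<Union>\<C>" "y \<in> \<Union>\<C>"
      then obtain D E where DE: "D \<in> \<C>" "x \<in> D" "E \<in> \<C>" "y \<in> E" by blast
      show "x \<oplus>\<^bsub>M\<^esub> y \<in> \<Union>\<C>"
      proof (cases "D \<subseteq> E")
        case True
        then show ?thesis using M.submoduleD(4)[OF sub(1)[OF DE(3)], of x y] DE by blast
      next
        case False
        then have "E \<subseteq> D" using tot[OF DE(1,3)] by blast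
        then show ?thesis using M.submoduleD(4)[OF sub(1)[OF DE(1)], of x y] DE by blast
      qed
    next
      fix a x assume "a \<in> carrier S" "x \<in> \<Union>\<C>"
      then show "a \<odot>\<^bsub>M\<^esub> x \<in> \<Union>\<C>" using M.submoduleD(5)[OF sub(1)] by blast
    qed
    then show "\<Union>\<C> \<in> ?\<A>" using sub(2) ne by blast
  qed
  then obtain D where D: "submodule D S M" "K \<subseteq> D" "D \<subseteq> C" "z \<notin> D"
    and max: "\<And>X. submodule X S M \<Longrightarrow> K \<subseteq> X \<Longrightarrow> X \<subseteq> C \<Longrightarrow> z \<notin> X \<Longrightarrow> D \<subseteq> X \<Longrightarrow> X = D" by auto
  have zM: "z \<in> carrier M" using CD(1) z by blast
  let ?Z = "lin_span S M (insert z D)"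
  have Z: "submodule ?Z S M" using zM M.submoduleD(2)[OF D(1)] by (intro M.span_submodule) auto
  note ZD = M.submoduleD[OF Z] and DD = M.submoduleD[OF D(1)]
  have DZ: "D \<subseteq> ?Z" "z \<in> ?Z" using span_superset[of "insert z D" S M] by auto
  have "y \<in> ?Z" if y: "y \<in> C" for y
  proof (rule ccontr)
    assume "y \<notin> ?Z"
    then obtain e' b where e': "e' \<in> \<E>" "b \<in> carrier S" "(e' \<otimes> b) \<odot>\<^bsub>M\<^esub> y \<notin> ?Z"
      using idempotent_multiple_outside[OF M Z, of y] y CD(1) rC D(2) DZ by blast
    define w where "w = (e' \<otimes> b) \<odot>\<^bsub>M\<^esub> y"
    have e'c: "e' \<in> carrier S" using \<E>_closed e' by blast
    have w: "w \<in> C" "w \<notin> ?Z" using e' e'c CD(5)[OF _ y] by (auto simp: w_def)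
    have wM: "w \<in> carrier M" using CD(1) w by blast
    have e'w: "e' \<odot>\<^bsub>M\<^esub> w = w"
      using e' e'c \<E>_idem[OF e'(1)] CD(1)[OF y] by (simp add: w_def M.smult_assoc[symmetric] m_assoc[symmetric])
    \<comment> \<open>By maximality \<open>z \<in> D + S w\<close>, and as \<open>S w\<close> is simple modulo \<open>D\<close>, also \<open>w \<in> D + S z\<close>.\<close>
    let ?X = "{k \<oplus>\<^bsub>M\<^esub> a \<odot>\<^bsub>M\<^esub> w | k a. k \<in> D \<and> a \<in> carrier S}"
    note X = M.submodule_adjoin[OF D(1) wM]
    have "?X \<noteq> D" using X(3) w(2) DZ by blast
    moreover have "?X \<subseteq> C" using CD(4,5) w D(3) by blast
    ultimately have "z \<in> ?X" using max[OF X(1)] X(2) D(2) by blast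
    then obtain k c where kc: "z = k \<oplus>\<^bsub>M\<^esub> c \<odot>\<^bsub>M\<^esub> w" "k \<in> D" "c \<in> carrier S" by blast
    have cw: "(c \<otimes> e') \<odot>\<^bsub>M\<^esub> w = c \<odot>\<^bsub>M\<^esub> w" using e'w e'c kc wM by (simp add: M.smult_assoc)
    have "c \<otimes> e' \<notin> r"
    proof
      assume "c \<otimes> e' \<in> r"
      then have "(c \<otimes> e') \<odot>\<^bsub>M\<^esub> w \<in> D" using rC[OF _ w(1)] D(2) by blast
      then have "c \<odot>\<^bsub>M\<^esub> w \<in> D" by (simp only: cw)
      then show False using kc DD(4) D(4) by blast
    qed
    then obtain a where a: "a \<in> carrier S" "e' \<ominus> a \<otimes> (c \<otimes> e') \<in> r"
      using left_simple[OF e'(1), of "c \<otimes> e'"] \<E>_idem[OF e'(1)] e'c kc(3) by (auto simp: m_assoc)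
    have "(e' \<ominus> a \<otimes> (c \<otimes> e')) \<odot>\<^bsub>M\<^esub> w \<in> ?Z" using rC[OF a(2) w(1)] D(2) DZ by blast
    moreover have "(a \<otimes> (c \<otimes> e')) \<odot>\<^bsub>M\<^esub> w \<in> ?Z"
    proof -
      have "c \<odot>\<^bsub>M\<^esub> w \<in> ?Z" using kc DZ M.submodule_diffD(2)[OF Z, of k "c \<odot>\<^bsub>M\<^esub> w"] wM by auto
      then show ?thesis using ZD(5)[OF a(1)] a kc e'c wM cw by (simp add: M.smult_assoc)
    qed
    ultimately have "(e' \<ominus> a \<otimes> (c \<otimes> e')) \<odot>\<^bsub>M\<^esub> w \<oplus>\<^bsub>M\<^esub> (a \<otimes> (c \<otimes> e')) \<odot>\<^bsub>M\<^esub> w \<in> ?Z" by (rule ZD(4))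
    moreover have "(e' \<ominus> a \<otimes> (c \<otimes> e')) \<odot>\<^bsub>M\<^esub> w \<oplus>\<^bsub>M\<^esub> (a \<otimes> (c \<otimes> e')) \<odot>\<^bsub>M\<^esub> w = e' \<odot>\<^bsub>M\<^esub> w"
      using a kc e'c wM by (simp add: M.smult_l_distr[symmetric] a_minus_def a_assoc l_neg)
    ultimately show False using e'w w by simp
  qed
  then show ?thesis using D by blast
qed

text \<open>One layer of the Hopkins--Levitzki theorem: the semisimple module \<open>L/K\<close> is finitely generated
  because a submodule \<open>C \<supseteq> K\<close> of \<open>L\<close> that is minimal with finitely generated \<open>L/C\<close> equals \<open>K\<close>; otherwise
  a simple summand of \<open>C/K\<close> could be split off.\<close>

lemma (in semiprimary) finite_over_layer:
  assumes M: "left_module S M" and dcc: "chain_stable False (submodules S M)"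
    and K: "submodule K S M" and L: "submodule L S M" "K \<subseteq> L"
    and rL: "\<And>a x. a \<in> r \<Longrightarrow> x \<in> L \<Longrightarrow> a \<odot>\<^bsub>M\<^esub> x \<in> K"
  shows "\<exists>F. finite F \<and> F \<subseteq> L \<and> L = lin_span S M (K \<union> F)"
proof -
  interpret M: left_module S M by fact
  note LD = M.submoduleD[OF L(1)]
  let ?\<L> = "{C. submodule C S M \<and> K \<subseteq> C \<and> C \<subseteq> L \<and> (\<exists>F. finite F \<and> F \<subseteq> L \<and> L = lin_span S M (C \<union> F))}"
  have "chain_stable False ?\<L>" by (rule chain_stable_subset[OF dcc]) auto
  moreover have "L \<in> ?\<L>"
  proof -
    have "L = lin_span S M (L \<union> {})"
      using span_minimal[OF L(1), of L] span_superset[of L S M] by auto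
    then show ?thesis using L by blast
  qed
  ultimately obtain C where C: "C \<in> ?\<L>" "\<forall>Y\<in>?\<L>. Y \<subseteq> C \<longrightarrow> Y = C"
    by (rule chain_stable_minimal[THEN bexE])
  then obtain F where Cs: "submodule C S M" "K \<subseteq> C" "C \<subseteq> L" and F: "finite F" "F \<subseteq> L" "L = lin_span S M (C \<union> F)"
    by blast
  have "C \<subseteq> K"
  proof
    fix y assume y: "y \<in> C"
    show "y \<in> K"
    proof (rule ccontr)
      assume "y \<notin> K"
      then obtain e b where e: "e \<in> \<E>" "b \<in> carrier S" "(e \<otimes> b) \<odot>\<^bsub>M\<^esub> y \<notin> K"
        using idempotent_multiple_outside[OF M K, of y] y Cs(3) LD(1) rL by blast
      define z where "z = (e \<otimes> b) \<odot>\<^bsub>M\<^esub> y"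
      have ec: "e \<in> carrier S" using \<E>_closed e by blast
      have yM: "y \<in> carrier M" using y Cs LD(1) by blast
      have z: "z \<in> C" "z \<notin> K" using M.submoduleD(5)[OF Cs(1) _ y] e ec by (auto simp: z_def)
      have ez: "e \<odot>\<^bsub>M\<^esub> z = z"
        using e ec \<E>_idem[OF e(1)] yM by (simp add: z_def M.smult_assoc[symmetric] m_assoc[symmetric])
      have rC: "a \<odot>\<^bsub>M\<^esub> x \<in> K" if "a \<in> r" "x \<in> C" for a x using rL that Cs(3) by blast
      obtain D where D: "submodule D S M" "K \<subseteq> D" "D \<subseteq> C" "z \<notin> D" "C \<subseteq> lin_span S M (insert z D)"
        using complement_of_simple[OF M K Cs(1,2) rC z e(1) ez] by blast
      have "L = lin_span S M (D \<union> insert z F)"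
      proof
        have sub: "submodule (lin_span S M (D \<union> insert z F)) S M"
          using M.submoduleD(2)[OF D(1)] F(2) LD(2) M.submoduleD(1)[OF Cs(1) z(1)] by (intro M.span_submodule) auto
        have "lin_span S M (insert z D) \<subseteq> lin_span S M (D \<union> insert z F)" by (rule span_mono) auto
        then have "C \<union> F \<subseteq> lin_span S M (D \<union> insert z F)"
          using D(5) span_superset[of "D \<union> insert z F" S M] by auto
        then show "L \<subseteq> lin_span S M (D \<union> insert z F)" unfolding F(3) by (rule span_minimal[OF sub])
        show "lin_span S M (D \<union> insert z F) \<subseteq> L"
          using D(3) Cs(3) F(2) z(1) by (intro span_minimal[OF L(1)]) auto
      qed
      then have "D \<in> ?\<L>" using D Cs(3) F(1,2) z(1) by (auto intro!: exI[of _ "insert z F"])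
      then show False using C(2) D(3,4) z(1) by blast
    qed
  qed
  then have "C = K" using Cs(2) by blast
  then show ?thesis using F by blast
qed

text \<open>The Hopkins--Levitzki theorem: a left ideal is filtered by its intersections with the annihilator chain,
  whose layers are modules over \<open>S/r\<close>.\<close>

lemma (in semiprimary) artinian_imp_noetherian:
  assumes dcc: "chain_stable False (submodules S (regular_module S))"
  shows "chain_stable True (submodules S (regular_module S))"
proof (rule noetherian_if_finite_span)
  let ?M = "regular_module S"
  show M: "left_module S ?M" by (rule left_module_regular[OF ring_axioms])
  interpret M: left_module S ?M by (rule M)
  fix N assume N: "submodule N S ?M"
  have A: "submodule (ann_chain S r i) S ?M" for i
    by (rule submodule_regular_ideal[OF ann_chain_ideal[OF r_ideal]])
  have NA: "submodule (N \<inter> ann_chain S r i) S ?M" for i by (rule M.submodule_Int[OF N A])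
  have "\<exists>F. finite F \<and> F \<subseteq> N \<inter> ann_chain S r i \<and> N \<inter> ann_chain S r i = lin_span S ?M F" for i
  proof (induction i)
    case 0
    have "N \<inter> ann_chain S r 0 = lin_span S ?M {}" using M.submoduleD(3)[OF N] by (auto simp: M.span_empty)
    then show ?case by blast
  next
    case (Suc i)
    then obtain F where F: "finite F" "F \<subseteq> N \<inter> ann_chain S r i" "N \<inter> ann_chain S r i = lin_span S ?M F" by blast
    let ?K = "N \<inter> ann_chain S r i" and ?L = "N \<inter> ann_chain S r (Suc i)"
    have "?K \<subseteq> ?L" using ann_chain_mono[OF r_ideal, of i] by blast
    moreover have "a \<odot>\<^bsub>?M\<^esub> x \<in> ?K" if "a \<in> r" "x \<in> ?L" for a x
      using that M.submoduleD(5)[OF N, of a x] ideal.Icarr[OF r_ideal] by auto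
    ultimately obtain G where G: "finite G" "G \<subseteq> ?L" "?L = lin_span S ?M (?K \<union> G)"
      using finite_over_layer[OF M dcc NA NA, of i "Suc i"] by blast
    have "lin_span S ?M (?K \<union> G) = lin_span S ?M (F \<union> G)"
    proof
      have sub: "submodule (lin_span S ?M (F \<union> G)) S ?M"
        using F(2) G(2) M.submoduleD(2)[OF N] by (intro M.span_submodule) auto
      show "lin_span S ?M (?K \<union> G) \<subseteq> lin_span S ?M (F \<union> G)"
        using span_mono[of F "F \<union> G" S ?M] span_superset[of "F \<union> G" S ?M] unfolding F(3)
        by (intro span_minimal[OF sub]) auto
      show "lin_span S ?M (F \<union> G) \<subseteq> lin_span S ?M (?K \<union> G)" using F(2) by (intro span_mono) auto
    qed
    then have "?L = lin_span S ?M (F \<union> G)" using G(3) by simp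
    moreover have "F \<union> G \<subseteq> ?L" using F(2) G(2) \<open>?K \<subseteq> ?L\<close> by blast
    ultimately show ?case using F(1) G(1) by (metis finite_Un)
  qed
  moreover obtain n where "\<one> \<in> ann_chain S r n" using left_nilpotent by blast
  then have "carrier S \<subseteq> ann_chain S r n"
    using ideal.I_l_closed[OF ann_chain_ideal[OF r_ideal], of \<one> n] by fastforce
  then have "N \<inter> ann_chain S r n = N" using M.submoduleD(2)[OF N] by auto
  ultimately show "\<exists>F. finite F \<and> F \<subseteq> N \<and> N = lin_span S ?M F" by metis
qed

subsection \<open>Lifting idempotents\<close>

text \<open>Given \<open>e + f = 1\<close> with \<open>e f\<close> nilpotent, the expansion of \<open>(e + f)\<^sup>3\<close> splits as
  \<open>e\<^sup>2 (e + 3 f) + f\<^sup>2 (f + 3 e)\<close>; the product of the two parts is a multiple of \<open>(e f)\<^sup>2\<close>.\<close>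

lemma (in ideal) lift_idempotent:
  assumes "e \<in> carrier R" "f \<in> carrier R" "e \<oplus> f = \<one>" "e \<otimes> f \<in> I" "(e \<otimes> f) [^] (k::nat) = \<zero>"
  shows "\<exists>e'\<in>carrier R. e' \<otimes> e' = e' \<and> e' \<ominus> e \<in> I"
  using assms
proof (induction k arbitrary: e f rule: less_induct)
  case (less k)
  note e = less.prems(1) and f = less.prems(2) and ef1 = less.prems(3) and efI = less.prems(4)
  have "e \<otimes> e \<oplus> e \<otimes> f = e \<otimes> (e \<oplus> f)" using e f by (simp add: r_distr)
  then have e1: "e \<otimes> e \<oplus> e \<otimes> f = e" using e ef1 by simp
  have "e \<otimes> e \<oplus> f \<otimes> e = (e \<oplus> f) \<otimes> e" using e f by (simp add: l_distr)
  then have "e \<otimes> e \<oplus> f \<otimes> e = e \<otimes> e \<oplus> e \<otimes> f" using e ef1 e1 by simp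
  then have fe: "f \<otimes> e = e \<otimes> f" using e f by simp
  have "e \<otimes> f = \<zero>" if "\<not> k \<ge> 2"
  proof (cases "k = 0")
    case True
    then have "\<one> = \<zero>" using less.prems(5) by simp
    then have "\<one> \<otimes> (e \<otimes> f) = \<zero>" using e f by simp
    then show ?thesis using e f by simp
  next
    case False
    then have "k = Suc 0" using that by simp
    then show ?thesis using less.prems(5) e f by simp
  qed
  then consider "e \<otimes> f = \<zero>" | "k \<ge> 2" by blast
  then show ?case
  proof cases
    case 1
    then have "e \<otimes> e = e" using e1 e by simp
    moreover have "e \<ominus> e \<in> I" using e by (rule cong_refl)
    ultimately show ?thesis using e by blast
  next
    case 2
    define t s where "t = e \<oplus> (f \<oplus> (f \<oplus> f))" and "s = f \<oplus> (e \<oplus> (e \<oplus> e))"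
    have t: "t \<in> carrier R" and s: "s \<in> carrier R" using e f by (auto simp: t_def s_def)
    define e1 f1 where "e1 = e \<otimes> (e \<otimes> t)" and "f1 = f \<otimes> (f \<otimes> s)"
    have e1c: "e1 \<in> carrier R" and f1c: "f1 \<in> carrier R" using e f t s by (auto simp: e1_def f1_def)
    have fel: "f \<otimes> (e \<otimes> x) = e \<otimes> (f \<otimes> x)" if "x \<in> carrier R" for x
      using e f fe that by (metis m_assoc)
    have "e1 \<oplus> f1 = (e \<oplus> f) \<otimes> ((e \<oplus> f) \<otimes> (e \<oplus> f))"
      unfolding e1_def f1_def t_def s_def using e f by (simp add: r_distr l_distr fe fel a_ac)
    then have sum1: "e1 \<oplus> f1 = \<one>" using ef1 by simp
    have tc: "t \<otimes> f = f \<otimes> t" "s \<otimes> t = t \<otimes> s"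
      using e f by (simp_all add: t_def s_def r_distr l_distr fe a_ac)
    have "e1 \<otimes> f1 = ((e \<otimes> f) \<otimes> (e \<otimes> f)) \<otimes> (t \<otimes> s)"
    proof -
      have "t \<otimes> (f \<otimes> x) = f \<otimes> (t \<otimes> x)" if "x \<in> carrier R" for x
        using t f tc that by (metis m_assoc)
      then show ?thesis unfolding e1_def f1_def using e f t s fe fel by (simp add: m_assoc)
    qed
    moreover have comm: "((e \<otimes> f) \<otimes> (e \<otimes> f)) \<otimes> (t \<otimes> s) = (t \<otimes> s) \<otimes> ((e \<otimes> f) \<otimes> (e \<otimes> f))"
      unfolding t_def s_def using e f by (simp add: r_distr l_distr fe fel m_assoc a_ac)
    moreover have "((e \<otimes> f) \<otimes> (e \<otimes> f)) [^] n = (e \<otimes> f) [^] (2 * n)" for n :: nat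
    proof -
      have "(e \<otimes> f) [^] (2::nat) = (e \<otimes> f) \<otimes> (e \<otimes> f)" using e f by (simp add: numeral_2_eq_2)
      then show ?thesis using nat_pow_pow[of "e \<otimes> f" 2 n] e f by simp
    qed
    ultimately have pow: "(e1 \<otimes> f1) [^] n = (e \<otimes> f) [^] (2 * n) \<otimes> (t \<otimes> s) [^] n" for n :: nat
      using e f t s pow_mult_distrib[OF comm, of n] by simp
    define m where "m = (k + 1) div 2"
    have m: "m < k" "k \<le> 2 * m" using 2 by (auto simp: m_def)
    have "(e \<otimes> f) [^] (2 * m) = (e \<otimes> f) [^] k \<otimes> (e \<otimes> f) [^] (2 * m - k)"
      using e f m by (simp add: nat_pow_mult)
    then have nil: "(e1 \<otimes> f1) [^] m = \<zero>" using pow[of m] less.prems(5) e f t s by simp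
    have "((e \<otimes> f) \<otimes> (e \<otimes> f)) \<otimes> (t \<otimes> s) \<in> I" using efI e f t s by (simp add: I_r_closed)
    then have "e1 \<otimes> f1 \<in> I" using \<open>e1 \<otimes> f1 = _\<close> by simp
    then obtain e' where e': "e' \<in> carrier R" "e' \<otimes> e' = e'" "e' \<ominus> e1 \<in> I"
      using less.IH[OF m(1) e1c f1c sum1 _ nil] by blast
    have "e1 \<ominus> e \<in> I"
    proof -
      have "e = (e \<otimes> (e \<oplus> f)) \<otimes> (e \<oplus> f)" using e ef1 by simp
      also have "\<dots> = e \<otimes> (e \<otimes> e) \<oplus> (e \<otimes> f \<otimes> (e \<oplus> \<one>))"
        using e f ef1 unfolding ef1[symmetric] by (simp add: r_distr l_distr fe fel m_assoc a_ac)
      finally have ee: "e = e \<otimes> (e \<otimes> e) \<oplus> (e \<otimes> f \<otimes> (e \<oplus> \<one>))" .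
      have "e1 = e \<otimes> (e \<otimes> e) \<oplus> (e \<otimes> f) \<otimes> (e \<oplus> (e \<oplus> e))"
        unfolding e1_def t_def using e f by (simp add: r_distr l_distr fe fel m_assoc a_ac)
      moreover have diff: "(a \<oplus> x) \<ominus> a = x" if "a \<in> carrier R" "x \<in> carrier R" for a x
        using that r_neg1[of a x] by (simp add: a_minus_def a_comm)
      ultimately have "e1 \<ominus> e \<otimes> (e \<otimes> e) \<in> I"
        using diff[of "e \<otimes> (e \<otimes> e)" "(e \<otimes> f) \<otimes> (e \<oplus> (e \<oplus> e))"] I_r_closed[OF efI] e f by simp
      moreover have "e \<ominus> e \<otimes> (e \<otimes> e) \<in> I"
        by (subst ee) (use diff[of "e \<otimes> (e \<otimes> e)" "e \<otimes> f \<otimes> (e \<oplus> \<one>)"] I_r_closed[OF efI] e f in simp)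
      ultimately show ?thesis
        using cong_trans[OF e1c _ e, of "e \<otimes> (e \<otimes> e)"] cong_sym[OF e, of "e \<otimes> (e \<otimes> e)"] e by simp
    qed
    then have "e' \<ominus> e \<in> I" using cong_trans[OF e'(1) e1c e e'(3)] by blast
    then show ?thesis using e' by blast
  qed
qed

subsection \<open>The radical of a left artinian ring\<close>

abbreviation jacobson_radical :: "('a, 's) ring_scheme \<Rightarrow> 'a set"
  where "jacobson_radical S \<equiv> radical S (regular_module S) (carrier S)"

text \<open>If \<open>K\<close> is maximal in \<open>N\<close> and \<open>x \<in> N - K\<close>, then \<open>{a. a x \<in> K}\<close> is a maximal left ideal.\<close>

lemma radical_smult:
  assumes M: "left_module S M" and N: "submodule N S M" and a: "a \<in> jacobson_radical S" and x: "x \<in> N"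
  shows "a \<odot>\<^bsub>M\<^esub> x \<in> radical S M N"
proof -
  interpret M: left_module S M by fact
  interpret reg: left_module S "regular_module S" by (rule left_module_regular[OF M.R.ring_axioms])
  note ND = M.submoduleD[OF N]
  have ac: "a \<in> carrier S" using a by (simp add: radical_def)
  have "a \<odot>\<^bsub>M\<^esub> x \<in> K" if K: "maximal_submodule S M K N" for K
  proof (cases "x \<in> K")
    case True
    then show ?thesis using K ac M.submoduleD(5) unfolding maximal_submodule_def by blast
  next
    case False
    have Ks: "submodule K S M" "K \<subseteq> N" and max: "\<And>L. submodule L S M \<Longrightarrow> K \<subset> L \<Longrightarrow> L \<subseteq> N \<Longrightarrow> L = N"
      using K unfolding maximal_submodule_def by blast+
    have xM: "x \<in> carrier M" using ND(1) x .
    let ?m = "{b \<in> carrier S. b \<odot>\<^bsub>M\<^esub> x \<in> K}"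
    note KD = M.submoduleD[OF Ks(1)]
    have m: "submodule ?m S (regular_module S)"
      by (rule reg.submoduleI) (use xM KD in \<open>auto simp: M.smult_l_distr M.smult_assoc\<close>)
    have "maximal_submodule S (regular_module S) ?m (carrier S)"
      unfolding maximal_submodule_def
    proof (intro conjI notI)
      have "\<one>\<^bsub>S\<^esub> \<notin> ?m" using False xM by simp
      then show "?m \<subset> carrier S" by blast
      assume "\<exists>L. submodule L S (regular_module S) \<and> ?m \<subset> L \<and> L \<subset> carrier S"
      then obtain L where L: "submodule L S (regular_module S)" "?m \<subset> L" "L \<subset> carrier S" by blast
      note LD = reg.submoduleD[OF L(1)]
      obtain b where b: "b \<in> L" "b \<odot>\<^bsub>M\<^esub> x \<notin> K" using L by blast
      have bc: "b \<in> carrier S" using b L by blast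
      have bx: "b \<odot>\<^bsub>M\<^esub> x \<in> N" using ND(5)[OF bc x] .
      then have bxM: "b \<odot>\<^bsub>M\<^esub> x \<in> carrier M" using ND(1) by blast
      let ?X = "{k \<oplus>\<^bsub>M\<^esub> a \<odot>\<^bsub>M\<^esub> (b \<odot>\<^bsub>M\<^esub> x) | k a. k \<in> K \<and> a \<in> carrier S}"
      note X = M.submodule_adjoin[OF Ks(1) bxM]
      have "?X \<subseteq> N" using Ks(2) ND(4,5) bx by blast
      then have "?X = N" using max[OF X(1)] X(2,3) b(2) by blast
      then obtain k c where kc: "x = k \<oplus>\<^bsub>M\<^esub> c \<odot>\<^bsub>M\<^esub> (b \<odot>\<^bsub>M\<^esub> x)" "k \<in> K" "c \<in> carrier S" using x by blast
      have kM: "k \<in> carrier M" using KD(1) kc by blast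
      have "(\<one>\<^bsub>S\<^esub> \<ominus>\<^bsub>S\<^esub> c \<otimes>\<^bsub>S\<^esub> b) \<odot>\<^bsub>M\<^esub> x \<oplus>\<^bsub>M\<^esub> (c \<otimes>\<^bsub>S\<^esub> b) \<odot>\<^bsub>M\<^esub> x = x"
        using xM kc bc by (simp add: M.smult_l_distr[symmetric] a_minus_def M.R.a_assoc M.R.l_neg)
      also have "\<dots> = k \<oplus>\<^bsub>M\<^esub> (c \<otimes>\<^bsub>S\<^esub> b) \<odot>\<^bsub>M\<^esub> x" using kc(1) xM bc kc(3) by (simp add: M.smult_assoc)
      finally have "(\<one>\<^bsub>S\<^esub> \<ominus>\<^bsub>S\<^esub> c \<otimes>\<^bsub>S\<^esub> b) \<odot>\<^bsub>M\<^esub> x = k" using xM bc kc(3) kM by simp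
      then have "\<one>\<^bsub>S\<^esub> \<ominus>\<^bsub>S\<^esub> c \<otimes>\<^bsub>S\<^esub> b \<in> ?m" using kc(2,3) bc by simp
      then have "\<one>\<^bsub>S\<^esub> \<ominus>\<^bsub>S\<^esub> c \<otimes>\<^bsub>S\<^esub> b \<in> L" using L(2) by blast
      moreover have "c \<otimes>\<^bsub>S\<^esub> b \<in> L" using LD(5)[OF kc(3) b(1)] by simp
      ultimately have "(\<one>\<^bsub>S\<^esub> \<ominus>\<^bsub>S\<^esub> c \<otimes>\<^bsub>S\<^esub> b) \<oplus>\<^bsub>S\<^esub> c \<otimes>\<^bsub>S\<^esub> b \<in> L" using LD(4) by simp
      then have "\<one>\<^bsub>S\<^esub> \<in> L" using bc kc(3) by (simp add: a_minus_def M.R.a_assoc M.R.l_neg)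
      then have "carrier S \<subseteq> L" using LD(5)[of _ "\<one>\<^bsub>S\<^esub>"] by (metis M.R.r_one regular_module_simps(4) subsetI)
      then show False using L by blast
    qed (rule m)
    then show ?thesis using a unfolding radical_def by auto
  qed
  then show ?thesis using ND(5)[OF ac x] by (auto simp: radical_def)
qed

lemma submodule_radical:
  assumes M: "left_module S M" and N: "submodule N S M"
  shows "submodule (radical S M N) S M"
proof -
  interpret left_module S M by fact
  have "submodule (\<Inter>(insert N {K. maximal_submodule S M K N})) S M"
    using N by (intro submodule_Inter) (auto simp: maximal_submodule_def)
  then show ?thesis by (simp add: radical_def)
qed

lemma ideal_jacobson_radical:
  assumes "ring S"
  shows "ideal (jacobson_radical S) S"
proof -
  interpret ring S by fact
  interpret reg: left_module S "regular_module S" by (rule left_module_regular[OF ring_axioms])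
  have sub: "submodule (jacobson_radical S) S (regular_module S)"
    using submodule_radical[OF reg.left_module_axioms reg.submodule_self] by simp
  note D = reg.submoduleD[OF sub]
  show ?thesis
  proof (rule idealI2)
    fix a x assume "a \<in> carrier S" "x \<in> jacobson_radical S"
    then show "x \<otimes>\<^bsub>S\<^esub> a \<in> jacobson_radical S"
      using radical_smult[OF reg.left_module_axioms reg.submodule_self, of x a] by simp
  qed (use D in auto)
qed

text \<open>The radical series of the regular module reaches zero, and multiplication by the radical moves down
  at least one step in it. From the left, the \<open>(n - i)\<close>-th term is killed by \<open>i\<close> factors; from the right, an
  element that kills the \<open>i\<close>-th term lies in the \<open>i\<close>-th annihilator.\<close>

lemma ann_chain_loewy:
  assumes "ring S" and n: "(radical S (regular_module S) ^^ n) (carrier S) = {\<zero>\<^bsub>S\<^esub>}"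
  shows "\<one>\<^bsub>S\<^esub> \<in> ann_chain S (jacobson_radical S) n"
    and "\<one>\<^bsub>S\<^esub> \<in> ann_chain (opposite S) (jacobson_radical S) n"
proof -
  interpret ring S by fact
  interpret reg: left_module S "regular_module S" by (rule left_module_regular[OF ring_axioms])
  let ?r = "jacobson_radical S" and ?N = "\<lambda>i. (radical S (regular_module S) ^^ i) (carrier S)"
  have N: "submodule (?N i) S (regular_module S)" for i
  proof (induction i)
    case 0 show ?case using reg.submodule_self by simp
  next
    case (Suc i) then show ?case using submodule_radical[OF reg.left_module_axioms] by simp
  qed
  have step: "a \<otimes>\<^bsub>S\<^esub> x \<in> ?N (Suc i)" if "a \<in> ?r" "x \<in> ?N i" for a x i
    using radical_smult[OF reg.left_module_axioms N that] by simp
  have c: "?N i \<subseteq> carrier S" for i using reg.submoduleD(2)[OF N] by simp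
  have "i \<le> n \<Longrightarrow> ?N (n - i) \<subseteq> ann_chain S ?r i" for i
  proof (induction i)
    case 0 then show ?case using n by simp
  next
    case (Suc i)
    show ?case
    proof
      fix x assume x: "x \<in> ?N (n - Suc i)"
      have "Suc (n - Suc i) = n - i" using Suc.prems by simp
      then have "a \<otimes>\<^bsub>S\<^esub> x \<in> ann_chain S ?r i" if "a \<in> ?r" for a
        using step[OF that x] Suc.IH Suc.prems by auto
      then show "x \<in> ann_chain S ?r (Suc i)" using c x by auto
    qed
  qed
  from this[of n] show "\<one>\<^bsub>S\<^esub> \<in> ann_chain S ?r n" by auto
  have "\<forall>x\<in>carrier S. (\<forall>y\<in>?N i. x \<otimes>\<^bsub>S\<^esub> y = \<zero>\<^bsub>S\<^esub>) \<longrightarrow> x \<in> ann_chain (opposite S) ?r i" for i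
  proof (induction i)
    case 0
    show ?case
    proof (intro ballI impI)
      fix x assume "x \<in> carrier S" "\<forall>y\<in>?N 0. x \<otimes>\<^bsub>S\<^esub> y = \<zero>\<^bsub>S\<^esub>"
      then have "\<forall>y\<in>carrier S. x \<otimes>\<^bsub>S\<^esub> y = \<zero>\<^bsub>S\<^esub>" by simp
      then have "x \<otimes>\<^bsub>S\<^esub> \<one>\<^bsub>S\<^esub> = \<zero>\<^bsub>S\<^esub>" by (rule bspec) (rule one_closed)
      then show "x \<in> ann_chain (opposite S) ?r 0" using \<open>x \<in> carrier S\<close> by simp
    qed
  next
    case (Suc i)
    show ?case
    proof (intro ballI impI)
      fix x assume x: "x \<in> carrier S" "\<forall>y\<in>?N (Suc i). x \<otimes>\<^bsub>S\<^esub> y = \<zero>\<^bsub>S\<^esub>"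
      have "x \<otimes>\<^bsub>S\<^esub> a \<in> ann_chain (opposite S) ?r i" if a: "a \<in> ?r" for a
      proof -
        have ac: "a \<in> carrier S" using a by (simp add: radical_def)
        have "(x \<otimes>\<^bsub>S\<^esub> a) \<otimes>\<^bsub>S\<^esub> y = \<zero>\<^bsub>S\<^esub>" if "y \<in> ?N i" for y
          using step[OF a that] x ac c[of i] that by (auto simp: m_assoc)
        then show ?thesis using Suc.IH x(1) ac by auto
      qed
      then show "x \<in> ann_chain (opposite S) ?r (Suc i)" using x(1) by auto
    qed
  qed
  then show "\<one>\<^bsub>S\<^esub> \<in> ann_chain (opposite S) ?r n" using n by auto
qed

text \<open>A finite intersection of maximal left ideals that is minimal among all of them is contained in
  every maximal left ideal.\<close>

lemma jacobson_radical_finite_intersection: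
  assumes "ring S" "chain_stable False (submodules S (regular_module S))"
  shows "\<exists>\<M>. finite \<M> \<and> \<M> \<subseteq> {K. maximal_submodule S (regular_module S) K (carrier S)} \<and>
    jacobson_radical S = carrier S \<inter> \<Inter>\<M>"
proof -
  interpret reg: left_module S "regular_module S" by (rule left_module_regular) fact
  let ?X = "{K. maximal_submodule S (regular_module S) K (carrier S)}"
  let ?\<L> = "{carrier S \<inter> \<Inter>\<M> | \<M>. finite \<M> \<and> \<M> \<subseteq> ?X}"
  have "submodule (carrier S \<inter> \<Inter>\<M>) S (regular_module S)" if "\<M> \<subseteq> ?X" for \<M>
  proof -
    have "submodule (\<Inter>(insert (carrier S) \<M>)) S (regular_module S)"
      using that reg.submodule_self by (intro reg.submodule_Inter) (auto simp: maximal_submodule_def)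
    then show ?thesis by simp
  qed
  then have "?\<L> \<subseteq> submodules S (regular_module S)" by blast
  then have "chain_stable False ?\<L>" by (rule chain_stable_subset[OF assms(2)])
  moreover have "carrier S \<inter> \<Inter>{} \<in> ?\<L>" by blast
  ultimately obtain D where D: "D \<in> ?\<L>" "\<forall>Y\<in>?\<L>. Y \<subseteq> D \<longrightarrow> Y = D"
    by (rule chain_stable_minimal[THEN bexE])
  then obtain \<M> where M: "finite \<M>" "\<M> \<subseteq> ?X" "D = carrier S \<inter> \<Inter>\<M>" by blast
  have "D \<subseteq> K" if K: "K \<in> ?X" for K
  proof -
    have "carrier S \<inter> \<Inter>(insert K \<M>) \<in> ?\<L>" using M K by blast
    moreover have "carrier S \<inter> \<Inter>(insert K \<M>) \<subseteq> D" using M(3) by auto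
    ultimately have "carrier S \<inter> \<Inter>(insert K \<M>) = D" using D(2) by blast
    then show ?thesis by auto
  qed
  then have "jacobson_radical S = carrier S \<inter> \<Inter>\<M>" using M unfolding radical_def by blast
  then show ?thesis using M by blast
qed

text \<open>If \<open>c = e c\<close> is not in \<open>r\<close>, then some \<open>d = c a e'\<close> is not in \<open>r\<close>, and \<open>e' \<equiv> b d\<close>. The
  element \<open>g = d b e\<close> is then idempotent modulo \<open>r\<close> with \<open>e \<in> S g + r\<close>, so \<open>e \<equiv> g\<close>.\<close>

lemma (in ring) right_simple_if_left_simple:
  assumes r: "ideal r R" and \<E>: "\<And>e. e \<in> \<E> \<Longrightarrow> e \<in> carrier R" "\<And>e. e \<in> \<E> \<Longrightarrow> e \<otimes> e = e"
    and left: "\<And>e c. \<lbrakk>e \<in> \<E>; c \<in> carrier R; c \<otimes> e = c; c \<notin> r\<rbrakk> \<Longrightarrow> \<exists>a\<in>carrier R. e \<ominus> a \<otimes> c \<in> r"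
    and cover: "\<And>I. \<lbrakk>ideal I R; r \<subseteq> I; \<E> \<subseteq> I\<rbrakk> \<Longrightarrow> \<one> \<in> I"
    and e: "e \<in> \<E>" and c: "c \<in> carrier R" "e \<otimes> c = c" "c \<notin> r"
  shows "\<exists>a\<in>carrier R. e \<ominus> c \<otimes> a \<in> r"
proof -
  interpret r: ideal r R by (rule r)
  have ec: "e \<in> carrier R" and ee: "e \<otimes> e = e" using \<E> e by auto
  let ?I = "{x \<in> carrier R. \<forall>a\<in>carrier R. \<forall>b\<in>carrier R. c \<otimes> a \<otimes> x \<otimes> b \<in> r}"
  have I: "ideal ?I R"
  proof (rule idealI2)
    show "x \<oplus> y \<in> ?I" if "x \<in> ?I" "y \<in> ?I" for x y
      using that c(1) r.plus_closed by (auto simp: l_distr r_distr)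
    fix a x assume a: "a \<in> carrier R" and x: "x \<in> ?I"
    have "c \<otimes> a' \<otimes> (a \<otimes> x) \<otimes> b \<in> r" if "a' \<in> carrier R" "b \<in> carrier R" for a' b
    proof -
      have "c \<otimes> (a' \<otimes> a) \<otimes> x \<otimes> b \<in> r" using x a that by blast
      then show ?thesis using x a that c(1) by (simp add: m_assoc)
    qed
    then show "a \<otimes> x \<in> ?I" using a x by blast
    have "c \<otimes> a' \<otimes> (x \<otimes> a) \<otimes> b \<in> r" if "a' \<in> carrier R" "b \<in> carrier R" for a' b
    proof -
      have "c \<otimes> a' \<otimes> x \<otimes> (a \<otimes> b) \<in> r" using x a that by blast
      then show ?thesis using x a that c(1) by (simp add: m_assoc)
    qed
    then show "x \<otimes> a \<in> ?I" using a x by blast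
  qed (use c(1) in auto)
  have "\<one> \<notin> ?I"
  proof
    assume "\<one> \<in> ?I"
    then have "c \<otimes> \<one> \<otimes> \<one> \<otimes> \<one> \<in> r" by blast
    then show False using c by simp
  qed
  moreover have "r \<subseteq> ?I" using c(1) r.I_l_closed r.I_r_closed r.Icarr by auto
  ultimately have "\<not> \<E> \<subseteq> ?I" using cover[OF I] by blast
  then obtain e' a b where e': "e' \<in> \<E>" and ab: "a \<in> carrier R" "b \<in> carrier R" "c \<otimes> a \<otimes> e' \<otimes> b \<notin> r"
    using \<E>(1) by blast
  have e'c: "e' \<in> carrier R" and e'e': "e' \<otimes> e' = e'" using \<E> e' by auto
  define d where "d = c \<otimes> a \<otimes> e'"
  have d: "d \<in> carrier R" "d \<notin> r" "d \<otimes> e' = d" "e \<otimes> d = d"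
    using ab c ec e'c e'e' r.I_r_closed[of d b]
    by (auto simp: d_def m_assoc) (simp add: c(1) c(2) ec m_assoc[symmetric])
  obtain b' where b': "b' \<in> carrier R" "e' \<ominus> b' \<otimes> d \<in> r" using left[OF e' d(1,3,2)] by blast
  define g where "g = d \<otimes> b' \<otimes> e"
  have g: "g \<in> carrier R" "g \<otimes> e = g" "e \<otimes> g = g"
    using d b' ec ee by (auto simp: g_def m_assoc) (simp add: d ec b' m_assoc[symmetric])
  have gd: "g \<otimes> d = d \<otimes> (b' \<otimes> d)" using d b' ec by (simp add: g_def m_assoc)
  have "d \<otimes> e' \<ominus> d \<otimes> (b' \<otimes> d) \<in> r" using r.cong_mult_left[OF e'c _ d(1) b'(2)] b' d by simp
  then have dg: "d \<ominus> g \<otimes> d \<in> r" using d gd by simp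
  have "g \<notin> r"
  proof
    assume "g \<in> r"
    then have "g \<otimes> d \<in> r" using d r.I_r_closed by blast
    then show False using r.cong_mem[OF d(1) _ dg] d(2) by blast
  qed
  then obtain x where x: "x \<in> carrier R" "e \<ominus> x \<otimes> g \<in> r" using left[OF e g(1,2)] by blast
  have "d \<otimes> (b' \<otimes> e) \<ominus> g \<otimes> d \<otimes> (b' \<otimes> e) \<in> r" using r.cong_mult_right[OF d(1) _ _ dg] b' ec g d by simp
  then have gg: "g \<ominus> g \<otimes> g \<in> r" using g d b' ec by (simp add: g_def m_assoc)
  have xg: "x \<otimes> g \<ominus> x \<otimes> g \<otimes> g \<in> r" using r.cong_mult_left[OF g(1) _ x(1) gg] x g by (simp add: m_assoc)
  have eg: "e \<otimes> g \<ominus> x \<otimes> g \<otimes> g \<in> r" using r.cong_mult_right[OF ec _ g(1) x(2)] x g by simp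
  have "e \<ominus> x \<otimes> g \<otimes> g \<in> r" using r.cong_trans[OF ec _ _ x(2) xg] x g by simp
  then have "e \<ominus> e \<otimes> g \<in> r"
    using r.cong_trans[OF ec _ _ _ r.cong_sym[OF _ _ eg], of] x g ec by simp
  then have "e \<ominus> c \<otimes> (a \<otimes> e' \<otimes> b' \<otimes> e) \<in> r"
    unfolding g(3) using ab e'c b' ec c(1) by (simp add: g_def d_def m_assoc)
  then show ?thesis using ab e'c b' ec by blast
qed

text \<open>Write the radical as an irredundant intersection of maximal left ideals \<open>m\<close> and let \<open>E m\<close> be
  the intersection of the others. A decomposition \<open>1 = e + f\<close> with \<open>e \<in> E m\<close> and \<open>f \<in> m\<close> makes \<open>e\<close>
  idempotent modulo the radical, as \<open>e f \<in> E m \<inter> m\<close>, and \<open>e\<close> lifts to an idempotent. An element of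
  \<open>E m\<close> outside \<open>m\<close> generates \<open>S\<close> together with \<open>m\<close>; this makes \<open>S e\<close> simple modulo the radical.\<close>

lemma semiprimary_if_artinian:
  assumes S: "ring S" and dcc: "chain_stable False (submodules S (regular_module S))"
    and n: "(radical S (regular_module S) ^^ n) (carrier S) = {\<zero>\<^bsub>S\<^esub>}"
  shows "\<exists>\<E>. finite \<E> \<and> semiprimary S (jacobson_radical S) \<E>"
proof -
  interpret ring S by (rule S)
  let ?r = "jacobson_radical S" and ?M = "regular_module S"
  let ?max = "\<lambda>K. maximal_submodule S ?M K (carrier S)"
  interpret reg: left_module S ?M by (rule left_module_regular[OF S])
  note rI = ideal_jacobson_radical[OF S]
  interpret r: ideal ?r S by (rule rI)
  let ?P = "\<lambda>\<M>. finite \<M> \<and> \<M> \<subseteq> {K. ?max K} \<and> ?r = carrier S \<inter> \<Inter>\<M>"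
  obtain \<M>0 where "?P \<M>0" using jacobson_radical_finite_intersection[OF S dcc] by (elim exE)
  from ex_has_least_nat[of ?P, OF this, of card]
  obtain \<M> where min: "?P \<M> \<and> (\<forall>\<N>. ?P \<N> \<longrightarrow> card \<M> \<le> card \<N>)" by (rule exE)
  note \<M> = conjunct1[OF min] and least' = conjunct2[OF min]
  have least: "card \<M> \<le> card \<N>" if "?P \<N>" for \<N> by (rule least'[rule_format, OF that])
  have maxD: "submodule m S ?M" "m \<subset> carrier S" if "m \<in> \<M>" for m
    using \<M> that by (auto simp: maximal_submodule_def)
  have max: "L = carrier S" if "m \<in> \<M>" "submodule L S ?M" "m \<subset> L" for m L
  proof -
    have "?max m" using \<M> that(1) by blast
    then have "\<not> L \<subset> carrier S" using that(2,3) unfolding maximal_submodule_def by blast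
    then show ?thesis using reg.submoduleD(2)[OF that(2)] by auto
  qed
  define E where "E m = carrier S \<inter> \<Inter>(\<M> - {m})" for m
  have Es: "submodule (E m) S ?M" for m
  proof -
    have "submodule (\<Inter>(insert (carrier S) (\<M> - {m}))) S ?M"
      using maxD reg.submodule_self by (intro reg.submodule_Inter) auto
    then show ?thesis by (simp add: E_def)
  qed
  have Em: "E m \<inter> m = ?r" if "m \<in> \<M>" for m
    using \<M> maxD(2)[OF that] that by (auto simp: E_def)
  have split: "\<exists>k\<in>m. \<exists>a\<in>carrier S. \<one>\<^bsub>S\<^esub> = k \<oplus>\<^bsub>S\<^esub> a \<otimes>\<^bsub>S\<^esub> x" if m: "m \<in> \<M>" "x \<in> carrier S" "x \<notin> m" for m x
  proof -
    let ?X = "{k \<oplus>\<^bsub>?M\<^esub> a \<odot>\<^bsub>?M\<^esub> x | k a. k \<in> m \<and> a \<in> carrier S}"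
    have "x \<in> carrier ?M" using m by simp
    note X = reg.submodule_adjoin[OF maxD(1)[OF m(1)] this]
    have "m \<subset> ?X" using X(2,3) m(3) by blast
    then have "?X = carrier S" by (rule max[OF m(1) X(1)])
    then have "\<one>\<^bsub>S\<^esub> \<in> ?X" by blast
    then show ?thesis by auto
  qed
  have one_notin: "\<one>\<^bsub>S\<^esub> \<notin> m" if "m \<in> \<M>" for m
  proof
    assume "\<one>\<^bsub>S\<^esub> \<in> m"
    then have "x \<in> m" if "x \<in> carrier S" for x
      using reg.submoduleD(5)[OF maxD(1)[OF \<open>m \<in> \<M>\<close>] that, of "\<one>\<^bsub>S\<^esub>"] that by simp
    then show False using maxD(2)[OF \<open>m \<in> \<M>\<close>] by blast
  qed
  have "\<exists>e. e \<in> E m \<and> \<one>\<^bsub>S\<^esub> \<ominus>\<^bsub>S\<^esub> e \<in> m" if m: "m \<in> \<M>" for m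
  proof -
    have "\<not> E m \<subseteq> m"
    proof
      assume "E m \<subseteq> m"
      then have "?r = E m" using Em[OF m] by blast
      then have "?P (\<M> - {m})" using \<M> unfolding E_def by blast
      from least[OF this] have "card \<M> \<le> card (\<M> - {m})" .
      moreover have "card (\<M> - {m}) < card \<M>" by (rule card_Diff1_less) (use \<M> m in auto)
      ultimately show False by simp
    qed
    then obtain x where x: "x \<in> E m" "x \<notin> m" by blast
    then have xc: "x \<in> carrier S" by (simp add: E_def)
    obtain k a where ka: "k \<in> m" "a \<in> carrier S" "\<one>\<^bsub>S\<^esub> = k \<oplus>\<^bsub>S\<^esub> a \<otimes>\<^bsub>S\<^esub> x" using split[OF m xc x(2)] by blast
    have "k \<in> carrier S" using ka maxD(2)[OF m] by blast
    then have "\<one>\<^bsub>S\<^esub> \<ominus>\<^bsub>S\<^esub> a \<otimes>\<^bsub>S\<^esub> x = k" using ka xc by (simp add: a_minus_def a_assoc r_neg)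
    then show ?thesis using ka reg.submoduleD(5)[OF Es ka(2) x(1)] by auto
  qed
  then obtain e where e: "\<And>m. m \<in> \<M> \<Longrightarrow> e m \<in> E m" "\<And>m. m \<in> \<M> \<Longrightarrow> \<one>\<^bsub>S\<^esub> \<ominus>\<^bsub>S\<^esub> e m \<in> m" by metis
  have ec: "e m \<in> carrier S" if "m \<in> \<M>" for m using e(1)[OF that] by (simp add: E_def)
  have mult_e: "x \<otimes>\<^bsub>S\<^esub> e m \<in> E m" "x \<ominus>\<^bsub>S\<^esub> x \<otimes>\<^bsub>S\<^esub> e m \<in> m" if "m \<in> \<M>" "x \<in> carrier S" for m x
  proof -
    show "x \<otimes>\<^bsub>S\<^esub> e m \<in> E m" using reg.submoduleD(5)[OF Es that(2) e(1)[OF that(1)]] by simp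
    have "x \<otimes>\<^bsub>S\<^esub> (\<one>\<^bsub>S\<^esub> \<ominus>\<^bsub>S\<^esub> e m) \<in> m"
      using reg.submoduleD(5)[OF maxD(1)[OF that(1)] that(2) e(2)[OF that(1)]] by simp
    then show "x \<ominus>\<^bsub>S\<^esub> x \<otimes>\<^bsub>S\<^esub> e m \<in> m" using that ec by (simp add: a_minus_def r_distr r_minus)
  qed
  have minus_E: "x \<ominus>\<^bsub>S\<^esub> y \<in> E m" if "x \<in> E m" "y \<in> E m" for x y m
    using reg.submoduleD(4)[OF Es that(1) reg.submoduleD(6)[OF Es that(2)]] by (simp add: a_minus_def)
  have cong_e: "x \<ominus>\<^bsub>S\<^esub> x \<otimes>\<^bsub>S\<^esub> e m \<in> ?r" if "m \<in> \<M>" "x \<in> E m" for m x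
  proof -
    have xc: "x \<in> carrier S" using that(2) by (simp add: E_def)
    show ?thesis
      using mult_e(2)[OF that(1) xc] minus_E[OF that(2) mult_e(1)[OF that(1) xc]] Em[OF that(1)] by blast
  qed
  have "\<exists>e'\<in>carrier S. e' \<otimes>\<^bsub>S\<^esub> e' = e' \<and> e' \<ominus>\<^bsub>S\<^esub> e m \<in> ?r" if m: "m \<in> \<M>" for m
  proof (rule r.lift_idempotent)
    let ?f = "\<one>\<^bsub>S\<^esub> \<ominus>\<^bsub>S\<^esub> e m"
    show ef: "e m \<in> carrier S" "?f \<in> carrier S" using ec[OF m] by auto
    show "e m \<oplus>\<^bsub>S\<^esub> ?f = \<one>\<^bsub>S\<^esub>" using ec[OF m] by (simp add: a_minus_def a_lcomm[of _ "\<one>\<^bsub>S\<^esub>"] r_neg)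
    have "e m \<otimes>\<^bsub>S\<^esub> ?f = e m \<ominus>\<^bsub>S\<^esub> e m \<otimes>\<^bsub>S\<^esub> e m" using ec[OF m] by (simp add: a_minus_def r_distr r_minus)
    then show *: "e m \<otimes>\<^bsub>S\<^esub> ?f \<in> ?r" using cong_e[OF m e(1)[OF m]] by simp
    show "(e m \<otimes>\<^bsub>S\<^esub> ?f) [^]\<^bsub>S\<^esub> n = \<zero>\<^bsub>S\<^esub>"
      using ann_chain_nilpotent[OF rI * ann_chain_loewy(1)[OF S n]] ef by simp
  qed
  then obtain e' where e': "\<And>m. m \<in> \<M> \<Longrightarrow> e' m \<in> carrier S" "\<And>m. m \<in> \<M> \<Longrightarrow> e' m \<otimes>\<^bsub>S\<^esub> e' m = e' m"
    "\<And>m. m \<in> \<M> \<Longrightarrow> e' m \<ominus>\<^bsub>S\<^esub> e m \<in> ?r" by metis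
  let ?\<E> = "e' ` \<M>"
  have left: "\<exists>a\<in>carrier S. x \<ominus>\<^bsub>S\<^esub> a \<otimes>\<^bsub>S\<^esub> c \<in> ?r"
    if x: "x \<in> ?\<E>" and c: "c \<in> carrier S" "c \<otimes>\<^bsub>S\<^esub> x = c" "c \<notin> ?r" for x c
  proof -
    obtain m where m: "m \<in> \<M>" "x = e' m" using x by blast
    have xc: "x \<in> carrier S" using e' m by simp
    have "c \<otimes>\<^bsub>S\<^esub> x \<ominus>\<^bsub>S\<^esub> c \<otimes>\<^bsub>S\<^esub> e m \<in> ?r"
      using r.cong_mult_left[OF xc ec[OF m(1)] c(1)] e'(3)[OF m(1)] m(2) by simp
    then have ce: "c \<ominus>\<^bsub>S\<^esub> c \<otimes>\<^bsub>S\<^esub> e m \<in> ?r" using c by simp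
    have "c \<otimes>\<^bsub>S\<^esub> e m \<notin> m"
      using r.cong_mem[OF c(1) _ ce] c(3) mult_e(1)[OF m(1) c(1)] Em[OF m(1)] by blast
    then obtain k a where ka: "k \<in> m" "a \<in> carrier S" "\<one>\<^bsub>S\<^esub> = k \<oplus>\<^bsub>S\<^esub> a \<otimes>\<^bsub>S\<^esub> (c \<otimes>\<^bsub>S\<^esub> e m)"
      using split[OF m(1), of "c \<otimes>\<^bsub>S\<^esub> e m"] c(1) ec[OF m(1)] by blast
    have kc: "k \<in> carrier S" using ka maxD(2)[OF m(1)] by blast
    let ?b = "e m \<otimes>\<^bsub>S\<^esub> a"
    have bc: "?b \<in> carrier S" using ka ec[OF m(1)] by simp
    have "e m = e m \<otimes>\<^bsub>S\<^esub> (k \<oplus>\<^bsub>S\<^esub> a \<otimes>\<^bsub>S\<^esub> (c \<otimes>\<^bsub>S\<^esub> e m))" using ec[OF m(1)] by (simp flip: ka(3))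
    also have "\<dots> = e m \<otimes>\<^bsub>S\<^esub> k \<oplus>\<^bsub>S\<^esub> ?b \<otimes>\<^bsub>S\<^esub> (c \<otimes>\<^bsub>S\<^esub> e m)"
      using ec[OF m(1)] ka kc c(1) by (simp add: r_distr m_assoc)
    finally have eq: "e m = e m \<otimes>\<^bsub>S\<^esub> k \<oplus>\<^bsub>S\<^esub> ?b \<otimes>\<^bsub>S\<^esub> (c \<otimes>\<^bsub>S\<^esub> e m)" .
    have "e m \<ominus>\<^bsub>S\<^esub> ?b \<otimes>\<^bsub>S\<^esub> (c \<otimes>\<^bsub>S\<^esub> e m) = e m \<otimes>\<^bsub>S\<^esub> k"
      by (subst eq) (use ec[OF m(1)] bc kc c(1) in \<open>simp add: a_minus_def a_assoc r_neg\<close>)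
    moreover have "e m \<otimes>\<^bsub>S\<^esub> k \<in> m" using reg.submoduleD(5)[OF maxD(1)[OF m(1)] ec[OF m(1)] ka(1)] by simp
    moreover have bE: "?b \<otimes>\<^bsub>S\<^esub> (c \<otimes>\<^bsub>S\<^esub> e m) \<in> E m"
      using mult_e(1)[OF m(1), of "?b \<otimes>\<^bsub>S\<^esub> c"] bc c(1) ec[OF m(1)] by (simp add: m_assoc)
    ultimately have "e m \<ominus>\<^bsub>S\<^esub> ?b \<otimes>\<^bsub>S\<^esub> (c \<otimes>\<^bsub>S\<^esub> e m) \<in> E m \<inter> m"
      using minus_E[OF e(1)[OF m(1)] bE] by simp
    then have 1: "e m \<ominus>\<^bsub>S\<^esub> ?b \<otimes>\<^bsub>S\<^esub> (c \<otimes>\<^bsub>S\<^esub> e m) \<in> ?r" by (simp only: Em[OF m(1)])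
    have "?b \<otimes>\<^bsub>S\<^esub> c \<ominus>\<^bsub>S\<^esub> ?b \<otimes>\<^bsub>S\<^esub> (c \<otimes>\<^bsub>S\<^esub> e m) \<in> ?r"
      using r.cong_mult_left[OF c(1) _ bc ce] c(1) ec[OF m(1)] by simp
    then have 2: "?b \<otimes>\<^bsub>S\<^esub> (c \<otimes>\<^bsub>S\<^esub> e m) \<ominus>\<^bsub>S\<^esub> ?b \<otimes>\<^bsub>S\<^esub> c \<in> ?r"
      by (rule r.cong_sym[rotated 2]) (use bc c(1) ec[OF m(1)] in auto)
    have "e m \<ominus>\<^bsub>S\<^esub> ?b \<otimes>\<^bsub>S\<^esub> c \<in> ?r"
      by (rule r.cong_trans[OF _ _ _ 1 2]) (use bc c(1) ec[OF m(1)] in auto)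
    then have "x \<ominus>\<^bsub>S\<^esub> ?b \<otimes>\<^bsub>S\<^esub> c \<in> ?r"
      by (rule r.cong_trans[rotated 4]) (use bc c(1) ec[OF m(1)] xc e'(3)[OF m(1)] m(2) in auto)
    then show ?thesis using bc by blast
  qed
  \<comment> \<open>Modulo \<open>I\<close>, the unit is moved into more and more of the maximal left ideals by subtracting multiples
    of the \<open>e m\<close>, until it lies in the radical.\<close>
  have cover: "\<one>\<^bsub>S\<^esub> \<in> I" if I: "ideal I S" "?r \<subseteq> I" "?\<E> \<subseteq> I" for I
  proof -
    interpret I: ideal I S by (rule I)
    have EI: "x \<in> I" if m: "m \<in> \<M>" and x: "x \<in> E m" for m x
    proof -
      have xc: "x \<in> carrier S" using x by (simp add: E_def)
      have "e' m \<ominus>\<^bsub>S\<^esub> e m \<in> I" using e'(3)[OF m] I(2) by blast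
      then have "e m \<ominus>\<^bsub>S\<^esub> e' m \<in> I" using I.cong_sym e'(1)[OF m] ec[OF m] by blast
      then have "e m \<in> I" using I.cong_mem[OF ec[OF m]] I(3) m by blast
      then have "x \<otimes>\<^bsub>S\<^esub> e m \<in> I" using I.I_l_closed xc by blast
      moreover have "x \<ominus>\<^bsub>S\<^esub> x \<otimes>\<^bsub>S\<^esub> e m \<in> I" using cong_e[OF m x] I(2) by blast
      ultimately show ?thesis using I.cong_mem[OF xc] by blast
    qed
    have "\<exists>d\<in>carrier S \<inter> \<Inter>\<F>. \<one>\<^bsub>S\<^esub> \<ominus>\<^bsub>S\<^esub> d \<in> I" if "finite \<F>" "\<F> \<subseteq> \<M>" for \<F>
      using that
    proof (induction \<F>)
      case empty
      have "\<one>\<^bsub>S\<^esub> \<ominus>\<^bsub>S\<^esub> \<one>\<^bsub>S\<^esub> \<in> I" by (rule I.cong_refl) simp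
      then show ?case by auto
    next
      case (insert m \<F>)
      then obtain d where d: "d \<in> carrier S" "d \<in> \<Inter>\<F>" "\<one>\<^bsub>S\<^esub> \<ominus>\<^bsub>S\<^esub> d \<in> I" by auto
      have m: "m \<in> \<M>" using insert by blast
      let ?d = "d \<ominus>\<^bsub>S\<^esub> d \<otimes>\<^bsub>S\<^esub> e m"
      have dc: "?d \<in> carrier S" using d ec[OF m] by simp
      have "?d \<in> K" if K: "K \<in> \<F>" for K
      proof -
        have KM: "K \<in> \<M>" using K insert.prems by blast
        have "d \<otimes>\<^bsub>S\<^esub> e m \<in> K" using mult_e(1)[OF m d(1)] K KM insert.hyps by (auto simp: E_def)
        then show ?thesis
          using reg.submoduleD(7)[OF maxD(1)[OF KM], of d "d \<otimes>\<^bsub>S\<^esub> e m"] d(2) K by (auto simp: a_minus_def)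
      qed
      moreover have "\<one>\<^bsub>S\<^esub> \<ominus>\<^bsub>S\<^esub> ?d \<in> I"
      proof (rule I.cong_trans[OF _ d(1) dc d(3)])
        have "d \<otimes>\<^bsub>S\<^esub> e m \<in> I" using EI[OF m mult_e(1)[OF m d(1)]] .
        moreover have "d \<ominus>\<^bsub>S\<^esub> ?d = d \<otimes>\<^bsub>S\<^esub> e m"
          using d ec[OF m] by (simp add: a_minus_def minus_add a_assoc[symmetric] r_neg)
        ultimately show "d \<ominus>\<^bsub>S\<^esub> ?d \<in> I" by simp
      qed simp
      ultimately show ?case using dc mult_e(2)[OF m d(1)] by blast
    qed
    from this[of \<M>] \<M> obtain d where "d \<in> carrier S \<inter> \<Inter>\<M>" "\<one>\<^bsub>S\<^esub> \<ominus>\<^bsub>S\<^esub> d \<in> I" by blast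
    then show ?thesis using \<M> I(2) I.cong_mem[OF one_closed] by blast
  qed
  have proper: "x \<notin> ?r" if x: "x \<in> ?\<E>" for x
  proof
    assume "x \<in> ?r"
    obtain m where m: "m \<in> \<M>" "x = e' m" using x by blast
    have "e m \<ominus>\<^bsub>S\<^esub> e' m \<in> ?r" using r.cong_sym[OF e'(1)[OF m(1)] ec[OF m(1)] e'(3)[OF m(1)]] .
    then have "e m \<in> m" using r.cong_mem[OF ec[OF m(1)]] \<open>x \<in> ?r\<close> m Em[OF m(1)] by blast
    then have "(\<one>\<^bsub>S\<^esub> \<ominus>\<^bsub>S\<^esub> e m) \<oplus>\<^bsub>S\<^esub> e m \<in> m"
      using reg.submoduleD(4)[OF maxD(1)[OF m(1)] e(2)[OF m(1)]] by simp
    then show False using one_notin[OF m(1)] ec[OF m(1)] by (simp add: a_minus_def a_assoc l_neg)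
  qed
  have idem: "x \<in> carrier S" "x \<otimes>\<^bsub>S\<^esub> x = x" if "x \<in> ?\<E>" for x using that e' by auto
  have "semiprimary S ?r ?\<E>"
  proof (intro semiprimary.intro semiprimary_axioms.intro S rI)
    show "\<exists>n. \<one>\<^bsub>S\<^esub> \<in> ann_chain S ?r n" "\<exists>n. \<one>\<^bsub>S\<^esub> \<in> ann_chain (opposite S) ?r n"
      using ann_chain_loewy[OF S n] by blast+
    show "\<exists>a\<in>carrier S. x \<ominus>\<^bsub>S\<^esub> c \<otimes>\<^bsub>S\<^esub> a \<in> ?r"
      if "x \<in> ?\<E>" "c \<in> carrier S" "x \<otimes>\<^bsub>S\<^esub> c = c" "c \<notin> ?r" for x c
      by (rule right_simple_if_left_simple[OF rI idem left cover that])
  qed (fact idem proper left cover)+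
  moreover have "finite ?\<E>" using \<M> by blast
  ultimately show ?thesis by blast
qed

subsection \<open>Artin algebras\<close>

lemma artin_algebra_artinian:
  assumes "artin_algebra R \<Lambda>"
  shows "chain_stable False (submodules \<Lambda> (regular_module \<Lambda>))"
    and "chain_stable False (submodules (opposite \<Lambda>) (regular_module (opposite \<Lambda>)))"
proof -
  interpret A: artin_algebra R \<Lambda> by fact
  have R: "ring R" and \<Lambda>: "ring \<Lambda>" and cR: "cring R"
    by (rule A.R.ring_axioms, rule A.ring_axioms, rule A.R.is_cring)
  interpret \<Lambda>: ring \<Lambda> by (rule \<Lambda>)
  have m: "left_module R \<Lambda>"
    by (intro left_module.intro left_module_axioms.intro R A.M.abelian_group_axioms)
       (simp_all add: A.smult_l_distr A.smult_r_distr A.smult_assoc1)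
  interpret m: left_module R \<Lambda> by (rule m)
  interpret regR: left_module R "regular_module R" by (rule left_module_regular[OF R])
  have dccR: "chain_stable False (submodules R (regular_module R))"
    unfolding chain_stable_def
  proof (intro allI impI)
    fix f :: "nat \<Rightarrow> _"
    assume f: "(\<forall>t. f t \<in> submodules R (regular_module R)) \<and> (\<forall>t. if False then f t \<subseteq> f (Suc t) else f (Suc t) \<subseteq> f t)"
    have "ideal (f t) R" for t
    proof (rule ring.idealI2[OF R])
      have s: "submodule (f t) R (regular_module R)" using f by blast
      note D = regR.submoduleD[OF s]
      show "f t \<subseteq> carrier R" "\<zero>\<^bsub>R\<^esub> \<in> f t" using D(2,3) by simp_all
      show "x \<oplus>\<^bsub>R\<^esub> y \<in> f t" if "x \<in> f t" "y \<in> f t" for x y using D(4)[OF that] by simp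
      show *: "a \<otimes>\<^bsub>R\<^esub> x \<in> f t" if "a \<in> carrier R" "x \<in> f t" for a x using D(5)[OF that] by simp
      show "x \<otimes>\<^bsub>R\<^esub> a \<in> f t" if "a \<in> carrier R" "x \<in> f t" for a x
        using *[OF that] cring.cring_simprules(14)[OF cR, of a x] that D(1)[OF that(2)] by simp
    qed
    then show "\<exists>T. \<forall>t\<ge>T. f t = f T" using A.descending_chain[of f] f by auto
  qed
  let ?\<phi> = "\<lambda>a. a \<odot>\<^bsub>\<Lambda>\<^esub> \<one>\<^bsub>\<Lambda>\<^esub>"
  have left: "?\<phi> a \<otimes>\<^bsub>\<Lambda>\<^esub> x = a \<odot>\<^bsub>\<Lambda>\<^esub> x" and right: "x \<otimes>\<^bsub>\<Lambda>\<^esub> ?\<phi> a = a \<odot>\<^bsub>\<Lambda>\<^esub> x"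
    if "a \<in> carrier R" "x \<in> carrier \<Lambda>" for a x
    using that A.smult_mult_left[of a "\<one>\<^bsub>\<Lambda>\<^esub>" x] A.smult_mult_right[of a x "\<one>\<^bsub>\<Lambda>\<^esub>"] by simp_all
  have fg: "finitely_generated R (restrict_scalars ?\<phi> (regular_module T))"
    if T: "ring T" "?\<phi> \<in> ring_hom R T" "carrier T = carrier \<Lambda>" "add T = add \<Lambda>" "zero T = zero \<Lambda>"
      "\<And>a x. a \<in> carrier R \<Longrightarrow> x \<in> carrier \<Lambda> \<Longrightarrow> ?\<phi> a \<otimes>\<^bsub>T\<^esub> x = a \<odot>\<^bsub>\<Lambda>\<^esub> x" for T :: "'c ring"
  proof -
    interpret r: left_module R "restrict_scalars ?\<phi> (regular_module T)"
      by (rule left_module_restrict[OF left_module_regular[OF T(1)] R T(2)])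
    have "submodule N R (restrict_scalars ?\<phi> (regular_module T)) \<longleftrightarrow> submodule N R \<Lambda>" for N
      unfolding r.submodule_iff m.submodule_iff by (auto simp: T(3-6) subset_eq)
    then show ?thesis using A.finitely_generated unfolding finitely_generated_def by (simp add: T(3))
  qed
  have hom: "?\<phi> \<in> ring_hom R \<Lambda>"
    by (rule ring_hom_memI) (simp_all add: left m.smult_assoc m.smult_l_distr)
  have hom': "?\<phi> \<in> ring_hom R (opposite \<Lambda>)"
    by (rule ring_hom_memI) (simp_all add: right m.smult_assoc m.smult_l_distr)
  let ?T = "opposite (opposite \<Lambda>)"
  have rT: "ring (opposite \<Lambda>)" "ring ?T" using ring_opposite[OF \<Lambda>] ring_opposite by blast+
  show "chain_stable False (submodules (opposite \<Lambda>) (regular_module (opposite \<Lambda>)))"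
    by (rule chain_stable_finite_extension[OF R rT(1) hom' fg[OF rT(1) hom'] dccR]) (simp_all add: right)
  have hT: "?\<phi> \<in> ring_hom R ?T" using hom by (simp add: ring_hom_def)
  have "chain_stable False (submodules ?T (regular_module ?T))"
    by (rule chain_stable_finite_extension[OF R rT(2) hT fg[OF rT(2) hT] dccR]) (simp_all add: left)
  moreover have "submodules ?T (regular_module ?T) = submodules \<Lambda> (regular_module \<Lambda>)"
    by (simp add: left_module.submodule_iff[OF left_module_regular[OF rT(2)]]
        left_module.submodule_iff[OF left_module_regular[OF \<Lambda>]])
  ultimately show "chain_stable False (submodules \<Lambda> (regular_module \<Lambda>))" by simp
qed

section \<open>Selfinjective rings\<close>

lemma finsum_regular [simp]: "finsum (regular_module R) = finsum R"
  by (simp add: finsum_def finprod_def fun_eq_iff)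

lemma selfinjectiveD:
  fixes M N :: "'a umodule" and S :: "('a, 's) ring_scheme"
  assumes "selfinjective S" "left_module S M \<and> left_module S N \<and> i \<in> module_hom S M N \<and>
    inj_on i (carrier M) \<and> f \<in> module_hom S M (regular_module S)"
  shows "\<exists>g\<in>module_hom S N (regular_module S). \<forall>x\<in>carrier M. g (i x) = f x"
  using assms(1) unfolding selfinjective_def injective_def by (elim conjE allE impE) (rule assms(2))

text \<open>A homomorphism from a submodule of a free module to a selfinjective ring is the restriction of a
  map given by a column of coefficients.\<close>

lemma selfinjective_extend:
  assumes S: "ring S" and inj: "selfinjective S"
    and N: "submodule N S (power_module (regular_module S) k)"
    and f: "f \<in> module_hom S ((power_module (regular_module S) k)\<lparr>carrier := N\<rparr>) (regular_module S)"
  shows "\<exists>q. (\<forall>i<k. q i \<in> carrier S) \<and> (\<forall>x\<in>N. f x = (\<Oplus>\<^bsub>S\<^esub>i\<in>{..<k}. x i \<otimes>\<^bsub>S\<^esub> q i))"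
proof -
  interpret ring S by (rule S)
  let ?F = "power_module (regular_module S) k"
  have reg: "left_module S (regular_module S)" by (rule left_module_regular[OF S])
  interpret F: left_module S ?F by (rule left_module_power[OF reg])
  let ?N = "?F\<lparr>carrier := N\<rparr>"
  have Nm: "left_module S ?N" by (rule F.left_module_sub[OF N])
  have NF: "N \<subseteq> carrier ?F" by (rule F.submoduleD(2)[OF N])
  have i: "(\<lambda>X. X) \<in> module_hom S (singleton_module ?N) (singleton_module ?F)"
    by (rule module_homI) (use NF in auto)
  have f': "(\<lambda>X. f (the_elem X)) \<in> module_hom S (singleton_module ?N) (regular_module S)"
    by (rule module_hom_comp[OF the_elem_hom[OF Nm] f])
  from selfinjectiveD[OF inj, of "singleton_module ?N" "singleton_module ?F" "\<lambda>X. X" "\<lambda>X. f (the_elem X)"]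
  obtain g where g: "g \<in> module_hom S (singleton_module ?F) (regular_module S)"
    "\<forall>x\<in>carrier (singleton_module ?N). g x = f (the_elem x)"
    using left_module_singleton[OF Nm] left_module_singleton[OF F.left_module_axioms] i f' by auto
  have h: "(\<lambda>x. g {x}) \<in> module_hom S ?F (regular_module S)"
    by (rule module_hom_comp[OF singleton_hom g(1)])
  have "g {x} = (\<Oplus>\<^bsub>S\<^esub>i\<in>{..<k}. x i \<otimes>\<^bsub>S\<^esub> g {unit_vector S k i})" if "x \<in> N" for x
    using free_hom_unique[OF reg h, of x] that NF by auto
  moreover have "g {x} = f x" if "x \<in> N" for x using g(2) that by auto
  moreover have "g {unit_vector S k i} \<in> carrier S" for i
    using module_homD(1)[OF h unit_vector_carrier] by simp
  ultimately show ?thesis by (intro exI[of _ "\<lambda>i. g {unit_vector S k i}"]) auto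
qed

lemma selfinjective_left_ideal:
  assumes S: "ring S" and inj: "selfinjective S" and L: "submodule L S (regular_module S)"
    and f: "f \<in> module_hom S ((regular_module S)\<lparr>carrier := L\<rparr>) (regular_module S)"
  shows "\<exists>c\<in>carrier S. \<forall>x\<in>L. f x = x \<otimes>\<^bsub>S\<^esub> c"
proof -
  interpret ring S by (rule S)
  let ?F = "power_module (regular_module S) 1"
  have reg: "left_module S (regular_module S)" by (rule left_module_regular[OF S])
  interpret reg: left_module S "regular_module S" by (rule reg)
  interpret F: left_module S ?F by (rule left_module_power[OF reg])
  have p: "(\<lambda>x. x 0) \<in> module_hom S ?F (regular_module S)" by (rule power_module_proj) simp
  let ?N = "{x \<in> carrier ?F. x 0 \<in> L}"
  have N: "submodule ?N S ?F" by (rule submodule_vimage[OF F.left_module_axioms reg p L])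
  have "(\<lambda>x. f (x 0)) \<in> module_hom S (?F\<lparr>carrier := ?N\<rparr>) (regular_module S)"
    using module_homD[OF f] module_homD[OF p] by (intro module_homI) auto
  from selfinjective_extend[OF S inj N this] obtain q where
    q: "q (0::nat) \<in> carrier S" "\<forall>x\<in>?N. f (x 0) = (\<Oplus>\<^bsub>S\<^esub>i\<in>{..<1::nat}. x i \<otimes>\<^bsub>S\<^esub> q i)" by auto
  have "f x = x \<otimes>\<^bsub>S\<^esub> q 0" if x: "x \<in> L" for x
  proof -
    have xc: "x \<in> carrier S" using reg.submoduleD(1)[OF L x] by simp
    then have "(\<lambda>i\<in>{..<1::nat}. x) \<in> ?N" using x by (auto simp: power_module_simps)
    from bspec[OF q(2) this] show ?thesis using xc q(1) by (simp add: lessThan_Suc)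
  qed
  then show ?thesis using q(1) by blast
qed

context semiprimary
begin

text \<open>Elements \<open>y = e y\<close> killed by \<open>r\<close> generate simple modules that only depend on \<open>e\<close>.\<close>

lemma simple_annihilator:
  assumes M: "left_module S M" and e: "e \<in> \<E>" and y: "y \<in> carrier M" "e \<odot>\<^bsub>M\<^esub> y = y" "y \<noteq> \<zero>\<^bsub>M\<^esub>"
    "\<And>a. a \<in> r \<Longrightarrow> a \<odot>\<^bsub>M\<^esub> y = \<zero>\<^bsub>M\<^esub>" and c: "c \<in> carrier S"
  shows "c \<odot>\<^bsub>M\<^esub> y = \<zero>\<^bsub>M\<^esub> \<longleftrightarrow> c \<otimes> e \<in> r"
proof
  interpret M: left_module S M by fact
  have ec: "e \<in> carrier S" using \<E>_closed e .
  have cy: "(c \<otimes> e) \<odot>\<^bsub>M\<^esub> y = c \<odot>\<^bsub>M\<^esub> y" using y c ec by (simp add: M.smult_assoc)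
  show "c \<odot>\<^bsub>M\<^esub> y = \<zero>\<^bsub>M\<^esub>" if "c \<otimes> e \<in> r" using y(4)[OF that] cy by simp
  show "c \<otimes> e \<in> r" if "c \<odot>\<^bsub>M\<^esub> y = \<zero>\<^bsub>M\<^esub>"
  proof (rule ccontr)
    assume "c \<otimes> e \<notin> r"
    then obtain a where a: "a \<in> carrier S" "e \<ominus> a \<otimes> (c \<otimes> e) \<in> r"
      using left_simple[OF e, of "c \<otimes> e"] c ec \<E>_idem[OF e] by (auto simp: m_assoc)
    have "e = (e \<ominus> a \<otimes> (c \<otimes> e)) \<oplus> a \<otimes> (c \<otimes> e)" using ec a c by (simp add: a_minus_def a_assoc l_neg)
    then have "e \<odot>\<^bsub>M\<^esub> y = (e \<ominus> a \<otimes> (c \<otimes> e)) \<odot>\<^bsub>M\<^esub> y \<oplus>\<^bsub>M\<^esub> (a \<otimes> (c \<otimes> e)) \<odot>\<^bsub>M\<^esub> y"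
      using M.smult_l_distr[of "e \<ominus> a \<otimes> (c \<otimes> e)" "a \<otimes> (c \<otimes> e)" y] ec a(1) c y(1) by simp
    also have "\<dots> = a \<odot>\<^bsub>M\<^esub> ((c \<otimes> e) \<odot>\<^bsub>M\<^esub> y)" using y(4)[OF a(2)] ec a(1) c y(1) by (simp add: M.smult_assoc)
    also have "\<dots> = \<zero>\<^bsub>M\<^esub>" using cy that a(1) by simp
    finally show False using y by simp
  qed
qed

lemma cyclic_hom:
  assumes M: "left_module S M" and e: "e \<in> \<E>" and y: "y \<in> carrier M" "e \<odot>\<^bsub>M\<^esub> y = y" "y \<noteq> \<zero>\<^bsub>M\<^esub>"
    "\<And>a. a \<in> r \<Longrightarrow> a \<odot>\<^bsub>M\<^esub> y = \<zero>\<^bsub>M\<^esub>"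
    and t: "t \<in> carrier S" "e \<otimes> t = t" "\<And>a. a \<in> r \<Longrightarrow> a \<otimes> t = \<zero>"
  shows "submodule {c \<odot>\<^bsub>M\<^esub> y | c. c \<in> carrier S} S M"
    and "\<exists>f \<in> module_hom S (M\<lparr>carrier := {c \<odot>\<^bsub>M\<^esub> y | c. c \<in> carrier S}\<rparr>) (regular_module S). f y = t"
proof -
  interpret M: left_module S M by fact
  let ?Y = "{c \<odot>\<^bsub>M\<^esub> y | c. c \<in> carrier S}"
  have add: "c \<odot>\<^bsub>M\<^esub> y \<oplus>\<^bsub>M\<^esub> d \<odot>\<^bsub>M\<^esub> y = (c \<oplus> d) \<odot>\<^bsub>M\<^esub> y" if "c \<in> carrier S" "d \<in> carrier S" for c d
    using that y(1) by (simp add: M.smult_l_distr)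
  have mul: "a \<odot>\<^bsub>M\<^esub> (c \<odot>\<^bsub>M\<^esub> y) = (a \<otimes> c) \<odot>\<^bsub>M\<^esub> y" if "c \<in> carrier S" "a \<in> carrier S" for a c
    using that y(1) by (simp add: M.smult_assoc)
  show Y: "submodule ?Y S M"
  proof (rule M.submoduleI)
    show "?Y \<subseteq> carrier M" using y(1) by auto
    show "\<zero>\<^bsub>M\<^esub> \<in> ?Y" using y(1) by (auto intro!: exI[of _ \<zero>])
  qed (use add mul in auto)
  define f where "f x = (SOME c. c \<in> carrier S \<and> x = c \<odot>\<^bsub>M\<^esub> y) \<otimes> t" for x
  have f: "f (c \<odot>\<^bsub>M\<^esub> y) = c \<otimes> t" if c: "c \<in> carrier S" for c
  proof -
    define d where "d = (SOME d. d \<in> carrier S \<and> c \<odot>\<^bsub>M\<^esub> y = d \<odot>\<^bsub>M\<^esub> y)"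
    have d: "d \<in> carrier S \<and> c \<odot>\<^bsub>M\<^esub> y = d \<odot>\<^bsub>M\<^esub> y" unfolding d_def by (rule someI_ex) (use c in blast)
    have "(d \<ominus> c) \<odot>\<^bsub>M\<^esub> y \<oplus>\<^bsub>M\<^esub> c \<odot>\<^bsub>M\<^esub> y = d \<odot>\<^bsub>M\<^esub> y"
      using add[of "d \<ominus> c" c] c d by (simp add: a_minus_def a_assoc l_neg)
    then have "(d \<ominus> c) \<odot>\<^bsub>M\<^esub> y = \<zero>\<^bsub>M\<^esub>" using c d y(1) by simp
    then have "(d \<ominus> c) \<otimes> e \<in> r" using simple_annihilator[OF M e y, of "d \<ominus> c"] c d by simp
    then have "(d \<ominus> c) \<otimes> e \<otimes> t = \<zero>" by (rule t(3))
    then have "(d \<ominus> c) \<otimes> t = \<zero>" using c d t \<E>_closed[OF e] by (simp add: m_assoc)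
    moreover have "(d \<ominus> c) \<otimes> t = d \<otimes> t \<ominus> c \<otimes> t" using c d t(1) by (simp add: a_minus_def l_distr l_minus)
    ultimately have "d \<otimes> t \<ominus> c \<otimes> t = \<zero>" by simp
    then have "d \<otimes> t = c \<otimes> t" by (rule diff_eq_zero[rotated 2]) (use c d t(1) in simp_all)
    then show ?thesis by (simp add: f_def d_def)
  qed
  have "f \<in> module_hom S (M\<lparr>carrier := ?Y\<rparr>) (regular_module S)"
    by (rule module_homI) (auto simp: f add mul t(1) l_distr m_assoc)
  moreover have "f y = t" using f[of \<one>] y(1) t(1) by simp
  ultimately show "\<exists>f\<in>module_hom S (M\<lparr>carrier := ?Y\<rparr>) (regular_module S). f y = t" by blast
qed

text \<open>Every nonzero cyclic module has a simple submodule.\<close>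

lemma simple_multiple:
  assumes M: "left_module S M" and x: "x \<in> carrier M" "x \<noteq> \<zero>\<^bsub>M\<^esub>"
  shows "\<exists>e\<in>\<E>. \<exists>a\<in>carrier S. e \<otimes> a = a \<and> a \<odot>\<^bsub>M\<^esub> x \<noteq> \<zero>\<^bsub>M\<^esub> \<and> (\<forall>b\<in>r. b \<odot>\<^bsub>M\<^esub> (a \<odot>\<^bsub>M\<^esub> x) = \<zero>\<^bsub>M\<^esub>)"
proof -
  interpret M: left_module S M by fact
  interpret r: ideal r S by (rule r_ideal)
  let ?Q = "\<lambda>i. \<exists>a\<in>ann_chain S r i. a \<odot>\<^bsub>M\<^esub> x \<noteq> \<zero>\<^bsub>M\<^esub>"
  obtain n where "\<one> \<in> ann_chain S r n" using left_nilpotent by blast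
  then have "?Q n" using x by (intro bexI[of _ \<one>]) auto
  then have Q: "?Q (LEAST i. ?Q i)" by (rule LeastI)
  obtain j where j: "(LEAST i. ?Q i) = Suc j"
    using Q x by (cases "LEAST i. ?Q i") auto
  then obtain a where a: "a \<in> carrier S" "\<forall>b\<in>r. b \<otimes> a \<in> ann_chain S r j" "a \<odot>\<^bsub>M\<^esub> x \<noteq> \<zero>\<^bsub>M\<^esub>" using Q by auto
  have "\<not> ?Q j" using not_less_Least[of j ?Q] j by simp
  then have "(b \<otimes> a) \<odot>\<^bsub>M\<^esub> x = \<zero>\<^bsub>M\<^esub>" if "b \<in> r" for b using a(2) that by blast
  then have rx: "b \<odot>\<^bsub>M\<^esub> (a \<odot>\<^bsub>M\<^esub> x) = \<zero>\<^bsub>M\<^esub>" if "b \<in> r" for b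
    using M.smult_assoc[OF r.Icarr[OF that] a(1) x(1)] that by simp
  have "a \<odot>\<^bsub>M\<^esub> x \<notin> {\<zero>\<^bsub>M\<^esub>}" using a by simp
  then obtain e b where eb: "e \<in> \<E>" "b \<in> carrier S" "(e \<otimes> b) \<odot>\<^bsub>M\<^esub> (a \<odot>\<^bsub>M\<^esub> x) \<notin> {\<zero>\<^bsub>M\<^esub>}"
    using idempotent_multiple_outside[OF M M.submodule_zero M.smult_closed[OF a(1) x(1)]] rx by auto
  have ec: "e \<in> carrier S" using \<E>_closed eb(1) .
  have 1: "e \<otimes> (e \<otimes> b \<otimes> a) = e \<otimes> b \<otimes> a" using ec eb a \<E>_idem[OF eb(1)] by (simp add: m_assoc[symmetric])
  have 2: "(e \<otimes> b \<otimes> a) \<odot>\<^bsub>M\<^esub> x \<noteq> \<zero>\<^bsub>M\<^esub>" using ec eb a x by (simp add: M.smult_assoc)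
  have 3: "c \<odot>\<^bsub>M\<^esub> ((e \<otimes> b \<otimes> a) \<odot>\<^bsub>M\<^esub> x) = \<zero>\<^bsub>M\<^esub>" if c: "c \<in> r" for c
  proof -
    have "(c \<otimes> (e \<otimes> b)) \<odot>\<^bsub>M\<^esub> (a \<odot>\<^bsub>M\<^esub> x) = \<zero>\<^bsub>M\<^esub>" using rx r.I_r_closed[OF c] ec eb(2) by simp
    then show ?thesis using r.Icarr[OF c] ec eb(2) a x by (simp add: M.smult_assoc)
  qed
  have "e \<otimes> b \<otimes> a \<in> carrier S" using ec eb(2) a(1) by simp
  with 1 2 3 show ?thesis by (intro bexI[OF _ eb(1)]) (rule bexI[of _ "e \<otimes> b \<otimes> a"], auto)
qed

text \<open>The annihilator of the simple module \<open>S e / r e\<close>.\<close>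

definition primitive_ideal :: "'a \<Rightarrow> 'a set"
  where "primitive_ideal e = {x \<in> carrier S. \<forall>a\<in>carrier S. x \<otimes> a \<otimes> e \<in> r}"

lemma primitive_ideal:
  assumes e: "e \<in> \<E>"
  shows "ideal (primitive_ideal e) S" "r \<subseteq> primitive_ideal e" "e \<notin> primitive_ideal e" "\<one> \<notin> primitive_ideal e"
proof -
  interpret r: ideal r S by (rule r_ideal)
  have ec: "e \<in> carrier S" using \<E>_closed e .
  show "ideal (primitive_ideal e) S"
  proof (rule idealI2)
    fix a x assume a: "a \<in> carrier S" and x: "x \<in> primitive_ideal e"
    then have xc: "x \<in> carrier S" by (simp add: primitive_ideal_def)
    show "a \<otimes> x \<in> primitive_ideal e"
      using x a ec r.I_l_closed[OF _ a] xc by (auto simp: primitive_ideal_def m_assoc)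
    have "x \<otimes> a \<otimes> b \<otimes> e \<in> r" if "b \<in> carrier S" for b
    proof -
      have "x \<otimes> (a \<otimes> b) \<otimes> e \<in> r" using x a that by (simp add: primitive_ideal_def)
      then show ?thesis using a that xc by (simp add: m_assoc)
    qed
    then show "x \<otimes> a \<in> primitive_ideal e" using a xc by (simp add: primitive_ideal_def)
  qed (use ec r.plus_closed in \<open>auto simp: primitive_ideal_def l_distr\<close>)
  show "r \<subseteq> primitive_ideal e" using r.I_r_closed r.Icarr ec by (auto simp: primitive_ideal_def)
  have "x \<notin> primitive_ideal e" if "x = \<one> \<or> x = e" for x
  proof
    assume "x \<in> primitive_ideal e"
    then have "x \<otimes> \<one> \<otimes> e \<in> r" unfolding primitive_ideal_def by blast
    then show False using that ec \<E>_idem[OF e] \<E>_proper[OF e] by auto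
  qed
  then show "e \<notin> primitive_ideal e" "\<one> \<notin> primitive_ideal e" by blast+
qed

text \<open>A nonzero element of \<open>e' (S/r) e\<close> gives an isomorphism between the simple modules of \<open>e\<close> and
  \<open>e'\<close>, and primitive ideals only depend on these.\<close>

lemma primitive_ideal_eq:
  assumes e: "e \<in> \<E>" and e': "e' \<in> \<E>" and n: "e' \<notin> primitive_ideal e"
  shows "primitive_ideal e' = primitive_ideal e"
proof -
  interpret r: ideal r S by (rule r_ideal)
  have ec: "e \<in> carrier S" "e' \<in> carrier S" using \<E>_closed e e' by auto
  obtain a where a: "a \<in> carrier S" "e' \<otimes> a \<otimes> e \<notin> r" using n ec(2) by (auto simp: primitive_ideal_def)
  let ?c = "e' \<otimes> a \<otimes> e"
  obtain b where b: "b \<in> carrier S" "e \<ominus> b \<otimes> ?c \<in> r"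
    using left_simple[OF e, of ?c] a ec \<E>_idem[OF e] by (auto simp: m_assoc)
  show ?thesis
  proof (intro equalityI subsetI)
    fix x assume x: "x \<in> primitive_ideal e'"
    then have xc: "x \<in> carrier S" by (simp add: primitive_ideal_def)
    have "x \<otimes> y \<otimes> e \<in> r" if y: "y \<in> carrier S" for y
    proof (rule r.cong_mem)
      have "x \<otimes> (y \<otimes> b) \<otimes> e' \<in> r" using x y b by (simp add: primitive_ideal_def)
      then have "x \<otimes> (y \<otimes> b) \<otimes> e' \<otimes> (a \<otimes> e) \<in> r" using r.I_r_closed a ec by simp
      then show "x \<otimes> y \<otimes> (b \<otimes> ?c) \<in> r" using xc y a b ec by (simp add: m_assoc)
      show "x \<otimes> y \<otimes> e \<ominus> x \<otimes> y \<otimes> (b \<otimes> ?c) \<in> r"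
        using r.cong_mult_left[OF ec(1) _ _ b(2)] xc y a b ec by simp
    qed (use xc y ec in simp)
    then show "x \<in> primitive_ideal e" using xc by (simp add: primitive_ideal_def)
  next
    fix x assume x: "x \<in> primitive_ideal e"
    then have xc: "x \<in> carrier S" by (simp add: primitive_ideal_def)
    have "x \<otimes> y \<otimes> e' \<in> r" if y: "y \<in> carrier S" for y
    proof (rule ccontr)
      let ?w = "x \<otimes> y \<otimes> e'"
      assume "?w \<notin> r"
      then obtain d where d: "d \<in> carrier S" "e' \<ominus> d \<otimes> ?w \<in> r"
        using left_simple[OF e', of ?w] xc y ec \<E>_idem[OF e'] by (auto simp: m_assoc)
      have "x \<otimes> (y \<otimes> e' \<otimes> a) \<otimes> e \<in> r" using x y ec a by (simp add: primitive_ideal_def)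
      then have "d \<otimes> (x \<otimes> (y \<otimes> e' \<otimes> a) \<otimes> e) \<in> r" using r.I_l_closed d by simp
      then have "d \<otimes> ?w \<otimes> (a \<otimes> e) \<in> r" using xc y ec a d by (simp add: m_assoc)
      moreover have "e' \<otimes> (a \<otimes> e) \<ominus> d \<otimes> ?w \<otimes> (a \<otimes> e) \<in> r"
        using r.cong_mult_right[OF ec(2) _ _ d(2)] xc y ec a d by simp
      ultimately have "e' \<otimes> (a \<otimes> e) \<in> r" using r.cong_mem[of "e' \<otimes> (a \<otimes> e)"] ec a by simp
      then show False using a ec by (simp add: m_assoc)
    qed
    then show "x \<in> primitive_ideal e'" using xc by (simp add: primitive_ideal_def)
  qed
qed

text \<open>A proper, finitely generated right ideal \<open>P\<close> of a left selfinjective ring has a nonzero left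
  annihilator: otherwise \<open>s \<mapsto> (s p\<^sub>1, \<dots>, s p\<^sub>k)\<close> is a split monomorphism, and a retraction shows
  \<open>1 = \<Sum> p\<^sub>i q\<^sub>i \<in> P\<close>.\<close>

lemma left_annihilator_nonzero:
  assumes inj: "selfinjective S" and P: "ideal P S" "\<one> \<notin> P"
    and noeth: "chain_stable True (submodules (opposite S) (regular_module (opposite S)))"
  shows "\<exists>s\<in>carrier S. s \<noteq> \<zero> \<and> (\<forall>p\<in>P. s \<otimes> p = \<zero>)"
proof (rule ccontr)
  assume no: "\<not> ?thesis"
  interpret P: ideal P S by (rule P)
  have op: "left_module (opposite S) (regular_module (opposite S))"
    by (intro left_module_regular ring_opposite ring_axioms)
  interpret op: left_module "opposite S" "regular_module (opposite S)" by (rule op)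
  have "submodule P (opposite S) (regular_module (opposite S))"
    using P(1) by (intro submodule_regular_ideal) (simp add: ideal_opposite[OF ring_axioms])
  from noetherian_finite_span[OF op noeth this]
  obtain F where F: "finite F" "F \<subseteq> P" "P = lin_span (opposite S) (regular_module (opposite S)) F" by blast
  obtain p and k :: nat where p: "F = p ` {..<k}"
    using F(1) by (metis finite_imp_nat_seg_image_inj_on lessThan_def)
  have pP: "p i \<in> P" "p i \<in> carrier S" if "i < k" for i using p F(2) P.Icarr that by auto
  have zero: "s = \<zero>" if s: "s \<in> carrier S" "\<And>i. i < k \<Longrightarrow> s \<otimes> p i = \<zero>" for s
  proof -
    have "submodule {x \<in> carrier S. s \<otimes> x = \<zero>} (opposite S) (regular_module (opposite S))"
      by (rule op.submoduleI) (use s(1) in \<open>auto simp: r_distr m_assoc[symmetric]\<close>)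
    then have "P \<subseteq> {x \<in> carrier S. s \<otimes> x = \<zero>}"
      unfolding F(3) by (rule span_minimal) (use p pP s(2) in auto)
    then show ?thesis using no s(1) by blast
  qed
  let ?F = "power_module (regular_module S) k"
  have reg: "left_module S (regular_module S)" by (rule left_module_regular[OF ring_axioms])
  interpret reg: left_module S "regular_module S" by (rule reg)
  interpret F: left_module S ?F by (rule left_module_power[OF reg])
  define v where "v s = (\<lambda>i\<in>{..<k}. s \<otimes> p i)" for s
  have vh: "v \<in> module_hom S (regular_module S) ?F"
    by (rule module_homI) (use pP in \<open>auto simp: v_def power_module_simps l_distr m_assoc\<close>)
  have vinj: "inj_on v (carrier S)"
  proof -
    have "s = \<zero>" if s: "s \<in> carrier S" and v: "v s = \<zero>\<^bsub>?F\<^esub>" for s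
    proof (rule zero[OF s])
      fix i assume "i < k"
      then show "s \<otimes> p i = \<zero>" using fun_cong[OF v, of i] by (simp add: v_def power_module_simps)
    qed
    then show ?thesis using module_hom_inj_iff[OF reg F.left_module_axioms vh] by auto
  qed
  have N: "submodule (v ` carrier S) S ?F"
    using submodule_image[OF reg F.left_module_axioms vh reg.submodule_self] by simp
  define w where "w = inv_into (carrier S) v"
  have w: "w (v s) = s" if "s \<in> carrier S" for s using vinj that by (simp add: w_def)
  have "w \<in> module_hom S (?F\<lparr>carrier := v ` carrier S\<rparr>) (regular_module S)"
    by (rule module_homI) (auto simp: w simp flip: module_homD(2,3)[OF vh, simplified])
  from selfinjective_extend[OF ring_axioms inj N this] obtain q where
    q: "\<And>i. i < k \<Longrightarrow> q i \<in> carrier S" "\<And>x. x \<in> v ` carrier S \<Longrightarrow> w x = (\<Oplus>i\<in>{..<k}. x i \<otimes> q i)" by blast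
  have "\<one> = (\<Oplus>i\<in>{..<k}. v \<one> i \<otimes> q i)" using q(2)[of "v \<one>"] w[of \<one>] by simp
  also have "\<dots> = (\<Oplus>i\<in>{..<k}. p i \<otimes> q i)"
    by (rule finsum_cong') (use q(1) pP in \<open>auto simp: v_def\<close>)
  also have "\<dots> \<in> P"
  proof -
    have "m \<le> k \<Longrightarrow> (\<Oplus>i\<in>{..<m}. p i \<otimes> q i) \<in> P" for m
    proof (induction m)
      case (Suc m)
      then show ?case
        using q(1) pP P.I_r_closed P.plus_closed
        by (subst lessThan_Suc, subst finsum_insert) auto
    qed simp
    then show ?thesis by blast
  qed
  finally show False using P(2) by blast
qed

text \<open>Every simple module embeds into a selfinjective ring: each primitive ideal \<open>P\<close> has a simple
  left ideal in its left annihilator, and by injectivity the isomorphism class of this left ideal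
  determines \<open>P\<close>. As there are finitely many classes, all of them occur.\<close>

lemma simple_left_ideal_exists:
  assumes inj: "selfinjective S" and fin: "finite \<E>"
    and noeth: "chain_stable True (submodules (opposite S) (regular_module (opposite S)))"
    and e: "e \<in> \<E>"
  shows "\<exists>t\<in>carrier S. t \<noteq> \<zero> \<and> e \<otimes> t = t \<and> (\<forall>a\<in>r. a \<otimes> t = \<zero>)"
proof -
  interpret r: ideal r S by (rule r_ideal)
  have reg: "left_module S (regular_module S)" by (rule left_module_regular[OF ring_axioms])
  let ?P = primitive_ideal
  let ?simple = "\<lambda>h t. t \<in> carrier S \<and> t \<noteq> \<zero> \<and> h \<otimes> t = t \<and> (\<forall>a\<in>r. a \<otimes> t = \<zero>)"
  have "\<exists>h t. h \<in> \<E> \<and> ?simple h t \<and> (\<forall>p\<in>?P e. t \<otimes> p = \<zero>)" if e: "e \<in> \<E>" for e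
  proof -
    obtain s where s: "s \<in> carrier S" "s \<noteq> \<zero>" "\<forall>p\<in>?P e. s \<otimes> p = \<zero>"
      using left_annihilator_nonzero[OF inj primitive_ideal(1,4)[OF e] noeth] by blast
    obtain h a where ha: "h \<in> \<E>" "a \<in> carrier S" "h \<otimes> a = a" "a \<otimes> s \<noteq> \<zero>" "\<forall>b\<in>r. b \<otimes> (a \<otimes> s) = \<zero>"
      using simple_multiple[OF reg, of s] s by auto
    have "h \<otimes> (a \<otimes> s) = a \<otimes> s" using ha s \<E>_closed by (simp flip: m_assoc)
    moreover have "a \<otimes> s \<otimes> p = \<zero>" if "p \<in> ?P e" for p
      using s that ha(2) ideal.Icarr[OF primitive_ideal(1)[OF e] that] by (simp add: m_assoc)
    ultimately show ?thesis using ha s by blast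
  qed
  then obtain h t where ht: "\<And>e. e \<in> \<E> \<Longrightarrow> h e \<in> \<E>" "\<And>e. e \<in> \<E> \<Longrightarrow> ?simple (h e) (t e)"
    "\<And>e p. e \<in> \<E> \<Longrightarrow> p \<in> ?P e \<Longrightarrow> t e \<otimes> p = \<zero>" by metis
  have move: "\<exists>a\<in>carrier S. ?simple h' (h' \<otimes> (a \<otimes> t))"
    if hh: "h \<in> \<E>" "h' \<in> \<E>" "?P h = ?P h'" and t: "?simple h t" for h h' t
  proof -
    have hc: "h \<in> carrier S" "h' \<in> carrier S" using \<E>_closed hh by auto
    have "h' \<notin> ?P h" using primitive_ideal(3)[OF hh(2)] hh(3) by simp
    then obtain a where a: "a \<in> carrier S" "h' \<otimes> a \<otimes> h \<notin> r" using hc by (auto simp: primitive_ideal_def)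
    have "h' \<otimes> a \<otimes> t \<noteq> \<zero>"
      using simple_annihilator[OF reg hh(1), of t "h' \<otimes> a"] t a hc by simp
    moreover have "c \<otimes> (h' \<otimes> (a \<otimes> t)) = \<zero>" if "c \<in> r" for c
    proof -
      have "(c \<otimes> (h' \<otimes> a)) \<otimes> t = \<zero>" using t r.I_r_closed[OF that] a hc by blast
      then show ?thesis using r.Icarr[OF that] t a hc by (simp add: m_assoc)
    qed
    moreover have "h' \<otimes> (h' \<otimes> (a \<otimes> t)) = h' \<otimes> (a \<otimes> t)"
      using \<E>_idem[OF hh(2)] t a hc by (simp flip: m_assoc)
    ultimately show ?thesis using t a hc by (intro bexI[of _ a]) (auto simp: m_assoc)
  qed
  \<comment> \<open>If \<open>S t e1\<close> and \<open>S t e2\<close> are isomorphic, then \<open>t e2 = s c\<close> for some \<open>s \<in> S t e1\<close> by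
    injectivity, so that \<open>t e2\<close> is killed from the right by \<open>P e1\<close> as well as by \<open>P e2\<close>. Both then
    equal \<open>P e3\<close> for any \<open>e3\<close> that does not annihilate \<open>t e2 S\<close>.\<close>
  have inj_P: "?P e1 = ?P e2" if e: "e1 \<in> \<E>" "e2 \<in> \<E>" and eq: "?P (h e1) = ?P (h e2)" for e1 e2
  proof -
    obtain a where a: "a \<in> carrier S" "?simple (h e2) (h e2 \<otimes> (a \<otimes> t e1))"
      using move[OF ht(1)[OF e(1)] ht(1)[OF e(2)] eq ht(2)[OF e(1)]] by blast
    let ?s = "h e2 \<otimes> (a \<otimes> t e1)"
    have hc: "h e2 \<in> carrier S" "t e1 \<in> carrier S" "t e2 \<in> carrier S" using ht \<E>_closed e by blast+
    have sc: "?s \<in> carrier S" using hc a by simp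
    let ?Y = "{c \<odot>\<^bsub>regular_module S\<^esub> ?s | c. c \<in> carrier S}"
    note ch = cyclic_hom[OF reg ht(1)[OF e(2)], of ?s "t e2"]
    have Y: "submodule ?Y S (regular_module S)"
      by (rule ch(1)) (use a(2) ht(2)[OF e(2)] in simp_all)
    have "\<exists>f\<in>module_hom S ((regular_module S)\<lparr>carrier := ?Y\<rparr>) (regular_module S). f ?s = t e2"
      by (rule ch(2)) (use a(2) ht(2)[OF e(2)] in simp_all)
    then obtain f where f: "f \<in> module_hom S ((regular_module S)\<lparr>carrier := ?Y\<rparr>) (regular_module S)" "f ?s = t e2"
      by (elim bexE)
    obtain c where c: "c \<in> carrier S" "\<forall>x\<in>?Y. f x = x \<otimes> c"
      using selfinjective_left_ideal[OF ring_axioms inj Y f(1)] by (elim bexE)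
    have "?s \<in> ?Y" using sc by (auto intro!: exI[of _ \<one>])
    then have t2: "t e2 = ?s \<otimes> c" using c f(2) by auto
    have kill1: "t e2 \<otimes> p = \<zero>" if p: "p \<in> ?P e1" for p
    proof -
      have "c \<otimes> p \<in> ?P e1" by (rule ideal.I_l_closed[OF primitive_ideal(1)[OF e(1)] p c(1)])
      then have "t e1 \<otimes> (c \<otimes> p) = \<zero>" by (rule ht(3)[OF e(1)])
      then show ?thesis
        unfolding t2 using hc a c ideal.Icarr[OF primitive_ideal(1)[OF e(1)] p] by (simp add: m_assoc)
    qed
    let ?I = "{x \<in> carrier S. \<forall>a\<in>carrier S. t e2 \<otimes> a \<otimes> x = \<zero>}"
    have I: "ideal ?I S"
    proof (rule idealI2)
      fix a x assume a: "a \<in> carrier S" and x: "x \<in> ?I"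
      show "x \<otimes> a \<in> ?I" using a x hc by (auto simp flip: m_assoc)
      have "t e2 \<otimes> b \<otimes> (a \<otimes> x) = \<zero>" if "b \<in> carrier S" for b
      proof -
        have "t e2 \<otimes> (b \<otimes> a) \<otimes> x = \<zero>" using x a that by blast
        then show ?thesis using a that x hc by (simp add: m_assoc)
      qed
      then show "a \<otimes> x \<in> ?I" using a x by blast
    qed (use hc in \<open>auto simp: r_distr\<close>)
    have PI: "?P e' \<subseteq> ?I" if e': "e' \<in> \<E>" and k: "\<And>p. p \<in> ?P e' \<Longrightarrow> t e2 \<otimes> p = \<zero>" for e'
    proof
      fix x assume x: "x \<in> ?P e'"
      interpret P: ideal "?P e'" S by (rule primitive_ideal(1)[OF e'])
      have "t e2 \<otimes> (a \<otimes> x) = \<zero>" if "a \<in> carrier S" for a using k P.I_l_closed[OF x that] by blast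
      then show "x \<in> ?I" using P.Icarr[OF x] hc by (simp add: m_assoc)
    qed
    have "\<one> \<notin> ?I"
    proof
      assume "\<one> \<in> ?I"
      then have "t e2 \<otimes> \<one> \<otimes> \<one> = \<zero>" by blast
      then show False using ht(2)[OF e(2)] by simp
    qed
    moreover have "r \<subseteq> ?I" using PI[OF e(2) ht(3)[OF e(2)]] primitive_ideal(2)[OF e(2)] by blast
    ultimately obtain e3 where e3: "e3 \<in> \<E>" "e3 \<notin> ?I" using cover[OF I] by blast
    have "?P e3 = ?P e1" "?P e3 = ?P e2"
      using e3 PI[OF e(1) kill1] PI[OF e(2) ht(3)[OF e(2)]] primitive_ideal_eq[OF _ e3(1)] e by blast+
    then show ?thesis by simp
  qed
  have "?P ` \<E> = (\<lambda>e. ?P (h e)) ` \<E>"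
  proof -
    have sub: "(\<lambda>e. ?P (h e)) ` \<E> \<subseteq> ?P ` \<E>" using ht(1) by blast
    define g where "g Q = ?P (SOME e. e \<in> \<E> \<and> Q = ?P (h e))" for Q
    have "g (?P (h e)) = ?P e" if "e \<in> \<E>" for e
    proof -
      let ?s = "SOME e'. e' \<in> \<E> \<and> ?P (h e) = ?P (h e')"
      have "?s \<in> \<E> \<and> ?P (h e) = ?P (h ?s)" by (rule someI[of _ e]) (use that in simp)
      then have "?P e = ?P ?s" using inj_P[OF that] by blast
      then show ?thesis by (simp only: g_def)
    qed
    then have "?P ` \<E> = g ` (\<lambda>e. ?P (h e)) ` \<E>" by (auto simp: image_image)
    then have "card (?P ` \<E>) \<le> card ((\<lambda>e. ?P (h e)) ` \<E>)"
      using card_image_le[of "(\<lambda>e. ?P (h e)) ` \<E>" g] fin by simp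
    then show ?thesis using card_seteq[OF _ sub] fin by simp
  qed
  then obtain e1 where e1: "e1 \<in> \<E>" "?P e = ?P (h e1)" using e by blast
  obtain a where "a \<in> carrier S" "?simple e (e \<otimes> (a \<otimes> t e1))"
    using move[OF ht(1)[OF e1(1)] e e1(2)[symmetric] ht(2)[OF e1(1)]] by blast
  then show ?thesis by blast
qed

text \<open>Homomorphisms to a selfinjective ring separate points, first on the type of the test modules.\<close>

lemma separating_hom_umodule:
  fixes X :: "'a umodule"
  assumes inj: "selfinjective S" and fin: "finite \<E>"
    and noeth: "chain_stable True (submodules (opposite S) (regular_module (opposite S)))"
    and X: "left_module S X" and x: "x \<in> carrier X" "x \<noteq> \<zero>\<^bsub>X\<^esub>"
  shows "\<exists>f\<in>module_hom S X (regular_module S). f x \<noteq> \<zero>"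
proof -
  interpret X: left_module S X by (rule X)
  have reg: "left_module S (regular_module S)" by (rule left_module_regular[OF ring_axioms])
  obtain e a where ea: "e \<in> \<E>" "a \<in> carrier S" "e \<otimes> a = a" "a \<odot>\<^bsub>X\<^esub> x \<noteq> \<zero>\<^bsub>X\<^esub>" "\<forall>b\<in>r. b \<odot>\<^bsub>X\<^esub> (a \<odot>\<^bsub>X\<^esub> x) = \<zero>\<^bsub>X\<^esub>"
    using simple_multiple[OF X x] by blast
  obtain t where t: "t \<in> carrier S" "t \<noteq> \<zero>" "e \<otimes> t = t" "\<forall>a\<in>r. a \<otimes> t = \<zero>"
    using simple_left_ideal_exists[OF inj fin noeth ea(1)] by blast
  let ?y = "a \<odot>\<^bsub>X\<^esub> x"
  let ?Y = "{c \<odot>\<^bsub>X\<^esub> ?y | c. c \<in> carrier S}"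
  have y: "?y \<in> carrier X" using ea x by simp
  have ey: "e \<odot>\<^bsub>X\<^esub> ?y = ?y" using ea x \<E>_closed[OF ea(1)] by (simp add: X.smult_assoc[symmetric])
  note ch = cyclic_hom[OF X ea(1) y ey ea(4), of t]
  have Y: "submodule ?Y S X" by (rule ch(1)) (use ea(5) t in simp_all)
  have "\<exists>f\<in>module_hom S (X\<lparr>carrier := ?Y\<rparr>) (regular_module S). f ?y = t"
    by (rule ch(2)) (use ea(5) t in simp_all)
  then obtain f where f: "f \<in> module_hom S (X\<lparr>carrier := ?Y\<rparr>) (regular_module S)" "f ?y = t" by (elim bexE)
  have "(\<lambda>x. x) \<in> module_hom S (X\<lparr>carrier := ?Y\<rparr>) X" by (rule module_homI) (use y in auto)
  then obtain g where g: "g \<in> module_hom S X (regular_module S)" "\<forall>x\<in>?Y. g x = f x"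
    using selfinjectiveD[OF inj, of "X\<lparr>carrier := ?Y\<rparr>" X "\<lambda>x. x" f] X.left_module_sub[OF Y] X f(1)
    by auto
  have "?y \<in> ?Y" using y by (auto intro!: exI[of _ \<one>])
  then have "g ?y = t" using g(2) f(2) by auto
  then have "a \<otimes> g x = t" using module_homD(3)[OF g(1) ea(2) x(1)] by simp
  then have "g x \<noteq> \<zero>" using t(2) ea(2) by auto
  then show ?thesis using g(1) by blast
qed

lemma separating_hom:
  fixes X :: "('a, 'm, 'x) module_scheme"
  assumes inj: "selfinjective S" and fin: "finite \<E>"
    and noeth: "chain_stable True (submodules (opposite S) (regular_module (opposite S)))"
    and X: "left_module S X" "finitely_generated S X" and x: "x \<in> carrier X" "x \<noteq> \<zero>\<^bsub>X\<^esub>"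
  shows "\<exists>f\<in>module_hom S X (regular_module S). f x \<noteq> \<zero>"
proof -
  interpret X: left_module S X by (rule X)
  obtain N :: "'a umodule" and h where N: "left_module S N" and h: "h \<in> module_hom S X N" "bij_betw h (carrier X) (carrier N)"
    using finitely_generated_representable[OF X] by blast
  have "inj_on h (carrier X)" using h(2) by (rule bij_betw_imp_inj_on)
  then have "h x \<noteq> \<zero>\<^bsub>N\<^esub>" using module_hom_inj_iff[OF X(1) N h(1)] x by blast
  then obtain f where f: "f \<in> module_hom S N (regular_module S)" "f (h x) \<noteq> \<zero>"
    using separating_hom_umodule[OF inj fin noeth N module_homD(1)[OF h(1) x(1)]] by blast
  then show ?thesis by (intro bexI[OF _ module_hom_comp[OF h(1) f(1)]])
qed

end

text \<open>If \<open>T\<close> is generated over \<open>S\<close> by finitely many elements \<open>t\<close> and \<open>M\<close> over \<open>T\<close> by finitely many \<open>x\<close>, the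
  products \<open>t x\<close> generate \<open>M\<close> over \<open>S\<close>.\<close>

lemma finitely_generated_restrict:
  assumes S: "ring S" and T: "ring T" and \<phi>: "\<phi> \<in> ring_hom S T"
    and fgT: "finitely_generated S (restrict_scalars \<phi> (regular_module T))"
    and M: "left_module T M" and fgM: "finitely_generated T M"
  shows "finitely_generated S (restrict_scalars \<phi> M)"
proof -
  interpret M: left_module T M by (rule M)
  interpret r: left_module S "restrict_scalars \<phi> M" by (rule left_module_restrict[OF M S \<phi>])
  interpret t: left_module S "restrict_scalars \<phi> (regular_module T)"
    by (rule left_module_restrict[OF left_module_regular[OF T] S \<phi>])
  obtain D where D: "finite D" "D \<subseteq> carrier T" "lin_span S (restrict_scalars \<phi> (regular_module T)) D = carrier T"
    using fgT unfolding finitely_generated_span by auto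
  obtain F where F: "finite F" "F \<subseteq> carrier M" "lin_span T M F = carrier M"
    using fgM unfolding finitely_generated_span by auto
  let ?G = "(\<lambda>(d, x). d \<odot>\<^bsub>M\<^esub> x) ` (D \<times> F)"
  have G: "finite ?G" "?G \<subseteq> carrier M" using D F by auto
  have "carrier M \<subseteq> N" if N: "submodule N S (restrict_scalars \<phi> M)" "?G \<subseteq> N" for N
  proof -
    note ND = r.submoduleD[OF N(1), simplified]
    have tx: "t \<odot>\<^bsub>M\<^esub> x \<in> N" if t: "t \<in> carrier T" and x: "x \<in> F" for t x
    proof -
      have xM: "x \<in> carrier M" using x F(2) by blast
      have "submodule {t \<in> carrier T. t \<odot>\<^bsub>M\<^esub> x \<in> N} S (restrict_scalars \<phi> (regular_module T))"
        by (rule t.submoduleI)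
          (use ND xM ring_hom_memE(1)[OF \<phi>] in \<open>auto simp: M.smult_l_distr M.smult_assoc\<close>)
      then have "lin_span S (restrict_scalars \<phi> (regular_module T)) D \<subseteq> {t \<in> carrier T. t \<odot>\<^bsub>M\<^esub> x \<in> N}"
        by (rule span_minimal) (use N(2) D(2) x in auto)
      then have "carrier T \<subseteq> {t \<in> carrier T. t \<odot>\<^bsub>M\<^esub> x \<in> N}" by (simp only: D(3))
      then show ?thesis using t by blast
    qed
    let ?Y = "{y \<in> carrier M. \<forall>t\<in>carrier T. t \<odot>\<^bsub>M\<^esub> y \<in> N}"
    have "submodule ?Y T M"
    proof (rule M.submoduleI)
      fix a y assume a: "a \<in> carrier T" and y: "y \<in> ?Y"
      have "t \<odot>\<^bsub>M\<^esub> (a \<odot>\<^bsub>M\<^esub> y) \<in> N" if "t \<in> carrier T" for t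
      proof -
        have "(t \<otimes>\<^bsub>T\<^esub> a) \<odot>\<^bsub>M\<^esub> y \<in> N" using y a that by blast
        then show ?thesis using y a that by (simp add: M.smult_assoc)
      qed
      then show "a \<odot>\<^bsub>M\<^esub> y \<in> ?Y" using a y by blast
    qed (use ND(3,4) in \<open>auto simp: M.smult_r_distr\<close>)
    then have "lin_span T M F \<subseteq> ?Y" by (rule span_minimal) (use tx F(2) in auto)
    then have "carrier M \<subseteq> ?Y" by (simp only: F(3))
    then have "\<one>\<^bsub>T\<^esub> \<odot>\<^bsub>M\<^esub> y \<in> N" if "y \<in> carrier M" for y using that by blast
    then show ?thesis by auto
  qed
  then have "carrier M \<subseteq> lin_span S (restrict_scalars \<phi> M) ?G" unfolding lin_span_def by blast
  moreover have "lin_span S (restrict_scalars \<phi> M) ?G \<subseteq> carrier M"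
    using span_minimal[OF r.submodule_self, of ?G] G(2) by simp
  ultimately show ?thesis unfolding finitely_generated_span using G by (intro exI[of _ ?G]) auto
qed

section \<open>The Morita ring with zero bimodule maps\<close>

lemma morita_simps [simp]:
  "carrier (morita_ring L) = carrier L \<times> carrier L \<times> carrier L \<times> carrier L"
  "one (morita_ring L) = (\<one>\<^bsub>L\<^esub>, \<zero>\<^bsub>L\<^esub>, \<zero>\<^bsub>L\<^esub>, \<one>\<^bsub>L\<^esub>)"
  "zero (morita_ring L) = (\<zero>\<^bsub>L\<^esub>, \<zero>\<^bsub>L\<^esub>, \<zero>\<^bsub>L\<^esub>, \<zero>\<^bsub>L\<^esub>)"
  "(a, n, m, b) \<otimes>\<^bsub>morita_ring L\<^esub> (a', n', m', b') =
    (a \<otimes>\<^bsub>L\<^esub> a', a \<otimes>\<^bsub>L\<^esub> n' \<oplus>\<^bsub>L\<^esub> n \<otimes>\<^bsub>L\<^esub> b', m \<otimes>\<^bsub>L\<^esub> a' \<oplus>\<^bsub>L\<^esub> b \<otimes>\<^bsub>L\<^esub> m', b \<otimes>\<^bsub>L\<^esub> b')"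
  "(a, n, m, b) \<oplus>\<^bsub>morita_ring L\<^esub> (a', n', m', b') =
    (a \<oplus>\<^bsub>L\<^esub> a', n \<oplus>\<^bsub>L\<^esub> n', m \<oplus>\<^bsub>L\<^esub> m', b \<oplus>\<^bsub>L\<^esub> b')"
  by (simp_all add: morita_ring_def)

lemma morita_minus:
  assumes L: "ring L" and c: "{a, n, m, b, a', n', m', b'} \<subseteq> carrier L"
  shows "(a, n, m, b) \<ominus>\<^bsub>morita_ring L\<^esub> (a', n', m', b') =
    (a \<ominus>\<^bsub>L\<^esub> a', n \<ominus>\<^bsub>L\<^esub> n', m \<ominus>\<^bsub>L\<^esub> m', b \<ominus>\<^bsub>L\<^esub> b')"
proof -
  interpret ring L by (rule L)
  interpret G: ring "morita_ring L" by (rule ring_morita_ring[OF L])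
  have "\<ominus>\<^bsub>morita_ring L\<^esub> (a', n', m', b') = (\<ominus>\<^bsub>L\<^esub> a', \<ominus>\<^bsub>L\<^esub> n', \<ominus>\<^bsub>L\<^esub> m', \<ominus>\<^bsub>L\<^esub> b')"
    by (rule G.minus_equality) (use c in \<open>auto simp: l_neg\<close>)
  then show ?thesis by (simp add: a_minus_def)
qed

definition morita_diag :: "('a, 's) ring_scheme \<Rightarrow> 'a \<Rightarrow> 'a \<times> 'a \<times> 'a \<times> 'a"
  where "morita_diag L a = (a, \<zero>\<^bsub>L\<^esub>, \<zero>\<^bsub>L\<^esub>, a)"

lemma morita_diag_hom:
  assumes L: "ring L"
  shows "morita_diag L \<in> ring_hom L (morita_ring L)"
    "morita_diag L \<in> ring_hom (opposite L) (opposite (morita_ring L))"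
proof -
  interpret ring L by (rule L)
  show "morita_diag L \<in> ring_hom L (morita_ring L)"
    "morita_diag L \<in> ring_hom (opposite L) (opposite (morita_ring L))"
    by (rule ring_hom_memI; auto simp: morita_diag_def)+
qed

lemma morita_finite:
  assumes L: "ring L"
  shows "finitely_generated L (restrict_scalars (morita_diag L) (regular_module (morita_ring L)))"
    "finitely_generated (opposite L) (restrict_scalars (morita_diag L) (regular_module (opposite (morita_ring L))))"
proof -
  interpret ring L by (rule L)
  let ?z = "\<zero>\<^bsub>L\<^esub>" and ?o = "\<one>\<^bsub>L\<^esub>"
  let ?F = "{(?o, ?z, ?z, ?z), (?z, ?o, ?z, ?z), (?z, ?z, ?o, ?z), (?z, ?z, ?z, ?o)}"
  have gen: "finitely_generated A M" if M: "left_module A M" and c: "carrier M = carrier (morita_ring L)"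
    "carrier A = carrier L" and add: "\<And>x y. x \<oplus>\<^bsub>M\<^esub> y = x \<oplus>\<^bsub>morita_ring L\<^esub> y"
    and smult: "\<And>a. a \<in> carrier L \<Longrightarrow> a \<odot>\<^bsub>M\<^esub> (?o, ?z, ?z, ?z) = (a, ?z, ?z, ?z)"
      "\<And>a. a \<in> carrier L \<Longrightarrow> a \<odot>\<^bsub>M\<^esub> (?z, ?o, ?z, ?z) = (?z, a, ?z, ?z)"
      "\<And>a. a \<in> carrier L \<Longrightarrow> a \<odot>\<^bsub>M\<^esub> (?z, ?z, ?o, ?z) = (?z, ?z, a, ?z)"
      "\<And>a. a \<in> carrier L \<Longrightarrow> a \<odot>\<^bsub>M\<^esub> (?z, ?z, ?z, ?o) = (?z, ?z, ?z, a)"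
    for A :: "'a ring" and M :: "('a, 'a \<times> 'a \<times> 'a \<times> 'a) module"
  proof -
    interpret M: left_module A M by (rule M)
    have all: "carrier M \<subseteq> N" if N: "submodule N A M" "?F \<subseteq> N" for N
    proof
      note ND = M.submoduleD[OF N(1)]
      fix x assume "x \<in> carrier M"
      then obtain a n m b where x: "x = (a, n, m, b)" and anmb: "a \<in> carrier L" "n \<in> carrier L" "m \<in> carrier L" "b \<in> carrier L"
        by (auto simp: c)
      have 1: "(a, ?z, ?z, ?z) \<in> N" "(?z, n, ?z, ?z) \<in> N" "(?z, ?z, m, ?z) \<in> N" "(?z, ?z, ?z, b) \<in> N"
        using ND(5)[of a "(?o, ?z, ?z, ?z)"] ND(5)[of n "(?z, ?o, ?z, ?z)"] ND(5)[of m "(?z, ?z, ?o, ?z)"]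
          ND(5)[of b "(?z, ?z, ?z, ?o)"] N(2) anmb smult by (simp_all add: c)
      have "(a, ?z, ?z, ?z) \<oplus>\<^bsub>M\<^esub> ((?z, n, ?z, ?z) \<oplus>\<^bsub>M\<^esub> ((?z, ?z, m, ?z) \<oplus>\<^bsub>M\<^esub> (?z, ?z, ?z, b))) \<in> N"
        by (intro ND(4) 1)
      then show "x \<in> N" using anmb by (simp add: x add)
    qed
    have F: "?F \<subseteq> carrier M" "finite ?F" by (auto simp: c)
    have "carrier M \<subseteq> lin_span A M ?F" unfolding lin_span_def by (rule Inter_greatest) (use all in blast)
    then have "lin_span A M ?F = carrier M" using span_minimal[OF M.submodule_self F(1)] by blast
    then show ?thesis unfolding finitely_generated_span using F by blast
  qed
  have eq: "finitely_generated (opposite (opposite L)) M \<longleftrightarrow> finitely_generated L M" if "left_module L M" "left_module (opposite (opposite L)) M" for M :: "('a, 'a \<times> 'a \<times> 'a \<times> 'a) module"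
    unfolding finitely_generated_def left_module.submodule_iff[OF that(1)] left_module.submodule_iff[OF that(2)] by simp
  have G: "ring (morita_ring L)" by (rule ring_morita_ring[OF L])
  have oo: "ring (opposite (opposite L))" by (intro ring_opposite L)
  have l1: "left_module L (restrict_scalars (morita_diag L) (regular_module (morita_ring L)))"
    by (rule left_module_restrict[OF left_module_regular[OF G] L morita_diag_hom(1)[OF L]])
  have l2: "left_module (opposite (opposite L)) (restrict_scalars (morita_diag L) (regular_module (morita_ring L)))"
    by (rule left_module_restrict[OF left_module_regular[OF G] oo])
       (use morita_diag_hom(1)[OF L] in \<open>simp add: ring_hom_def\<close>)
  have "finitely_generated (opposite (opposite L)) (restrict_scalars (morita_diag L) (regular_module (morita_ring L)))"
    by (rule gen[OF l2]) (auto simp: morita_diag_def)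
  then show "finitely_generated L (restrict_scalars (morita_diag L) (regular_module (morita_ring L)))"
    using eq[OF l1 l2] by simp
  have l3: "left_module (opposite L) (restrict_scalars (morita_diag L) (regular_module (opposite (morita_ring L))))"
    by (rule left_module_restrict[OF left_module_regular[OF ring_opposite[OF G]] ring_opposite[OF L] morita_diag_hom(2)[OF L]])
  show "finitely_generated (opposite L) (restrict_scalars (morita_diag L) (regular_module (opposite (morita_ring L))))"
    by (rule gen[OF l3]) (auto simp: morita_diag_def)
qed

text \<open>The radical of the Morita ring has the radical of \<open>L\<close> on the diagonal and everything off the
  diagonal; its powers reach zero one step later.\<close>

definition morita_radical :: "('a, 's) ring_scheme \<Rightarrow> 'a set \<Rightarrow> ('a \<times> 'a \<times> 'a \<times> 'a) set"
  where "morita_radical L r = r \<times> carrier L \<times> carrier L \<times> r"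

lemma ideal_morita_radical:
  assumes "ideal r L"
  shows "ideal (morita_radical L r) (morita_ring L)"
proof -
  interpret r: ideal r L by fact
  interpret G: ring "morita_ring L" by (rule ring_morita_ring[OF r.ring_axioms])
  show ?thesis
    by (rule G.idealI2) (auto simp: morita_radical_def r.plus_closed r.I_l_closed r.I_r_closed r.Icarr)
qed

lemma morita_ann_chain:
  assumes r: "ideal r L"
  shows "\<lbrakk>a \<in> ann_chain L r i; b \<in> ann_chain L r i; n \<in> ann_chain L r (Suc i); m \<in> ann_chain L r (Suc i)\<rbrakk>
      \<Longrightarrow> (a, n, m, b) \<in> ann_chain (morita_ring L) (morita_radical L r) (Suc i)"
    and "\<lbrakk>a \<in> ann_chain (opposite L) r i; b \<in> ann_chain (opposite L) r i;
       n \<in> ann_chain (opposite L) r (Suc i); m \<in> ann_chain (opposite L) r (Suc i)\<rbrakk>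
      \<Longrightarrow> (a, n, m, b) \<in> ann_chain (opposite (morita_ring L)) (morita_radical L r) (Suc i)"
proof -
  interpret r: ideal r L by (rule r)
  have r': "ideal r (opposite L)" using r by (simp add: ideal_opposite[OF r.ring_axioms])
  have I: "ideal (ann_chain L r i) L" for i by (rule ann_chain_ideal[OF r])
  have I': "ideal (ann_chain (opposite L) r i) L" for i
    using ann_chain_ideal[OF r', of i] by (simp add: ideal_opposite[OF r.ring_axioms])
  note cl = ideal.plus_closed[OF I] ideal.I_l_closed[OF I] ideal.Icarr[OF I]
  note cl' = ideal.plus_closed[OF I'] ideal.I_r_closed[OF I'] ideal.Icarr[OF I']
  show "\<lbrakk>a \<in> ann_chain L r i; b \<in> ann_chain L r i; n \<in> ann_chain L r (Suc i); m \<in> ann_chain L r (Suc i)\<rbrakk>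
      \<Longrightarrow> (a, n, m, b) \<in> ann_chain (morita_ring L) (morita_radical L r) (Suc i)"
  proof (induction i arbitrary: a n m b)
    case 0
    then show ?case by (auto simp: morita_radical_def r.Icarr)
  next
    case (Suc i)
    have c: "a \<in> carrier L" "b \<in> carrier L" "n \<in> carrier L" "m \<in> carrier L" using Suc.prems cl(3) by blast+
    have "x \<otimes>\<^bsub>morita_ring L\<^esub> (a, n, m, b) \<in> ann_chain (morita_ring L) (morita_radical L r) (Suc i)"
      if x: "x \<in> morita_radical L r" for x
    proof -
      obtain p u v q where x': "x = (p, u, v, q)" "p \<in> r" "q \<in> r" "u \<in> carrier L" "v \<in> carrier L"
        using x by (auto simp: morita_radical_def)
      have h: "p \<otimes>\<^bsub>L\<^esub> a \<in> ann_chain L r i" "q \<otimes>\<^bsub>L\<^esub> b \<in> ann_chain L r i"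
        "p \<otimes>\<^bsub>L\<^esub> n \<in> ann_chain L r (Suc i)" "q \<otimes>\<^bsub>L\<^esub> m \<in> ann_chain L r (Suc i)"
        using Suc.prems x' unfolding ann_chain.simps(2)[of L r i] ann_chain.simps(2)[of L r "Suc i"] by blast+
      show ?thesis unfolding x' morita_simps
        by (rule Suc.IH[OF h(1,2) cl(1)[OF h(3) cl(2)[OF Suc.prems(2) x'(4)]] cl(1)[OF cl(2)[OF Suc.prems(1) x'(5)] h(4)]])
    qed
    then show ?case using c by (subst ann_chain.simps(2)) auto
  qed
  show "\<lbrakk>a \<in> ann_chain (opposite L) r i; b \<in> ann_chain (opposite L) r i;
       n \<in> ann_chain (opposite L) r (Suc i); m \<in> ann_chain (opposite L) r (Suc i)\<rbrakk>
      \<Longrightarrow> (a, n, m, b) \<in> ann_chain (opposite (morita_ring L)) (morita_radical L r) (Suc i)"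
  proof (induction i arbitrary: a n m b)
    case 0
    then show ?case by (auto simp: morita_radical_def r.Icarr)
  next
    case (Suc i)
    have c: "a \<in> carrier L" "b \<in> carrier L" "n \<in> carrier L" "m \<in> carrier L" using Suc.prems cl'(3) by blast+
    have "(a, n, m, b) \<otimes>\<^bsub>morita_ring L\<^esub> x \<in> ann_chain (opposite (morita_ring L)) (morita_radical L r) (Suc i)"
      if x: "x \<in> morita_radical L r" for x
    proof -
      obtain p u v q where x': "x = (p, u, v, q)" "p \<in> r" "q \<in> r" "u \<in> carrier L" "v \<in> carrier L"
        using x by (auto simp: morita_radical_def)
      have h: "a \<otimes>\<^bsub>L\<^esub> p \<in> ann_chain (opposite L) r i" "b \<otimes>\<^bsub>L\<^esub> q \<in> ann_chain (opposite L) r i"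
        "n \<otimes>\<^bsub>L\<^esub> q \<in> ann_chain (opposite L) r (Suc i)" "m \<otimes>\<^bsub>L\<^esub> p \<in> ann_chain (opposite L) r (Suc i)"
        using Suc.prems x' unfolding ann_chain.simps(2)[of _ r i] ann_chain.simps(2)[of _ r "Suc i"] opposite_simps by blast+
      show ?thesis unfolding x' morita_simps
        by (rule Suc.IH[OF h(1,2) cl'(1)[OF cl'(2)[OF Suc.prems(1) x'(4)] h(3)] cl'(1)[OF h(4) cl'(2)[OF Suc.prems(2) x'(5)]]])
    qed
    then show ?case using c by (subst ann_chain.simps(2)) auto
  qed
qed

lemma morita_one_ann_chain:
  assumes r: "ideal r L"
  shows "\<one>\<^bsub>L\<^esub> \<in> ann_chain L r n \<Longrightarrow> \<one>\<^bsub>morita_ring L\<^esub> \<in> ann_chain (morita_ring L) (morita_radical L r) (Suc n)"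
    and "\<one>\<^bsub>L\<^esub> \<in> ann_chain (opposite L) r n \<Longrightarrow>
      \<one>\<^bsub>morita_ring L\<^esub> \<in> ann_chain (opposite (morita_ring L)) (morita_radical L r) (Suc n)"
proof -
  interpret r: ideal r L by (rule r)
  have r': "ideal r (opposite L)" using r by (simp add: ideal_opposite[OF r.ring_axioms])
  have z: "\<zero>\<^bsub>L\<^esub> \<in> ann_chain L r i" "\<zero>\<^bsub>L\<^esub> \<in> ann_chain (opposite L) r i" for i
    using additive_subgroup.zero_closed[OF ideal.axioms(1)[OF ann_chain_ideal[OF r]]]
      additive_subgroup.zero_closed[OF ideal.axioms(1)[OF ann_chain_ideal[OF r']]] by simp_all
  show "\<one>\<^bsub>L\<^esub> \<in> ann_chain L r n \<Longrightarrow> \<one>\<^bsub>morita_ring L\<^esub> \<in> ann_chain (morita_ring L) (morita_radical L r) (Suc n)"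
    "\<one>\<^bsub>L\<^esub> \<in> ann_chain (opposite L) r n \<Longrightarrow>
      \<one>\<^bsub>morita_ring L\<^esub> \<in> ann_chain (opposite (morita_ring L)) (morita_radical L r) (Suc n)"
    unfolding morita_simps by (intro morita_ann_chain[OF r] z; assumption)+
qed

definition morita_idempotents :: "('a, 's) ring_scheme \<Rightarrow> 'a set \<Rightarrow> ('a \<times> 'a \<times> 'a \<times> 'a) set"
  where "morita_idempotents L \<E> = (\<lambda>e. (e, \<zero>\<^bsub>L\<^esub>, \<zero>\<^bsub>L\<^esub>, \<zero>\<^bsub>L\<^esub>)) ` \<E> \<union> (\<lambda>e. (\<zero>\<^bsub>L\<^esub>, \<zero>\<^bsub>L\<^esub>, \<zero>\<^bsub>L\<^esub>, e)) ` \<E>"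

lemma semiprimary_morita:
  assumes "semiprimary L r \<E>"
  shows "semiprimary (morita_ring L) (morita_radical L r) (morita_idempotents L \<E>)"
proof -
  interpret semiprimary L r \<E> by fact
  interpret r: ideal r L by (rule r_ideal)
  let ?G = "morita_ring L" and ?J = "morita_radical L r" and ?z = "\<zero>\<^bsub>L\<^esub>"
  interpret G: ring ?G by (rule ring_morita_ring[OF ring_axioms])
  interpret J: ideal ?J ?G by (rule ideal_morita_radical[OF r_ideal])
  have zz: "?z \<ominus>\<^bsub>L\<^esub> ?z \<in> r" using r.cong_refl[of ?z] by simp
  show ?thesis
  proof (intro semiprimary.intro semiprimary_axioms.intro G.ring_axioms J.ideal_axioms)
    fix x assume x: "x \<in> morita_idempotents L \<E>"
    then obtain e where e: "e \<in> \<E>" "x = (e, ?z, ?z, ?z) \<or> x = (?z, ?z, ?z, e)" by (auto simp: morita_idempotents_def)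
    note ec = \<E>_closed[OF e(1)] and ee = \<E>_idem[OF e(1)] and er = \<E>_proper[OF e(1)]
    show xc: "x \<in> carrier ?G" "x \<otimes>\<^bsub>?G\<^esub> x = x" "x \<notin> ?J" using e ec ee er by (auto simp: morita_radical_def)
    fix c assume c: "c \<in> carrier ?G" "c \<notin> ?J"
    then obtain p u v q where c': "c = (p, u, v, q)" and pq: "p \<in> carrier L" "u \<in> carrier L" "v \<in> carrier L" "q \<in> carrier L"
      by auto
    show "\<exists>a\<in>carrier ?G. x \<ominus>\<^bsub>?G\<^esub> a \<otimes>\<^bsub>?G\<^esub> c \<in> ?J" if cx: "c \<otimes>\<^bsub>?G\<^esub> x = c"
    proof (rule disjE[OF e(2)])
      assume x1: "x = (e, ?z, ?z, ?z)"
      have "p \<otimes>\<^bsub>L\<^esub> e = p" "q = ?z" using cx pq ec by (auto simp: x1 c')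
      then have "p \<notin> r" using c pq by (auto simp: c' morita_radical_def)
      then obtain a where "a \<in> carrier L" "e \<ominus>\<^bsub>L\<^esub> a \<otimes>\<^bsub>L\<^esub> p \<in> r" using left_simple[OF e(1) pq(1)] \<open>p \<otimes>\<^bsub>L\<^esub> e = p\<close> by blast
      then show ?thesis using pq ec \<open>q = ?z\<close>
        by (intro bexI[of _ "(a, ?z, ?z, ?z)"]) (auto simp: x1 c' morita_minus[OF ring_axioms] morita_radical_def zz)
    next
      assume x1: "x = (?z, ?z, ?z, e)"
      have "q \<otimes>\<^bsub>L\<^esub> e = q" "p = ?z" using cx pq ec by (auto simp: x1 c')
      then have "q \<notin> r" using c pq by (auto simp: c' morita_radical_def)
      then obtain a where "a \<in> carrier L" "e \<ominus>\<^bsub>L\<^esub> a \<otimes>\<^bsub>L\<^esub> q \<in> r" using left_simple[OF e(1) pq(4)] \<open>q \<otimes>\<^bsub>L\<^esub> e = q\<close> by blast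
      then show ?thesis using pq ec \<open>p = ?z\<close>
        by (intro bexI[of _ "(?z, ?z, ?z, a)"]) (auto simp: x1 c' morita_minus[OF ring_axioms] morita_radical_def zz)
    qed
    show "\<exists>a\<in>carrier ?G. x \<ominus>\<^bsub>?G\<^esub> c \<otimes>\<^bsub>?G\<^esub> a \<in> ?J" if cx: "x \<otimes>\<^bsub>?G\<^esub> c = c"
    proof (rule disjE[OF e(2)])
      assume x1: "x = (e, ?z, ?z, ?z)"
      have "e \<otimes>\<^bsub>L\<^esub> p = p" "q = ?z" using cx pq ec by (auto simp: x1 c')
      then have "p \<notin> r" using c pq by (auto simp: c' morita_radical_def)
      then obtain a where "a \<in> carrier L" "e \<ominus>\<^bsub>L\<^esub> p \<otimes>\<^bsub>L\<^esub> a \<in> r" using right_simple[OF e(1) pq(1)] \<open>e \<otimes>\<^bsub>L\<^esub> p = p\<close> by blast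
      then show ?thesis using pq ec \<open>q = ?z\<close>
        by (intro bexI[of _ "(a, ?z, ?z, ?z)"]) (auto simp: x1 c' morita_minus[OF ring_axioms] morita_radical_def zz)
    next
      assume x1: "x = (?z, ?z, ?z, e)"
      have "e \<otimes>\<^bsub>L\<^esub> q = q" "p = ?z" using cx pq ec by (auto simp: x1 c')
      then have "q \<notin> r" using c pq by (auto simp: c' morita_radical_def)
      then obtain a where "a \<in> carrier L" "e \<ominus>\<^bsub>L\<^esub> q \<otimes>\<^bsub>L\<^esub> a \<in> r" using right_simple[OF e(1) pq(4)] \<open>e \<otimes>\<^bsub>L\<^esub> q = q\<close> by blast
      then show ?thesis using pq ec \<open>p = ?z\<close>
        by (intro bexI[of _ "(?z, ?z, ?z, a)"]) (auto simp: x1 c' morita_minus[OF ring_axioms] morita_radical_def zz)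
    qed
  next
    fix I assume I: "ideal I ?G" "?J \<subseteq> I" "morita_idempotents L \<E> \<subseteq> I"
    interpret I: ideal I ?G by (rule I)
    have I1: "ideal {a \<in> carrier L. (a, ?z, ?z, ?z) \<in> I} L"
    proof (rule idealI2)
      fix a x assume "a \<in> carrier L" "x \<in> {a \<in> carrier L. (a, ?z, ?z, ?z) \<in> I}"
      then show "a \<otimes>\<^bsub>L\<^esub> x \<in> {a \<in> carrier L. (a, ?z, ?z, ?z) \<in> I}" "x \<otimes>\<^bsub>L\<^esub> a \<in> {a \<in> carrier L. (a, ?z, ?z, ?z) \<in> I}"
        using I.I_l_closed[of "(x, ?z, ?z, ?z)" "(a, ?z, ?z, ?z)"] I.I_r_closed[of "(x, ?z, ?z, ?z)" "(a, ?z, ?z, ?z)"] by auto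
    next
      fix x y assume "x \<in> {a \<in> carrier L. (a, ?z, ?z, ?z) \<in> I}" "y \<in> {a \<in> carrier L. (a, ?z, ?z, ?z) \<in> I}"
      then show "x \<oplus>\<^bsub>L\<^esub> y \<in> {a \<in> carrier L. (a, ?z, ?z, ?z) \<in> I}"
        using I.plus_closed[of "(x, ?z, ?z, ?z)" "(y, ?z, ?z, ?z)"] by auto
    qed (use I.zero_closed in auto)
    have I2: "ideal {a \<in> carrier L. (?z, ?z, ?z, a) \<in> I} L"
    proof (rule idealI2)
      fix a x assume "a \<in> carrier L" "x \<in> {a \<in> carrier L. (?z, ?z, ?z, a) \<in> I}"
      then show "a \<otimes>\<^bsub>L\<^esub> x \<in> {a \<in> carrier L. (?z, ?z, ?z, a) \<in> I}" "x \<otimes>\<^bsub>L\<^esub> a \<in> {a \<in> carrier L. (?z, ?z, ?z, a) \<in> I}"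
        using I.I_l_closed[of "(?z, ?z, ?z, x)" "(?z, ?z, ?z, a)"] I.I_r_closed[of "(?z, ?z, ?z, x)" "(?z, ?z, ?z, a)"] by auto
    next
      fix x y assume "x \<in> {a \<in> carrier L. (?z, ?z, ?z, a) \<in> I}" "y \<in> {a \<in> carrier L. (?z, ?z, ?z, a) \<in> I}"
      then show "x \<oplus>\<^bsub>L\<^esub> y \<in> {a \<in> carrier L. (?z, ?z, ?z, a) \<in> I}"
        using I.plus_closed[of "(?z, ?z, ?z, x)" "(?z, ?z, ?z, y)"] by auto
    qed (use I.zero_closed in auto)
    have rz: "r \<subseteq> carrier L" "?z \<in> r" using r.Icarr r.zero_closed by auto
    have "\<one>\<^bsub>L\<^esub> \<in> {a \<in> carrier L. (a, ?z, ?z, ?z) \<in> I}" "\<one>\<^bsub>L\<^esub> \<in> {a \<in> carrier L. (?z, ?z, ?z, a) \<in> I}"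
      using I(2,3) \<E>_closed rz
      by (intro cover[OF I1] cover[OF I2]; auto simp: morita_idempotents_def morita_radical_def subset_eq)+
    then show "\<one>\<^bsub>?G\<^esub> \<in> I"
      using I.plus_closed[of "(\<one>\<^bsub>L\<^esub>, ?z, ?z, ?z)" "(?z, ?z, ?z, \<one>\<^bsub>L\<^esub>)"] by simp
  next
    show "\<exists>n. \<one>\<^bsub>?G\<^esub> \<in> ann_chain ?G ?J n" "\<exists>n. \<one>\<^bsub>?G\<^esub> \<in> ann_chain (opposite ?G) ?J n"
      using morita_one_ann_chain[OF r_ideal] left_nilpotent right_nilpotent by blast+
  qed
qed

text \<open>Left multiplication by the matrix units gives \<open>f x\<close> from the off-diagonal entries of
  \<open>f (0, 0, m, b)\<close> and \<open>f (a, n, 0, 0)\<close> alone. These are \<open>L\<close>-linear in \<open>(m, b)\<close> and \<open>(a, n)\<close>, so that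
  they extend to \<open>L\<^sup>2\<close>.\<close>

lemma morita_right_multiplication:
  assumes L: "ring L" and inj: "selfinjective L"
    and A: "submodule A (morita_ring L) (regular_module (morita_ring L))"
    and f: "f \<in> module_hom (morita_ring L) ((regular_module (morita_ring L))\<lparr>carrier := A\<rparr>) (regular_module (morita_ring L))"
  shows "\<exists>c\<in>carrier (morita_ring L). \<forall>x\<in>A. f x = x \<otimes>\<^bsub>morita_ring L\<^esub> c"
proof -
  interpret ring L by (rule L)
  let ?G = "morita_ring L" and ?z = "\<zero>\<^bsub>L\<^esub>" and ?o = "\<one>\<^bsub>L\<^esub>"
  have G: "ring ?G" by (rule ring_morita_ring[OF L])
  interpret reg: left_module ?G "regular_module ?G" by (rule left_module_regular[OF G])
  note AD = reg.submoduleD[OF A, simplified]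
  have fc: "f x \<in> carrier L \<times> carrier L \<times> carrier L \<times> carrier L" if "x \<in> A" for x
    using module_homD(1)[OF f, of x] that by simp
  have fa: "f (x \<oplus>\<^bsub>?G\<^esub> y) = f x \<oplus>\<^bsub>?G\<^esub> f y" if "x \<in> A" "y \<in> A" for x y
    using module_homD(2)[OF f, of x y] that by simp
  have fs: "f (c \<otimes>\<^bsub>?G\<^esub> x) = c \<otimes>\<^bsub>?G\<^esub> f x" if "c \<in> carrier L \<times> carrier L \<times> carrier L \<times> carrier L" "x \<in> A" for c x
    using module_homD(3)[OF f, of c x] that by simp
  let ?F = "power_module (regular_module L) 2"
  have reg: "left_module L (regular_module L)" by (rule left_module_regular[OF L])
  interpret F: left_module L ?F by (rule left_module_power[OF reg])
  have lin: "\<exists>q. q (0::nat) \<in> carrier L \<and> q 1 \<in> carrier L \<and>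
      (\<forall>x y. x \<in> carrier L \<and> y \<in> carrier L \<and> \<iota> x y \<in> A \<longrightarrow> pr (f (\<iota> x y)) = x \<otimes>\<^bsub>L\<^esub> q 0 \<oplus>\<^bsub>L\<^esub> y \<otimes>\<^bsub>L\<^esub> q 1)"
    if \<iota>: "\<And>x y. \<iota> x y = (if up then (x, y, ?z, ?z) else (?z, ?z, x, y))"
      and pr: "\<And>a n m b. pr (a, n, m, b) = (if up then n else m)" for \<iota> :: "'a \<Rightarrow> 'a \<Rightarrow> 'a \<times> 'a \<times> 'a \<times> 'a" and pr :: "'a \<times> 'a \<times> 'a \<times> 'a \<Rightarrow> 'a" and up
  proof -
    let ?N = "{v \<in> carrier ?F. \<iota> (v 0) (v 1) \<in> A}"
    have add: "\<iota> (x \<oplus>\<^bsub>L\<^esub> x') (y \<oplus>\<^bsub>L\<^esub> y') = \<iota> x y \<oplus>\<^bsub>?G\<^esub> \<iota> x' y'"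
      if "x \<in> carrier L" "y \<in> carrier L" "x' \<in> carrier L" "y' \<in> carrier L" for x y x' y'
      using that by (simp add: \<iota>)
    have smult: "\<iota> (a \<otimes>\<^bsub>L\<^esub> x) (a \<otimes>\<^bsub>L\<^esub> y) = morita_diag L a \<otimes>\<^bsub>?G\<^esub> \<iota> x y"
      if "a \<in> carrier L" "x \<in> carrier L" "y \<in> carrier L" for a x y
      using that by (simp add: \<iota> morita_diag_def)
    have dc: "morita_diag L a \<in> carrier L \<times> carrier L \<times> carrier L \<times> carrier L" if "a \<in> carrier L" for a
      using that by (simp add: morita_diag_def)
    have prc: "pr x \<in> carrier L" if "x \<in> carrier L \<times> carrier L \<times> carrier L \<times> carrier L" for x using that pr by auto
    have pra: "pr (x \<oplus>\<^bsub>?G\<^esub> y) = pr x \<oplus>\<^bsub>L\<^esub> pr y" for x y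
      by (cases x; cases y) (simp add: pr)
    have prs: "pr (morita_diag L a \<otimes>\<^bsub>?G\<^esub> x) = a \<otimes>\<^bsub>L\<^esub> pr x"
      if "a \<in> carrier L" "x \<in> carrier L \<times> carrier L \<times> carrier L \<times> carrier L" for a x
      using that by (auto simp: pr morita_diag_def)
    have c01: "v 0 \<in> carrier L" "v 1 \<in> carrier L" "v (Suc 0) \<in> carrier L" if "v \<in> carrier ?F" for v
      using that PiE_mem[of v "{..<2}" "\<lambda>_. carrier L" 0] PiE_mem[of v "{..<2}" "\<lambda>_. carrier L" 1]
      by (simp_all add: power_module_simps(1))
    have N: "submodule ?N L ?F"
    proof (rule F.submoduleI)
      have "\<iota> ?z ?z = \<zero>\<^bsub>?G\<^esub>" by (simp add: \<iota>)
      then show "\<zero>\<^bsub>?F\<^esub> \<in> ?N" using AD(3) F.M.zero_closed by (simp add: power_module_simps)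
      fix v w assume v: "v \<in> ?N" and w: "w \<in> ?N"
      have "\<iota> (v 0 \<oplus>\<^bsub>L\<^esub> w 0) (v 1 \<oplus>\<^bsub>L\<^esub> w 1) \<in> A"
        using v w AD(4)[of "\<iota> (v 0) (v 1)" "\<iota> (w 0) (w 1)"] c01 by (simp add: add)
      moreover have "v \<oplus>\<^bsub>?F\<^esub> w \<in> carrier ?F" using v w by simp
      ultimately show "v \<oplus>\<^bsub>?F\<^esub> w \<in> ?N" by (simp add: power_module_simps)
    next
      fix a v assume a: "a \<in> carrier L" and v: "v \<in> ?N"
      have "\<iota> (a \<otimes>\<^bsub>L\<^esub> v 0) (a \<otimes>\<^bsub>L\<^esub> v 1) \<in> A"
        using v a AD(5)[of "morita_diag L a" "\<iota> (v 0) (v 1)"] c01 dc[OF a] by (simp add: smult)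
      moreover have "a \<odot>\<^bsub>?F\<^esub> v \<in> carrier ?F" using v a by simp
      ultimately show "a \<odot>\<^bsub>?F\<^esub> v \<in> ?N" by (simp add: power_module_simps)
    qed auto
    have "(\<lambda>v. pr (f (\<iota> (v 0) (v 1)))) \<in> module_hom L (?F\<lparr>carrier := ?N\<rparr>) (regular_module L)"
    proof (rule module_homI)
      fix v assume "v \<in> carrier (?F\<lparr>carrier := ?N\<rparr>)"
      then show "pr (f (\<iota> (v 0) (v 1))) \<in> carrier (regular_module L)" using prc[OF fc] by simp
    next
      fix v w assume "v \<in> carrier (?F\<lparr>carrier := ?N\<rparr>)" "w \<in> carrier (?F\<lparr>carrier := ?N\<rparr>)"
      then show "pr (f (\<iota> ((v \<oplus>\<^bsub>?F\<lparr>carrier := ?N\<rparr>\<^esub> w) 0) ((v \<oplus>\<^bsub>?F\<lparr>carrier := ?N\<rparr>\<^esub> w) 1)))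
          = pr (f (\<iota> (v 0) (v 1))) \<oplus>\<^bsub>regular_module L\<^esub> pr (f (\<iota> (w 0) (w 1)))"
        using add[of "v 0" "v 1" "w 0" "w 1"] c01 fa pra by (simp add: power_module_simps(3))
    next
      fix a v assume "a \<in> carrier L" "v \<in> carrier (?F\<lparr>carrier := ?N\<rparr>)"
      then show "pr (f (\<iota> ((a \<odot>\<^bsub>?F\<lparr>carrier := ?N\<rparr>\<^esub> v) 0) ((a \<odot>\<^bsub>?F\<lparr>carrier := ?N\<rparr>\<^esub> v) 1)))
          = a \<odot>\<^bsub>regular_module L\<^esub> pr (f (\<iota> (v 0) (v 1)))"
        using smult[of a "v 0" "v 1"] c01 fs[OF dc] prs[OF _ fc] by (simp add: power_module_simps(4))
    qed
    from selfinjective_extend[OF L inj N this] obtain q where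
      q: "\<And>i. i < 2 \<Longrightarrow> q i \<in> carrier L"
        "\<And>v. v \<in> ?N \<Longrightarrow> pr (f (\<iota> (v 0) (v 1))) = (\<Oplus>\<^bsub>L\<^esub>i\<in>{..<2::nat}. v i \<otimes>\<^bsub>L\<^esub> q i)" by blast
    have "pr (f (\<iota> x y)) = x \<otimes>\<^bsub>L\<^esub> q 0 \<oplus>\<^bsub>L\<^esub> y \<otimes>\<^bsub>L\<^esub> q 1"
      if "x \<in> carrier L" "y \<in> carrier L" "\<iota> x y \<in> A" for x y
    proof -
      let ?v = "\<lambda>i\<in>{..<2::nat}. if i = 0 then x else y"
      have "?v \<in> ?N" using that by (auto simp: power_module_simps)
      from q(2)[OF this] show ?thesis
        using that q(1)[of 0] q(1)[of 1] by (simp add: numeral_2_eq_2 lessThan_Suc a_comm)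
    qed
    then show ?thesis using q(1)[of 0] q(1)[of 1] by (intro exI[of _ q]) auto
  qed
  obtain q where q: "q (0::nat) \<in> carrier L" "q 1 \<in> carrier L"
    "\<And>x y. x \<in> carrier L \<Longrightarrow> y \<in> carrier L \<Longrightarrow> (?z, ?z, x, y) \<in> A \<Longrightarrow>
      fst (snd (snd (f (?z, ?z, x, y)))) = x \<otimes>\<^bsub>L\<^esub> q 0 \<oplus>\<^bsub>L\<^esub> y \<otimes>\<^bsub>L\<^esub> q 1"
    using lin[of "\<lambda>x y. (?z, ?z, x, y)" False "\<lambda>x. fst (snd (snd x))"] by auto
  obtain p where p: "p (0::nat) \<in> carrier L" "p 1 \<in> carrier L"
    "\<And>x y. x \<in> carrier L \<Longrightarrow> y \<in> carrier L \<Longrightarrow> (x, y, ?z, ?z) \<in> A \<Longrightarrow>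
      fst (snd (f (x, y, ?z, ?z))) = x \<otimes>\<^bsub>L\<^esub> p 0 \<oplus>\<^bsub>L\<^esub> y \<otimes>\<^bsub>L\<^esub> p 1"
    using lin[of "\<lambda>x y. (x, y, ?z, ?z)" True "\<lambda>x. fst (snd x)"] by auto
  have "f x = x \<otimes>\<^bsub>?G\<^esub> (q 0, p 0, q 1, p 1)" if x: "x \<in> A" for x
  proof -
    obtain a n m b where x': "x = (a, n, m, b)" and c: "a \<in> carrier L" "n \<in> carrier L" "m \<in> carrier L" "b \<in> carrier L"
      using AD(1)[OF x] by auto
    obtain a' n' m' b' where y: "f x = (a', n', m', b')" and c': "a' \<in> carrier L" "n' \<in> carrier L" "m' \<in> carrier L" "b' \<in> carrier L"
      using fc[OF x] by auto
    have unit: "(c \<otimes>\<^bsub>?G\<^esub> x) \<in> A" "f (c \<otimes>\<^bsub>?G\<^esub> x) = c \<otimes>\<^bsub>?G\<^esub> f x"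
      if "c \<in> {(?o, ?z, ?z, ?z), (?z, ?o, ?z, ?z), (?z, ?z, ?o, ?z), (?z, ?z, ?z, ?o)}" for c
      using AD(5)[of c x] fs[of c x] x that by auto
    have 1: "(?z, ?z, m, b) \<in> A" "f (?z, ?z, m, b) = (?z, ?z, m', b')"
      using unit[of "(?z, ?z, ?z, ?o)"] c c' by (simp_all add: x' y[unfolded x'])
    have 2: "(?z, ?z, a, ?z) \<in> A" "f (?z, ?z, a, ?z) = (?z, ?z, a', ?z)"
      using unit[of "(?z, ?z, ?o, ?z)"] c c' by (simp_all add: x' y[unfolded x'])
    have 3: "(a, n, ?z, ?z) \<in> A" "f (a, n, ?z, ?z) = (a', n', ?z, ?z)"
      using unit[of "(?o, ?z, ?z, ?z)"] c c' by (simp_all add: x' y[unfolded x'])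
    have 4: "(?z, b, ?z, ?z) \<in> A" "f (?z, b, ?z, ?z) = (?z, b', ?z, ?z)"
      using unit[of "(?z, ?o, ?z, ?z)"] c c' by (simp_all add: x' y[unfolded x'])
    show ?thesis
      using q(3)[OF c(3,4) 1(1)] q(3)[OF c(1) zero_closed 2(1)] p(3)[OF c(1,2) 3(1)] p(3)[OF zero_closed c(4) 4(1)]
        1(2) 2(2) 3(2) 4(2) p(1,2) q(1,2) c y[unfolded x'] by (simp add: x')
  qed
  then show ?thesis using p(1,2) q(1,2) by (intro bexI[of _ "(q 0, p 0, q 1, p 1)"]) auto
qed

text \<open>A functional \<open>f\<close> on \<open>X\<close> gives the homomorphisms to the columns of the Morita ring whose entries
  are the values of \<open>f\<close> at the products with matrix units.\<close>

lemma morita_separating_hom: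
  fixes X :: "('a \<times> 'a \<times> 'a \<times> 'a, 'm, 'x) module_scheme"
  assumes sp: "semiprimary L r \<E>" and inj: "selfinjective L" and fin: "finite \<E>"
    and noeth: "chain_stable True (submodules (opposite L) (regular_module (opposite L)))"
    and X: "left_module (morita_ring L) X" "finitely_generated (morita_ring L) X"
    and x: "x \<in> carrier X" "x \<noteq> \<zero>\<^bsub>X\<^esub>"
  shows "\<exists>F\<in>module_hom (morita_ring L) X (regular_module (morita_ring L)). F x \<noteq> \<zero>\<^bsub>morita_ring L\<^esub>"
proof -
  interpret semiprimary L r \<E> by (rule sp)
  have L: "ring L" by (rule ring_axioms)
  let ?G = "morita_ring L" and ?z = "\<zero>\<^bsub>L\<^esub>" and ?o = "\<one>\<^bsub>L\<^esub>"
  have G: "ring ?G" by (rule ring_morita_ring[OF L])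
  interpret X: left_module ?G X by (rule X)
  let ?XL = "restrict_scalars (morita_diag L) X"
  have XL: "left_module L ?XL" by (rule left_module_restrict[OF X(1) L morita_diag_hom(1)[OF L]])
  have fg: "finitely_generated L ?XL"
    by (rule finitely_generated_restrict[OF L G morita_diag_hom(1)[OF L] morita_finite(1)[OF L] X])
  define u11 u12 u21 u22 where "u11 = (?o, ?z, ?z, ?z)" and "u12 = (?z, ?o, ?z, ?z)" and "u21 = (?z, ?z, ?o, ?z)" and "u22 = (?z, ?z, ?z, ?o)"
  note u = u11_def u12_def u21_def u22_def
  have uc: "u11 \<in> carrier ?G" "u12 \<in> carrier ?G" "u21 \<in> carrier ?G" "u22 \<in> carrier ?G" by (auto simp: u)
  have dc: "morita_diag L a \<in> carrier ?G" if "a \<in> carrier L" for a using that by (simp add: morita_diag_def)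
  have row: "f (u \<odot>\<^bsub>X\<^esub> (c \<odot>\<^bsub>X\<^esub> y)) = a \<otimes>\<^bsub>L\<^esub> f (v \<odot>\<^bsub>X\<^esub> y) \<oplus>\<^bsub>L\<^esub> b \<otimes>\<^bsub>L\<^esub> f (w \<odot>\<^bsub>X\<^esub> y)"
    if f: "f \<in> module_hom L ?XL (regular_module L)" and y: "y \<in> carrier X" and c: "c \<in> carrier ?G" "u \<in> carrier ?G"
      and ab: "a \<in> carrier L" "b \<in> carrier L" and vw: "v \<in> carrier ?G" "w \<in> carrier ?G"
      and eq: "u \<otimes>\<^bsub>?G\<^esub> c = morita_diag L a \<otimes>\<^bsub>?G\<^esub> v \<oplus>\<^bsub>?G\<^esub> morita_diag L b \<otimes>\<^bsub>?G\<^esub> w" for f y c u a b v w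
  proof -
    have "u \<odot>\<^bsub>X\<^esub> (c \<odot>\<^bsub>X\<^esub> y) = morita_diag L a \<odot>\<^bsub>X\<^esub> (v \<odot>\<^bsub>X\<^esub> y) \<oplus>\<^bsub>X\<^esub> morita_diag L b \<odot>\<^bsub>X\<^esub> (w \<odot>\<^bsub>X\<^esub> y)"
      using X.smult_assoc[OF c(2,1) y] X.smult_l_distr[OF X.R.m_closed[OF dc[OF ab(1)] vw(1)] X.R.m_closed[OF dc[OF ab(2)] vw(2)] y]
        X.smult_assoc[OF dc[OF ab(1)] vw(1) y] X.smult_assoc[OF dc[OF ab(2)] vw(2) y] eq by simp
    then show ?thesis
      using module_homD[OF f] y ab vw dc X.smult_closed by simp
  qed
  have "u11 \<odot>\<^bsub>X\<^esub> x \<oplus>\<^bsub>X\<^esub> u22 \<odot>\<^bsub>X\<^esub> x = (u11 \<oplus>\<^bsub>?G\<^esub> u22) \<odot>\<^bsub>X\<^esub> x" using X.smult_l_distr[OF uc(1,4) x(1)] by simp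
  also have "u11 \<oplus>\<^bsub>?G\<^esub> u22 = \<one>\<^bsub>?G\<^esub>" by (simp add: u)
  finally have sum: "u11 \<odot>\<^bsub>X\<^esub> x \<oplus>\<^bsub>X\<^esub> u22 \<odot>\<^bsub>X\<^esub> x = x" using X.smult_one[OF x(1)] by simp
  have "u11 \<odot>\<^bsub>X\<^esub> x \<noteq> \<zero>\<^bsub>X\<^esub> \<or> u22 \<odot>\<^bsub>X\<^esub> x \<noteq> \<zero>\<^bsub>X\<^esub>"
  proof (rule ccontr)
    assume "\<not> ?thesis"
    then show False using sum x(2) by simp
  qed
  then show ?thesis
  proof
    assume n: "u11 \<odot>\<^bsub>X\<^esub> x \<noteq> \<zero>\<^bsub>X\<^esub>"
    obtain f where f: "f \<in> module_hom L ?XL (regular_module L)" "f (u11 \<odot>\<^bsub>X\<^esub> x) \<noteq> ?z"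
      using separating_hom[OF inj fin noeth XL fg, of "u11 \<odot>\<^bsub>X\<^esub> x"] n X.smult_closed[OF uc(1) x(1)] by auto
    let ?F = "\<lambda>y. (?z, f (u11 \<odot>\<^bsub>X\<^esub> y), ?z, f (u12 \<odot>\<^bsub>X\<^esub> y))"
    have fc: "f y \<in> carrier L" if "y \<in> carrier X" for y using module_homD(1)[OF f(1), of y] that by simp
    have fadd: "f (y \<oplus>\<^bsub>X\<^esub> y') = f y \<oplus>\<^bsub>L\<^esub> f y'" if "y \<in> carrier X" "y' \<in> carrier X" for y y'
      using module_homD(2)[OF f(1), of y y'] that by simp
    have "?F \<in> module_hom ?G X (regular_module ?G)"
    proof (rule module_homI)
      fix c y assume c: "c \<in> carrier ?G" and y: "y \<in> carrier X"
      obtain a n m b where c': "c = (a, n, m, b)" and cc: "a \<in> carrier L" "n \<in> carrier L" "m \<in> carrier L" "b \<in> carrier L" using c by auto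
      have "f (u11 \<odot>\<^bsub>X\<^esub> (c \<odot>\<^bsub>X\<^esub> y)) = a \<otimes>\<^bsub>L\<^esub> f (u11 \<odot>\<^bsub>X\<^esub> y) \<oplus>\<^bsub>L\<^esub> n \<otimes>\<^bsub>L\<^esub> f (u12 \<odot>\<^bsub>X\<^esub> y)"
        by (rule row[OF f(1) y c uc(1) cc(1,2) uc(1,2)]) (use cc in \<open>simp add: u c' morita_diag_def\<close>)
      moreover have "f (u12 \<odot>\<^bsub>X\<^esub> (c \<odot>\<^bsub>X\<^esub> y)) = ?z \<otimes>\<^bsub>L\<^esub> f (u11 \<odot>\<^bsub>X\<^esub> y) \<oplus>\<^bsub>L\<^esub> b \<otimes>\<^bsub>L\<^esub> f (u12 \<odot>\<^bsub>X\<^esub> y)"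
        by (rule row[OF f(1) y c uc(2) zero_closed cc(4) uc(1,2)]) (use cc in \<open>simp add: u c' morita_diag_def\<close>)
      ultimately show "?F (c \<odot>\<^bsub>X\<^esub> y) = c \<odot>\<^bsub>regular_module ?G\<^esub> ?F y"
        using fc[OF X.smult_closed[OF uc(1) y]] fc[OF X.smult_closed[OF uc(2) y]] cc by (simp add: c')
    next
      fix y assume y: "y \<in> carrier X"
      show "?F y \<in> carrier (regular_module ?G)"
        using fc[OF X.smult_closed[OF uc(1) y]] fc[OF X.smult_closed[OF uc(2) y]] by simp
    next
      fix y y' assume y: "y \<in> carrier X" "y' \<in> carrier X"
      show "?F (y \<oplus>\<^bsub>X\<^esub> y') = ?F y \<oplus>\<^bsub>regular_module ?G\<^esub> ?F y'"
        using X.smult_r_distr[OF uc(1) y] X.smult_r_distr[OF uc(2) y]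
          fadd[OF X.smult_closed[OF uc(1) y(1)] X.smult_closed[OF uc(1) y(2)]]
          fadd[OF X.smult_closed[OF uc(2) y(1)] X.smult_closed[OF uc(2) y(2)]] by simp
    qed
    then show ?thesis using f(2) by (intro bexI[of _ ?F]) auto
  next
    assume n: "u22 \<odot>\<^bsub>X\<^esub> x \<noteq> \<zero>\<^bsub>X\<^esub>"
    obtain f where f: "f \<in> module_hom L ?XL (regular_module L)" "f (u22 \<odot>\<^bsub>X\<^esub> x) \<noteq> ?z"
      using separating_hom[OF inj fin noeth XL fg, of "u22 \<odot>\<^bsub>X\<^esub> x"] n X.smult_closed[OF uc(4) x(1)] by auto
    let ?F = "\<lambda>y. (f (u21 \<odot>\<^bsub>X\<^esub> y), ?z, f (u22 \<odot>\<^bsub>X\<^esub> y), ?z)"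
    have fc: "f y \<in> carrier L" if "y \<in> carrier X" for y using module_homD(1)[OF f(1), of y] that by simp
    have fadd: "f (y \<oplus>\<^bsub>X\<^esub> y') = f y \<oplus>\<^bsub>L\<^esub> f y'" if "y \<in> carrier X" "y' \<in> carrier X" for y y'
      using module_homD(2)[OF f(1), of y y'] that by simp
    have "?F \<in> module_hom ?G X (regular_module ?G)"
    proof (rule module_homI)
      fix c y assume c: "c \<in> carrier ?G" and y: "y \<in> carrier X"
      obtain a n m b where c': "c = (a, n, m, b)" and cc: "a \<in> carrier L" "n \<in> carrier L" "m \<in> carrier L" "b \<in> carrier L" using c by auto
      have "f (u22 \<odot>\<^bsub>X\<^esub> (c \<odot>\<^bsub>X\<^esub> y)) = m \<otimes>\<^bsub>L\<^esub> f (u21 \<odot>\<^bsub>X\<^esub> y) \<oplus>\<^bsub>L\<^esub> b \<otimes>\<^bsub>L\<^esub> f (u22 \<odot>\<^bsub>X\<^esub> y)"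
        by (rule row[OF f(1) y c uc(4) cc(3,4) uc(3,4)]) (use cc in \<open>simp add: u c' morita_diag_def\<close>)
      moreover have "f (u21 \<odot>\<^bsub>X\<^esub> (c \<odot>\<^bsub>X\<^esub> y)) = a \<otimes>\<^bsub>L\<^esub> f (u21 \<odot>\<^bsub>X\<^esub> y) \<oplus>\<^bsub>L\<^esub> ?z \<otimes>\<^bsub>L\<^esub> f (u22 \<odot>\<^bsub>X\<^esub> y)"
        by (rule row[OF f(1) y c uc(3) cc(1) zero_closed uc(3,4)]) (use cc in \<open>simp add: u c' morita_diag_def\<close>)
      ultimately show "?F (c \<odot>\<^bsub>X\<^esub> y) = c \<odot>\<^bsub>regular_module ?G\<^esub> ?F y"
        using fc[OF X.smult_closed[OF uc(3) y]] fc[OF X.smult_closed[OF uc(4) y]] cc by (simp add: c')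
    next
      fix y assume y: "y \<in> carrier X"
      show "?F y \<in> carrier (regular_module ?G)"
        using fc[OF X.smult_closed[OF uc(3) y]] fc[OF X.smult_closed[OF uc(4) y]] by simp
    next
      fix y y' assume y: "y \<in> carrier X" "y' \<in> carrier X"
      show "?F (y \<oplus>\<^bsub>X\<^esub> y') = ?F y \<oplus>\<^bsub>regular_module ?G\<^esub> ?F y'"
        using X.smult_r_distr[OF uc(3) y] X.smult_r_distr[OF uc(4) y]
          fadd[OF X.smult_closed[OF uc(3) y(1)] X.smult_closed[OF uc(3) y(2)]]
          fadd[OF X.smult_closed[OF uc(4) y(1)] X.smult_closed[OF uc(4) y(2)]] by simp
    qed
    then show ?thesis using f(2) by (intro bexI[of _ ?F]) auto
  qed
qed

section \<open>Endomorphism rings of chains of annihilators\<close>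

text \<open>For the ideals \<open>A i = {x. x J\<^sup>i\<^sup>+\<^sup>1 = 0}\<close> of \<open>G\<close>, \<open>i < n\<close>, with \<open>A (n - 1) = G\<close>, the ring \<open>E\<close>
  abstracts the endomorphism ring of the direct sum of the left modules \<open>A i\<close>: \<open>\<tau> i j c\<close> stands for
  right multiplication by \<open>c\<close>, as a map from \<open>A i\<close> to \<open>A j\<close>. The assumption \<open>\<tau>_surj\<close> says that there
  are no other homomorphisms, and is where injectivity will enter; \<open>\<tau>_one\<close> expresses that the unit of \<open>E\<close> is a
  sum of the projections \<open>\<tau> i i 1\<close>, and \<open>\<tau>_mono\<close> that the inclusions \<open>\<tau> i j 1\<close> are monomorphisms.\<close>

definition level :: "('g, 's) ring_scheme \<Rightarrow> 'g set \<Rightarrow> nat \<Rightarrow> 'g set"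
  where "level G J i = ann_chain (opposite G) J (Suc i)"

text \<open>The level \<open>k\<close> of the \<open>E\<close>-module \<open>E\<^sup>a\<close> is a right \<open>G\<close>-module, \<open>c\<close> acting as \<open>\<tau> k k c\<close>.\<close>

definition level_module :: "('e, 't) ring_scheme \<Rightarrow> ('g, 's) ring_scheme \<Rightarrow> (nat \<Rightarrow> nat \<Rightarrow> 'g \<Rightarrow> 'e) \<Rightarrow> nat \<Rightarrow> nat \<Rightarrow>
    ('g, nat \<Rightarrow> 'e) module"
  where "level_module E G \<tau> a k = (let M = power_module (regular_module E) a in
    \<lparr>carrier = {x \<in> carrier M. \<tau> k k \<one>\<^bsub>G\<^esub> \<odot>\<^bsub>M\<^esub> x = x}, mult = undefined, one = undefined,
     zero = zero M, add = add M, smult = (\<lambda>c x. \<tau> k k c \<odot>\<^bsub>M\<^esub> x)\<rparr>)"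

locale level_maps = semiprimary G J \<E> + E: ring E
  for G :: "('g, 's) ring_scheme" (structure) and J :: "'g set" and \<E> :: "'g set"
    and E :: "('e, 't) ring_scheme" +
  fixes n :: nat and \<tau> :: "nat \<Rightarrow> nat \<Rightarrow> 'g \<Rightarrow> 'e"
  assumes top_level: "\<one> \<in> ann_chain (opposite G) J n"
    and \<tau>_closed: "\<lbrakk>i < n; j < n; c \<in> carrier G; \<And>x. x \<in> level G J i \<Longrightarrow> x \<otimes> c \<in> level G J j\<rbrakk> \<Longrightarrow> \<tau> i j c \<in> carrier E"
    and \<tau>_mult: "\<lbrakk>i < n; j < n; k < n; c \<in> carrier G; \<And>x. x \<in> level G J i \<Longrightarrow> x \<otimes> c \<in> level G J j;
      d \<in> carrier G; \<And>x. x \<in> level G J j \<Longrightarrow> x \<otimes> d \<in> level G J k\<rbrakk> \<Longrightarrow> \<tau> j k d \<otimes>\<^bsub>E\<^esub> \<tau> i j c = \<tau> i k (c \<otimes> d)"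
    and \<tau>_add: "\<lbrakk>i < n; j < n; c \<in> carrier G; \<And>x. x \<in> level G J i \<Longrightarrow> x \<otimes> c \<in> level G J j;
      d \<in> carrier G; \<And>x. x \<in> level G J i \<Longrightarrow> x \<otimes> d \<in> level G J j\<rbrakk> \<Longrightarrow> \<tau> i j (c \<oplus> d) = \<tau> i j c \<oplus>\<^bsub>E\<^esub> \<tau> i j d"
    and \<tau>_zero: "\<lbrakk>i < n; j < n; c \<in> carrier G; \<And>x. x \<in> level G J i \<Longrightarrow> x \<otimes> c = \<zero>\<rbrakk> \<Longrightarrow> \<tau> i j c = \<zero>\<^bsub>E\<^esub>"
    and \<tau>_one: "\<lbrakk>W \<subseteq> carrier E; \<zero>\<^bsub>E\<^esub> \<in> W; \<And>x y. x \<in> W \<Longrightarrow> y \<in> W \<Longrightarrow> x \<oplus>\<^bsub>E\<^esub> y \<in> W;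
      \<And>i. i < n \<Longrightarrow> \<tau> i i \<one> \<in> W\<rbrakk> \<Longrightarrow> \<one>\<^bsub>E\<^esub> \<in> W"
    and \<tau>_surj: "\<lbrakk>i < n; j < n; x \<in> carrier E\<rbrakk> \<Longrightarrow> \<exists>c\<in>carrier G. (\<forall>y\<in>level G J i. y \<otimes> c \<in> level G J j) \<and>
      \<tau> j j \<one> \<otimes>\<^bsub>E\<^esub> x \<otimes>\<^bsub>E\<^esub> \<tau> i i \<one> = \<tau> i j c"
    and \<tau>_mono: "\<lbrakk>i \<le> j; j < n; x \<in> carrier E; \<tau> i j \<one> \<otimes>\<^bsub>E\<^esub> (\<tau> i i \<one> \<otimes>\<^bsub>E\<^esub> x) = \<zero>\<^bsub>E\<^esub>\<rbrakk> \<Longrightarrow> \<tau> i i \<one> \<otimes>\<^bsub>E\<^esub> x = \<zero>\<^bsub>E\<^esub>"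
begin

abbreviation "A \<equiv> level G J"
abbreviation "\<epsilon> i \<equiv> \<tau> i i \<one>"
abbreviation "N a \<equiv> power_module (regular_module E) a"

sublocale J: ideal J G by (rule r_ideal)

lemma A_ideal: "ideal (A i) G"
  using ann_chain_ideal[of J "opposite G" "Suc i"] r_ideal
  unfolding level_def ideal_opposite[OF ring_axioms] .

lemma A_mono: "i \<le> j \<Longrightarrow> A i \<subseteq> A j"
proof (induction j rule: dec_induct)
  case (step j)
  have "ideal J (opposite G)" using r_ideal by (simp add: ideal_opposite[OF ring_axioms])
  from ann_chain_mono[OF this, of "Suc j"] step show ?case unfolding level_def by blast
qed simp

lemma A_up: "i \<le> j \<Longrightarrow> c \<in> carrier G \<Longrightarrow> x \<in> A i \<Longrightarrow> x \<otimes> c \<in> A j"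
  using ideal.I_r_closed[OF A_ideal] A_mono by blast

lemma A_down: "c \<in> J \<Longrightarrow> x \<in> A (Suc i) \<Longrightarrow> x \<otimes> c \<in> A i"
  by (simp add: level_def)

lemma A_bottom: "c \<in> J \<Longrightarrow> x \<in> A 0 \<Longrightarrow> x \<otimes> c = \<zero>"
  by (simp add: level_def)

lemma \<tau>_up_closed: "i \<le> j \<Longrightarrow> j < n \<Longrightarrow> c \<in> carrier G \<Longrightarrow> \<tau> i j c \<in> carrier E"
  using A_up by (intro \<tau>_closed) auto

lemma \<epsilon>_closed: "i < n \<Longrightarrow> \<epsilon> i \<in> carrier E"
  by (rule \<tau>_up_closed) auto

lemma \<tau>_down_closed: "Suc i < n \<Longrightarrow> c \<in> J \<Longrightarrow> \<tau> (Suc i) i c \<in> carrier E"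
  using A_down J.Icarr by (intro \<tau>_closed) auto

lemma \<tau>_up_mult: "i \<le> j \<Longrightarrow> j \<le> k \<Longrightarrow> k < n \<Longrightarrow> c \<in> carrier G \<Longrightarrow> d \<in> carrier G \<Longrightarrow>
    \<tau> j k d \<otimes>\<^bsub>E\<^esub> \<tau> i j c = \<tau> i k (c \<otimes> d)"
  using A_up by (intro \<tau>_mult) auto

text \<open>Multiplication by an element of \<open>J\<close> factors through the next lower level.\<close>

lemma \<tau>_radical_factor:
  assumes "Suc k \<le> j" "j < n" "c \<in> J"
  shows "\<tau> (Suc k) j c = \<tau> k j \<one> \<otimes>\<^bsub>E\<^esub> \<tau> (Suc k) k c"
proof -
  have "\<tau> k j \<one> \<otimes>\<^bsub>E\<^esub> \<tau> (Suc k) k c = \<tau> (Suc k) j (c \<otimes> \<one>)"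
    using assms A_up[of k j \<one>] A_down J.Icarr by (intro \<tau>_mult) auto
  then show ?thesis using J.Icarr[OF assms(3)] by simp
qed

lemma \<tau>_radical_bottom: "j < n \<Longrightarrow> c \<in> J \<Longrightarrow> \<tau> 0 j c = \<zero>\<^bsub>E\<^esub>"
  using A_bottom J.Icarr by (intro \<tau>_zero) auto

lemma left_module_N: "left_module E (N a)"
  by (intro left_module_power left_module_regular E.ring_axioms)

lemma in_submodule_if_levels:
  assumes M: "left_module E M" and W: "submodule W E M" and x: "x \<in> carrier M"
    and l: "\<And>i. i < n \<Longrightarrow> \<epsilon> i \<odot>\<^bsub>M\<^esub> x \<in> W"
  shows "x \<in> W"
proof -
  interpret M: left_module E M by (rule M)
  note WD = M.submoduleD[OF W]
  have "\<one>\<^bsub>E\<^esub> \<in> {c \<in> carrier E. c \<odot>\<^bsub>M\<^esub> x \<in> W}"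
    by (rule \<tau>_one) (use x WD(3,4) l \<epsilon>_closed in \<open>auto simp: M.smult_l_distr\<close>)
  then show ?thesis using x by simp
qed

lemma left_module_level: "k < n \<Longrightarrow> left_module (opposite G) (level_module E G \<tau> a k)"
proof -
  assume k: "k < n"
  interpret N: left_module E "N a" by (rule left_module_N)
  let ?M = "level_module E G \<tau> a k"
  have t: "\<tau> k k c \<in> carrier E" if "c \<in> carrier G" for c using that k by (simp add: \<tau>_up_closed)
  have fix_neg: "\<epsilon> k \<odot>\<^bsub>N a\<^esub> (\<ominus>\<^bsub>N a\<^esub> x) = \<ominus>\<^bsub>N a\<^esub> x" if "x \<in> carrier (N a)" "\<epsilon> k \<odot>\<^bsub>N a\<^esub> x = x" for x
  proof -
    have "\<epsilon> k \<odot>\<^bsub>N a\<^esub> (\<ominus>\<^bsub>N a\<^esub> x) \<oplus>\<^bsub>N a\<^esub> x = \<epsilon> k \<odot>\<^bsub>N a\<^esub> (\<ominus>\<^bsub>N a\<^esub> x \<oplus>\<^bsub>N a\<^esub> x)"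
      using that t[of \<one>] N.smult_r_distr[of "\<epsilon> k" "\<ominus>\<^bsub>N a\<^esub> x" x] by simp
    also have "\<dots> = \<zero>\<^bsub>N a\<^esub>" using that t[of \<one>] by (simp add: N.M.l_neg)
    finally show ?thesis using that t[of \<one>] N.M.minus_equality[of "\<epsilon> k \<odot>\<^bsub>N a\<^esub> (\<ominus>\<^bsub>N a\<^esub> x)" x] by simp
  qed
  have "abelian_group ?M"
  proof (rule abelian_groupI)
    fix x assume "x \<in> carrier ?M"
    then show "\<exists>y\<in>carrier ?M. y \<oplus>\<^bsub>?M\<^esub> x = \<zero>\<^bsub>?M\<^esub>"
      using fix_neg by (intro bexI[of _ "\<ominus>\<^bsub>N a\<^esub> x"]) (auto simp: level_module_def Let_def N.M.l_neg)
  qed (use t[of \<one>] in \<open>auto simp: level_module_def Let_def N.M.a_ac N.smult_r_distr\<close>)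
  then show ?thesis
  proof (intro left_module.intro left_module_axioms.intro ring_opposite ring_axioms)
    fix c d x y assume c: "c \<in> carrier (opposite G)" and x: "x \<in> carrier ?M"
    then have x': "x \<in> carrier (N a)" "\<epsilon> k \<odot>\<^bsub>N a\<^esub> x = x" by (auto simp: level_module_def Let_def)
    have "\<epsilon> k \<odot>\<^bsub>N a\<^esub> (\<tau> k k c \<odot>\<^bsub>N a\<^esub> x) = \<tau> k k c \<odot>\<^bsub>N a\<^esub> x"
      using N.smult_assoc[of "\<epsilon> k" "\<tau> k k c" x] t[of \<one>] t[of c] c k x' by (simp add: \<tau>_up_mult)
    then show "c \<odot>\<^bsub>?M\<^esub> x \<in> carrier ?M" using t c x' by (auto simp: level_module_def Let_def)
    { assume d: "d \<in> carrier (opposite G)"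
      show "(c \<oplus>\<^bsub>opposite G\<^esub> d) \<odot>\<^bsub>?M\<^esub> x = c \<odot>\<^bsub>?M\<^esub> x \<oplus>\<^bsub>?M\<^esub> d \<odot>\<^bsub>?M\<^esub> x"
        using \<tau>_add[of k k c d] A_up[of k k] c d k t x' by (simp add: level_module_def Let_def N.smult_l_distr)
      show "(c \<otimes>\<^bsub>opposite G\<^esub> d) \<odot>\<^bsub>?M\<^esub> x = c \<odot>\<^bsub>?M\<^esub> (d \<odot>\<^bsub>?M\<^esub> x)"
        using \<tau>_up_mult[of k k k d c] c d k t x' N.smult_assoc[of "\<tau> k k c" "\<tau> k k d" x] by (simp add: level_module_def Let_def) }
    { assume "y \<in> carrier ?M"
      then show "c \<odot>\<^bsub>?M\<^esub> (x \<oplus>\<^bsub>?M\<^esub> y) = c \<odot>\<^bsub>?M\<^esub> x \<oplus>\<^bsub>?M\<^esub> c \<odot>\<^bsub>?M\<^esub> y"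
        using c t x' by (simp add: level_module_def Let_def N.smult_r_distr) }
  next
    fix x assume "x \<in> carrier ?M"
    then have "\<epsilon> k \<odot>\<^bsub>N a\<^esub> x = x" by (simp add: level_module_def Let_def)
    then show "\<one>\<^bsub>opposite G\<^esub> \<odot>\<^bsub>?M\<^esub> x = x" unfolding level_module_def Let_def by simp
  qed
qed

end

locale level_endomorphisms = level_maps G J \<E> E n \<tau>
  for G :: "('g, 's) ring_scheme" (structure) and J :: "'g set" and \<E> :: "'g set"
    and E :: "('e, 't) ring_scheme" and n :: nat and \<tau> :: "nat \<Rightarrow> nat \<Rightarrow> 'g \<Rightarrow> 'e" +
  assumes level_noetherian: "k < n \<Longrightarrow> chain_stable True (submodules (opposite G) (level_module E G \<tau> a k))"
begin

text \<open>\<open>gen a k U\<close>: the submodule \<open>U\<close> of \<open>E\<^sup>a\<close> is generated by its elements of level below \<open>k\<close>.\<close>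

definition gen :: "nat \<Rightarrow> nat \<Rightarrow> (nat \<Rightarrow> 'e) set \<Rightarrow> bool"
  where "gen a k U \<longleftrightarrow> (\<forall>W. submodule W E (N a) \<and> (\<forall>i<k. \<forall>x\<in>U. \<epsilon> i \<odot>\<^bsub>N a\<^esub> x \<in> W) \<longrightarrow> U \<subseteq> W)"

text \<open>As \<open>Hom (A i, A j) = Hom (A i, A i)\<close> for \<open>i \<le> j\<close>, a module generated in levels up to \<open>k\<close> has
  nothing new above level \<open>k\<close>.\<close>

lemma gen_stationary:
  assumes Y: "submodule Y E (N a)" "gen a (Suc k) Y" and y: "y \<in> Y" and kj: "k \<le> j" "j < n"
  shows "\<exists>y'\<in>Y. \<epsilon> j \<odot>\<^bsub>N a\<^esub> y = \<tau> k j \<one> \<odot>\<^bsub>N a\<^esub> (\<epsilon> k \<odot>\<^bsub>N a\<^esub> y')"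
proof -
  interpret N: left_module E "N a" by (rule left_module_N)
  note YD = N.submoduleD[OF Y(1)]
  have ej: "\<epsilon> j \<in> carrier E" and ek: "\<epsilon> k \<in> carrier E" and kjE: "\<tau> k j \<one> \<in> carrier E"
    using kj by (auto intro: \<tau>_up_closed)
  let ?W = "{y \<in> Y. \<forall>x\<in>carrier E. \<exists>y'\<in>Y. \<epsilon> j \<odot>\<^bsub>N a\<^esub> (x \<odot>\<^bsub>N a\<^esub> y) = \<tau> k j \<one> \<odot>\<^bsub>N a\<^esub> (\<epsilon> k \<odot>\<^bsub>N a\<^esub> y')}"
  have W: "submodule ?W E (N a)"
  proof (rule N.submoduleI)
    show "?W \<subseteq> carrier (N a)" using YD(2) by blast
    show "\<zero>\<^bsub>N a\<^esub> \<in> ?W" using YD(3) ej ek kjE by (auto intro!: bexI[of _ "\<zero>\<^bsub>N a\<^esub>"])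
    fix u v assume u: "u \<in> ?W" and v: "v \<in> ?W"
    have "\<exists>y'\<in>Y. \<epsilon> j \<odot>\<^bsub>N a\<^esub> (x \<odot>\<^bsub>N a\<^esub> (u \<oplus>\<^bsub>N a\<^esub> v)) = \<tau> k j \<one> \<odot>\<^bsub>N a\<^esub> (\<epsilon> k \<odot>\<^bsub>N a\<^esub> y')" if x: "x \<in> carrier E" for x
    proof -
      obtain u' v' where "u' \<in> Y" "\<epsilon> j \<odot>\<^bsub>N a\<^esub> (x \<odot>\<^bsub>N a\<^esub> u) = \<tau> k j \<one> \<odot>\<^bsub>N a\<^esub> (\<epsilon> k \<odot>\<^bsub>N a\<^esub> u')"
        "v' \<in> Y" "\<epsilon> j \<odot>\<^bsub>N a\<^esub> (x \<odot>\<^bsub>N a\<^esub> v) = \<tau> k j \<one> \<odot>\<^bsub>N a\<^esub> (\<epsilon> k \<odot>\<^bsub>N a\<^esub> v')" using u v x by blast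
      then show ?thesis using u v x ej ek kjE YD(1,4)
        by (intro bexI[of _ "u' \<oplus>\<^bsub>N a\<^esub> v'"]) (simp_all add: N.smult_r_distr)
    qed
    then show "u \<oplus>\<^bsub>N a\<^esub> v \<in> ?W" using u v YD(4) by blast
  next
    fix b u assume b: "b \<in> carrier E" and u: "u \<in> ?W"
    have "\<exists>y'\<in>Y. \<epsilon> j \<odot>\<^bsub>N a\<^esub> (x \<odot>\<^bsub>N a\<^esub> (b \<odot>\<^bsub>N a\<^esub> u)) = \<tau> k j \<one> \<odot>\<^bsub>N a\<^esub> (\<epsilon> k \<odot>\<^bsub>N a\<^esub> y')" if x: "x \<in> carrier E" for x
    proof -
      have "x \<odot>\<^bsub>N a\<^esub> (b \<odot>\<^bsub>N a\<^esub> u) = (x \<otimes>\<^bsub>E\<^esub> b) \<odot>\<^bsub>N a\<^esub> u" using N.smult_assoc[OF x b] YD(1) u by simp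
      moreover have "x \<otimes>\<^bsub>E\<^esub> b \<in> carrier E" using x b by simp
      ultimately show ?thesis using u by simp
    qed
    then show "b \<odot>\<^bsub>N a\<^esub> u \<in> ?W" using u YD(5)[OF b] by blast
  qed
  have "\<epsilon> i \<odot>\<^bsub>N a\<^esub> u \<in> ?W" if i: "i < Suc k" and u: "u \<in> Y" for i u
  proof -
    have i': "i \<le> k" "i < n" using i kj by auto
    have ei: "\<epsilon> i \<in> carrier E" using i' by (simp add: \<epsilon>_closed)
    have uN: "u \<in> carrier (N a)" using YD(1) u .
    have "\<exists>y'\<in>Y. \<epsilon> j \<odot>\<^bsub>N a\<^esub> (x \<odot>\<^bsub>N a\<^esub> (\<epsilon> i \<odot>\<^bsub>N a\<^esub> u)) = \<tau> k j \<one> \<odot>\<^bsub>N a\<^esub> (\<epsilon> k \<odot>\<^bsub>N a\<^esub> y')" if x: "x \<in> carrier E" for x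
    proof -
      obtain c where c: "c \<in> carrier G" "\<epsilon> j \<otimes>\<^bsub>E\<^esub> x \<otimes>\<^bsub>E\<^esub> \<epsilon> i = \<tau> i j c" using \<tau>_surj[OF i'(2) kj(2) x] by blast
      have t: "\<tau> i k c \<in> carrier E" using i' kj c by (simp add: \<tau>_up_closed)
      have eq: "\<tau> i j c = \<tau> k j \<one> \<otimes>\<^bsub>E\<^esub> (\<epsilon> k \<otimes>\<^bsub>E\<^esub> \<tau> i k c)" using i' kj c by (simp add: \<tau>_up_mult)
      have "\<epsilon> j \<odot>\<^bsub>N a\<^esub> (x \<odot>\<^bsub>N a\<^esub> (\<epsilon> i \<odot>\<^bsub>N a\<^esub> u)) = \<tau> i j c \<odot>\<^bsub>N a\<^esub> u"
        unfolding c(2)[symmetric] using uN x ei ej by (simp add: N.smult_assoc)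
      also have "\<dots> = \<tau> k j \<one> \<odot>\<^bsub>N a\<^esub> (\<epsilon> k \<odot>\<^bsub>N a\<^esub> (\<tau> i k c \<odot>\<^bsub>N a\<^esub> u))"
        unfolding eq using uN t ek kjE by (simp add: N.smult_assoc)
      finally show ?thesis using YD(5)[OF t u] by blast
    qed
    then show ?thesis using YD(5)[OF ei u] by blast
  qed
  then have "Y \<subseteq> ?W" using Y(2) W unfolding gen_def by blast
  then have "\<exists>y'\<in>Y. \<epsilon> j \<odot>\<^bsub>N a\<^esub> (\<one>\<^bsub>E\<^esub> \<odot>\<^bsub>N a\<^esub> y) = \<tau> k j \<one> \<odot>\<^bsub>N a\<^esub> (\<epsilon> k \<odot>\<^bsub>N a\<^esub> y')" using y by blast
  then show ?thesis using YD(1)[OF y] by simp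
qed

lemma N_mono:
  assumes "i \<le> j" "j < n" "x \<in> carrier (N a)" "\<tau> i j \<one> \<odot>\<^bsub>N a\<^esub> (\<epsilon> i \<odot>\<^bsub>N a\<^esub> x) = \<zero>\<^bsub>N a\<^esub>"
  shows "\<epsilon> i \<odot>\<^bsub>N a\<^esub> x = \<zero>\<^bsub>N a\<^esub>"
proof -
  have "\<epsilon> i \<otimes>\<^bsub>E\<^esub> x t = \<zero>\<^bsub>E\<^esub>" if t: "t < a" for t
  proof (rule \<tau>_mono[OF assms(1,2)])
    show "x t \<in> carrier E" using assms(3) t by (auto simp: power_module_simps)
    show "\<tau> i j \<one> \<otimes>\<^bsub>E\<^esub> (\<epsilon> i \<otimes>\<^bsub>E\<^esub> x t) = \<zero>\<^bsub>E\<^esub>"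
      using fun_cong[OF assms(4), of t] t by (simp add: power_module_simps)
  qed
  then show ?thesis by (auto simp: power_module_simps fun_eq_iff)
qed

text \<open>The elements \<open>\<tau> k k c z\<close> form a simple right \<open>G\<close>-module modulo \<open>Y\<close>: for \<open>c \<in> J\<close> they come from a
  lower level and lie in \<open>Y\<close>. Hence, if \<open>x z \<in> Y\<close> for an element \<open>x\<close> of the projective module \<open>E e\<close> that covers
  \<open>z\<close>, the components of \<open>x\<close> in the levels \<open>j \<ge> k\<close> are given by elements of \<open>J\<close> and factor through
  level \<open>k - 1\<close>, or vanish if \<open>k = 0\<close>. So the relations are generated in levels below \<open>k\<close>, and have a short resolution.\<close>

lemma adjoin_generator:
  assumes k: "k < n"
    and U: "submodule U E (N a)" and Y: "submodule Y E (N a)" "gen a (Suc k) Y"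
    and low: "\<And>i u. i < k \<Longrightarrow> u \<in> U \<Longrightarrow> \<epsilon> i \<odot>\<^bsub>N a\<^esub> u \<in> Y"
    and e: "e \<in> \<E>" and z: "z \<in> U" "z \<notin> Y" "\<tau> k k e \<odot>\<^bsub>N a\<^esub> z = z"
    and lenY: "res_len E (Suc k) ((N a)\<lparr>carrier := Y\<rparr>)"
    and IH: "\<And>K. submodule K E (N 1) \<Longrightarrow> gen 1 k K \<Longrightarrow> res_len E k ((N 1)\<lparr>carrier := K\<rparr>)"
  shows "res_len E (Suc k) ((N a)\<lparr>carrier := lin_span E (N a) (insert z Y)\<rparr>)"
proof -
  interpret N: left_module E "N a" by (rule left_module_N)
  interpret F: left_module E "N 1" by (rule left_module_N)
  note YD = N.submoduleD[OF Y(1)] and UD = N.submoduleD[OF U]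
  have zN: "z \<in> carrier (N a)" by (rule UD(1)[OF z(1)])
  have ec: "e \<in> carrier G" and ee: "e \<otimes> e = e" using \<E>_closed \<E>_idem e by auto
  define e' where "e' = \<tau> k k e"
  have e'c: "e' \<in> carrier E" and e'e': "e' \<otimes>\<^bsub>E\<^esub> e' = e'" and ke': "\<epsilon> k \<otimes>\<^bsub>E\<^esub> e' = e'"
    using k ec ee by (simp_all add: e'_def \<tau>_up_closed \<tau>_up_mult)
  have e'z: "e' \<odot>\<^bsub>N a\<^esub> z = z" using z by (simp add: e'_def)
  have ekc: "\<epsilon> k \<in> carrier E" using k by (simp add: \<epsilon>_closed)
  have radical: "\<tau> k j c \<odot>\<^bsub>N a\<^esub> z \<in> Y" if c: "c \<in> J" and j: "k \<le> j" "j < n" for c j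
  proof (cases k)
    case 0
    then show ?thesis using \<tau>_radical_bottom[OF j(2) c] zN YD(3) by simp
  next
    case (Suc k')
    have t: "\<tau> k k' c \<in> carrier E" using \<tau>_down_closed[of k' c] c k Suc by simp
    have t': "\<tau> k' j \<one> \<in> carrier E" using j Suc by (intro \<tau>_up_closed) auto
    have "\<epsilon> k' \<otimes>\<^bsub>E\<^esub> \<tau> k k' c = \<tau> k k' c"
      using \<tau>_mult[of k k' k' c \<one>] k Suc c J.Icarr A_down A_up[of k' k' \<one>] by simp
    then have "\<tau> k k' c \<odot>\<^bsub>N a\<^esub> z = \<epsilon> k' \<odot>\<^bsub>N a\<^esub> (\<tau> k k' c \<odot>\<^bsub>N a\<^esub> z)"
      using N.smult_assoc[of "\<epsilon> k'" "\<tau> k k' c" z] t zN \<epsilon>_closed[of k'] k Suc by simp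
    also have "\<dots> \<in> Y" using low[of k'] Suc UD(5)[OF t z(1)] by simp
    finally have "\<tau> k' j \<one> \<odot>\<^bsub>N a\<^esub> (\<tau> k k' c \<odot>\<^bsub>N a\<^esub> z) \<in> Y" by (rule YD(5)[OF t'])
    then show ?thesis using \<tau>_radical_factor[of k' j c] j c Suc t t' zN by (simp add: N.smult_assoc)
  qed
  let ?Pc = "{x \<in> carrier (N 1). x 0 \<otimes>\<^bsub>E\<^esub> e' = x 0}"
  have N1: "x 0 \<in> carrier E" if "x \<in> carrier (N 1)" for x using that by (auto simp: power_module_simps)
  have Pc: "submodule ?Pc E (N 1)"
  proof (rule F.submoduleI)
    show "\<zero>\<^bsub>N 1\<^esub> \<in> ?Pc" using F.M.zero_closed e'c by (simp add: power_module_simps)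
    fix x y assume "x \<in> ?Pc" "y \<in> ?Pc"
    then show "x \<oplus>\<^bsub>N 1\<^esub> y \<in> ?Pc"
      using F.M.add.m_closed[of x y] N1 e'c by (simp add: power_module_simps(3) E.l_distr)
  next
    fix c x assume "c \<in> carrier E" "x \<in> ?Pc"
    then show "c \<odot>\<^bsub>N 1\<^esub> x \<in> ?Pc"
      using F.smult_closed[of c x] N1 e'c by (simp add: power_module_simps(4) E.m_assoc)
  qed auto
  let ?P = "(N 1)\<lparr>carrier := ?Pc\<rparr>"
  define mk where "mk x = (\<lambda>i\<in>{..<1::nat}. x)" for x :: 'e
  have mk: "mk x \<in> carrier (N 1)" if "x \<in> carrier E" for x using that by (auto simp: mk_def power_module_simps)
  have mk0: "mk x 0 = x" for x by (simp add: mk_def)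
  have mk_eq: "mk (x 0) = x" if "x \<in> carrier (N 1)" for x
    using that by (auto simp: mk_def power_module_simps PiE_iff extensional_def fun_eq_iff)
  have P: "projective E ?P"
  proof (rule projective_retract[OF projective_free[OF E.ring_axioms, of 1] F.left_module_sub[OF Pc]])
    show "(\<lambda>x. x) \<in> module_hom E ?P (N 1)" by (rule module_homI) auto
    show "(\<lambda>x. mk (x 0 \<otimes>\<^bsub>E\<^esub> e')) \<in> module_hom E (N 1) ?P"
    proof (rule module_homI)
      fix x assume "x \<in> carrier (N 1)"
      then show "mk (x 0 \<otimes>\<^bsub>E\<^esub> e') \<in> carrier ?P" using mk N1 e'c e'e' by (simp add: mk0 E.m_assoc)
    next
      fix x y assume "x \<in> carrier (N 1)" "y \<in> carrier (N 1)"
      then show "mk ((x \<oplus>\<^bsub>N 1\<^esub> y) 0 \<otimes>\<^bsub>E\<^esub> e') = mk (x 0 \<otimes>\<^bsub>E\<^esub> e') \<oplus>\<^bsub>?P\<^esub> mk (y 0 \<otimes>\<^bsub>E\<^esub> e')"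
        using N1 e'c by (auto simp: mk_def power_module_simps(3) E.l_distr fun_eq_iff)
    next
      fix c x assume "c \<in> carrier E" "x \<in> carrier (N 1)"
      then show "mk ((c \<odot>\<^bsub>N 1\<^esub> x) 0 \<otimes>\<^bsub>E\<^esub> e') = c \<odot>\<^bsub>?P\<^esub> mk (x 0 \<otimes>\<^bsub>E\<^esub> e')"
        using N1 e'c by (auto simp: mk_def power_module_simps(4) E.m_assoc fun_eq_iff)
    qed
    show "mk (x 0 \<otimes>\<^bsub>E\<^esub> e') = x" if "x \<in> carrier ?P" for x using that mk_eq by simp
  qed
  let ?Z = "lin_span E (N a) (insert z Y)"
  have spanY: "lin_span E (N a) Y = Y" using span_minimal[OF Y(1), of Y] span_superset[of Y E "N a"] by auto
  have Zeq: "?Z = {y \<oplus>\<^bsub>N a\<^esub> c \<odot>\<^bsub>N a\<^esub> z | y c. y \<in> Y \<and> c \<in> carrier E}"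
    using N.span_insert[OF YD(2) zN] unfolding spanY .
  have Z: "submodule ?Z E (N a)" using YD(2) zN by (intro N.span_submodule) auto
  have zZ: "z \<in> ?Z" "Y \<subseteq> ?Z" using span_superset[of "insert z Y" E "N a"] by auto
  let ?q = "\<lambda>x. x 0 \<odot>\<^bsub>N a\<^esub> z"
  have q0: "?q \<in> module_hom E (N 1) (N a)"
  proof (rule module_homI)
    fix x y assume "x \<in> carrier (N 1)" "y \<in> carrier (N 1)"
    moreover have "(x \<oplus>\<^bsub>N 1\<^esub> y) 0 = x 0 \<oplus>\<^bsub>E\<^esub> y 0" by (simp add: power_module_simps(3))
    ultimately show "?q (x \<oplus>\<^bsub>N 1\<^esub> y) = ?q x \<oplus>\<^bsub>N a\<^esub> ?q y" using N1 zN by (simp add: N.smult_l_distr)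
  next
    fix c x assume "c \<in> carrier E" "x \<in> carrier (N 1)"
    moreover have "(c \<odot>\<^bsub>N 1\<^esub> x) 0 = c \<otimes>\<^bsub>E\<^esub> x 0" by (simp add: power_module_simps(4))
    ultimately show "?q (c \<odot>\<^bsub>N 1\<^esub> x) = c \<odot>\<^bsub>N a\<^esub> ?q x" using N1 zN by (simp add: N.smult_assoc)
  qed (use N1 zN in simp)
  have q: "?q \<in> module_hom E ?P ((N a)\<lparr>carrier := ?Z\<rparr>)"
    using module_homD[OF q0] N.submoduleD(5)[OF Z _ zZ(1)] N1 by (intro module_homI) auto
  let ?K = "{x \<in> ?Pc. ?q x \<in> Y}"
  have K: "submodule ?K E (N 1)"
    using F.submodule_Int[OF Pc submodule_vimage[OF left_module_N left_module_N q0 Y(1)]]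
    by (rule back_subst[of "\<lambda>X. submodule X E (N 1)"]) auto
  note KD = F.submoduleD[OF K]
  have "gen 1 k ?K"
    unfolding gen_def
  proof (intro allI impI subsetI)
    fix W x assume W: "submodule W E (N 1) \<and> (\<forall>i<k. \<forall>x\<in>?K. \<epsilon> i \<odot>\<^bsub>N 1\<^esub> x \<in> W)" and x: "x \<in> ?K"
    note WD = F.submoduleD[OF conjunct1[OF W]]
    have xN: "x \<in> carrier (N 1)" and x0: "x 0 \<in> carrier E" "x 0 \<otimes>\<^bsub>E\<^esub> e' = x 0" and xz: "x 0 \<odot>\<^bsub>N a\<^esub> z \<in> Y"
      using x N1 by auto
    show "x \<in> W"
    proof (rule in_submodule_if_levels[OF left_module_N conjunct1[OF W] xN])
      fix j assume j: "j < n"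
      show "\<epsilon> j \<odot>\<^bsub>N 1\<^esub> x \<in> W"
      proof (cases "j < k")
        case True
        then show ?thesis using W x by blast
      next
        case False
        then have kj: "k \<le> j" by simp
        have ejc: "\<epsilon> j \<in> carrier E" using j by (simp add: \<epsilon>_closed)
        have kjc: "\<tau> k j \<one> \<in> carrier E" using kj j by (simp add: \<tau>_up_closed)
        obtain c0 where c0: "c0 \<in> carrier G" "\<epsilon> j \<otimes>\<^bsub>E\<^esub> x 0 \<otimes>\<^bsub>E\<^esub> \<epsilon> k = \<tau> k j c0" using \<tau>_surj[OF k j x0(1)] by blast
        define c where "c = e \<otimes> c0"
        have c: "c \<in> carrier G" "e \<otimes> c = c" using c0 ec ee by (simp_all add: c_def flip: m_assoc)
        have "\<epsilon> j \<otimes>\<^bsub>E\<^esub> x 0 = \<epsilon> j \<otimes>\<^bsub>E\<^esub> (x 0 \<otimes>\<^bsub>E\<^esub> (\<epsilon> k \<otimes>\<^bsub>E\<^esub> e'))" using x0 ke' by simp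
        also have "\<dots> = \<tau> k j c0 \<otimes>\<^bsub>E\<^esub> e'" unfolding c0(2)[symmetric] using x0(1) ejc ekc e'c by (simp add: E.m_assoc)
        also have "\<dots> = \<tau> k j c" using kj j c0 ec by (simp add: e'_def c_def \<tau>_up_mult)
        finally have ejx: "\<epsilon> j \<otimes>\<^bsub>E\<^esub> x 0 = \<tau> k j c" .
        have kkc: "\<tau> k k c \<in> carrier E" using k c by (simp add: \<tau>_up_closed)
        have fac: "\<tau> k j c = \<tau> k j \<one> \<otimes>\<^bsub>E\<^esub> \<tau> k k c" using kj j c by (simp add: \<tau>_up_mult)
        have ekkc: "\<epsilon> k \<otimes>\<^bsub>E\<^esub> \<tau> k k c = \<tau> k k c" using k c by (simp add: \<tau>_up_mult)
        \<comment> \<open>Above level \<open>k\<close> the submodule \<open>Y\<close> is the image of its level \<open>k\<close>, and \<open>\<tau> k j 1\<close> is injective.\<close>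
        obtain y where y: "y \<in> Y" "\<epsilon> j \<odot>\<^bsub>N a\<^esub> (x 0 \<odot>\<^bsub>N a\<^esub> z) = \<tau> k j \<one> \<odot>\<^bsub>N a\<^esub> (\<epsilon> k \<odot>\<^bsub>N a\<^esub> y)"
          using gen_stationary[OF Y xz kj j] by blast
        have yN: "y \<in> carrier (N a)" using YD(1) y(1) .
        let ?d = "\<tau> k k c \<odot>\<^bsub>N a\<^esub> z \<ominus>\<^bsub>N a\<^esub> \<epsilon> k \<odot>\<^bsub>N a\<^esub> y"
        have dc: "?d \<in> carrier (N a)" using kkc ekc zN yN by simp
        have "\<tau> k j \<one> \<odot>\<^bsub>N a\<^esub> (\<tau> k k c \<odot>\<^bsub>N a\<^esub> z) = \<epsilon> j \<odot>\<^bsub>N a\<^esub> (x 0 \<odot>\<^bsub>N a\<^esub> z)"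
          using ejx fac zN kjc kkc ejc x0(1) by (metis N.smult_assoc)
        then have eq: "\<tau> k j \<one> \<odot>\<^bsub>N a\<^esub> (\<tau> k k c \<odot>\<^bsub>N a\<^esub> z) = \<tau> k j \<one> \<odot>\<^bsub>N a\<^esub> (\<epsilon> k \<odot>\<^bsub>N a\<^esub> y)" using y(2) by simp
        have "(?d \<oplus>\<^bsub>N a\<^esub> \<epsilon> k \<odot>\<^bsub>N a\<^esub> y) = \<tau> k k c \<odot>\<^bsub>N a\<^esub> z"
          using kkc ekc zN yN by (simp add: a_minus_def N.M.a_assoc N.M.l_neg)
        then have "\<tau> k j \<one> \<odot>\<^bsub>N a\<^esub> ?d \<oplus>\<^bsub>N a\<^esub> \<tau> k j \<one> \<odot>\<^bsub>N a\<^esub> (\<epsilon> k \<odot>\<^bsub>N a\<^esub> y) = \<tau> k j \<one> \<odot>\<^bsub>N a\<^esub> (\<epsilon> k \<odot>\<^bsub>N a\<^esub> y)"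
          using N.smult_r_distr[OF kjc dc, of "\<epsilon> k \<odot>\<^bsub>N a\<^esub> y"] eq ekc yN by simp
        then have d0: "\<tau> k j \<one> \<odot>\<^bsub>N a\<^esub> ?d = \<zero>\<^bsub>N a\<^esub>" using kjc dc ekc yN by simp
        have ekek: "\<epsilon> k \<otimes>\<^bsub>E\<^esub> \<epsilon> k = \<epsilon> k" using k by (simp add: \<tau>_up_mult)
        have ed: "\<epsilon> k \<odot>\<^bsub>N a\<^esub> ?d = ?d"
        proof -
          have 1: "\<epsilon> k \<odot>\<^bsub>N a\<^esub> (\<tau> k k c \<odot>\<^bsub>N a\<^esub> z) = \<tau> k k c \<odot>\<^bsub>N a\<^esub> z"
            using N.smult_assoc[OF ekc kkc zN] ekkc by simp
          have 2: "\<epsilon> k \<odot>\<^bsub>N a\<^esub> (\<epsilon> k \<odot>\<^bsub>N a\<^esub> y) = \<epsilon> k \<odot>\<^bsub>N a\<^esub> y"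
            using N.smult_assoc[OF ekc ekc yN] ekek by simp
          have "\<epsilon> k \<odot>\<^bsub>N a\<^esub> ?d \<oplus>\<^bsub>N a\<^esub> \<epsilon> k \<odot>\<^bsub>N a\<^esub> (\<epsilon> k \<odot>\<^bsub>N a\<^esub> y) = \<epsilon> k \<odot>\<^bsub>N a\<^esub> (\<tau> k k c \<odot>\<^bsub>N a\<^esub> z)"
            using N.smult_r_distr[OF ekc dc, of "\<epsilon> k \<odot>\<^bsub>N a\<^esub> y"] \<open>?d \<oplus>\<^bsub>N a\<^esub> \<epsilon> k \<odot>\<^bsub>N a\<^esub> y = _\<close> ekc yN by simp
          then have "\<epsilon> k \<odot>\<^bsub>N a\<^esub> ?d \<oplus>\<^bsub>N a\<^esub> \<epsilon> k \<odot>\<^bsub>N a\<^esub> y = ?d \<oplus>\<^bsub>N a\<^esub> \<epsilon> k \<odot>\<^bsub>N a\<^esub> y"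
            using 1 2 \<open>?d \<oplus>\<^bsub>N a\<^esub> \<epsilon> k \<odot>\<^bsub>N a\<^esub> y = _\<close> by simp
          then show ?thesis using N.M.add.right_cancel[of "\<epsilon> k \<odot>\<^bsub>N a\<^esub> y" "\<epsilon> k \<odot>\<^bsub>N a\<^esub> ?d" ?d] dc ekc yN by simp
        qed
        have "\<epsilon> k \<odot>\<^bsub>N a\<^esub> ?d = \<zero>\<^bsub>N a\<^esub>" by (rule N_mono[OF kj j dc]) (simp only: ed d0)
        then have "?d = \<zero>\<^bsub>N a\<^esub>" using ed by simp
        then have "\<tau> k k c \<odot>\<^bsub>N a\<^esub> z = \<epsilon> k \<odot>\<^bsub>N a\<^esub> y"
          by (rule N.M.diff_eq_zero[rotated 2]) (use kkc ekc zN yN in simp_all)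
        then have cz: "\<tau> k k c \<odot>\<^bsub>N a\<^esub> z \<in> Y" using YD(5)[OF ekc y(1)] by simp
        have cJ: "c \<in> J"
        proof (rule ccontr)
          assume "c \<notin> J"
          then obtain d where d: "d \<in> carrier G" "e \<ominus> c \<otimes> d \<in> J" using right_simple[OF e c] by blast
          have kkd: "\<tau> k k d \<in> carrier E" using k d by (simp add: \<tau>_up_closed)
          have kkr: "\<tau> k k (e \<ominus> c \<otimes> d) \<in> carrier E" "\<tau> k k (c \<otimes> d) \<in> carrier E" using k d c ec by (simp_all add: \<tau>_up_closed)
          have "\<tau> k k (c \<otimes> d) \<odot>\<^bsub>N a\<^esub> z \<in> Y"
            using YD(5)[OF kkd cz] N.smult_assoc[OF kkd kkc zN] k c d by (simp add: \<tau>_up_mult)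
          moreover have "\<tau> k k (e \<ominus> c \<otimes> d) \<odot>\<^bsub>N a\<^esub> z \<in> Y" by (rule radical[OF d(2) order_refl k])
          moreover have "e = (e \<ominus> c \<otimes> d) \<oplus> c \<otimes> d" using c d ec by (simp add: a_minus_def a_assoc l_neg)
          then have "\<tau> k k e = \<tau> k k (e \<ominus> c \<otimes> d) \<oplus>\<^bsub>E\<^esub> \<tau> k k (c \<otimes> d)"
            using \<tau>_add[of k k "e \<ominus> c \<otimes> d" "c \<otimes> d"] A_up[of k k] k c d ec by simp
          ultimately have "\<tau> k k e \<odot>\<^bsub>N a\<^esub> z \<in> Y" using kkr zN YD(4) by (simp add: N.smult_l_distr)
          then show False using z by simp
        qed
        have ejx': "\<epsilon> j \<odot>\<^bsub>N 1\<^esub> x = mk (\<tau> k j c)"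
          using ejx by (auto simp: mk_def power_module_simps(4) fun_eq_iff)
        show ?thesis
        proof (cases k)
          case 0
          then have "\<tau> k j c = \<zero>\<^bsub>E\<^esub>" using \<tau>_radical_bottom[OF j cJ] by simp
          then have "mk (\<tau> k j c) = \<zero>\<^bsub>N 1\<^esub>" by (simp add: mk_def power_module_simps(2))
          then show ?thesis using WD(3) ejx' by simp
        next
          case (Suc k')
          let ?w = "\<tau> k k' c"
          have k': "k' < k" "k' < n" "k' \<le> j" using Suc k kj by auto
          have wc: "?w \<in> carrier E" using \<tau>_down_closed[of k' c] cJ k Suc by simp
          have ek'c: "\<epsilon> k' \<in> carrier E" using k' by (simp add: \<epsilon>_closed)
          have k'j: "\<tau> k' j \<one> \<in> carrier E" using k' j by (intro \<tau>_up_closed) auto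
          have ew: "\<epsilon> k' \<otimes>\<^bsub>E\<^esub> ?w = ?w"
            using \<tau>_mult[of k k' k' c \<one>] k k' Suc cJ c(1) A_down A_up[of k' k' \<one>] by simp
          have we: "?w \<otimes>\<^bsub>E\<^esub> e' = ?w"
            using \<tau>_mult[of k k k' e c] k k' Suc cJ c ec A_down A_up[of k k e] by (simp add: e'_def)
          have "?w \<odot>\<^bsub>N a\<^esub> z = \<epsilon> k' \<odot>\<^bsub>N a\<^esub> (?w \<odot>\<^bsub>N a\<^esub> z)" using N.smult_assoc[OF ek'c wc zN] ew by simp
          also have "\<dots> \<in> Y" by (rule low[OF k'(1) UD(5)[OF wc z(1)]])
          finally have "mk ?w \<in> ?K" using mk[OF wc] we by (simp add: mk0)
          then have "\<epsilon> k' \<odot>\<^bsub>N 1\<^esub> mk ?w \<in> W" using W k' by blast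
          moreover have "\<epsilon> k' \<odot>\<^bsub>N 1\<^esub> mk ?w = mk ?w" using ew by (auto simp: mk_def power_module_simps(4) fun_eq_iff)
          ultimately have "\<tau> k' j \<one> \<odot>\<^bsub>N 1\<^esub> mk ?w \<in> W" using WD(5)[OF k'j] by simp
          moreover have "\<tau> k' j \<one> \<odot>\<^bsub>N 1\<^esub> mk ?w = mk (\<tau> k j c)"
            using \<tau>_radical_factor[of k' j c] kj j cJ Suc by (auto simp: mk_def power_module_simps(4) fun_eq_iff)
          ultimately show ?thesis using ejx' by simp
        qed
      qed
    qed
  qed
  then have lenK: "res_len E k ((N 1)\<lparr>carrier := ?K\<rparr>)" by (rule IH[OF K])
  show ?thesis
  proof (rule res_len_attach[OF lenY N.left_module_sub[OF Z] _ _ P q, where f = "\<lambda>x. x"])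
    show "(\<lambda>x. x) \<in> module_hom E ((N a)\<lparr>carrier := Y\<rparr>) ((N a)\<lparr>carrier := ?Z\<rparr>)"
      by (rule module_homI) (use zZ in auto)
    show "inj_on (\<lambda>x. x) (carrier ((N a)\<lparr>carrier := Y\<rparr>))" by simp
    show "res_len E k (?P\<lparr>carrier := {x \<in> carrier ?P. ?q x \<in> (\<lambda>x. x) ` carrier ((N a)\<lparr>carrier := Y\<rparr>)}\<rparr>)"
      using lenK by simp
    fix v assume "v \<in> carrier ((N a)\<lparr>carrier := ?Z\<rparr>)"
    then obtain y c where yc: "v = y \<oplus>\<^bsub>N a\<^esub> c \<odot>\<^bsub>N a\<^esub> z" "y \<in> Y" "c \<in> carrier E" unfolding Zeq by auto
    have "mk (c \<otimes>\<^bsub>E\<^esub> e') \<in> carrier ?P" using mk yc e'c e'e' by (simp add: mk0 E.m_assoc)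
    moreover have "?q (mk (c \<otimes>\<^bsub>E\<^esub> e')) = c \<odot>\<^bsub>N a\<^esub> z"
      using N.smult_assoc[OF yc(3) e'c zN] e'z by (simp add: mk0)
    ultimately show "\<exists>u\<in>carrier ((N a)\<lparr>carrier := Y\<rparr>). \<exists>x\<in>carrier ?P. v = u \<oplus>\<^bsub>(N a)\<lparr>carrier := ?Z\<rparr>\<^esub> ?q x"
      using yc by (intro bexI[of _ y] bexI[of _ "mk (c \<otimes>\<^bsub>E\<^esub> e')"]) auto
  qed
qed

text \<open>Among the submodules of \<open>U\<close> that contain the levels below \<open>k\<close>, are generated in levels up to \<open>k\<close>
  and have a resolution of the required length, choose \<open>Y\<close> with maximal level \<open>k\<close>. If it were not
  all of \<open>U\<close>, some element of level \<open>k\<close> could be adjoined.\<close>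

lemma res_len_gen:
  "k \<le> n \<Longrightarrow> submodule U E (N a) \<Longrightarrow> gen a k U \<Longrightarrow> res_len E k ((N a)\<lparr>carrier := U\<rparr>)"
proof (induction k arbitrary: a U)
  case 0
  interpret N: left_module E "N a" by (rule left_module_N)
  have "U \<subseteq> {\<zero>\<^bsub>N a\<^esub>}" using 0(3) N.submodule_zero unfolding gen_def by blast
  then have "U = {\<zero>\<^bsub>N a\<^esub>}" using N.submoduleD(3)[OF 0(2)] by blast
  then show ?case using N.left_module_sub[OF 0(2)] by simp
next
  case (Suc k)
  then have k: "k < n" by simp
  interpret N: left_module E "N a" by (rule left_module_N)
  interpret op: semiprimary "opposite G" J \<E> by (rule semiprimary_opposite) (rule semiprimary_axioms)
  note U = Suc.prems(2) and UD = N.submoduleD[OF Suc.prems(2)]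
  have ekc: "\<epsilon> k \<in> carrier E" using k by (simp add: \<epsilon>_closed)
  let ?lev = "\<lambda>Y. {y \<in> Y. \<epsilon> k \<odot>\<^bsub>N a\<^esub> y = y}"
  let ?X = "{\<epsilon> i \<odot>\<^bsub>N a\<^esub> u | i u. i < k \<and> u \<in> U}"
  let ?U' = "lin_span E (N a) ?X"
  have XU: "?X \<subseteq> U" using UD(5) \<epsilon>_closed k by auto
  have U': "submodule ?U' E (N a)" using XU UD(2) by (intro N.span_submodule) auto
  have XU': "?X \<subseteq> ?U'" by (rule span_superset)
  have U'U: "?U' \<subseteq> U" by (rule span_minimal[OF U XU])
  have genU': "gen a k ?U'"
    unfolding gen_def
  proof (intro allI impI)
    fix W assume W: "submodule W E (N a) \<and> (\<forall>i<k. \<forall>x\<in>?U'. \<epsilon> i \<odot>\<^bsub>N a\<^esub> x \<in> W)"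
    have "?X \<subseteq> W"
    proof
      fix x assume "x \<in> ?X"
      then obtain i u where iu: "x = \<epsilon> i \<odot>\<^bsub>N a\<^esub> u" "i < k" "u \<in> U" by blast
      have ei: "\<epsilon> i \<in> carrier E" "\<epsilon> i \<otimes>\<^bsub>E\<^esub> \<epsilon> i = \<epsilon> i" using iu k by (simp_all add: \<epsilon>_closed \<tau>_up_mult)
      have "x = \<epsilon> i \<odot>\<^bsub>N a\<^esub> x" using N.smult_assoc[OF ei(1) ei(1) UD(1)[OF iu(3)]] ei(2) iu(1) by simp
      then show "x \<in> W" using W iu(2) XU' \<open>x \<in> ?X\<close> by (metis (no_types, lifting) subsetD)
    qed
    then show "?U' \<subseteq> W" using W by (intro span_minimal) auto
  qed
  let ?good = "{Y. submodule Y E (N a) \<and> ?U' \<subseteq> Y \<and> Y \<subseteq> U \<and> gen a (Suc k) Y \<and> res_len E (Suc k) ((N a)\<lparr>carrier := Y\<rparr>)}"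
  let ?M = "level_module E G \<tau> a k"
  have Mm: "left_module (opposite G) ?M" by (rule left_module_level[OF k])
  interpret M: left_module "opposite G" ?M by (rule Mm)
  have kkc: "\<tau> k k c \<in> carrier E" if "c \<in> carrier G" for c using that k by (simp add: \<tau>_up_closed)
  have lev: "submodule (?lev Y) (opposite G) ?M" if Y: "submodule Y E (N a)" for Y
  proof -
    note YD = N.submoduleD[OF Y]
    have "\<epsilon> k \<odot>\<^bsub>N a\<^esub> (\<tau> k k c \<odot>\<^bsub>N a\<^esub> x) = \<tau> k k c \<odot>\<^bsub>N a\<^esub> x" if "c \<in> carrier G" "x \<in> Y" for c x
      using N.smult_assoc[OF ekc kkc[OF that(1)] YD(1)[OF that(2)]] that k by (simp add: \<tau>_up_mult)
    then show ?thesis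
      using YD(1,3,4) YD(5)[OF kkc] ekc
      by (intro M.submoduleI) (auto simp: level_module_def Let_def N.smult_r_distr)
  qed
  have cs: "chain_stable True (?lev ` ?good)"
    by (rule chain_stable_subset[OF level_noetherian[OF k]]) (use lev in auto)
  have "?U' \<in> ?good"
  proof -
    have "res_len E k ((N a)\<lparr>carrier := ?U'\<rparr>)" using k by (intro Suc.IH U' genU') simp
    then have "res_len E (Suc k) ((N a)\<lparr>carrier := ?U'\<rparr>)" by (rule res_len_Suc)
    moreover have "gen a (Suc k) ?U'" using genU' unfolding gen_def by (meson less_SucI)
    ultimately show ?thesis using U' U'U by blast
  qed
  then have "?lev ?U' \<in> ?lev ` ?good" by blast
  from chain_stable_maximal[OF cs this] obtain Y where Y: "Y \<in> ?good"
    and max: "\<forall>Z\<in>?lev ` ?good. ?lev Y \<subseteq> Z \<longrightarrow> Z = ?lev Y" by (elim bexE imageE) simp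
  have Ys: "submodule Y E (N a)" and YU: "?U' \<subseteq> Y" "Y \<subseteq> U" and Yg: "gen a (Suc k) Y"
    and Yl: "res_len E (Suc k) ((N a)\<lparr>carrier := Y\<rparr>)" using Y by blast+
  note YD = N.submoduleD[OF Ys]
  have low: "\<epsilon> i \<odot>\<^bsub>N a\<^esub> u \<in> Y" if "i < k" "u \<in> U" for i u using that XU' YU(1) by blast
  have "?lev U \<subseteq> Y"
  proof (rule ccontr)
    assume "\<not> ?lev U \<subseteq> Y"
    then obtain y where y: "y \<in> U" "\<epsilon> k \<odot>\<^bsub>N a\<^esub> y = y" "y \<notin> Y" by blast
    have yM: "y \<in> carrier ?M" using y UD(1) by (simp add: level_module_def Let_def)
    have radical: "\<tau> k k c \<odot>\<^bsub>N a\<^esub> y \<in> Y" if c: "c \<in> J" for c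
    proof (cases k)
      case 0
      then show ?thesis using \<tau>_radical_bottom[of 0 c] c k UD(1)[OF y(1)] YD(3) by simp
    next
      case (Suc k')
      have t: "\<tau> k k' c \<in> carrier E" using \<tau>_down_closed[of k' c] c k Suc by simp
      have t': "\<tau> k' k \<one> \<in> carrier E" "\<epsilon> k' \<in> carrier E" using k Suc by (auto intro: \<tau>_up_closed)
      have "\<tau> k k c = \<tau> k' k \<one> \<otimes>\<^bsub>E\<^esub> (\<epsilon> k' \<otimes>\<^bsub>E\<^esub> \<tau> k k' c)"
        using \<tau>_mult[of k k' k' c \<one>] k Suc c J.Icarr A_down A_up[of k' k' \<one>] \<tau>_radical_factor[of k' k c] by simp
      then have "\<tau> k k c \<odot>\<^bsub>N a\<^esub> y = \<tau> k' k \<one> \<odot>\<^bsub>N a\<^esub> (\<epsilon> k' \<odot>\<^bsub>N a\<^esub> (\<tau> k k' c \<odot>\<^bsub>N a\<^esub> y))"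
        using t t' UD(1)[OF y(1)] by (simp add: N.smult_assoc)
      then show ?thesis using YD(5)[OF t'(1) low[of k', OF _ UD(5)[OF t y(1)]]] Suc by simp
    qed
    have "\<exists>e\<in>\<E>. \<exists>b\<in>carrier (opposite G). (e \<otimes>\<^bsub>opposite G\<^esub> b) \<odot>\<^bsub>?M\<^esub> y \<notin> ?lev Y"
    proof (rule op.idempotent_multiple_outside[OF Mm lev[OF Ys] yM])
      show "y \<notin> ?lev Y" using y by blast
      show "c \<odot>\<^bsub>?M\<^esub> y \<in> ?lev Y" if "c \<in> J" for c
        using radical[OF that] M.smult_closed[of c y] J.Icarr[OF that] yM by (simp add: level_module_def Let_def)
    qed
    then obtain e b where eb: "e \<in> \<E>" "b \<in> carrier G" "\<tau> k k (b \<otimes> e) \<odot>\<^bsub>N a\<^esub> y \<notin> ?lev Y"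
      by (auto simp: level_module_def Let_def)
    have ec: "e \<in> carrier G" "e \<otimes> e = e" using \<E>_closed \<E>_idem eb(1) by auto
    define z where "z = \<tau> k k (b \<otimes> e) \<odot>\<^bsub>N a\<^esub> y"
    have zU: "z \<in> U" using UD(5)[OF kkc y(1)] eb ec by (simp add: z_def)
    have zt: "\<tau> k k c \<odot>\<^bsub>N a\<^esub> z = \<tau> k k (b \<otimes> e \<otimes> c) \<odot>\<^bsub>N a\<^esub> y" if "c \<in> carrier G" for c
      using N.smult_assoc[OF kkc[OF that] kkc UD(1)[OF y(1)], of "b \<otimes> e"] that eb ec k by (simp add: z_def \<tau>_up_mult)
    have ze: "\<tau> k k e \<odot>\<^bsub>N a\<^esub> z = z" using zt[OF ec(1)] eb ec by (simp add: m_assoc z_def)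
    have zk: "\<epsilon> k \<odot>\<^bsub>N a\<^esub> z = z" using zt[OF one_closed] eb ec by (simp add: z_def)
    have zY: "z \<notin> Y" using eb(3) zk by (simp add: z_def)
    let ?Z = "lin_span E (N a) (insert z Y)"
    have Zs: "submodule ?Z E (N a)" using YD(2) UD(1)[OF zU] by (intro N.span_submodule) auto
    have zZ: "z \<in> ?Z" "Y \<subseteq> ?Z" using span_superset[of "insert z Y" E "N a"] by auto
    have "res_len E (Suc k) ((N a)\<lparr>carrier := ?Z\<rparr>)"
      by (rule adjoin_generator[OF k U Ys Yg low eb(1) zU zY ze Yl]) (use Suc.IH k in simp_all)
    moreover have "?Z \<subseteq> U" using YU zU by (intro span_minimal[OF U]) auto
    moreover have "gen a (Suc k) ?Z"
      unfolding gen_def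
    proof (intro allI impI)
      fix W assume W: "submodule W E (N a) \<and> (\<forall>i<Suc k. \<forall>x\<in>?Z. \<epsilon> i \<odot>\<^bsub>N a\<^esub> x \<in> W)"
      then have "\<forall>i<Suc k. \<forall>x\<in>Y. \<epsilon> i \<odot>\<^bsub>N a\<^esub> x \<in> W" using zZ(2) by blast
      then have "Y \<subseteq> W" using Yg W unfolding gen_def by blast
      moreover have "\<epsilon> k \<odot>\<^bsub>N a\<^esub> z \<in> W" using W zZ(1) by blast
      ultimately show "?Z \<subseteq> W" using W zk by (intro span_minimal) auto
    qed
    ultimately have "?Z \<in> ?good" using Zs YU zZ(2) by blast
    then have "?lev ?Z \<in> ?lev ` ?good" by (rule imageI)
    from bspec[OF max this] have "?lev ?Z = ?lev Y" by (rule mp) (use zZ(2) in blast)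
    moreover have "z \<in> ?lev ?Z" using zZ(1) zk by simp
    ultimately have "z \<in> ?lev Y" by simp
    then show False using zY by simp
  qed
  then have "\<epsilon> i \<odot>\<^bsub>N a\<^esub> u \<in> Y" if "i < Suc k" "u \<in> U" for i u
  proof (cases "i < k")
    case True
    then show ?thesis using low that by blast
  next
    case False
    then have i: "i = k" using that by simp
    have "\<epsilon> k \<odot>\<^bsub>N a\<^esub> (\<epsilon> k \<odot>\<^bsub>N a\<^esub> u) = \<epsilon> k \<odot>\<^bsub>N a\<^esub> u"
      using N.smult_assoc[OF ekc ekc UD(1)[OF that(2)]] k by (simp add: \<tau>_up_mult)
    then have "\<epsilon> k \<odot>\<^bsub>N a\<^esub> u \<in> ?lev U" using UD(5)[OF ekc that(2)] by simp
    then show ?thesis using \<open>?lev U \<subseteq> Y\<close> i by blast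
  qed
  then have "U \<subseteq> Y" using Suc.prems(3) Ys unfolding gen_def by blast
  then have "U = Y" using YU(2) by blast
  then show ?case using Yl by simp
qed

lemma global_dim_le: "global_dim E \<le> enat n"
  unfolding global_dim_def
proof (rule Sup_least)
  fix d assume "d \<in> {projective_dim E M | M :: 'e umodule. left_module E M \<and> finitely_generated E M}"
  then obtain M :: "'e umodule" where M: "d = projective_dim E M" "left_module E M" "finitely_generated E M" by blast
  obtain a p where p: "p \<in> module_hom E (N a) M" "p ` carrier (N a) = carrier M"
    using finitely_generated_free_cover[OF M(2,3)] by blast
  let ?K = "module_ker (N a) M p"
  have K: "submodule ?K E (N a)" by (rule submodule_ker[OF left_module_N M(2) p(1)])
  interpret N: left_module E "N a" by (rule left_module_N)
  have "gen a n ?K"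
    unfolding gen_def
    using in_submodule_if_levels[OF left_module_N] N.submoduleD(1)[OF K] by blast
  from res_len_gen[OF order_refl K this]
  show "d \<le> enat n"
    unfolding M(1) by (intro projective_dim_le[OF projective_free[OF E.ring_axioms] M(2) p])
qed

end

section \<open>The generator-cogenerator\<close>

lemma finitely_generated_image:
  assumes "left_module R M" "left_module R N" "f \<in> module_hom R M N" "f ` carrier M = carrier N" "finitely_generated R M"
  shows "finitely_generated R N"
proof -
  interpret N: left_module R N by fact
  obtain S where S: "finite S" "S \<subseteq> carrier M" "lin_span R M S = carrier M"
    using assms(5) unfolding finitely_generated_span by blast
  have fS: "f ` S \<subseteq> carrier N" using S(2) assms(4) by blast
  have "carrier N \<subseteq> K" if K: "submodule K R N" "f ` S \<subseteq> K" for K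
  proof -
    have "lin_span R M S \<subseteq> {x \<in> carrier M. f x \<in> K}"
      using S(2) K(2) by (intro span_minimal submodule_vimage[OF assms(1-3) K(1)]) auto
    then show ?thesis unfolding S(3) assms(4)[symmetric] by blast
  qed
  then have "carrier N \<subseteq> lin_span R N (f ` S)" unfolding lin_span_def by blast
  moreover have "lin_span R N (f ` S) \<subseteq> carrier N" by (rule span_minimal[OF N.submodule_self fS])
  ultimately show ?thesis unfolding finitely_generated_span using S(1) fS by (intro exI[of _ "f ` S"]) auto
qed

text \<open>If homomorphisms to \<open>M\<close> separate the points of an artinian module, finitely many of them do: choose
  them with minimal common kernel.\<close>

lemma embedding_if_separating:
  assumes X: "left_module R X" and M: "left_module R M" and dcc: "chain_stable False (submodules R X)"
    and sep: "\<And>x. x \<in> carrier X \<Longrightarrow> x \<noteq> \<zero>\<^bsub>X\<^esub> \<Longrightarrow> \<exists>f\<in>module_hom R X M. f x \<noteq> \<zero>\<^bsub>M\<^esub>"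
  shows "\<exists>m. \<exists>i\<in>module_hom R X (power_module M m). inj_on i (carrier X)"
proof -
  interpret X: left_module R X by (rule X)
  interpret M: left_module R M by (rule M)
  let ?\<L> = "{module_ker X (power_module M m) i | m i. i \<in> module_hom R X (power_module M m)}"
  have "?\<L> \<subseteq> submodules R X" using submodule_ker[OF X left_module_power[OF M]] by blast
  then have cs: "chain_stable False ?\<L>" by (rule chain_stable_subset[OF dcc])
  have "(\<lambda>x. \<lambda>i\<in>{..<0::nat}. \<zero>\<^bsub>M\<^esub>) \<in> module_hom R X (power_module M 0)"
    by (rule module_homI) (auto simp: power_module_simps)
  then have "module_ker X (power_module M 0) (\<lambda>x. \<lambda>i\<in>{..<0::nat}. \<zero>\<^bsub>M\<^esub>) \<in> ?\<L>" by blast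
  from chain_stable_minimal[OF cs this] obtain K where K: "K \<in> ?\<L>" "\<forall>Y\<in>?\<L>. Y \<subseteq> K \<longrightarrow> Y = K" by (elim bexE)
  then obtain m i where i: "i \<in> module_hom R X (power_module M m)" and Ki: "K = module_ker X (power_module M m) i" by blast
  have "x = \<zero>\<^bsub>X\<^esub>" if x: "x \<in> carrier X" "i x = \<zero>\<^bsub>power_module M m\<^esub>" for x
  proof (rule ccontr)
    assume "x \<noteq> \<zero>\<^bsub>X\<^esub>"
    then obtain f where f: "f \<in> module_hom R X M" "f x \<noteq> \<zero>\<^bsub>M\<^esub>" using sep x(1) by blast
    let ?g = "\<lambda>t x. if t < m then i x t else f x"
    let ?j = "\<lambda>x. \<lambda>t\<in>{..<Suc m}. ?g t x"
    have "?g t \<in> module_hom R X M" for t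
      using f(1) module_hom_comp[OF i power_module_proj[of t m R M]] by (cases "t < m") simp_all
    then have j: "?j \<in> module_hom R X (power_module M (Suc m))" by (rule power_module_tuple[OF _ X])
    let ?J = "module_ker X (power_module M (Suc m)) ?j"
    have "?J \<in> ?\<L>" using j by blast
    have "?J \<subseteq> K"
    proof
      fix y assume "y \<in> ?J"
      then have y: "y \<in> carrier X" "?j y = \<zero>\<^bsub>power_module M (Suc m)\<^esub>" by (auto simp: module_ker_def)
      have "i y t = (\<zero>\<^bsub>power_module M m\<^esub>) t" for t
      proof (cases "t < m")
        case True
        then show ?thesis using fun_cong[OF y(2), of t] by (simp add: power_module_simps)
      next
        case False
        then show ?thesis using module_homD(1)[OF i y(1)] by (auto simp: power_module_simps PiE_iff extensional_def)
      qed
      then show "y \<in> K" using y(1) by (auto simp: Ki module_ker_def)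
    qed
    then have "?J = K" using bspec[OF K(2) \<open>?J \<in> ?\<L>\<close>] by blast
    then have "x \<in> ?J" using x by (auto simp: Ki module_ker_def)
    then have "?j x = \<zero>\<^bsub>power_module M (Suc m)\<^esub>" by (simp add: module_ker_def)
    from fun_cong[OF this, of m] show False using f(2) by (simp add: power_module_simps)
  qed
  then have "inj_on i (carrier X)" using module_hom_inj_iff[OF X left_module_power[OF M] i] by blast
  then show ?thesis using i by blast
qed

definition level_sum :: "('g, 's) ring_scheme \<Rightarrow> 'g set \<Rightarrow> nat \<Rightarrow> ('g, nat \<Rightarrow> 'g) module"
  where "level_sum G J n = (power_module (regular_module G) n)
    \<lparr>carrier := {x \<in> carrier (power_module (regular_module G) n). \<forall>i<n. x i \<in> level G J i}\<rparr>"

text \<open>The sum of the levels, moved to the type of the test modules.\<close>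

definition level_generator :: "('g, 's) ring_scheme \<Rightarrow> 'g set \<Rightarrow> nat \<Rightarrow> 'g umodule"
  where "level_generator G J n = singleton_module (level_sum G J n)"

definition level_proj :: "nat \<Rightarrow> (nat \<Rightarrow> 'g) set \<Rightarrow> 'g"
  where "level_proj i v = (the_elem v) i"

definition level_inj :: "('g, 's) ring_scheme \<Rightarrow> nat \<Rightarrow> nat \<Rightarrow> 'g \<Rightarrow> (nat \<Rightarrow> 'g) set"
  where "level_inj G n i x = {\<lambda>k\<in>{..<n}. if k = i then x else \<zero>\<^bsub>G\<^esub>}"

definition level_map :: "('g, 's) ring_scheme \<Rightarrow> 'g set \<Rightarrow> nat \<Rightarrow> nat \<Rightarrow> nat \<Rightarrow> 'g \<Rightarrow> (nat \<Rightarrow> 'g) set \<Rightarrow> (nat \<Rightarrow> 'g) set"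
  where "level_map G J n i j c = (\<lambda>v\<in>carrier (level_generator G J n). level_inj G n j (level_proj i v \<otimes>\<^bsub>G\<^esub> c))"

lemma End_ring_simps:
  "carrier (End_ring R M) = module_hom R M M \<inter> extensional (carrier M)"
  "f \<otimes>\<^bsub>End_ring R M\<^esub> g = compose (carrier M) f g" "\<one>\<^bsub>End_ring R M\<^esub> = (\<lambda>x\<in>carrier M. x)"
  "\<zero>\<^bsub>End_ring R M\<^esub> = (\<lambda>x\<in>carrier M. \<zero>\<^bsub>M\<^esub>)" "f \<oplus>\<^bsub>End_ring R M\<^esub> g = (\<lambda>x\<in>carrier M. f x \<oplus>\<^bsub>M\<^esub> g x)"
  by (simp_all add: End_ring_def)

text \<open>Left ideals of \<open>G\<close> have only right multiplications as homomorphisms to \<open>G\<close>. Then the endomorphism ring of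
  the sum \<open>V\<close> of all levels is of the kind considered above.\<close>

locale level_summands = semiprimary G J \<E>
  for G :: "('g, 's) ring_scheme" (structure) and J :: "'g set" and \<E> :: "'g set" +
  fixes n :: nat
  assumes n: "0 < n" and top_level: "\<one> \<in> ann_chain (opposite G) J n"
    and left_noetherian: "chain_stable True (submodules G (regular_module G))"
    and right_noetherian: "chain_stable True (submodules (opposite G) (regular_module (opposite G)))"
    and right_multiplication: "\<lbrakk>submodule A G (regular_module G);
      f \<in> module_hom G ((regular_module G)\<lparr>carrier := A\<rparr>) (regular_module G)\<rbrakk> \<Longrightarrow>
      \<exists>c\<in>carrier G. \<forall>x\<in>A. f x = x \<otimes> c"
begin

abbreviation "V \<equiv> level_generator G J n"
abbreviation "\<pi> \<equiv> level_proj"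
abbreviation "\<iota> \<equiv> level_inj G n"
abbreviation "\<tau> \<equiv> level_map G J n"
abbreviation "End \<equiv> End_ring G V"

lemma level_ideal: "ideal (level G J i) G"
  using ann_chain_ideal[of J "opposite G" "Suc i"] r_ideal
  unfolding level_def ideal_opposite[OF ring_axioms] .

lemma left_module_regularG: "left_module G (regular_module G)"
  by (rule left_module_regular[OF ring_axioms])

lemma level_sum_submodule:
  "submodule {x \<in> carrier (power_module (regular_module G) n). \<forall>i<n. x i \<in> level G J i} G (power_module (regular_module G) n)"
proof -
  interpret F: left_module G "power_module (regular_module G) n" by (rule left_module_power[OF left_module_regularG])
  note I = ideal.plus_closed[OF level_ideal] ideal.I_l_closed[OF level_ideal]
    additive_subgroup.zero_closed[OF ideal.axioms(1)[OF level_ideal]]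
  show ?thesis
  proof (rule F.submoduleI)
    fix x y assume xy: "x \<in> {x \<in> carrier (power_module (regular_module G) n). \<forall>i<n. x i \<in> level G J i}"
      "y \<in> {x \<in> carrier (power_module (regular_module G) n). \<forall>i<n. x i \<in> level G J i}"
    then have "x \<oplus>\<^bsub>power_module (regular_module G) n\<^esub> y \<in> carrier (power_module (regular_module G) n)" by simp
    then show "x \<oplus>\<^bsub>power_module (regular_module G) n\<^esub> y \<in> {x \<in> carrier (power_module (regular_module G) n). \<forall>i<n. x i \<in> level G J i}"
      using xy I(1) by (simp add: power_module_simps(3))
  next
    fix a x assume ax: "a \<in> carrier G" "x \<in> {x \<in> carrier (power_module (regular_module G) n). \<forall>i<n. x i \<in> level G J i}"
    then have "a \<odot>\<^bsub>power_module (regular_module G) n\<^esub> x \<in> carrier (power_module (regular_module G) n)" by simp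
    then show "a \<odot>\<^bsub>power_module (regular_module G) n\<^esub> x \<in> {x \<in> carrier (power_module (regular_module G) n). \<forall>i<n. x i \<in> level G J i}"
      using ax I(2) by (simp add: power_module_simps(4))
  next
    show "\<zero>\<^bsub>power_module (regular_module G) n\<^esub> \<in> {x \<in> carrier (power_module (regular_module G) n). \<forall>i<n. x i \<in> level G J i}"
      using F.M.zero_closed I(3) by (simp add: power_module_simps(2))
  qed auto
qed

lemma left_module_level_sum: "left_module G (level_sum G J n)"
  unfolding level_sum_def
  by (rule left_module.left_module_sub[OF left_module_power[OF left_module_regularG] level_sum_submodule])

lemma left_module_V: "left_module G V"
  unfolding level_generator_def by (rule left_module_singleton[OF left_module_level_sum])

lemma finitely_generated_V: "finitely_generated G V"
proof -
  let ?F = "power_module (regular_module G) n"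
  have F: "left_module G ?F" by (rule left_module_power[OF left_module_regularG])
  have "chain_stable True (submodules G ?F)" by (rule chain_stable_power[OF left_module_regularG left_noetherian])
  from noetherian_finite_span[OF F this level_sum_submodule] obtain S where
    "finite S" "{x \<in> carrier ?F. \<forall>i<n. x i \<in> level G J i} = lin_span G ?F S" by blast
  from left_module.finitely_generated_sub[OF F level_sum_submodule this]
  have "finitely_generated G (level_sum G J n)" unfolding level_sum_def .
  then show ?thesis unfolding level_generator_def
    by (rule finitely_generated_image[OF left_module_level_sum left_module_singleton[OF left_module_level_sum] singleton_hom, rotated]) simp
qed

lemma V_cases:
  assumes "v \<in> carrier V"
  obtains x where "v = {x}" "x \<in> {..<n} \<rightarrow>\<^sub>E carrier G" "\<And>i. i < n \<Longrightarrow> x i \<in> level G J i"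
  using assms by (auto simp: level_generator_def level_sum_def power_module_simps(1))

lemma \<pi>_level: "v \<in> carrier V \<Longrightarrow> i < n \<Longrightarrow> \<pi> i v \<in> level G J i"
  by (erule V_cases) (simp add: level_proj_def)

lemma \<pi>_carrier: "v \<in> carrier V \<Longrightarrow> i < n \<Longrightarrow> \<pi> i v \<in> carrier G"
  using \<pi>_level ideal.Icarr[OF level_ideal] by blast

lemma \<pi>_hom: "i < n \<Longrightarrow> \<pi> i \<in> module_hom G V (regular_module G)"
  by (rule module_homI)
    (auto simp: \<pi>_carrier level_generator_def level_sum_def power_module_simps level_proj_def)

lemma V_eqI:
  assumes "v \<in> carrier V" "w \<in> carrier V" "\<And>i. i < n \<Longrightarrow> \<pi> i v = \<pi> i w"
  shows "v = w"
proof -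
  obtain x y where xy: "v = {x}" "w = {y}" "x \<in> {..<n} \<rightarrow>\<^sub>E carrier G" "y \<in> {..<n} \<rightarrow>\<^sub>E carrier G"
    using V_cases[OF assms(1)] V_cases[OF assms(2)] by metis
  have "x = y" by (rule PiE_ext[OF xy(3,4)]) (use assms(3) xy(1,2) in \<open>auto simp: level_proj_def\<close>)
  then show ?thesis using xy by simp
qed

lemma \<iota>_closed: "i < n \<Longrightarrow> x \<in> level G J i \<Longrightarrow> \<iota> i x \<in> carrier V"
  using additive_subgroup.zero_closed[OF ideal.axioms(1)[OF level_ideal]] ideal.Icarr[OF level_ideal]
  by (auto simp: level_inj_def level_generator_def level_sum_def power_module_simps(1))

lemma \<pi>_\<iota>: "j < n \<Longrightarrow> \<pi> j (\<iota> i x) = (if j = i then x else \<zero>)"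
  by (simp add: level_proj_def level_inj_def)

lemma \<iota>_hom: "i < n \<Longrightarrow> \<iota> i \<in> module_hom G ((regular_module G)\<lparr>carrier := level G J i\<rparr>) V"
proof (rule module_homI)
  assume i: "i < n"
  interpret V: left_module G V by (rule left_module_V)
  note I = ideal.plus_closed[OF level_ideal] ideal.I_l_closed[OF level_ideal] ideal.Icarr[OF level_ideal]
  { fix x assume x: "x \<in> carrier ((regular_module G)\<lparr>carrier := level G J i\<rparr>)"
    then show "\<iota> i x \<in> carrier V" using \<iota>_closed[OF i] by simp
    fix y assume y: "y \<in> carrier ((regular_module G)\<lparr>carrier := level G J i\<rparr>)"
    show "\<iota> i (x \<oplus>\<^bsub>(regular_module G)\<lparr>carrier := level G J i\<rparr>\<^esub> y) = \<iota> i x \<oplus>\<^bsub>V\<^esub> \<iota> i y"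
    proof (rule V_eqI)
      show "\<iota> i (x \<oplus>\<^bsub>(regular_module G)\<lparr>carrier := level G J i\<rparr>\<^esub> y) \<in> carrier V" using \<iota>_closed[OF i] x y I by simp
      show "\<iota> i x \<oplus>\<^bsub>V\<^esub> \<iota> i y \<in> carrier V" using \<iota>_closed[OF i] x y by simp
      fix k assume "k < n"
      then show "\<pi> k (\<iota> i (x \<oplus>\<^bsub>(regular_module G)\<lparr>carrier := level G J i\<rparr>\<^esub> y)) = \<pi> k (\<iota> i x \<oplus>\<^bsub>V\<^esub> \<iota> i y)"
        using module_homD(2)[OF \<pi>_hom, of k "\<iota> i x" "\<iota> i y"] \<iota>_closed[OF i] x y by (simp add: \<pi>_\<iota>)
    qed }
  fix a x assume a: "a \<in> carrier G" and x: "x \<in> carrier ((regular_module G)\<lparr>carrier := level G J i\<rparr>)"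
  show "\<iota> i (a \<odot>\<^bsub>(regular_module G)\<lparr>carrier := level G J i\<rparr>\<^esub> x) = a \<odot>\<^bsub>V\<^esub> \<iota> i x"
  proof (rule V_eqI)
    show "\<iota> i (a \<odot>\<^bsub>(regular_module G)\<lparr>carrier := level G J i\<rparr>\<^esub> x) \<in> carrier V" using \<iota>_closed[OF i] x a I by simp
    show "a \<odot>\<^bsub>V\<^esub> \<iota> i x \<in> carrier V" using \<iota>_closed[OF i] x a by simp
    fix k assume "k < n"
    then show "\<pi> k (\<iota> i (a \<odot>\<^bsub>(regular_module G)\<lparr>carrier := level G J i\<rparr>\<^esub> x)) = \<pi> k (a \<odot>\<^bsub>V\<^esub> \<iota> i x)"
      using module_homD(3)[OF \<pi>_hom, of k a "\<iota> i x"] \<iota>_closed[OF i] x a by (simp add: \<pi>_\<iota>)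
  qed
qed

lemma \<iota>_zero: "i < n \<Longrightarrow> \<iota> i \<zero> = \<zero>\<^bsub>V\<^esub>"
  by (simp add: level_inj_def level_generator_def level_sum_def power_module_simps(2) cong: if_cong)

lemma \<tau>_apply: "v \<in> carrier V \<Longrightarrow> \<tau> i j c v = \<iota> j (\<pi> i v \<otimes> c)"
  by (simp add: level_map_def)

lemma \<tau>_in_End:
  assumes ij: "i < n" "j < n" and c: "c \<in> carrier G" "\<And>x. x \<in> level G J i \<Longrightarrow> x \<otimes> c \<in> level G J j"
  shows "\<tau> i j c \<in> carrier End"
proof -
  interpret V: left_module G V by (rule left_module_V)
  have "\<tau> i j c \<in> module_hom G V V"
  proof (rule module_homI)
    fix v assume "v \<in> carrier V"
    then show "\<tau> i j c v \<in> carrier V" using \<iota>_closed[OF ij(2)] c(2) \<pi>_level ij(1) by (simp add: \<tau>_apply)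
  next
    fix v w assume v: "v \<in> carrier V" "w \<in> carrier V"
    then have "\<pi> i (v \<oplus>\<^bsub>V\<^esub> w) \<otimes> c = \<pi> i v \<otimes> c \<oplus> \<pi> i w \<otimes> c"
      using module_homD(2)[OF \<pi>_hom[OF ij(1)]] \<pi>_carrier ij(1) c(1) by (simp add: l_distr)
    then show "\<tau> i j c (v \<oplus>\<^bsub>V\<^esub> w) = \<tau> i j c v \<oplus>\<^bsub>V\<^esub> \<tau> i j c w"
      using module_homD(2)[OF \<iota>_hom[OF ij(2)], of "\<pi> i v \<otimes> c" "\<pi> i w \<otimes> c"] v \<pi>_level ij(1) c(2) by (simp add: \<tau>_apply)
  next
    fix a v assume v: "a \<in> carrier G" "v \<in> carrier V"
    then have "\<pi> i (a \<odot>\<^bsub>V\<^esub> v) \<otimes> c = a \<otimes> (\<pi> i v \<otimes> c)"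
      using module_homD(3)[OF \<pi>_hom[OF ij(1)]] \<pi>_carrier ij(1) c(1) by (simp add: m_assoc)
    then show "\<tau> i j c (a \<odot>\<^bsub>V\<^esub> v) = a \<odot>\<^bsub>V\<^esub> \<tau> i j c v"
      using module_homD(3)[OF \<iota>_hom[OF ij(2)], of a "\<pi> i v \<otimes> c"] v \<pi>_level ij(1) c(2) by (simp add: \<tau>_apply)
  qed
  then show ?thesis by (simp add: End_ring_simps level_map_def)
qed

lemma End_eqI: "f \<in> carrier End \<Longrightarrow> g \<in> carrier End \<Longrightarrow> (\<And>v. v \<in> carrier V \<Longrightarrow> f v = g v) \<Longrightarrow> f = g"
  unfolding End_ring_simps by (intro extensionalityI[of f "carrier V" g]) auto

lemma End_apply: "f \<in> carrier End \<Longrightarrow> v \<in> carrier V \<Longrightarrow> f v \<in> carrier V"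
  unfolding End_ring_simps by (blast intro: module_homD(1))

lemma level_up: "c \<in> carrier G \<Longrightarrow> x \<in> level G J i \<Longrightarrow> x \<otimes> c \<in> level G J i"
  by (rule ideal.I_r_closed[OF level_ideal])

lemma level_maps_End: "level_maps G J \<E> End n \<tau>"
proof -
  interpret V: left_module G V by (rule left_module_V)
  interpret End: ring End by (rule ring_End_ring[OF left_module_V])
  have \<epsilon>: "\<tau> i i \<one> \<in> carrier End" if "i < n" for i using level_up that by (intro \<tau>_in_End) auto
  have \<epsilon>_apply: "\<tau> i i \<one> v = \<iota> i (\<pi> i v)" if "i < n" "v \<in> carrier V" for i v
    using that \<pi>_carrier by (simp add: \<tau>_apply)
  show ?thesis
  proof (intro level_maps.intro level_maps_axioms.intro semiprimary_axioms End.ring_axioms top_level)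
    fix i j c assume "i < n" "j < n" "c \<in> carrier G" "\<And>x. x \<in> level G J i \<Longrightarrow> x \<otimes> c \<in> level G J j"
    then show "\<tau> i j c \<in> carrier End" by (rule \<tau>_in_End)
  next
    fix i j k c d
    assume ijk: "i < n" "j < n" "k < n" and c: "c \<in> carrier G" "\<And>x. x \<in> level G J i \<Longrightarrow> x \<otimes> c \<in> level G J j"
      and d: "d \<in> carrier G" "\<And>x. x \<in> level G J j \<Longrightarrow> x \<otimes> d \<in> level G J k"
    note cc = \<tau>_in_End[OF ijk(1,2) c] and dd = \<tau>_in_End[OF ijk(2,3) d]
    show "\<tau> j k d \<otimes>\<^bsub>End\<^esub> \<tau> i j c = \<tau> i k (c \<otimes> d)"
    proof (rule End_eqI)
      show "\<tau> j k d \<otimes>\<^bsub>End\<^esub> \<tau> i j c \<in> carrier End" using cc dd by simp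
      have "x \<otimes> (c \<otimes> d) \<in> level G J k" if "x \<in> level G J i" for x
        using d(2)[OF c(2)[OF that]] ideal.Icarr[OF level_ideal that] c(1) d(1) by (simp add: m_assoc)
      then show "\<tau> i k (c \<otimes> d) \<in> carrier End" using c(1) d(1) ijk by (intro \<tau>_in_End) auto
      fix v assume v: "v \<in> carrier V"
      then show "(\<tau> j k d \<otimes>\<^bsub>End\<^esub> \<tau> i j c) v = \<tau> i k (c \<otimes> d) v"
        using End_apply[OF cc v] \<pi>_carrier[OF v ijk(1)] ijk c(1) d(1)
        by (simp add: End_ring_simps compose_def \<tau>_apply \<pi>_\<iota> m_assoc)
    qed
  next
    fix i j c d
    assume ij: "i < n" "j < n" and c: "c \<in> carrier G" "\<And>x. x \<in> level G J i \<Longrightarrow> x \<otimes> c \<in> level G J j"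
      and d: "d \<in> carrier G" "\<And>x. x \<in> level G J i \<Longrightarrow> x \<otimes> d \<in> level G J j"
    have cd: "x \<otimes> (c \<oplus> d) \<in> level G J j" if "x \<in> level G J i" for x
      using ideal.plus_closed[OF level_ideal c(2)[OF that] d(2)[OF that]] ideal.Icarr[OF level_ideal that] c(1) d(1)
      by (simp add: r_distr)
    show "\<tau> i j (c \<oplus> d) = \<tau> i j c \<oplus>\<^bsub>End\<^esub> \<tau> i j d"
    proof (rule End_eqI)
      show "\<tau> i j (c \<oplus> d) \<in> carrier End" using cd c(1) d(1) ij by (intro \<tau>_in_End) auto
      show "\<tau> i j c \<oplus>\<^bsub>End\<^esub> \<tau> i j d \<in> carrier End" using \<tau>_in_End[OF ij c] \<tau>_in_End[OF ij d] by simp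
      fix v assume v: "v \<in> carrier V"
      then show "\<tau> i j (c \<oplus> d) v = (\<tau> i j c \<oplus>\<^bsub>End\<^esub> \<tau> i j d) v"
        using module_homD(2)[OF \<iota>_hom[OF ij(2)], of "\<pi> i v \<otimes> c" "\<pi> i v \<otimes> d"] \<pi>_level[OF v ij(1)] \<pi>_carrier[OF v ij(1)] c d
        by (simp add: End_ring_simps \<tau>_apply r_distr)
    qed
  next
    fix i j c assume ij: "i < n" "j < n" and c: "c \<in> carrier G" "\<And>x. x \<in> level G J i \<Longrightarrow> x \<otimes> c = \<zero>"
    show "\<tau> i j c = \<zero>\<^bsub>End\<^esub>"
      using c(2)[OF \<pi>_level[OF _ ij(1)]] \<iota>_zero[OF ij(2)]
      by (auto simp: End_ring_simps level_map_def fun_eq_iff)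
  next
    fix W assume W: "W \<subseteq> carrier End" "\<zero>\<^bsub>End\<^esub> \<in> W" "\<And>x y. x \<in> W \<Longrightarrow> y \<in> W \<Longrightarrow> x \<oplus>\<^bsub>End\<^esub> y \<in> W"
      "\<And>i. i < n \<Longrightarrow> \<tau> i i \<one> \<in> W"
    \<comment> \<open>The projections to the first \<open>t\<close> summands.\<close>
    have "t \<le> n \<Longrightarrow> \<exists>f\<in>W. \<forall>v\<in>carrier V. \<forall>k<n. \<pi> k (f v) = (if k < t then \<pi> k v else \<zero>)" for t
    proof (induction t)
      case 0
      have "\<pi> k (\<zero>\<^bsub>End\<^esub> v) = \<zero>" if "v \<in> carrier V" "k < n" for v k
        using that module_hom_zero[OF left_module_V left_module_regularG \<pi>_hom] by (simp add: End_ring_simps)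
      then show ?case using W(2) by (intro bexI[of _ "\<zero>\<^bsub>End\<^esub>"]) auto
    next
      case (Suc t)
      then obtain f where f: "f \<in> W" "\<forall>v\<in>carrier V. \<forall>k<n. \<pi> k (f v) = (if k < t then \<pi> k v else \<zero>)" by auto
      have t: "t < n" using Suc.prems by simp
      have fE: "f \<in> carrier End" using f(1) W(1) by blast
      have "\<pi> k ((f \<oplus>\<^bsub>End\<^esub> \<tau> t t \<one>) v) = (if k < Suc t then \<pi> k v else \<zero>)" if "v \<in> carrier V" "k < n" for v k
        using that f(2) module_homD(2)[OF \<pi>_hom[OF that(2)] End_apply[OF fE that(1)] End_apply[OF \<epsilon>[OF t] that(1)]]
          \<pi>_carrier[OF that]
        by (auto simp: End_ring_simps \<epsilon>_apply[OF t] \<pi>_\<iota> less_Suc_eq)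
      then show ?case using W(3)[OF f(1) W(4)[OF t]] by (intro bexI[of _ "f \<oplus>\<^bsub>End\<^esub> \<tau> t t \<one>"]) auto
    qed
    from this[OF order_refl] obtain f where f: "f \<in> W" "\<forall>v\<in>carrier V. \<forall>k<n. \<pi> k (f v) = (if k < n then \<pi> k v else \<zero>)" by blast
    have fE: "f \<in> carrier End" using f(1) W(1) by blast
    have "f = \<one>\<^bsub>End\<^esub>"
    proof (rule End_eqI[OF fE End.one_closed])
      fix v assume v: "v \<in> carrier V"
      have "f v = v" by (rule V_eqI[OF End_apply[OF fE v] v]) (use f(2) v in simp)
      then show "f v = \<one>\<^bsub>End\<^esub> v" using v by (simp add: End_ring_simps)
    qed
    then show "\<one>\<^bsub>End\<^esub> \<in> W" using f(1) by simp
  next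
    fix i j x assume ij: "i < n" "j < n" and x: "x \<in> carrier End"
    have xh: "x \<in> module_hom G V V" using x by (simp add: End_ring_simps)
    let ?f = "\<lambda>y. \<pi> j (x (\<iota> i y))"
    have "?f \<in> module_hom G ((regular_module G)\<lparr>carrier := level G J i\<rparr>) (regular_module G)"
      by (rule module_hom_comp[OF module_hom_comp[OF \<iota>_hom[OF ij(1)] xh] \<pi>_hom[OF ij(2)]])
    from right_multiplication[OF submodule_regular_ideal[OF level_ideal] this]
    obtain c where c: "c \<in> carrier G" "\<forall>y\<in>level G J i. ?f y = y \<otimes> c" by blast
    have cl: "y \<otimes> c \<in> level G J j" if "y \<in> level G J i" for y
      using c(2) \<pi>_level[OF End_apply[OF x \<iota>_closed[OF ij(1) that]] ij(2)] that by auto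
    have "\<tau> j j \<one> \<otimes>\<^bsub>End\<^esub> x \<otimes>\<^bsub>End\<^esub> \<tau> i i \<one> = \<tau> i j c"
    proof (rule End_eqI)
      show "\<tau> j j \<one> \<otimes>\<^bsub>End\<^esub> x \<otimes>\<^bsub>End\<^esub> \<tau> i i \<one> \<in> carrier End" using \<epsilon> ij x by simp
      show "\<tau> i j c \<in> carrier End" by (rule \<tau>_in_End[OF ij c(1) cl])
      fix v assume v: "v \<in> carrier V"
      have w: "\<iota> i (\<pi> i v) \<in> carrier V" using \<iota>_closed[OF ij(1) \<pi>_level[OF v ij(1)]] .
      show "(\<tau> j j \<one> \<otimes>\<^bsub>End\<^esub> x \<otimes>\<^bsub>End\<^esub> \<tau> i i \<one>) v = \<tau> i j c v"
        using v w End_apply[OF x w] c(2) \<pi>_level[OF v ij(1)]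
        by (simp add: End_ring_simps compose_def \<epsilon>_apply ij) (simp add: \<tau>_apply)
    qed
    then show "\<exists>c\<in>carrier G. (\<forall>y\<in>level G J i. y \<otimes> c \<in> level G J j) \<and> \<tau> j j \<one> \<otimes>\<^bsub>End\<^esub> x \<otimes>\<^bsub>End\<^esub> \<tau> i i \<one> = \<tau> i j c"
      using c(1) cl by blast
  next
    fix i j x assume ij: "i \<le> j" "j < n" and x: "x \<in> carrier End"
      and z: "\<tau> i j \<one> \<otimes>\<^bsub>End\<^esub> (\<tau> i i \<one> \<otimes>\<^bsub>End\<^esub> x) = \<zero>\<^bsub>End\<^esub>"
    have i: "i < n" using ij by simp
    show "\<tau> i i \<one> \<otimes>\<^bsub>End\<^esub> x = \<zero>\<^bsub>End\<^esub>"
    proof (rule End_eqI)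
      show "\<tau> i i \<one> \<otimes>\<^bsub>End\<^esub> x \<in> carrier End" "\<zero>\<^bsub>End\<^esub> \<in> carrier End" using \<epsilon>[OF i] x by simp_all
      fix v assume v: "v \<in> carrier V"
      have xv: "x v \<in> carrier V" by (rule End_apply[OF x v])
      have w: "\<iota> i (\<pi> i (x v)) \<in> carrier V" using \<iota>_closed[OF i \<pi>_level[OF xv i]] .
      have "\<iota> j (\<pi> i (x v)) = \<zero>\<^bsub>V\<^esub>"
        using fun_cong[OF z, of v] v xv w i \<pi>_carrier[OF xv i]
        by (simp add: End_ring_simps compose_def \<epsilon>_apply) (simp add: \<tau>_apply \<pi>_\<iota>)
      then have "\<pi> j (\<iota> j (\<pi> i (x v))) = \<zero>"
        using module_hom_zero[OF left_module_V left_module_regularG \<pi>_hom[OF ij(2)]] by simp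
      then have "\<pi> i (x v) = \<zero>" using ij by (simp add: \<pi>_\<iota>)
      then show "(\<tau> i i \<one> \<otimes>\<^bsub>End\<^esub> x) v = \<zero>\<^bsub>End\<^esub> v"
        using v xv i \<iota>_zero by (simp add: End_ring_simps compose_def \<epsilon>_apply)
    qed
  qed
qed

text \<open>An element of level \<open>k\<close> of \<open>E\<^sup>a\<close> consists of \<open>a\<close> maps from \<open>V\<close> to \<open>A k\<close>. It is determined by the values
  of these at generators of \<open>V\<close>; the values form a vector over \<open>G\<close>, on which right multiplication acts
  entrywise.\<close>

lemma level_noetherian_End:
  assumes k: "k < n"
  shows "chain_stable True (submodules (opposite G) (level_module End G \<tau> a k))"
proof -
  interpret L: level_maps G J \<E> End n \<tau> by (rule level_maps_End)
  interpret V: left_module G V by (rule left_module_V)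
  let ?M = "level_module End G \<tau> a k"
  have M: "left_module (opposite G) ?M" by (rule L.left_module_level[OF k])
  interpret M: left_module "opposite G" ?M by (rule M)
  obtain F where F: "finite F" "F \<subseteq> carrier V" "lin_span G V F = carrier V"
    using finitely_generated_V unfolding finitely_generated_span by blast
  obtain s and m :: nat where s: "F = s ` {..<m}"
    using F(1) by (metis finite_imp_nat_seg_image_inj_on lessThan_def)
  have sV: "s t \<in> carrier V" if "t < m" for t using s F(2) that by auto
  let ?R = "regular_module (opposite G)"
  have R: "left_module (opposite G) ?R" by (intro left_module_regular ring_opposite ring_axioms)
  let ?P = "power_module ?R (a * m)"
  have P: "left_module (opposite G) ?P" by (rule left_module_power[OF R])
  define \<Phi> where "\<Phi> x = (\<lambda>q\<in>{..<a * m}. \<pi> k (x (q div m) (s (q mod m))))" for x :: "nat \<Rightarrow> (nat \<Rightarrow> 'g) set \<Rightarrow> (nat \<Rightarrow> 'g) set"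
  have idx: "q div m < a" "q mod m < m" if "q < a * m" for q
    using that by (auto simp: less_mult_imp_div_less) (metis mod_less_divisor mult_0_right not_gr_zero not_less0)
  have Mc: "x i \<in> carrier End" "\<And>v. v \<in> carrier V \<Longrightarrow> x i v = \<iota> k (\<pi> k (x i v))" if x: "x \<in> carrier ?M" and i: "i < a" for x i
  proof -
    have x': "x \<in> {..<a} \<rightarrow>\<^sub>E carrier End" "(\<lambda>i\<in>{..<a}. \<tau> k k \<one> \<otimes>\<^bsub>End\<^esub> x i) = x"
      using x by (simp_all add: level_module_def Let_def power_module_simps)
    show xi: "x i \<in> carrier End" using x'(1) i by blast
    fix v assume v: "v \<in> carrier V"
    have "\<tau> k k \<one> \<otimes>\<^bsub>End\<^esub> x i = x i" using fun_cong[OF x'(2), of i] i by simp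
    then have "(\<tau> k k \<one> \<otimes>\<^bsub>End\<^esub> x i) v = x i v" by simp
    then show "x i v = \<iota> k (\<pi> k (x i v))"
      using v End_apply[OF xi v] k \<pi>_carrier by (simp add: End_ring_simps compose_def \<tau>_apply)
  qed
  have \<Phi>: "\<Phi> \<in> module_hom (opposite G) ?M ?P"
  proof (rule module_homI)
    fix x assume x: "x \<in> carrier ?M"
    show "\<Phi> x \<in> carrier ?P"
      using End_apply[OF Mc(1)[OF x idx(1)] sV[OF idx(2)]] \<pi>_carrier k by (auto simp: \<Phi>_def power_module_simps)
    fix y assume y: "y \<in> carrier ?M"
    show "\<Phi> (x \<oplus>\<^bsub>?M\<^esub> y) = \<Phi> x \<oplus>\<^bsub>?P\<^esub> \<Phi> y"
    proof
      fix q
      show "\<Phi> (x \<oplus>\<^bsub>?M\<^esub> y) q = (\<Phi> x \<oplus>\<^bsub>?P\<^esub> \<Phi> y) q"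
      proof (cases "q < a * m")
        case True
        note i = idx[OF True]
        show ?thesis
          using True i module_homD(2)[OF \<pi>_hom[OF k] End_apply[OF Mc(1)[OF x i(1)] sV[OF i(2)]] End_apply[OF Mc(1)[OF y i(1)] sV[OF i(2)]]] sV[OF i(2)]
          by (simp add: \<Phi>_def power_module_simps level_module_def Let_def End_ring_simps)
      qed (simp add: \<Phi>_def power_module_simps)
    qed
  next
    fix c x assume c: "c \<in> carrier (opposite G)" and x: "x \<in> carrier ?M"
    have kkc: "\<tau> k k c \<in> carrier End" using c k level_up by (intro \<tau>_in_End) auto
    show "\<Phi> (c \<odot>\<^bsub>?M\<^esub> x) = c \<odot>\<^bsub>?P\<^esub> \<Phi> x"
    proof
      fix q
      show "\<Phi> (c \<odot>\<^bsub>?M\<^esub> x) q = (c \<odot>\<^bsub>?P\<^esub> \<Phi> x) q"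
      proof (cases "q < a * m")
        case True
        note i = idx[OF True]
        have "\<tau> k k c (x (q div m) (s (q mod m))) = \<iota> k (\<pi> k (x (q div m) (s (q mod m))) \<otimes> c)"
          by (rule \<tau>_apply[OF End_apply[OF Mc(1)[OF x i(1)] sV[OF i(2)]]])
        then show ?thesis
          using True i sV[OF i(2)] k
          by (simp add: \<Phi>_def power_module_simps level_module_def Let_def End_ring_simps compose_def \<pi>_\<iota>)
      qed (simp add: \<Phi>_def power_module_simps)
    qed
  qed
  have inj: "inj_on \<Phi> (carrier ?M)"
  proof -
    have "x = \<zero>\<^bsub>?M\<^esub>" if x: "x \<in> carrier ?M" and z: "\<Phi> x = \<zero>\<^bsub>?P\<^esub>" for x
    proof -
      have "x i = \<zero>\<^bsub>End\<^esub>" if i: "i < a" for i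
      proof (rule End_eqI[OF Mc(1)[OF x i]])
        show "\<zero>\<^bsub>End\<^esub> \<in> carrier End" by (rule L.E.zero_closed)
        have xh: "x i \<in> module_hom G V V" using Mc(1)[OF x i] by (simp add: End_ring_simps)
        have sub: "submodule {v \<in> carrier V. \<pi> k (x i v) \<in> {\<zero>}} G V"
          by (rule submodule_vimage[OF left_module_V left_module_regularG module_hom_comp[OF xh \<pi>_hom[OF k]]])
             (use left_module.submodule_zero[OF left_module_regularG] in simp)
        have "\<pi> k (x i (s t)) = \<zero>" if t: "t < m" for t
        proof -
          have "i * m + t < a * m"
            using i t by (metis add.commute add_less_cancel_left less_le_trans mult.commute mult_Suc_right mult_le_mono2 Suc_leI nat_less_le)
          moreover have "(i * m + t) div m = i" "(i * m + t) mod m = t" using t by auto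
          ultimately show ?thesis using fun_cong[OF z, of "i * m + t"] by (simp add: \<Phi>_def power_module_simps)
        qed
        then have "lin_span G V F \<subseteq> {v \<in> carrier V. \<pi> k (x i v) \<in> {\<zero>}}"
          using s sV by (intro span_minimal[OF sub]) auto
        then have "\<pi> k (x i v) = \<zero>" if "v \<in> carrier V" for v using F(3) that by auto
        then show "x i v = \<zero>\<^bsub>End\<^esub> v" if "v \<in> carrier V" for v
          using Mc(2)[OF x i that] that \<iota>_zero[OF k] by (simp add: End_ring_simps)
      qed
      moreover have "x \<in> {..<a} \<rightarrow>\<^sub>E carrier End" using x by (simp add: level_module_def Let_def power_module_simps)
      ultimately show ?thesis
        by (auto simp: level_module_def Let_def power_module_simps PiE_iff extensional_def fun_eq_iff)
    qed
    then show ?thesis using module_hom_inj_iff[OF M P \<Phi>] by blast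
  qed
  show ?thesis
  proof (rule chain_stable_transfer[OF chain_stable_power[OF R right_noetherian, of "a * m"], where \<phi> = "\<lambda>N. \<Phi> ` N"])
    fix X assume "X \<in> submodules (opposite G) ?M"
    then show "\<Phi> ` X \<in> submodules (opposite G) ?P" using submodule_image[OF M P \<Phi>] by blast
  next
    fix X Y assume XY: "X \<in> submodules (opposite G) ?M" "Y \<in> submodules (opposite G) ?M" "\<Phi> ` X = \<Phi> ` Y"
    then have "X \<subseteq> carrier ?M" "Y \<subseteq> carrier ?M" using M.submoduleD(2) by blast+
    then show "X = Y" using inj_on_image_eq_iff[OF inj] XY(3) by blast
  qed auto
qed

theorem global_dim_End: "global_dim End \<le> enat n"
proof -
  interpret L: level_maps G J \<E> End n \<tau> by (rule level_maps_End)
  interpret level_endomorphisms G J \<E> End n \<tau>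
    by unfold_locales (rule level_noetherian_End)
  show ?thesis by (rule global_dim_le)
qed

lemma top_carrier: "level G J (n - 1) = carrier G"
proof -
  have one: "\<one> \<in> level G J (n - 1)" using top_level n by (simp add: level_def)
  have "x \<in> level G J (n - 1)" if "x \<in> carrier G" for x
    using ideal.I_l_closed[OF level_ideal one that] that by simp
  then show ?thesis using ideal.Icarr[OF level_ideal] by blast
qed

text \<open>The top summand of \<open>V\<close> is \<open>G\<close> itself.\<close>

lemma generator_V: "generator G V"
  unfolding generator_def
proof (intro allI impI)
  fix X :: "'g umodule" assume X: "left_module G X \<and> finitely_generated G X"
  have n1: "n - 1 < n" using n by simp
  obtain m p where p: "p \<in> module_hom G (power_module (regular_module G) m) X"
    "p ` carrier (power_module (regular_module G) m) = carrier X"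
    using finitely_generated_free_cover[of G X] X by blast
  define h where "h v = (\<lambda>i\<in>{..<m}. \<pi> (n - 1) (v i))" for v :: "nat \<Rightarrow> (nat \<Rightarrow> 'g) set"
  have "(\<lambda>v. \<pi> (n - 1) (v i)) \<in> module_hom G (power_module V m) (regular_module G)" if "i < m" for i
    by (rule module_hom_comp[OF power_module_proj[OF that] \<pi>_hom[OF n1]])
  then have h: "h \<in> module_hom G (power_module V m) (power_module (regular_module G) m)"
    unfolding h_def by (rule power_module_tuple[OF _ left_module_power[OF left_module_V]])
  have "x \<in> h ` carrier (power_module V m)" if x: "x \<in> carrier (power_module (regular_module G) m)" for x
  proof (rule image_eqI)
    have x': "x \<in> {..<m} \<rightarrow>\<^sub>E carrier G" using x by (simp add: power_module_simps)
    have "x i \<in> level G J (n - 1)" if "i < m" for i unfolding top_carrier by (rule PiE_mem[OF x']) (simp add: that)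
    then have "(\<lambda>i\<in>{..<m}. \<iota> (n - 1) (x i)) \<in> {..<m} \<rightarrow>\<^sub>E carrier V" using \<iota>_closed[OF n1] by simp
    then show "(\<lambda>i\<in>{..<m}. \<iota> (n - 1) (x i)) \<in> carrier (power_module V m)" by (simp only: power_module_simps)
    show "x = h (\<lambda>i\<in>{..<m}. \<iota> (n - 1) (x i))"
    proof
      fix i show "x i = h (\<lambda>i\<in>{..<m}. \<iota> (n - 1) (x i)) i"
        using PiE_arb[OF x', of i] n1 by (cases "i < m") (simp_all add: h_def \<pi>_\<iota>)
    qed
  qed
  then have h_image: "h ` carrier (power_module V m) = carrier (power_module (regular_module G) m)"
    using module_homD(1)[OF h] by (intro equalityI image_subsetI subsetI)
  have "(\<lambda>v. p (h v)) ` carrier (power_module V m) = carrier X"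
    using p(2) unfolding h_image[symmetric] image_image .
  then show "\<exists>n. \<exists>p\<in>module_hom G (power_module V n) X. p ` carrier (power_module V n) = carrier X"
    by (intro exI[of _ m] bexI[OF _ module_hom_comp[OF h p(1)]])
qed

lemma cogenerator_V:
  assumes dcc: "chain_stable False (submodules G (regular_module G))"
    and sep: "\<And>(X :: 'g umodule) x. \<lbrakk>left_module G X; finitely_generated G X; x \<in> carrier X; x \<noteq> \<zero>\<^bsub>X\<^esub>\<rbrakk> \<Longrightarrow>
      \<exists>f\<in>module_hom G X (regular_module G). f x \<noteq> \<zero>"
  shows "cogenerator G V"
  unfolding cogenerator_def
proof (intro allI impI)
  fix X :: "'g umodule" assume X: "left_module G X \<and> finitely_generated G X"
  have n1: "n - 1 < n" using n by simp
  have X1: "left_module G X" and X2: "finitely_generated G X" using X by auto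
  have i: "\<iota> (n - 1) \<in> module_hom G (regular_module G) V"
    using \<iota>_hom[OF n1] unfolding top_carrier by (simp add: module_hom_def)
  show "\<exists>m. \<exists>i\<in>module_hom G X (power_module V m). inj_on i (carrier X)"
  proof (rule embedding_if_separating[OF X1 left_module_V chain_stable_finitely_generated[OF X1 dcc X2]])
    fix x assume x: "x \<in> carrier X" "x \<noteq> \<zero>\<^bsub>X\<^esub>"
    obtain f where f: "f \<in> module_hom G X (regular_module G)" "f x \<noteq> \<zero>" using sep[OF X1 X2 x] by blast
    have "\<iota> (n - 1) (f x) \<noteq> \<zero>\<^bsub>V\<^esub>"
    proof
      assume "\<iota> (n - 1) (f x) = \<zero>\<^bsub>V\<^esub>"
      then have "\<pi> (n - 1) (\<iota> (n - 1) (f x)) = \<zero>"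
        using module_hom_zero[OF left_module_V left_module_regularG \<pi>_hom[OF n1]] by simp
      then show False using f(2) n1 by (simp add: \<pi>_\<iota>)
    qed
    then show "\<exists>f\<in>module_hom G X V. f x \<noteq> \<zero>\<^bsub>V\<^esub>"
      by (intro bexI[OF _ module_hom_comp[OF f(1) i]])
  qed
qed

end

section \<open>The bound on the representation dimension\<close>

text \<open>Over the zero ring every module is zero.\<close>

lemma global_dim_zero_ring:
  assumes E: "ring E" and z: "\<one>\<^bsub>E\<^esub> = \<zero>\<^bsub>E\<^esub>"
  shows "global_dim E \<le> 0"
  unfolding global_dim_def
proof (rule Sup_least)
  fix d assume "d \<in> {projective_dim E M | M :: 'a umodule. left_module E M \<and> finitely_generated E M}"
  then obtain M :: "'a umodule" where M: "d = projective_dim E M" "left_module E M" by blast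
  interpret M: left_module E M by (rule M)
  have "x = \<zero>\<^bsub>M\<^esub>" if "x \<in> carrier M" for x using M.smult_one[OF that] M.smult_zero_left[OF that] z by simp
  then have zM: "carrier M = {\<zero>\<^bsub>M\<^esub>}" by auto
  let ?P = "power_module (regular_module E) 0"
  interpret P: left_module E ?P by (intro left_module_power left_module_regular E)
  have P: "carrier ?P = {\<zero>\<^bsub>?P\<^esub>}" by (auto simp: power_module_simps)
  let ?p = "\<lambda>_. \<zero>\<^bsub>M\<^esub>"
  have p: "?p \<in> module_hom E ?P M" by (rule module_homI) auto
  have ker: "module_ker ?P M ?p = {\<zero>\<^bsub>?P\<^esub>}" using P by (auto simp: module_ker_def)
  have "projective_dim E M \<le> enat 0"
    by (rule projective_dim_le[OF projective_free[OF E] M(2) p])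
       (use ker P.left_module_sub[OF P.submodule_zero] P zM in auto)
  then show "d \<le> 0" by (simp add: M(1) zero_enat_def)
qed

theorem corollary3p10:
  fixes R :: "('k, 'r) ring_scheme" and \<Lambda> :: "('k, 'a, 'x) module_scheme"
  assumes "artin_algebra R \<Lambda>" and "selfinjective \<Lambda>"
  shows "rep_dim (morita_ring \<Lambda>) \<le> 2 * loewy_length \<Lambda>"
proof (cases "\<exists>l. (radical \<Lambda> (regular_module \<Lambda>) ^^ l) (carrier \<Lambda>) = {\<zero>\<^bsub>\<Lambda>\<^esub>}")
  case False
  then have "loewy_length \<Lambda> = \<infinity>"
    by (simp add: loewy_length_def module_loewy_length_def top_enat_def)
  then show ?thesis by (simp add: numeral_eq_enat)
next
  case True
  define l where "l = (LEAST l. (radical \<Lambda> (regular_module \<Lambda>) ^^ l) (carrier \<Lambda>) = {\<zero>\<^bsub>\<Lambda>\<^esub>})"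
  let ?G = "morita_ring \<Lambda>"
  have l: "(radical \<Lambda> (regular_module \<Lambda>) ^^ l) (carrier \<Lambda>) = {\<zero>\<^bsub>\<Lambda>\<^esub>}"
    unfolding l_def using True by (rule LeastI_ex)
  have len: "enat l \<le> loewy_length \<Lambda>"
    unfolding loewy_length_def module_loewy_length_def
  proof (rule Inf_greatest)
    fix d assume "d \<in> {enat n |n. (radical \<Lambda> (regular_module \<Lambda>) ^^ n) (carrier (regular_module \<Lambda>)) = {\<zero>\<^bsub>regular_module \<Lambda>\<^esub>}}"
    then obtain n where n: "d = enat n" "(radical \<Lambda> (regular_module \<Lambda>) ^^ n) (carrier \<Lambda>) = {\<zero>\<^bsub>\<Lambda>\<^esub>}" by auto
    have "l \<le> n" unfolding l_def by (rule Least_le) (rule n(2))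
    then show "enat l \<le> d" using n(1) by simp
  qed
  have \<Lambda>: "ring \<Lambda>" using assms(1) by (simp add: artin_algebra_def)
  have G: "ring ?G" by (rule ring_morita_ring[OF \<Lambda>])
  note dcc = artin_algebra_artinian[OF assms(1)]
  obtain \<E> where fin: "finite \<E>" and sp: "semiprimary \<Lambda> (jacobson_radical \<Lambda>) \<E>"
    using semiprimary_if_artinian[OF \<Lambda> dcc(1) l] by blast
  note acc = semiprimary.artinian_imp_noetherian[OF sp dcc(1)]
    semiprimary.artinian_imp_noetherian[OF semiprimary_opposite[OF sp] dcc(2)]
  let ?J = "morita_radical \<Lambda> (jacobson_radical \<Lambda>)"
  have left: "chain_stable up (submodules \<Lambda> (regular_module \<Lambda>)) \<Longrightarrow> chain_stable up (submodules ?G (regular_module ?G))" for up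
    by (rule chain_stable_finite_extension[OF \<Lambda> G morita_diag_hom(1)[OF \<Lambda>] morita_finite(1)[OF \<Lambda>]])
  have right: "chain_stable True (submodules (opposite ?G) (regular_module (opposite ?G)))"
    by (rule chain_stable_finite_extension[OF ring_opposite[OF \<Lambda>] ring_opposite[OF G] morita_diag_hom(2)[OF \<Lambda>] morita_finite(2)[OF \<Lambda>] acc(2)])
  interpret level_summands ?G ?J "morita_idempotents \<Lambda> \<E>" "Suc l"
  proof (intro level_summands.intro level_summands_axioms.intro semiprimary_morita[OF sp] right left[OF acc(1)])
    show "\<one>\<^bsub>?G\<^esub> \<in> ann_chain (opposite ?G) ?J (Suc l)"
      by (rule morita_one_ann_chain(2)[OF ideal_jacobson_radical[OF \<Lambda>] ann_chain_loewy(2)[OF \<Lambda> l]])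
  qed (rule zero_less_Suc, rule morita_right_multiplication[OF \<Lambda> assms(2)])
  have "cogenerator ?G V"
    by (rule cogenerator_V[OF left[OF dcc(1)] morita_separating_hom[OF sp assms(2) fin acc(2)]])
  then have rd: "rep_dim ?G \<le> global_dim End"
    unfolding rep_dim_def using left_module_V finitely_generated_V generator_V
      \<open>cogenerator ?G V\<close> by (intro Inf_lower CollectI exI[of _ V] conjI refl)
  show ?thesis
  proof (cases "l = 0")
    case True
    then have "carrier \<Lambda> = {\<zero>\<^bsub>\<Lambda>\<^esub>}" using l by simp
    then have "\<one>\<^bsub>\<Lambda>\<^esub> = \<zero>\<^bsub>\<Lambda>\<^esub>" using ring.ring_simprules(6)[OF \<Lambda>] by blast
    then have one: "\<one>\<^bsub>?G\<^esub> = \<zero>\<^bsub>?G\<^esub>" by (simp add: morita_ring_def)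
    have End: "\<one>\<^bsub>End\<^esub> = \<zero>\<^bsub>End\<^esub>"
    proof -
      interpret V: left_module ?G V by (rule left_module_V)
      have "v = \<zero>\<^bsub>V\<^esub>" if "v \<in> carrier V" for v
        by (rule trans[OF V.smult_one[OF that, symmetric]], subst one, rule V.smult_zero_left[OF that])
      then show ?thesis unfolding End_ring_simps by (rule restrict_ext)
    qed
    have "global_dim End \<le> 0" by (rule global_dim_zero_ring[OF ring_End_ring[OF left_module_V] End])
    from order_trans[OF rd this] show ?thesis by (rule order_trans) simp
  next
    case False
    then have "Suc l \<le> 2 * l" by simp
    then have "enat (Suc l) \<le> 2 * enat l" by (simp add: numeral_eq_enat)
    also have "\<dots> \<le> 2 * loewy_length \<Lambda>" by (rule mult_left_mono[OF len]) simp
    finally show ?thesis using order_trans[OF rd global_dim_End] by (rule order_trans[rotated])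
  qed
qed

end
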